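(* Let $T_0$ be a complete simple theory in a language $\mathcal{L}_0$ with quantifier elimination, let $\mathcal{L}_1=\mathcal{L}_0\cup\mathcal{L}'$ where every symbol of $\mathcal{L}'$ is a constant, a unary relation symbol or a unary function symbol, and let $T_1$ be a complete simple $\mathcal{L}_1$-theory containing the universal part $T_0^\forall$ of $T_0$. Fix a cardinal $\kappa>|T_1|$, a $\kappa$-saturated model $N$ of $T_1$ and a $\kappa$-saturated model $M$ of $T_0$ such that the $\mathcal{L}_0$-reduct of $N$ is an $\mathcal{L}_0$-substructure of $M$. Let $\mathcal{G}$ be a class of small $\mathcal{L}'$-substructures of $N$ which is preserved by $\mathcal{L}_1$-automorphisms of $N$. Assume the following hypotheses H1–H6: (H1) for every subset $A\subseteq N$ with $A=\operatorname{acl}_0(A)\cap N$, we have $\operatorname{acl}_0(A)=\operatorname{dcl}_0(A\cup\operatorname{acl}_0(\emptyset))$; (H2) for every $C\subseteq N$ with $C=\operatorname{acl}_0(C)\cap N$ and every tuple $a$ from $N$, the type $\operatorname{tp}_0(a/C)$ has a unique extension to $\operatorname{acl}_0(C)$; (H3) every subset of $N$ that is algebraically closed in $T_1$ belongs to $\mathcal{G}$, and for every $a\in\mathcal{G}$ we have $\operatorname{acl}_1(a)=\operatorname{acl}_0(a)\cap N$; (H4) for all $A,B,C\in\mathcal{G}$ with $C\subseteq A\cap B$: $A\mathop{\perp\!\!\!\perp}^1_C B$ if and only if ($A\mathop{\perp\!\!\!\perp}^0_C B$ and $A\cup B\in\mathcal{G}$); (H5) for all tuples $a,b$ of $N$ with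 $a\in\mathcal{G}$ and $b$ algebraically closed in $T_1$, if $a$ and $b$ have the same quantifier-free $\mathcal{L}_1$-type, then they have the same $\mathcal{L}_1$-type; (H6) every minimal completion of a relatively algebraically closed strongly fair system is a strongly fair system; i.e. if $(p_w(x_w),I_w)_{w\in W}$ is a relatively algebraically closed strongly fair system and $p_\top(x_\top)$ is a minimal completion of $(p_w(x_w))_{w\in W}$, then $(p_w,I_w)_{w\in W}\cup\{(p_\top,\bigcup_{w\in W}I_w)\}$ is a strongly fair system. Let $Q\subseteq N$ be algebraically closed in $T_1$ and let $n\ge 1$. If $T_0$ has $n$-existence over $\operatorname{acl}_0(Q)$, then $T_1$ has $n$-existence over $Q$.
   Context: Subscripts $0$ (resp. $1$) refer to the $\mathcal{L}_0$-structure $M$ (resp. the $\mathcal{L}_1$-structure $N$): $\operatorname{tp}_i,\operatorname{acl}_i,\operatorname{dcl}_i$ and $\mathop{\perp\!\!\!\perp}^i$ (nonforking independence in $T_i$). "Small" means of cardinality $<\kappa$. A subset $A\subseteq N$ is relatively $T_0$-algebraically closed if $A=\operatorname{acl}_0(A)\cap N$. Amalgamation systems (in a complete simple theory $T$, with real algebraic closure $\operatorname{acl}$ and nonforking independence): for a finite $W\subseteq\mathfrak{P}(\mathbb{N})$ closed under subsets, a $W$-amalgamation system over a set $C$ is a family $(p_w(x_w))_{w\in W}$ of complete types over $C$ such that (1) for distinct variables $y,z$ in $x_w$, $p_w\vdash y\neq z$; (2) $x_v\cap x_w=x_{v\cap w}$ for all $v,w\in W$, and $p_w\upharpoonright x_v=p_v$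 when $v\subseteq w$; (3) for every realization $b_w$ of $p_w$, setting $b_i=b_w\upharpoonright x_{\{i\}}$ for $i\in w$, the family $(b_i)_{i\in w}$ is independent over $C$ and $b_w$ is algebraic over $C\cup\{b_i:i\in w\}$. It is an $n$-amalgamation system if $W\subseteq\mathfrak{P}(\{1,\dots,n\})$. A completion is a type $p_\top(x_\top)$, indexed by a set $\top$ containing every element of $W$, such that adding it yields an amalgamation system indexed by $W\cup\{\top\}$ (closed under subsets, with maximum $\top$); it is minimal if $x_\top=\bigcup_{w\in W}x_w$. The system is algebraically closed if every realization $b_w$ of each $p_w$ enumerates $\operatorname{acl}(C\cup\{b_i:i\in w\})$. $T$ has $n$-existence over $C$ if for every $W\subseteq\mathfrak{P}(\{1,\dots,n\})$ closed under subsets, every algebraically closed $W$-amalgamation system over $C$ has a completion. Annotated types and systems: an annotation on an $\mathcal{L}_0$-type $p(x)$ is a quantifier-free $\mathcal{L}'$-type $I(x)$ of an $\mathcal{L}'$-structure in the variables $x$; $(p,I)$ is an annotated type. It is fair if $p\cup I$ has a realization in $N$ belonging to $\mathcal{G}$, and relatively algebraically closed fair if such a realization can be chosen algebraically closed in $T_1$. An annotated amalgamation system is a family $(p_w(x_w),I_w)_{w\in W}$ such that $(p_w)_{w\in W}$ is an amalgamation system in $T_0$ (over parameters from $N$) and the $I_w$ are compatible ($I_v$ and $I_w$ agree with $I_{v\cap w}$ on $x_{v\cap w}=x_v\cap x_w$). It is a relatively algebraically closed fair system if every $(p_w,I_w)$ is relatively algebraically closed fair, and a strongly fair system if for each $w\in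 W$, $p_w\cup I_w$ has a realization $a_w$ in $N$ such that for all $v_1,\dots,v_m\in W$ contained in $w$, the union $a_{v_1}\cup\dots\cup a_{v_m}$ (with $a_v=a_w\upharpoonright x_v$) belongs to $\mathcal{G}$.
   Formalization: H3, Q and all amalgamation systems are restricted to small sets (H3 for A = N contradicts smallness of G); W is nonempty; a completion need not make W ∪ {⊤} closed under subsets, only contain {i} for i in ⊤, also in H6 (otherwise n-existence fails for n ≥ 3). *)

theory Defs
  imports Main
begin

unbundle cardinal_syntax

section \<open>One-sorted first-order logic\<close>

text \<open>A symbol is a name together with its arity; constants are function symbols of arity 0.\<close>

record ('f, 'r) lang =
  Fsym :: "('f \<times> nat) set"
  Rsym :: "('r \<times> nat) set"

definition lang_union :: "('f, 'r) lang \<Rightarrow> ('f, 'r) lang \<Rightarrow> ('f, 'r) lang" where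
  "lang_union L K = \<lparr>Fsym = Fsym L \<union> Fsym K, Rsym = Rsym L \<union> Rsym K\<rparr>"

text \<open>The constructor \<open>Par\<close> names elements of structures, so that formulas with parameters
  in a set \<open>A\<close> are the formulas with \<open>pars \<phi> \<subseteq> A\<close>.\<close>

datatype ('f, pars_tm: 'a, fv_tm: 'v) tm =
    Var 'v
  | Par 'a
  | Fn 'f "('f, 'a, 'v) tm list"

datatype ('f, 'r, pars: 'a, 'v) fm =
    Bot
  | Eq "('f, 'a, 'v) tm" "('f, 'a, 'v) tm"
  | Rel 'r "('f, 'a, 'v) tm list"
  | Imp "('f, 'r, 'a, 'v) fm" "('f, 'r, 'a, 'v) fm"
  | All 'v "('f, 'r, 'a, 'v) fm"

definition Neg :: "('f, 'r, 'a, 'v) fm \<Rightarrow> ('f, 'r, 'a, 'v) fm" where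
  "Neg \<phi> = Imp \<phi> Bot"

definition Iff :: "('f, 'r, 'a, 'v) fm \<Rightarrow> ('f, 'r, 'a, 'v) fm \<Rightarrow> ('f, 'r, 'a, 'v) fm" where
  "Iff \<phi> \<psi> = Neg (Imp (Imp \<phi> \<psi>) (Neg (Imp \<psi> \<phi>)))"

primrec fv :: "('f, 'r, 'a, 'v) fm \<Rightarrow> 'v set" where
  "fv Bot = {}"
| "fv (Eq s t) = fv_tm s \<union> fv_tm t"
| "fv (Rel r ts) = (\<Union>t\<in>set ts. fv_tm t)"
| "fv (Imp \<phi> \<psi>) = fv \<phi> \<union> fv \<psi>"
| "fv (All v \<phi>) = fv \<phi> - {v}"

primrec qfree :: "('f, 'r, 'a, 'v) fm \<Rightarrow> bool" where
  "qfree Bot = True"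
| "qfree (Eq s t) = True"
| "qfree (Rel r ts) = True"
| "qfree (Imp \<phi> \<psi>) = (qfree \<phi> \<and> qfree \<psi>)"
| "qfree (All v \<phi>) = False"

fun wf_tm :: "('f, 'r) lang \<Rightarrow> ('f, 'a, 'v) tm \<Rightarrow> bool" where
  "wf_tm L (Var v) = True"
| "wf_tm L (Par a) = True"
| "wf_tm L (Fn f ts) = ((f, length ts) \<in> Fsym L \<and> (\<forall>t\<in>set ts. wf_tm L t))"

primrec wf_fm :: "('f, 'r) lang \<Rightarrow> ('f, 'r, 'a, 'v) fm \<Rightarrow> bool" where
  "wf_fm L Bot = True"
| "wf_fm L (Eq s t) = (wf_tm L s \<and> wf_tm L t)"
| "wf_fm L (Rel r ts) = ((r, length ts) \<in> Rsym L \<and> (\<forall>t\<in>set ts. wf_tm L t))"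
| "wf_fm L (Imp \<phi> \<psi>) = (wf_fm L \<phi> \<and> wf_fm L \<psi>)"
| "wf_fm L (All v \<phi>) = wf_fm L \<phi>"

text \<open>\<open>L(A)\<close>-formulas with free variables in \<open>X\<close>.\<close>

definition forms :: "('f, 'r) lang \<Rightarrow> 'a set \<Rightarrow> 'v set \<Rightarrow> ('f, 'r, 'a, 'v) fm set" where
  "forms L A X = {\<phi>. wf_fm L \<phi> \<and> pars \<phi> \<subseteq> A \<and> fv \<phi> \<subseteq> X}"

record ('f, 'r, 'a) struc =
  univ :: "'a set"
  fint :: "'f \<Rightarrow> 'a list \<Rightarrow> 'a"
  rint :: "'r \<Rightarrow> 'a list \<Rightarrow> bool"

primrec eval :: "('f, 'r, 'a) struc \<Rightarrow> ('v \<Rightarrow> 'a) \<Rightarrow> ('f, 'a, 'v) tm \<Rightarrow> 'a" where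
  "eval S \<sigma> (Var v) = \<sigma> v"
| "eval S \<sigma> (Par a) = a"
| "eval S \<sigma> (Fn f ts) = fint S f (map (eval S \<sigma>) ts)"

primrec sat :: "('f, 'r, 'a) struc \<Rightarrow> ('v \<Rightarrow> 'a) \<Rightarrow> ('f, 'r, 'a, 'v) fm \<Rightarrow> bool" where
  "sat S \<sigma> Bot = False"
| "sat S \<sigma> (Eq s t) = (eval S \<sigma> s = eval S \<sigma> t)"
| "sat S \<sigma> (Rel r ts) = rint S r (map (eval S \<sigma>) ts)"
| "sat S \<sigma> (Imp \<phi> \<psi>) = (sat S \<sigma> \<phi> \<longrightarrow> sat S \<sigma> \<psi>)"
| "sat S \<sigma> (All v \<phi>) = (\<forall>a\<in>univ S. sat S (\<sigma>(v := a)) \<phi>)"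

definition substr_set :: "('f, 'r) lang \<Rightarrow> ('f, 'r, 'a) struc \<Rightarrow> 'a set \<Rightarrow> bool" where
  "substr_set L S A \<longleftrightarrow> A \<subseteq> univ S \<and>
     (\<forall>(f, n)\<in>Fsym L. \<forall>as. length as = n \<and> set as \<subseteq> A \<longrightarrow> fint S f as \<in> A)"

text \<open>Empty structures are allowed here (they are needed for annotations in no variables);
  models are nonempty.\<close>

definition is_struc :: "('f, 'r) lang \<Rightarrow> ('f, 'r, 'a) struc \<Rightarrow> bool" where
  "is_struc L S \<longleftrightarrow> substr_set L S (univ S)"

definition substructure :: "('f, 'r) lang \<Rightarrow> ('f, 'r, 'a) struc \<Rightarrow> ('f, 'r, 'a) struc \<Rightarrow> bool" where
  "substructure L N M \<longleftrightarrow> substr_set L M (univ N) \<and>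
     (\<forall>(f, n)\<in>Fsym L. \<forall>as. length as = n \<and> set as \<subseteq> univ N \<longrightarrow> fint N f as = fint M f as) \<and>
     (\<forall>(r, n)\<in>Rsym L. \<forall>as. length as = n \<and> set as \<subseteq> univ N \<longrightarrow> rint N r as = rint M r as)"

definition automorphism :: "('f, 'r) lang \<Rightarrow> ('f, 'r, 'a) struc \<Rightarrow> ('a \<Rightarrow> 'a) \<Rightarrow> bool" where
  "automorphism L S h \<longleftrightarrow> bij_betw h (univ S) (univ S) \<and>
     (\<forall>(f, n)\<in>Fsym L. \<forall>as. length as = n \<and> set as \<subseteq> univ S \<longrightarrow>
        h (fint S f as) = fint S f (map h as)) \<and>
     (\<forall>(r, n)\<in>Rsym L. \<forall>as. length as = n \<and> set as \<subseteq> univ S \<longrightarrow>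
        rint S r as = rint S r (map h as))"


section \<open>Theories\<close>

text \<open>Sentences of theories use variables from \<open>nat\<close>, so that a complete theory in the sense
  below has the usual cardinality: the maximum of \<open>\<aleph>\<^sub>0\<close> and the number of symbols.
  Consistency is not part of \<open>complete_theory\<close>; it always comes from a given model.
  A complete theory with a model is deductively closed.\<close>

definition complete_theory :: "('f, 'r) lang \<Rightarrow> ('f, 'r, 'a, nat) fm set \<Rightarrow> bool" where
  "complete_theory L T \<longleftrightarrow> T \<subseteq> forms L {} {} \<and> (\<forall>\<phi>\<in>forms L {} {}. \<phi> \<in> T \<or> Neg \<phi> \<in> T)"

definition model :: "('f, 'r) lang \<Rightarrow> ('f, 'r, 'a, nat) fm set \<Rightarrow> ('f, 'r, 'a) struc \<Rightarrow> bool" where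
  "model L T S \<longleftrightarrow> is_struc L S \<and> univ S \<noteq> {} \<and> (\<forall>\<phi>\<in>T. \<forall>\<sigma>. sat S \<sigma> \<phi>)"

definition quantifier_elim :: "('f, 'r) lang \<Rightarrow> ('f, 'r, 'a, nat) fm set \<Rightarrow> bool" where
  "quantifier_elim L T \<longleftrightarrow> (\<forall>\<phi>\<in>forms L {} UNIV. \<exists>\<psi>\<in>forms L {} (fv \<phi>). \<exists>vs.
     qfree \<psi> \<and> foldr All vs (Iff \<phi> \<psi>) \<in> T)"

definition universal_part :: "('f, 'r, 'a, nat) fm set \<Rightarrow> ('f, 'r, 'a, nat) fm set" where
  "universal_part T = {\<phi>\<in>T. \<exists>vs \<psi>. qfree \<psi> \<and> \<phi> = foldr All vs \<psi>}"

text \<open>A formula \<open>\<phi>(x, b)\<close> is given by a parameter-free formula \<open>\<phi>\<close>, the set \<open>Y\<close> of variables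
  to be replaced by parameters, and the values \<open>b\<close> of these variables.\<close>

definition k_inconsistent ::
  "('f, 'r, 'a) struc \<Rightarrow> nat \<Rightarrow> ('f, 'r, 'a, nat) fm \<Rightarrow> nat set \<Rightarrow> (nat \<Rightarrow> nat \<Rightarrow> 'a) \<Rightarrow> bool" where
  "k_inconsistent S k \<phi> Y b \<longleftrightarrow> (\<forall>I. finite I \<and> card I = k \<longrightarrow>
     \<not> (\<exists>\<sigma>. range \<sigma> \<subseteq> univ S \<and> (\<forall>i\<in>I. sat S (override_on \<sigma> (b i) Y) \<phi>)))"

definition tree_property :: "('f, 'r) lang \<Rightarrow> ('f, 'r, 'a) struc \<Rightarrow> bool" where
  "tree_property L S \<longleftrightarrow> (\<exists>\<phi>\<in>forms L {} UNIV. \<exists>Y k. \<exists>b :: nat list \<Rightarrow> nat \<Rightarrow> 'a.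
     (\<forall>s. range (b s) \<subseteq> univ S) \<and>
     (\<forall>s. k_inconsistent S k \<phi> Y (\<lambda>i. b (s @ [i]))) \<and>
     (\<forall>(h :: nat \<Rightarrow> nat) m. \<exists>\<sigma>. range \<sigma> \<subseteq> univ S \<and>
        (\<forall>j<m. sat S (override_on \<sigma> (b (map h [0..<j])) Y) \<phi>)))"

text \<open>By compactness, a theory with an \<open>\<aleph>\<^sub>1\<close>-saturated model on the type \<open>'a\<close> has the
  tree property iff some model on \<open>'a\<close> has it.\<close>

definition simple_theory :: "('f, 'r) lang \<Rightarrow> ('f, 'r, 'a, nat) fm set \<Rightarrow> bool" where
  "simple_theory L T \<longleftrightarrow>
     (\<forall>S :: ('f, 'r, 'a) struc. model L T S \<longrightarrow> \<not> tree_property L S)"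


section \<open>Types, saturation, algebraic closure\<close>

definition tp ::
  "('f, 'r) lang \<Rightarrow> ('f, 'r, 'a) struc \<Rightarrow> 'a set \<Rightarrow> 'v set \<Rightarrow> ('v \<Rightarrow> 'a) \<Rightarrow> ('f, 'r, 'a, 'v) fm set" where
  "tp L S A X a = {\<phi>\<in>forms L A X. sat S a \<phi>}"

definition qftp ::
  "('f, 'r) lang \<Rightarrow> ('f, 'r, 'a) struc \<Rightarrow> 'a set \<Rightarrow> 'v set \<Rightarrow> ('v \<Rightarrow> 'a) \<Rightarrow> ('f, 'r, 'a, 'v) fm set" where
  "qftp L S A X a = {\<phi>\<in>tp L S A X a. qfree \<phi>}"

definition finitely_sat :: "('f, 'r, 'a) struc \<Rightarrow> ('f, 'r, 'a, 'v) fm set \<Rightarrow> bool" where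
  "finitely_sat S p \<longleftrightarrow> (\<forall>F\<subseteq>p. finite F \<longrightarrow> (\<exists>\<sigma>. range \<sigma> \<subseteq> univ S \<and> (\<forall>\<phi>\<in>F. sat S \<sigma> \<phi>)))"

definition complete_type ::
  "('f, 'r) lang \<Rightarrow> ('f, 'r, 'a) struc \<Rightarrow> 'a set \<Rightarrow> 'v set \<Rightarrow> ('f, 'r, 'a, 'v) fm set \<Rightarrow> bool" where
  "complete_type L S A X p \<longleftrightarrow> p \<subseteq> forms L A X \<and> (\<forall>\<phi>\<in>forms L A X. \<phi> \<in> p \<or> Neg \<phi> \<in> p) \<and>
     finitely_sat S p"

definition realizes ::
  "('f, 'r, 'a) struc \<Rightarrow> 'v set \<Rightarrow> ('v \<Rightarrow> 'a) \<Rightarrow> ('f, 'r, 'a, 'v) fm set \<Rightarrow> bool" where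
  "realizes S X b p \<longleftrightarrow> b ` X \<subseteq> univ S \<and> (\<forall>\<phi>\<in>p. sat S b \<phi>)"

definition saturated :: "('f, 'r) lang \<Rightarrow> ('f, 'r, 'a) struc \<Rightarrow> 'k rel \<Rightarrow> bool" where
  "saturated L S \<kappa> \<longleftrightarrow> (\<forall>A p. A \<subseteq> univ S \<and> |A| <o \<kappa> \<and> p \<subseteq> forms L A {0 :: nat} \<and> finitely_sat S p
     \<longrightarrow> (\<exists>b. realizes S {0} b p))"

definition acl :: "('f, 'r) lang \<Rightarrow> ('f, 'r, 'a) struc \<Rightarrow> 'a set \<Rightarrow> 'a set" where
  "acl L S A = {b\<in>univ S. \<exists>\<phi>\<in>forms L A {0 :: nat}.
     sat S (\<lambda>_. b) \<phi> \<and> finite {c\<in>univ S. sat S (\<lambda>_. c) \<phi>}}"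

definition dcl :: "('f, 'r) lang \<Rightarrow> ('f, 'r, 'a) struc \<Rightarrow> 'a set \<Rightarrow> 'a set" where
  "dcl L S A = {b\<in>univ S. \<exists>\<phi>\<in>forms L A {0 :: nat}. {c\<in>univ S. sat S (\<lambda>_. c) \<phi>} = {b}}"


section \<open>Forking\<close>

text \<open>The following notions are meant for a \<open>\<kappa>\<close>-saturated structure \<open>S\<close> and sets \<open>A\<close>, \<open>B\<close>, \<open>C\<close>
  of cardinality less than \<open>\<kappa>\<close>, where \<open>\<kappa>\<close> is uncountable and larger than the language.\<close>

definition divides ::
  "('f, 'r) lang \<Rightarrow> ('f, 'r, 'a) struc \<Rightarrow> 'a set \<Rightarrow> ('f, 'r, 'a, nat) fm \<Rightarrow> nat set \<Rightarrow> (nat \<Rightarrow> 'a) \<Rightarrow> bool" where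
  "divides L S C \<phi> Y b \<longleftrightarrow> (\<exists>k. \<exists>b' :: nat \<Rightarrow> nat \<Rightarrow> 'a.
     (\<forall>i. b' i ` Y \<subseteq> univ S \<and> tp L S C Y (b' i) = tp L S C Y b) \<and> k_inconsistent S k \<phi> Y b')"

text \<open>The formula \<open>\<theta>\<close>, which may contain parameters, implies a finite disjunction of formulas in
  the same variables that divide over \<open>C\<close>.\<close>

definition forks :: "('f, 'r) lang \<Rightarrow> ('f, 'r, 'a) struc \<Rightarrow> 'a set \<Rightarrow> ('f, 'r, 'a, nat) fm \<Rightarrow> bool" where
  "forks L S C \<theta> \<longleftrightarrow> (\<exists>D. finite D \<and>
     (\<forall>(\<phi>, Y, b)\<in>D. \<phi> \<in> forms L {} (fv \<theta> \<union> Y) \<and> finite Y \<and> b ` Y \<subseteq> univ S \<and> divides L S C \<phi> Y b) \<and>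
     (\<forall>\<sigma>. range \<sigma> \<subseteq> univ S \<and> sat S \<sigma> \<theta> \<longrightarrow> (\<exists>(\<phi>, Y, b)\<in>D. sat S (override_on \<sigma> b Y) \<phi>)))"

text \<open>\<open>indep L S A C B\<close>: \<open>A\<close> is independent from \<open>B\<close> over \<open>C\<close>, i.e. no formula in the type of a
  finite tuple of \<open>A\<close> over \<open>B \<union> C\<close> forks over \<open>C\<close>.\<close>

definition indep :: "('f, 'r) lang \<Rightarrow> ('f, 'r, 'a) struc \<Rightarrow> 'a set \<Rightarrow> 'a set \<Rightarrow> 'a set \<Rightarrow> bool" where
  "indep L S A C B \<longleftrightarrow> (\<forall>X a. finite X \<and> a ` X \<subseteq> A \<longrightarrow>
     (\<forall>\<theta>\<in>tp L S (B \<union> C) X a. \<not> forks L S C \<theta>))"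


section \<open>Amalgamation systems\<close>

text \<open>The types of a system live in a \<open>\<kappa>\<close>-saturated model \<open>S\<close>; parameter sets and tuples are small.
  A system is indexed by a finite family \<open>J\<close> of sets of natural numbers.  The family is not required
  to be closed under subsets here, since that fails for the index family \<open>W \<union> {\<top>}\<close> of a completion
  in general; only the singletons that occur in the third clause have to be present.\<close>

definition index_family :: "nat set set \<Rightarrow> bool" where
  "index_family W \<longleftrightarrow> finite W \<and> W \<noteq> {} \<and> (\<forall>w\<in>W. \<forall>v\<subseteq>w. v \<in> W)"

definition amalg_system ::
  "('f, 'r) lang \<Rightarrow> ('f, 'r, 'a) struc \<Rightarrow> 'k rel \<Rightarrow> 'a set \<Rightarrow> nat set set
    \<Rightarrow> (nat set \<Rightarrow> 'v set) \<Rightarrow> (nat set \<Rightarrow> ('f, 'r, 'a, 'v) fm set) \<Rightarrow> bool" where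
  "amalg_system L S \<kappa> C J x p \<longleftrightarrow>
     C \<subseteq> univ S \<and> |C| <o \<kappa> \<and> finite J \<and>
     (\<forall>w\<in>J. \<forall>i\<in>w. {i} \<in> J) \<and>
     (\<forall>w\<in>J. |x w| <o \<kappa> \<and> complete_type L S C (x w) (p w)) \<and>
     (\<forall>w\<in>J. \<forall>y\<in>x w. \<forall>z\<in>x w. y \<noteq> z \<longrightarrow> Neg (Eq (Var y) (Var z)) \<in> p w) \<and>
     (\<forall>v\<in>J. \<forall>w\<in>J. x v \<inter> x w = x (v \<inter> w)) \<and>
     (\<forall>v\<in>J. \<forall>w\<in>J. v \<subseteq> w \<longrightarrow> {\<phi>\<in>p w. fv \<phi> \<subseteq> x v} = p v) \<and>
     (\<forall>w\<in>J. \<forall>b. realizes S (x w) b (p w) \<longrightarrow>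
        (\<forall>i\<in>w. indep L S (b ` x {i}) C (\<Union>j\<in>w - {i}. b ` x {j})) \<and>
        b ` x w \<subseteq> acl L S (C \<union> (\<Union>i\<in>w. b ` x {i})))"

definition acl_system ::
  "('f, 'r) lang \<Rightarrow> ('f, 'r, 'a) struc \<Rightarrow> 'k rel \<Rightarrow> 'a set \<Rightarrow> nat set set
    \<Rightarrow> (nat set \<Rightarrow> 'v set) \<Rightarrow> (nat set \<Rightarrow> ('f, 'r, 'a, 'v) fm set) \<Rightarrow> bool" where
  "acl_system L S \<kappa> C J x p \<longleftrightarrow> amalg_system L S \<kappa> C J x p \<and>
     (\<forall>w\<in>J. \<forall>b. realizes S (x w) b (p w) \<longrightarrow>
        b ` x w = acl L S (C \<union> (\<Union>i\<in>w. b ` x {i})))"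

text \<open>\<open>(x', p')\<close> extends \<open>(x, p)\<close> by the tuple \<open>x' t\<close> and the type \<open>p' t\<close>,
  where \<open>t\<close> stands for \<open>\<top>\<close>.\<close>

definition completion ::
  "('f, 'r) lang \<Rightarrow> ('f, 'r, 'a) struc \<Rightarrow> 'k rel \<Rightarrow> 'a set \<Rightarrow> nat set set
    \<Rightarrow> (nat set \<Rightarrow> 'v set) \<Rightarrow> (nat set \<Rightarrow> ('f, 'r, 'a, 'v) fm set)
    \<Rightarrow> nat set \<Rightarrow> (nat set \<Rightarrow> 'v set) \<Rightarrow> (nat set \<Rightarrow> ('f, 'r, 'a, 'v) fm set) \<Rightarrow> bool" where
  "completion L S \<kappa> C W x p t x' p' \<longleftrightarrow>
     (\<forall>w\<in>W. w \<subseteq> t \<and> x' w = x w \<and> p' w = p w) \<and> amalg_system L S \<kappa> C (insert t W) x' p'"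

definition minimal_completion ::
  "('f, 'r) lang \<Rightarrow> ('f, 'r, 'a) struc \<Rightarrow> 'k rel \<Rightarrow> 'a set \<Rightarrow> nat set set
    \<Rightarrow> (nat set \<Rightarrow> 'v set) \<Rightarrow> (nat set \<Rightarrow> ('f, 'r, 'a, 'v) fm set)
    \<Rightarrow> nat set \<Rightarrow> (nat set \<Rightarrow> 'v set) \<Rightarrow> (nat set \<Rightarrow> ('f, 'r, 'a, 'v) fm set) \<Rightarrow> bool" where
  "minimal_completion L S \<kappa> C W x p t x' p' \<longleftrightarrow>
     completion L S \<kappa> C W x p t x' p' \<and> x' t = (\<Union>w\<in>W. x w)"

definition n_existence ::
  "'v itself \<Rightarrow> ('f, 'r) lang \<Rightarrow> ('f, 'r, 'a) struc \<Rightarrow> 'k rel \<Rightarrow> nat \<Rightarrow> 'a set \<Rightarrow> bool" where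
  "n_existence _ L S \<kappa> n C \<longleftrightarrow>
     (\<forall>W (x :: nat set \<Rightarrow> 'v set) p. index_family W \<and> W \<subseteq> Pow {1..n} \<and> acl_system L S \<kappa> C W x p
        \<longrightarrow> (\<exists>t x' p'. completion L S \<kappa> C W x p t x' p'))"


section \<open>Annotated systems\<close>

text \<open>An annotation is the quantifier-free type of a structure whose underlying set is the set of
  variables \<open>X\<close>, up to the bijection \<open>e\<close>.\<close>

definition annotation :: "('f, 'r) lang \<Rightarrow> 'v set \<Rightarrow> ('f, 'r, 'a, 'v) fm set \<Rightarrow> bool" where
  "annotation L' X I \<longleftrightarrow> (\<exists>(S :: ('f, 'r, 'a) struc) e.
     is_struc L' S \<and> bij_betw e X (univ S) \<and> I = qftp L' S {} X e)"

text \<open>The quantifier-free type in the variables \<open>X\<close> generated by \<open>\<Phi>\<close>.  For compatible annotations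
  \<open>I w\<close> in a language with only constants and unary symbols, the union of the \<open>I w\<close> determines a
  structure on the union of the variable sets, but it does not literally contain formulas that mix
  variables of different \<open>I w\<close>; these are added here.\<close>

definition generated_annotation ::
  "('f, 'r) lang \<Rightarrow> 'v set \<Rightarrow> ('f, 'r, 'a, 'v) fm set \<Rightarrow> ('f, 'r, 'a, 'v) fm set" where
  "generated_annotation L' X \<Phi> = {\<phi>\<in>forms L' {} X. qfree \<phi> \<and>
     (\<forall>(S :: ('f, 'r, 'a) struc) e. is_struc L' S \<and> bij_betw e X (univ S) \<and> (\<forall>\<psi>\<in>\<Phi>. sat S e \<psi>)
        \<longrightarrow> sat S e \<phi>)}"

text \<open>Realizations in \<open>N\<close> of an annotated type: the \<open>L\<^sub>0\<close>-type is evaluated in \<open>M\<close>,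
  the annotation in \<open>N\<close>.\<close>

definition realizes_annotated ::
  "('f, 'r, 'a) struc \<Rightarrow> ('f, 'r, 'a) struc \<Rightarrow> 'v set \<Rightarrow> ('v \<Rightarrow> 'a)
    \<Rightarrow> ('f, 'r, 'a, 'v) fm set \<Rightarrow> ('f, 'r, 'a, 'v) fm set \<Rightarrow> bool" where
  "realizes_annotated M N X a p I \<longleftrightarrow> realizes M X a p \<and> realizes N X a I"

definition annotated_system ::
  "('f, 'r) lang \<Rightarrow> ('f, 'r) lang \<Rightarrow> ('f, 'r, 'a) struc \<Rightarrow> ('f, 'r, 'a) struc \<Rightarrow> 'k rel
    \<Rightarrow> 'a set \<Rightarrow> nat set set \<Rightarrow> (nat set \<Rightarrow> 'v set)
    \<Rightarrow> (nat set \<Rightarrow> ('f, 'r, 'a, 'v) fm set) \<Rightarrow> (nat set \<Rightarrow> ('f, 'r, 'a, 'v) fm set) \<Rightarrow> bool" where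
  "annotated_system L\<^sub>0 L' M N \<kappa> C J x p I \<longleftrightarrow>
     C \<subseteq> univ N \<and> amalg_system L\<^sub>0 M \<kappa> C J x p \<and>
     (\<forall>w\<in>J. annotation L' (x w) (I w)) \<and>
     (\<forall>v\<in>J. \<forall>w\<in>J. {\<phi>\<in>I v. fv \<phi> \<subseteq> x (v \<inter> w)} = I (v \<inter> w))"

definition rel_acl_fair_system ::
  "('f, 'r) lang \<Rightarrow> ('f, 'r) lang \<Rightarrow> ('f, 'r) lang \<Rightarrow> ('f, 'r, 'a) struc \<Rightarrow> ('f, 'r, 'a) struc \<Rightarrow> 'k rel
    \<Rightarrow> 'a set set \<Rightarrow> 'a set \<Rightarrow> nat set set \<Rightarrow> (nat set \<Rightarrow> 'v set)
    \<Rightarrow> (nat set \<Rightarrow> ('f, 'r, 'a, 'v) fm set) \<Rightarrow> (nat set \<Rightarrow> ('f, 'r, 'a, 'v) fm set) \<Rightarrow> bool" where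
  "rel_acl_fair_system L\<^sub>0 L' L\<^sub>1 M N \<kappa> G C J x p I \<longleftrightarrow>
     annotated_system L\<^sub>0 L' M N \<kappa> C J x p I \<and>
     (\<forall>w\<in>J. \<exists>a. realizes_annotated M N (x w) a (p w) (I w) \<and>
        a ` x w \<in> G \<and> acl L\<^sub>1 N (a ` x w) = a ` x w)"

definition strongly_fair_system ::
  "('f, 'r) lang \<Rightarrow> ('f, 'r) lang \<Rightarrow> ('f, 'r, 'a) struc \<Rightarrow> ('f, 'r, 'a) struc \<Rightarrow> 'k rel
    \<Rightarrow> 'a set set \<Rightarrow> 'a set \<Rightarrow> nat set set \<Rightarrow> (nat set \<Rightarrow> 'v set)
    \<Rightarrow> (nat set \<Rightarrow> ('f, 'r, 'a, 'v) fm set) \<Rightarrow> (nat set \<Rightarrow> ('f, 'r, 'a, 'v) fm set) \<Rightarrow> bool" where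
  "strongly_fair_system L\<^sub>0 L' M N \<kappa> G C J x p I \<longleftrightarrow>
     annotated_system L\<^sub>0 L' M N \<kappa> C J x p I \<and>
     (\<forall>w\<in>J. \<exists>a. realizes_annotated M N (x w) a (p w) (I w) \<and>
        (\<forall>V\<subseteq>J. V \<noteq> {} \<and> (\<forall>v\<in>V. v \<subseteq> w) \<longrightarrow> (\<Union>v\<in>V. a ` x v) \<in> G))"

end

theory Submission
  imports Defs "HOL-Library.FuncSet"
begin

text \<open>Realize the types \<open>p\<^sub>w\<close> of an algebraically closed \<open>T\<^sub>1\<close>-system by tuples \<open>b\<^sub>w\<close> in \<open>N\<close>.
  Independence in \<open>T\<^sub>1\<close> together with H4 puts all unions of subtuples of \<open>b\<^sub>w\<close> into \<open>G\<close> and makes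
  the subtuples independent in \<open>T\<^sub>0\<close>, so the \<open>L\<^sub>0\<close>-types of the \<open>b\<^sub>w\<close>, annotated by their
  quantifier-free \<open>L'\<close>-types, form a relatively algebraically closed strongly fair system over \<open>Q\<close>.
  By H2 the \<open>L\<^sub>0\<close>-types determine types over \<open>acl\<^sub>0(Q)\<close>, and by H1 the identification of the tuple
  \<open>b\<^sub>v\<close> with the corresponding subtuple of \<open>b\<^sub>w\<close> extends uniquely to the algebraic closures; hence the
  system can be enlarged coherently to an algebraically closed \<open>T\<^sub>0\<close>-system over \<open>acl\<^sub>0(Q)\<close>.
  Its completion restricts to a minimal completion of the annotated system, which H6 realizes in \<open>N\<close>,
  and H5 and H4 show that the \<open>L\<^sub>1\<close>-type of that realization completes the original system.

  The forking calculus needed for this (left transitivity and invariance under algebraic closure)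
  holds for nonforking in an arbitrary theory: \<open>A\<close> is independent from \<open>B\<close> over \<open>C\<close> iff over every
  small set some \<open>B \<union> C\<close>-conjugate of \<open>A\<close> satisfies no formula that divides over \<open>C\<close>.\<close>

subsection \<open>Formulas and definable relations\<close>

text \<open>The hypothesis on T0 concerns only algebraically closed systems over
  \<open>acl L\<^sub>0 M Q\<close>, whereas the tuples \<open>b w\<close> are closed only inside
  \<open>N\<close>; this forces the enlargement. The obstacle is coherence: realizations chosen for
  different indices are related by their types alone, so their closures in \<open>M\<close> must be
  identified by maps that compose correctly. The cocycle rule comes from the uniqueness of these
  maps. A new variable belongs to an element together with a minimal index set in whose closure it
  lies; this set is unique because, by independence, the closures of two subtuples meet only in the
  closure of their common part. H4 speaks only of members of \<open>G\<close> over a common subset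
  in \<open>G\<close>, hence the need to put all unions of subtuples into \<open>G\<close>.

  A saturated structure need not have automorphisms extending its small elementary maps. Conjugation
  is therefore done by partial elementary maps, which compactness extends to any further small set.
  Formulas are handled as definable relations on tuples, so that renaming variables or turning
  parameters into variables becomes an operation on predicates.\<close>

lemma finite_fv_tm [simp]: "finite (fv_tm t)"
  by (induction t) auto

lemma finite_pars_tm [simp]: "finite (pars_tm t)"
  by (induction t) auto

lemma finite_fv [simp]: "finite (fv \<phi>)"
  by (induction \<phi>) auto

lemma finite_pars [simp]: "finite (pars \<phi>)"
  by (induction \<phi>) auto

lemma eval_cong: "(\<And>v. v \<in> fv_tm t \<Longrightarrow> \<sigma> v = \<tau> v) \<Longrightarrow> eval S \<sigma> t = eval S \<tau> t"
proof (induction t)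
  case (Fn f ts)
  then have "map (eval S \<sigma>) ts = map (eval S \<tau>) ts" by auto
  then show ?case by (metis eval.simps(3))
qed auto

lemma sat_cong: "(\<And>v. v \<in> fv \<phi> \<Longrightarrow> \<sigma> v = \<tau> v) \<Longrightarrow> sat S \<sigma> \<phi> = sat S \<tau> \<phi>"
proof (induction \<phi> arbitrary: \<sigma> \<tau>)
  case (Eq s t)
  then have "eval S \<sigma> s = eval S \<tau> s" "eval S \<sigma> t = eval S \<tau> t" by (auto intro: eval_cong)
  then show ?case by simp
next
  case (Rel r ts)
  then have "map (eval S \<sigma>) ts = map (eval S \<tau>) ts" by (auto intro: eval_cong)
  then show ?case by (metis sat.simps(3))
next
  case (Imp \<phi> \<psi>)
  have "sat S \<sigma> \<phi> = sat S \<tau> \<phi>" by (rule Imp.IH(1)) (simp add: Imp.prems)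
  moreover have "sat S \<sigma> \<psi> = sat S \<tau> \<psi>" by (rule Imp.IH(2)) (simp add: Imp.prems)
  ultimately show ?case by simp
next
  case (All v \<phi>)
  have "sat S (\<sigma>(v := a)) \<phi> = sat S (\<tau>(v := a)) \<phi>" for a
    by (rule All.IH) (auto simp: All.prems)
  then show ?case by simp
qed auto

lemma sat_Neg [simp]: "sat S \<sigma> (Neg \<phi>) \<longleftrightarrow> \<not> sat S \<sigma> \<phi>"
  by (simp add: Neg_def)

lemma sat_Iff [simp]: "sat S \<sigma> (Iff \<phi> \<psi>) \<longleftrightarrow> (sat S \<sigma> \<phi> \<longleftrightarrow> sat S \<sigma> \<psi>)"
  by (auto simp: Iff_def)

lemma Neg_in_forms [simp]: "Neg \<phi> \<in> forms L A X \<longleftrightarrow> \<phi> \<in> forms L A X"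
  by (auto simp: forms_def Neg_def)

lemma forms_mono: "A \<subseteq> A' \<Longrightarrow> X \<subseteq> X' \<Longrightarrow> forms L A X \<subseteq> forms L A' X'"
  by (auto simp: forms_def)

definition Con :: "('f, 'r, 'a, 'v) fm \<Rightarrow> ('f, 'r, 'a, 'v) fm \<Rightarrow> ('f, 'r, 'a, 'v) fm" where
  "Con \<phi> \<psi> = Neg (Imp \<phi> (Neg \<psi>))"

lemma sat_Con [simp]: "sat S \<sigma> (Con \<phi> \<psi>) \<longleftrightarrow> sat S \<sigma> \<phi> \<and> sat S \<sigma> \<psi>"
  by (auto simp: Con_def)

lemma Con_in_forms [simp]: "Con \<phi> \<psi> \<in> forms L A X \<longleftrightarrow> \<phi> \<in> forms L A X \<and> \<psi> \<in> forms L A X"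
  by (auto simp: forms_def Neg_def Con_def)

definition Exi :: "'v \<Rightarrow> ('f, 'r, 'a, 'v) fm \<Rightarrow> ('f, 'r, 'a, 'v) fm" where
  "Exi v \<phi> = Neg (All v (Neg \<phi>))"

lemma sat_Exi [simp]: "sat S \<sigma> (Exi v \<phi>) \<longleftrightarrow> (\<exists>a\<in>univ S. sat S (\<sigma>(v := a)) \<phi>)"
  by (auto simp: Exi_def)

lemma sat_foldr_Exi:
  "sat S \<sigma> (foldr Exi vs \<phi>) \<longleftrightarrow>
     (\<exists>\<tau>. \<tau> ` set vs \<subseteq> univ S \<and> (\<forall>v. v \<notin> set vs \<longrightarrow> \<tau> v = \<sigma> v) \<and> sat S \<tau> \<phi>)"
proof (induction vs arbitrary: \<sigma>)
  case Nil
  show ?case by (auto intro: sat_cong[THEN iffD1])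
next
  case (Cons v vs)
  show ?case
  proof
    assume "sat S \<sigma> (foldr Exi (v # vs) \<phi>)"
    then obtain a \<tau> where "a \<in> univ S" "\<tau> ` set vs \<subseteq> univ S"
      "\<forall>u. u \<notin> set vs \<longrightarrow> \<tau> u = (\<sigma>(v := a)) u" "sat S \<tau> \<phi>"
      by (auto simp: Cons.IH)
    then show "\<exists>\<tau>. \<tau> ` set (v # vs) \<subseteq> univ S \<and> (\<forall>u. u \<notin> set (v # vs) \<longrightarrow> \<tau> u = \<sigma> u) \<and> sat S \<tau> \<phi>"
      by (intro exI[of _ \<tau>]) (auto, metis image_subset_iff)
  next
    assume "\<exists>\<tau>. \<tau> ` set (v # vs) \<subseteq> univ S \<and> (\<forall>u. u \<notin> set (v # vs) \<longrightarrow> \<tau> u = \<sigma> u) \<and> sat S \<tau> \<phi>"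
    then obtain \<tau> where \<tau>: "\<tau> ` set (v # vs) \<subseteq> univ S" "\<forall>u. u \<notin> set (v # vs) \<longrightarrow> \<tau> u = \<sigma> u" "sat S \<tau> \<phi>"
      by blast
    then show "sat S \<sigma> (foldr Exi (v # vs) \<phi>)"
      by (auto simp: Cons.IH intro!: bexI[of _ "\<tau> v"] exI[of _ \<tau>])
  qed
qed

lemma Exi_in_forms: "\<phi> \<in> forms L A (insert v X) \<Longrightarrow> Exi v \<phi> \<in> forms L A X"
  by (auto simp: forms_def Exi_def Neg_def)

lemma foldr_Exi_in_forms:
  "\<phi> \<in> forms L A (X \<union> set vs) \<Longrightarrow> foldr Exi vs \<phi> \<in> forms L A X"
proof (induction vs arbitrary: X)
  case (Cons v vs)
  then have "foldr Exi vs \<phi> \<in> forms L A (insert v X)" by simp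
  then show ?case by (simp add: Exi_in_forms)
qed simp

lemma finite_image_avoid:
  assumes "infinite (UNIV :: 'w set)" and "finite F"
  obtains w :: 'w where "w \<notin> F"
  using assms ex_new_if_finite by blast

text \<open>In a value \<open>Inl a\<close> of \<open>g\<close>, \<open>a\<close> is a parameter; \<open>Inr w\<close> stands for the variable \<open>w\<close>.\<close>

definition inst :: "('w \<Rightarrow> 'a) \<Rightarrow> ('v \<Rightarrow> 'a + 'w) \<Rightarrow> 'v \<Rightarrow> 'a" where
  "inst \<sigma> g v = (case g v of Inl a \<Rightarrow> a | Inr w \<Rightarrow> \<sigma> w)"

primrec reindex_tm :: "('v \<Rightarrow> 'a + 'w) \<Rightarrow> ('f, 'a, 'v) tm \<Rightarrow> ('f, 'a, 'w) tm" where
  "reindex_tm g (Var v) = (case g v of Inl a \<Rightarrow> Par a | Inr w \<Rightarrow> Var w)"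
| "reindex_tm g (Par a) = Par a"
| "reindex_tm g (Fn f ts) = Fn f (map (reindex_tm g) ts)"

lemma eval_reindex_tm: "eval S \<sigma> (reindex_tm g t) = eval S (inst \<sigma> g) t"
proof (induction t)
  case (Fn f ts)
  then have "map (eval S \<sigma> \<circ> reindex_tm g) ts = map (eval S (inst \<sigma> g)) ts" by auto
  then show ?case by (metis eval.simps(3) list.map_comp reindex_tm.simps(3))
qed (auto simp: inst_def split: sum.split)

lemma wf_reindex_tm: "wf_tm L t \<Longrightarrow> wf_tm L (reindex_tm g t)"
  by (induction t) (auto split: sum.split)

lemma pars_reindex_tm: "pars_tm (reindex_tm g t) \<subseteq> pars_tm t \<union> {a. Inl a \<in> g ` fv_tm t}"
  by (induction t) (fastforce split: sum.splits simp: image_iff)+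

lemma fv_reindex_tm: "fv_tm (reindex_tm g t) \<subseteq> {w. Inr w \<in> g ` fv_tm t}"
  by (induction t) (fastforce split: sum.splits simp: image_iff)+

text \<open>Capture-avoiding substitution of parameters and variables for the free variables, possibly
  with a change of the type of variables.\<close>

lemma reindex_fm:
  fixes \<phi> :: "('f, 'r, 'a, 'v) fm" and g :: "'v \<Rightarrow> 'a + 'w"
  assumes inf: "infinite (UNIV :: 'w set)" and "wf_fm L \<phi>"
  shows "\<exists>\<phi>' :: ('f, 'r, 'a, 'w) fm. wf_fm L \<phi>' \<and> (qfree \<phi> \<longrightarrow> qfree \<phi>') \<and>
    pars \<phi>' \<subseteq> pars \<phi> \<union> {a. Inl a \<in> g ` fv \<phi>} \<and> fv \<phi>' \<subseteq> {w. Inr w \<in> g ` fv \<phi>} \<and>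
    (\<forall>S \<sigma>. sat S \<sigma> \<phi>' = sat S (inst \<sigma> g) \<phi>)"
  using assms(2)
proof (induction \<phi> arbitrary: g)
  case Bot
  show ?case by (rule exI[of _ Bot]) simp
next
  case (Eq s t)
  then show ?case
    using pars_reindex_tm[of g s] pars_reindex_tm[of g t] fv_reindex_tm[of g s] fv_reindex_tm[of g t]
    by (intro exI[of _ "Eq (reindex_tm g s) (reindex_tm g t)"])
      (auto simp: wf_reindex_tm eval_reindex_tm)
next
  case (Rel r ts)
  have "map (eval S \<sigma> \<circ> reindex_tm g) ts = map (eval S (inst \<sigma> g)) ts"
    for S :: "('f, 'r, 'a) struc" and \<sigma> by (auto simp: eval_reindex_tm)
  then have 1: "sat S \<sigma> (Rel r (map (reindex_tm g) ts)) = sat S (inst \<sigma> g) (Rel r ts)"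
    for S :: "('f, 'r, 'a) struc" and \<sigma> by (metis list.map_comp sat.simps(3))
  have 2: "pars (Rel r (map (reindex_tm g) ts)) \<subseteq> pars (Rel r ts) \<union> {a. Inl a \<in> g ` fv (Rel r ts)}"
  proof
    fix a assume "a \<in> pars (Rel r (map (reindex_tm g) ts))"
    then have "\<exists>t\<in>set ts. a \<in> pars_tm (reindex_tm g t)" by simp
    then obtain t where t: "t \<in> set ts" "a \<in> pars_tm (reindex_tm g t)" by (rule bexE)
    from t(2) have "a \<in> pars_tm t \<union> {a. Inl a \<in> g ` fv_tm t}" by (rule subsetD[OF pars_reindex_tm])
    moreover have "fv_tm t \<subseteq> fv (Rel r ts)" "pars_tm t \<subseteq> pars (Rel r ts)" using t(1) by auto
    ultimately show "a \<in> pars (Rel r ts) \<union> {a. Inl a \<in> g ` fv (Rel r ts)}" by blast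
  qed
  have 3: "fv (Rel r (map (reindex_tm g) ts)) \<subseteq> {w. Inr w \<in> g ` fv (Rel r ts)}"
  proof
    fix w assume "w \<in> fv (Rel r (map (reindex_tm g) ts))"
    then have "\<exists>t\<in>set ts. w \<in> fv_tm (reindex_tm g t)" by simp
    then obtain t where t: "t \<in> set ts" "w \<in> fv_tm (reindex_tm g t)" by (rule bexE)
    from t(2) have "w \<in> {w. Inr w \<in> g ` fv_tm t}" by (rule subsetD[OF fv_reindex_tm])
    moreover have "fv_tm t \<subseteq> fv (Rel r ts)" using t(1) by auto
    ultimately show "w \<in> {w. Inr w \<in> g ` fv (Rel r ts)}" by blast
  qed
  have 4: "wf_fm L (Rel r (map (reindex_tm g) ts))" using Rel.prems by (auto simp: wf_reindex_tm)
  show ?case using 1 2 3 4 by (intro exI[of _ "Rel r (map (reindex_tm g) ts)"]) (metis qfree.simps(3))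
next
  case (Imp \<phi> \<psi>)
  then obtain \<phi>' \<psi>' :: "('f, 'r, 'a, 'w) fm" where "wf_fm L \<phi>'" "qfree \<phi> \<longrightarrow> qfree \<phi>'"
    "pars \<phi>' \<subseteq> pars \<phi> \<union> {a. Inl a \<in> g ` fv \<phi>}" "fv \<phi>' \<subseteq> {w. Inr w \<in> g ` fv \<phi>}"
    "\<forall>S \<sigma>. sat S \<sigma> \<phi>' = sat S (inst \<sigma> g) \<phi>"
    "wf_fm L \<psi>'" "qfree \<psi> \<longrightarrow> qfree \<psi>'"
    "pars \<psi>' \<subseteq> pars \<psi> \<union> {a. Inl a \<in> g ` fv \<psi>}" "fv \<psi>' \<subseteq> {w. Inr w \<in> g ` fv \<psi>}"
    "\<forall>S \<sigma>. sat S \<sigma> \<psi>' = sat S (inst \<sigma> g) \<psi>"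
    by (metis wf_fm.simps(4))
  then show ?case by (intro exI[of _ "Imp \<phi>' \<psi>'"]) auto
next
  case (All v \<phi>)
  have fin: "finite {w. Inr w \<in> g ` fv \<phi>}"
    by (rule finite_subset[of _ "projr ` g ` fv \<phi>"]) (auto simp: rev_image_eqI image_iff, metis sum.sel(2))
  \<comment> \<open>The bound variable is renamed to one outside the images of the free variables,
    so nothing is captured; it exists because the target type of variables is infinite.\<close>
  obtain w where w: "w \<notin> {w. Inr w \<in> g ` fv \<phi>}"
    using finite_image_avoid[OF inf fin] by blast
  let ?g = "g(v := Inr w)"
  have "wf_fm L \<phi>" using All.prems by simp
  from All.IH[OF this, of ?g] obtain \<phi>' :: "('f, 'r, 'a, 'w) fm" where *: "wf_fm L \<phi>' \<and> (qfree \<phi> \<longrightarrow> qfree \<phi>') \<and>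
    pars \<phi>' \<subseteq> pars \<phi> \<union> {a. Inl a \<in> ?g ` fv \<phi>} \<and> fv \<phi>' \<subseteq> {w. Inr w \<in> ?g ` fv \<phi>} \<and>
    (\<forall>S \<sigma>. sat S \<sigma> \<phi>' = sat S (inst \<sigma> ?g) \<phi>)"
    by (rule exE)
  then have \<phi>': "wf_fm L \<phi>'"
    "pars \<phi>' \<subseteq> pars \<phi> \<union> {a. Inl a \<in> ?g ` fv \<phi>}" "fv \<phi>' \<subseteq> {w. Inr w \<in> ?g ` fv \<phi>}"
    and \<phi>'4: "\<And>S \<sigma>. sat S \<sigma> \<phi>' = sat S (inst \<sigma> ?g) \<phi>"
    by blast+
  have "sat S (\<sigma>(w := c)) \<phi>' = sat S ((inst \<sigma> g)(v := c)) \<phi>"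
    for S :: "('f, 'r, 'a) struc" and \<sigma> c
    unfolding \<phi>'4 by (rule sat_cong) (use w in \<open>auto split: sum.split simp: image_iff inst_def\<close>)
  then show ?case using \<phi>'(1-3)
    by (intro exI[of _ "All w \<phi>'"]) (auto split: if_splits)
qed

lemma reindex_formE:
  fixes \<phi> :: "('f, 'r, 'a, 'v) fm" and g :: "'v \<Rightarrow> 'a + 'w"
  assumes "\<phi> \<in> forms L A X" and "infinite (UNIV :: 'w set)"
  obtains \<phi>' :: "('f, 'r, 'a, 'w) fm" where "wf_fm L \<phi>'"
    "pars \<phi>' \<subseteq> pars \<phi> \<union> {a. Inl a \<in> g ` fv \<phi>}" "fv \<phi>' \<subseteq> {w. Inr w \<in> g ` fv \<phi>}"
    "\<And>S \<sigma>. sat S \<sigma> \<phi>' = sat S (inst \<sigma> g) \<phi>" "qfree \<phi> \<Longrightarrow> qfree \<phi>'"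
proof -
  have "wf_fm L \<phi>" using assms(1) by (simp add: forms_def)
  from reindex_fm[OF assms(2) this, of g] show thesis using that by metis
qed

text \<open>Each parameter becomes a variable \<open>Inl a\<close>, which no quantifier binds, and
  the valuation \<open>case_sum id \<sigma>\<close> gives the parameters their own values back.
  Statements over parameters are reduced in this way to parameter-free formulas.\<close>

primrec unpar_tm :: "('f, 'a, 'v) tm \<Rightarrow> ('f, 'a, 'a + 'v) tm" where
  "unpar_tm (Var v) = Var (Inr v)"
| "unpar_tm (Par a) = Var (Inl a)"
| "unpar_tm (Fn f ts) = Fn f (map unpar_tm ts)"

primrec unpar :: "('f, 'r, 'a, 'v) fm \<Rightarrow> ('f, 'r, 'a, 'a + 'v) fm" where
  "unpar Bot = Bot"
| "unpar (Eq s t) = Eq (unpar_tm s) (unpar_tm t)"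
| "unpar (Rel r ts) = Rel r (map unpar_tm ts)"
| "unpar (Imp \<phi> \<psi>) = Imp (unpar \<phi>) (unpar \<psi>)"
| "unpar (All v \<phi>) = All (Inr v) (unpar \<phi>)"

lemma eval_unpar_tm: "eval S (case_sum id \<sigma>) (unpar_tm t) = eval S \<sigma> t"
proof (induction t)
  case (Fn f ts)
  then have "map (eval S (case_sum id \<sigma>) \<circ> unpar_tm) ts = map (eval S \<sigma>) ts" by auto
  then show ?case by (metis eval.simps(3) list.map_comp unpar_tm.simps(3))
qed auto

lemma unpar_tm_props: "pars_tm (unpar_tm t) = {}" "fv_tm (unpar_tm t) = Inl ` pars_tm t \<union> Inr ` fv_tm t"
  "wf_tm L (unpar_tm t) = wf_tm L t"
  by (induction t) auto

lemma sat_unpar: "sat S (case_sum id \<sigma>) (unpar \<phi>) = sat S \<sigma> \<phi>"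
proof (induction \<phi> arbitrary: \<sigma>)
  case (Rel r ts)
  have "map (eval S (case_sum id \<sigma>) \<circ> unpar_tm) ts = map (eval S \<sigma>) ts"
    by (auto simp: eval_unpar_tm)
  then show ?case by (metis list.map_comp sat.simps(3) unpar.simps(3))
next
  case (All v \<phi>)
  have "(case_sum id \<sigma>)(Inr v := a) = case_sum id (\<sigma>(v := a))" for a
    by (auto simp: fun_eq_iff split: sum.split)
  then show ?case by (simp add: All.IH del: fun_upd_apply)
qed (auto simp: eval_unpar_tm)

lemma unpar_props: "pars (unpar \<phi>) = {}" "fv (unpar \<phi>) = Inl ` pars \<phi> \<union> Inr ` fv \<phi>"
  "wf_fm L (unpar \<phi>) = wf_fm L \<phi>" "qfree (unpar \<phi>) = qfree \<phi>"
  by (induction \<phi>) (auto simp: unpar_tm_props)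

section \<open>Definable relations on tuples\<close>

definition pad :: "('i \<Rightarrow> 'a) \<Rightarrow> 'i + nat \<Rightarrow> 'a" where
  "pad \<sigma> = case_sum \<sigma> undefined"

lemma pad_Inl [simp]: "pad \<sigma> (Inl i) = \<sigma> i"
  by (simp add: pad_def)

text \<open>\<open>R\<close> is a relation on \<open>X\<close>-tuples that is definable over \<open>A\<close>.  The variables
  \<open>Inr n\<close> only serve as a supply of bound variables, so that the index type may be finite.\<close>

definition definable :: "('f, 'r) lang \<Rightarrow> ('f, 'r, 'a) struc \<Rightarrow> 'a set \<Rightarrow> 'i set \<Rightarrow> (('i \<Rightarrow> 'a) \<Rightarrow> bool) \<Rightarrow> bool" where
  "definable L S A X R \<longleftrightarrow> (\<exists>\<phi> :: ('f, 'r, 'a, 'i + nat) fm. \<phi> \<in> forms L A (Inl ` X) \<and>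
     (\<forall>\<sigma>. \<sigma> ` X \<subseteq> univ S \<longrightarrow> R \<sigma> = sat S (pad \<sigma>) \<phi>))"

lemma infinite_UNIV_sum_nat: "infinite (UNIV :: ('i + nat) set)"
  using finite_Plus_UNIV_iff infinite_UNIV_nat by blast

lemma definable_sat:
  fixes \<phi> :: "('f, 'r, 'a, 'v) fm"
  assumes "\<phi> \<in> forms L A X"
  shows "definable L S A X (\<lambda>\<sigma>. sat S \<sigma> \<phi>)"
proof -
  let ?g = "(\<lambda>v. Inr (Inl v)) :: 'v \<Rightarrow> 'a + ('v + nat)"
  obtain \<phi>' :: "('f, 'r, 'a, 'v + nat) fm" where \<phi>': "wf_fm L \<phi>'"
    "pars \<phi>' \<subseteq> pars \<phi> \<union> {a. Inl a \<in> ?g ` fv \<phi>}" "fv \<phi>' \<subseteq> {w. Inr w \<in> ?g ` fv \<phi>}"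
    "\<And>S \<sigma>. sat S \<sigma> \<phi>' = sat S (inst \<sigma> ?g) \<phi>" "qfree \<phi> \<Longrightarrow> qfree \<phi>'"
    by (rule reindex_formE[OF assms infinite_UNIV_sum_nat, where g = ?g]) blast
  have "inst (pad \<sigma>) ?g = \<sigma>" for \<sigma> :: "'v \<Rightarrow> 'a" by (auto simp: inst_def)
  moreover have "fv \<phi>' \<subseteq> Inl ` X" using \<phi>'(3) assms by (fastforce simp: forms_def)
  ultimately show ?thesis unfolding definable_def
    using \<phi>'(1-4) assms by (intro exI[of _ \<phi>']) (auto simp: forms_def)
qed

lemma definable_formE:
  fixes S :: "('f, 'r, 'a) struc" and X :: "'v set"
  assumes "definable L S A X R" "infinite (UNIV :: 'v set)"
  obtains \<phi> where "\<phi> \<in> forms L A X" "\<And>\<sigma>. \<sigma> ` X \<subseteq> univ S \<Longrightarrow> R \<sigma> = sat S \<sigma> \<phi>"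
proof -
  obtain \<phi> where \<phi>: "\<phi> \<in> forms L A (Inl ` X)"
    "\<And>\<sigma>. \<sigma> ` X \<subseteq> univ S \<Longrightarrow> R \<sigma> = sat S (pad \<sigma>) \<phi>"
    using assms(1) unfolding definable_def by blast
  let ?g = "case_sum Inr (\<lambda>_. undefined) :: 'v + nat \<Rightarrow> 'a + 'v"
  obtain \<phi>' :: "('f, 'r, 'a, 'v) fm" where \<phi>': "wf_fm L \<phi>'"
    "pars \<phi>' \<subseteq> pars \<phi> \<union> {a. Inl a \<in> ?g ` fv \<phi>}" "fv \<phi>' \<subseteq> {w. Inr w \<in> ?g ` fv \<phi>}"
    "\<And>S \<sigma>. sat S \<sigma> \<phi>' = sat S (inst \<sigma> ?g) \<phi>" "qfree \<phi> \<Longrightarrow> qfree \<phi>'"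
    by (rule reindex_formE[OF \<phi>(1) assms(2), where g = ?g]) blast
  show thesis
  proof
    have fv: "fv \<phi> \<subseteq> Inl ` X" using \<phi>(1) by (auto simp: forms_def)
    show "\<phi>' \<in> forms L A X" using \<phi>'(1-3) \<phi>(1) fv by (fastforce simp: forms_def)
    fix \<sigma> assume "\<sigma> ` X \<subseteq> univ S"
    moreover have "sat S (inst \<sigma> ?g) \<phi> = sat S (pad \<sigma>) \<phi>"
      by (rule sat_cong) (use fv in \<open>auto simp: inst_def\<close>)
    ultimately show "R \<sigma> = sat S \<sigma> \<phi>'" using \<phi>(2) \<phi>'(4) by simp
  qed
qed

lemma definable_cong:
  assumes "definable L S A X R" "\<And>\<sigma>. \<sigma> ` X \<subseteq> univ S \<Longrightarrow> R \<sigma> = R' \<sigma>"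
  shows "definable L S A X R'"
  using assms unfolding definable_def by (metis (full_types))

lemma definable_mono:
  assumes "definable L S A X R" "A \<subseteq> A'" "X \<subseteq> X'"
  shows "definable L S A' X' R"
proof -
  obtain \<phi> where \<phi>: "\<phi> \<in> forms L A (Inl ` X)"
    "\<And>\<sigma>. \<sigma> ` X \<subseteq> univ S \<Longrightarrow> R \<sigma> = sat S (pad \<sigma>) \<phi>"
    using assms(1) unfolding definable_def by blast
  moreover have "\<phi> \<in> forms L A' (Inl ` X')"
    using \<phi>(1) forms_mono[OF assms(2) image_mono[OF assms(3)], of L Inl] by auto
  ultimately show ?thesis using assms(3) unfolding definable_def
    by (metis (no_types, lifting) image_mono order_trans)
qed

lemma definable_not: "definable L S A X R \<Longrightarrow> definable L S A X (\<lambda>\<sigma>. \<not> R \<sigma>)"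
  unfolding definable_def by (metis Neg_in_forms sat_Neg)

lemma definable_conj: "definable L S A X R \<Longrightarrow> definable L S A X R' \<Longrightarrow> definable L S A X (\<lambda>\<sigma>. R \<sigma> \<and> R' \<sigma>)"
  unfolding definable_def by (metis Con_in_forms sat_Con)

lemma definable_True: "definable L S A X (\<lambda>\<sigma>. True)"
  unfolding definable_def by (rule exI[of _ "Neg Bot"]) (auto simp: forms_def Neg_def)

lemma definable_ball:
  assumes "finite F" "\<And>i. i \<in> F \<Longrightarrow> definable L S A X (R i)"
  shows "definable L S A X (\<lambda>\<sigma>. \<forall>i\<in>F. R i \<sigma>)"
  using assms
proof (induction F rule: finite_induct)
  case empty
  then show ?case by (simp add: definable_True)
next
  case (insert i F)
  then have "definable L S A X (\<lambda>\<sigma>. R i \<sigma> \<and> (\<forall>i\<in>F. R i \<sigma>))" by (intro definable_conj) auto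
  then show ?case by simp
qed

text \<open>Only the finitely many variables of the defining formula that lie outside
  \<open>Y\<close> are quantified, even if \<open>X\<close> is infinite. The remaining coordinates
  of the witness do not matter and receive an arbitrary element, so the universe has to be
  nonempty.\<close>

lemma definable_ex:
  assumes "definable L S A X R" "univ S \<noteq> {}"
  shows "definable L S A Y (\<lambda>\<sigma>. \<exists>\<tau>. \<tau> ` X \<subseteq> univ S \<and> (\<forall>i\<in>X \<inter> Y. \<tau> i = \<sigma> i) \<and> R \<tau>)"
proof -
  obtain \<phi> where \<phi>: "\<phi> \<in> forms L A (Inl ` X)"
    "\<And>\<sigma>. \<sigma> ` X \<subseteq> univ S \<Longrightarrow> R \<sigma> = sat S (pad \<sigma>) \<phi>"
    using assms(1) unfolding definable_def by blast
  obtain d where d: "d \<in> univ S" using assms(2) by blast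
  obtain vs where vs: "set vs = fv \<phi> - Inl ` Y" using finite_list[of "fv \<phi> - Inl ` Y"] by auto
  let ?\<psi> = "foldr Exi vs \<phi>"
  have fv: "fv \<phi> \<subseteq> Inl ` X" using \<phi>(1) by (auto simp: forms_def)
  have "?\<psi> \<in> forms L A (Inl ` Y)"
    by (rule foldr_Exi_in_forms) (use \<phi>(1) vs in \<open>auto simp: forms_def\<close>)
  moreover have "(\<exists>\<tau>. \<tau> ` X \<subseteq> univ S \<and> (\<forall>i\<in>X \<inter> Y. \<tau> i = \<sigma> i) \<and> R \<tau>) = sat S (pad \<sigma>) ?\<psi>"
    (is "?l = ?r") if \<sigma>: "\<sigma> ` Y \<subseteq> univ S" for \<sigma>
  proof
    assume ?l
    then obtain \<tau> where \<tau>: "\<tau> ` X \<subseteq> univ S" "\<forall>i\<in>X \<inter> Y. \<tau> i = \<sigma> i" "R \<tau>" by blast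
    let ?\<tau> = "\<lambda>v. if v \<in> set vs then pad \<tau> v else pad \<sigma> v"
    have "sat S ?\<tau> \<phi> = sat S (pad \<tau>) \<phi>"
      by (rule sat_cong) (use vs \<tau>(2) fv in auto)
    then have "sat S ?\<tau> \<phi>" using \<phi>(2) \<tau> by simp
    moreover have "pad \<tau> v \<in> univ S" if "v \<in> fv \<phi>" for v using that fv \<tau>(1) by (auto dest!: subsetD[OF fv])
    ultimately show ?r unfolding sat_foldr_Exi
      by (intro exI[of _ ?\<tau>]) (use vs in auto)
  next
    assume ?r
    then obtain \<tau> where \<tau>: "\<tau> ` set vs \<subseteq> univ S" "\<forall>v. v \<notin> set vs \<longrightarrow> \<tau> v = pad \<sigma> v"
      "sat S \<tau> \<phi>" unfolding sat_foldr_Exi by blast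
    let ?\<tau> = "\<lambda>i. if Inl i \<in> set vs then \<tau> (Inl i) else if i \<in> Y then \<sigma> i else d"
    have "sat S (pad ?\<tau>) \<phi> = sat S \<tau> \<phi>"
      by (rule sat_cong) (use vs \<tau>(2) fv in auto)
    moreover have "?\<tau> ` X \<subseteq> univ S" using \<tau>(1) \<sigma> d by auto
    ultimately show ?l using \<phi>(2)[of ?\<tau>] \<tau>(3) vs
      by (intro exI[of _ ?\<tau>]) auto
  qed
  ultimately show ?thesis unfolding definable_def by blast
qed

text \<open>The map \<open>g\<close> renames some coordinates and fixes others to parameters. The
  parameters must lie in the universe because a defining formula describes \<open>R\<close> only on
  tuples from the universe.\<close>

lemma definable_reindex:
  fixes S :: "('f, 'r, 'a) struc" and g :: "'i \<Rightarrow> 'a + 'j"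
  assumes "definable L S A X R" "\<And>i. i \<in> X \<Longrightarrow> g i \<in> Inl ` (A' \<inter> univ S) \<union> Inr ` X'"
  shows "definable L S (A \<union> A') X' (\<lambda>\<sigma>. R (inst \<sigma> g))"
proof -
  obtain \<phi> where \<phi>: "\<phi> \<in> forms L A (Inl ` X)"
    "\<And>\<sigma>. \<sigma> ` X \<subseteq> univ S \<Longrightarrow> R \<sigma> = sat S (pad \<sigma>) \<phi>"
    using assms(1) unfolding definable_def by blast
  have fv: "fv \<phi> \<subseteq> Inl ` X" using \<phi>(1) by (auto simp: forms_def)
  let ?g = "case_sum (map_sum id Inl \<circ> g) (\<lambda>_. undefined) :: 'i + nat \<Rightarrow> 'a + ('j + nat)"
  obtain \<phi>' :: "('f, 'r, 'a, 'j + nat) fm" where \<phi>': "wf_fm L \<phi>'"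
    "pars \<phi>' \<subseteq> pars \<phi> \<union> {a. Inl a \<in> ?g ` fv \<phi>}" "fv \<phi>' \<subseteq> {w. Inr w \<in> ?g ` fv \<phi>}"
    "\<And>S \<sigma>. sat S \<sigma> \<phi>' = sat S (inst \<sigma> ?g) \<phi>" "qfree \<phi> \<Longrightarrow> qfree \<phi>'"
    by (rule reindex_formE[OF \<phi>(1) infinite_UNIV_sum_nat, where g = ?g]) blast
  have gi: "map_sum id Inl (g i) \<in> Inl ` (A' \<inter> univ S) \<union> Inr ` Inl ` X'" if "i \<in> X" for i
    using assms(2)[OF that] by auto
    have gv: "?g v \<in> Inl ` (A' \<inter> univ S) \<union> Inr ` Inl ` X'" if v: "v \<in> fv \<phi>" for v
    proof -
      obtain i where "v = Inl i" "i \<in> X" using subsetD[OF fv v] by (rule imageE)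
      then show ?thesis using gi[of i] by simp
    qed
  have "\<phi>' \<in> forms L (A \<union> A') (Inl ` X')"
    unfolding forms_def
  proof (intro CollectI conjI subsetI)
    show "wf_fm L \<phi>'" by fact
    fix a assume "a \<in> pars \<phi>'"
    then have "a \<in> pars \<phi> \<or> Inl a \<in> ?g ` fv \<phi>" using subsetD[OF \<phi>'(2)] by simp
    then show "a \<in> A \<union> A'"
    proof
      assume "a \<in> pars \<phi>"
      then show ?thesis using \<phi>(1) by (auto simp: forms_def)
    next
      assume "Inl a \<in> ?g ` fv \<phi>"
      then obtain v where v: "Inl a = ?g v" "v \<in> fv \<phi>" by (rule imageE)
      show ?thesis using gv[OF v(2)] unfolding v(1)[symmetric] by auto
    qed
  next
    fix v assume "v \<in> fv \<phi>'"
    then have "Inr v \<in> ?g ` fv \<phi>" using subsetD[OF \<phi>'(3)] by simp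
    then obtain u where u: "Inr v = ?g u" "u \<in> fv \<phi>" by (rule imageE)
    show "v \<in> Inl ` X'" using gv[OF u(2)] unfolding u(1)[symmetric] by auto
  qed
  moreover have "R (inst \<sigma> g) = sat S (pad \<sigma>) \<phi>'" if "\<sigma> ` X' \<subseteq> univ S" for \<sigma>
  proof -
    have "(inst \<sigma> g) ` X \<subseteq> univ S"
    proof (rule image_subsetI)
      fix i assume "i \<in> X"
      from assms(2)[OF this] that show "(inst \<sigma> g) i \<in> univ S" by (auto simp: inst_def)
    qed
    then have "R (inst \<sigma> g) = sat S (pad (inst \<sigma> g)) \<phi>" by (rule \<phi>(2))
    also have "\<dots> = sat S (inst (pad \<sigma>) ?g) \<phi>"
    proof (rule sat_cong)
      fix v assume "v \<in> fv \<phi>"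
      then obtain i where "v = Inl i" using fv by blast
      then show "pad (inst \<sigma> g) v = (inst (pad \<sigma>) ?g) v"
        by (cases "g i") (auto simp: inst_def)
    qed
    finally show ?thesis using \<phi>'(4) by simp
  qed
  ultimately show ?thesis unfolding definable_def by blast
qed

text \<open>The parameter set is enumerated by itself: its elements serve as coordinates, and
  \<open>case_sum id \<sigma>\<close> supplies the intended values. An elementary map can then move
  parameters and arguments at the same time.\<close>

lemma definable_unpar:
  assumes "definable L S A X R" "A \<subseteq> univ S"
  obtains R' where "definable L S {} (Inl ` A \<union> Inr ` X) R'" 
    "\<And>\<sigma>. \<sigma> ` X \<subseteq> univ S \<Longrightarrow> R' (case_sum id \<sigma>) = R \<sigma>"
proof -
  obtain \<phi> where \<phi>: "\<phi> \<in> forms L A (Inl ` X)"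
    "\<And>\<sigma>. \<sigma> ` X \<subseteq> univ S \<Longrightarrow> R \<sigma> = sat S (pad \<sigma>) \<phi>"
    using assms(1) unfolding definable_def by blast
  have 1: "definable L S {} (Inl ` A \<union> Inr ` Inl ` X) (\<lambda>\<sigma>. sat S \<sigma> (unpar \<phi>))"
    by (rule definable_sat) (use \<phi>(1) in \<open>auto simp: forms_def unpar_props\<close>)
  let ?g = "case_sum (Inr \<circ> Inl) (case_sum (Inr \<circ> Inr) undefined)"
  have 2: "definable L S ({} \<union> {}) (Inl ` A \<union> Inr ` X) (\<lambda>\<sigma>. sat S (inst \<sigma> ?g) (unpar \<phi>))"
    by (rule definable_reindex[OF 1, where g = ?g]) auto
  have "sat S (inst (case_sum id \<sigma>) ?g) (unpar \<phi>) = R \<sigma>" if "\<sigma> ` X \<subseteq> univ S" for \<sigma>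
  proof -
    have "sat S (inst (case_sum id \<sigma>) ?g) (unpar \<phi>)
        = sat S (case_sum id (pad \<sigma>)) (unpar \<phi>)"
      by (rule sat_cong) (use \<phi>(1) in \<open>auto simp: forms_def unpar_props inst_def\<close>)
    then show ?thesis using \<phi>(2)[OF that] by (simp add: sat_unpar)
  qed
  with 2 show thesis by (intro that) simp_all
qed

text \<open>A formula mentions finitely many parameters and variables. The relation
  \<open>R0\<close> is read off the formula, so it ignores the other coordinates on all valuations,
  whereas \<open>R\<close> is controlled only on tuples from the universe.\<close>

lemma definable_finite_support:
  fixes S :: "('f, 'r, 'a) struc" and X :: "'i set"
  assumes "definable L S A X R"
  obtains A0 X0 R0 where "finite A0" "A0 \<subseteq> A" "finite X0" "X0 \<subseteq> X" "definable L S A0 X0 R0"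
    "\<And>\<sigma>. \<sigma> ` X \<subseteq> univ S \<Longrightarrow> R0 \<sigma> = R \<sigma>"
    "\<And>\<sigma> \<tau>. \<forall>i\<in>X0. \<sigma> i = \<tau> i \<Longrightarrow> R0 \<sigma> = R0 \<tau>"
proof -
  obtain \<phi> where \<phi>: "\<phi> \<in> forms L A (Inl ` X)"
    "\<And>\<sigma>. \<sigma> ` X \<subseteq> univ S \<Longrightarrow> R \<sigma> = sat S (pad \<sigma>) \<phi>"
    using assms unfolding definable_def by blast
  let ?X = "{i. Inl i \<in> fv \<phi>}" and ?R = "\<lambda>\<sigma>. sat S (pad \<sigma>) \<phi>"
  have fv: "fv \<phi> = Inl ` ?X" using \<phi>(1) by (auto simp: forms_def)
  show thesis
  proof (rule that[of "pars \<phi>" ?X ?R])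
    show "finite ?X" using finite_vimageI[OF finite_fv[of \<phi>], of Inl] by (simp add: vimage_def)
    show "definable L S (pars \<phi>) ?X ?R" unfolding definable_def
      by (rule exI[of _ \<phi>]) (use \<phi>(1) fv in \<open>auto simp: forms_def\<close>)
    fix \<sigma> \<tau> :: "'i \<Rightarrow> 'a" assume eq: "\<forall>i\<in>?X. \<sigma> i = \<tau> i"
    show "?R \<sigma> = ?R \<tau>"
    proof (rule sat_cong)
      fix v assume "v \<in> fv \<phi>"
      then have "v \<in> Inl ` ?X" using fv by blast
      then show "pad \<sigma> v = pad \<tau> v" using eq by auto
    qed
  qed (use \<phi> in \<open>auto simp: forms_def\<close>)
qed

subsection \<open>Saturated structures\<close>

text \<open>\<open>saturated\<close> provides realizations of types in one variable only; small
  tuples are reached by the compactness theorem below. Uncountability of \<open>\<kappa>\<close>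
  makes countable index sets small, as needed for dividing sequences.\<close>

locale saturated_structure =
  fixes L :: "('f, 'r) lang" and S :: "('f, 'r, 'a) struc" and \<kappa> :: "'k rel"
  assumes nonempty: "univ S \<noteq> {}" and Card: "Card_order \<kappa>" and unctbl: "natLeq <o \<kappa>"
    and satur: "saturated L S \<kappa>"
begin

lemma infinite_Field: "\<not> finite (Field \<kappa>)"
proof -
  have "natLeq \<le>o |Field \<kappa>|"
    using unctbl card_of_Field_ordIso[OF Card] ordLess_imp_ordLeq ordIso_symmetric ordLeq_ordIso_trans by blast
  then show ?thesis using infinite_iff_natLeq_ordLeq by blast
qed

lemma small_Un [intro]: "|A| <o \<kappa> \<Longrightarrow> |B| <o \<kappa> \<Longrightarrow> |A \<union> B| <o \<kappa>"
  using card_of_Un_ordLess_infinite_Field[OF infinite_Field Card] by blast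

lemma small_nat_type: "|A :: nat set| <o \<kappa>"
  using ordLeq_ordLess_trans[OF ordLeq_ordIso_trans[OF card_of_mono1[OF subset_UNIV] card_of_nat] unctbl] .

lemma small_image [intro]: "|A| <o \<kappa> \<Longrightarrow> |f ` A| <o \<kappa>"
  using card_of_image ordLeq_ordLess_trans by blast

lemma small_subset: "|A| <o \<kappa> \<Longrightarrow> B \<subseteq> A \<Longrightarrow> |B| <o \<kappa>"
  using card_of_mono1 ordLeq_ordLess_trans by blast

lemma small_finite [intro]: "finite A \<Longrightarrow> |A| <o \<kappa>"
proof -
  assume "finite A"
  then obtain f :: "_ \<Rightarrow> nat" where "inj_on f A" using finite_imp_inj_to_nat_seg by blast
  then have "|A| \<le>o |UNIV :: nat set|" by (metis card_of_ordLeq top_greatest)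
  then show ?thesis using small_nat_type ordLeq_ordLess_trans by blast
qed

lemma small_UN_finite: "finite I \<Longrightarrow> (\<And>i. i \<in> I \<Longrightarrow> |F i| <o \<kappa>) \<Longrightarrow> |\<Union>i\<in>I. F i| <o \<kappa>"
  by (induction I rule: finite_induct) auto

text \<open>By Zorn's lemma there is a maximal partial assignment \<open>g\<close> that is
  compatible with every finite set of conditions. It is total: at a missing coordinate the possible
  values form a finitely satisfiable one-variable type over \<open>A\<close> and the values of
  \<open>g\<close>, and saturation supplies a further value.\<close>

theorem compactness:
  fixes X :: "'i set"
  assumes A: "A \<subseteq> univ S" "|A| <o \<kappa>" and X: "|X| <o \<kappa>"
    and Rs: "\<And>R. R \<in> Rs \<Longrightarrow> definable L S A X R"
    and fin: "\<And>F. finite F \<Longrightarrow> F \<subseteq> Rs \<Longrightarrow> \<exists>\<sigma>. \<sigma> ` X \<subseteq> univ S \<and> (\<forall>R\<in>F. R \<sigma>)"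
  shows "\<exists>\<sigma>. \<sigma> ` X \<subseteq> univ S \<and> (\<forall>R\<in>Rs. R \<sigma>)"
proof -
  define P where "P g \<longleftrightarrow> g \<subseteq> X \<times> univ S \<and> (\<forall>F. finite F \<longrightarrow> F \<subseteq> Rs \<longrightarrow>
    (\<exists>\<sigma>. \<sigma> ` X \<subseteq> univ S \<and> (\<forall>i a. (i, a) \<in> g \<longrightarrow> \<sigma> i = a) \<and> (\<forall>R\<in>F. R \<sigma>)))" for g
  have PD: "\<exists>\<sigma>. \<sigma> ` X \<subseteq> univ S \<and> (\<forall>i a. (i, a) \<in> g \<longrightarrow> \<sigma> i = a) \<and> (\<forall>R\<in>F. R \<sigma>)"
    if "P g" "finite F" "F \<subseteq> Rs" for g F using that by (simp add: P_def)
  have PX: "g \<subseteq> X \<times> univ S" if "P g" for g using that by (simp add: P_def)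
  have single: "a = b" if "P g" "(i, a) \<in> g" "(i, b) \<in> g" for g i a b
  proof -
    have "\<exists>\<sigma>. \<sigma> ` X \<subseteq> univ S \<and> (\<forall>i a. (i, a) \<in> g \<longrightarrow> \<sigma> i = a)"
      using PD[OF that(1), of "{}"] by simp
    then obtain \<sigma> where "\<And>i a. (i, a) \<in> g \<Longrightarrow> \<sigma> i = a" by auto
    from this[OF that(2)] this[OF that(3)] show ?thesis by simp
  qed
  have P0: "P {}" using fin by (auto simp: P_def)
  have "\<exists>U\<in>Collect P. \<forall>g\<in>c. g \<subseteq> U" if c: "subset.chain (Collect P) c" for c
  proof (cases "c = {}")
    case True
    then show ?thesis using P0 by blast
  next
    case False
    have cP: "P g" if "g \<in> c" for g using c that by (auto simp: subset.chain_def)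
    have cc: "g \<subseteq> h \<or> h \<subseteq> g" if "g \<in> c" "h \<in> c" for g h
      using c that by (auto simp: subset.chain_def)
    define U where "U = \<Union>c"
    have UX: "U \<subseteq> X \<times> univ S" using PX[OF cP] unfolding U_def by (rule Union_least)
    have sU: "a = b" if m: "(i, a) \<in> U" "(i, b) \<in> U" for i a b
    proof -
      obtain g h where "g \<in> c" "h \<in> c" "(i, a) \<in> g" "(i, b) \<in> h" using m unfolding U_def by blast
      then show ?thesis using cc[of g h] single[OF cP, of g i a b] single[OF cP, of h i a b] by blast
    qed
    have "\<exists>\<sigma>. \<sigma> ` X \<subseteq> univ S \<and> (\<forall>i a. (i, a) \<in> U \<longrightarrow> \<sigma> i = a) \<and> (\<forall>R\<in>F. R \<sigma>)" if F: "finite F" "F \<subseteq> Rs" for F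
    proof -
      \<comment> \<open>The conditions in \<open>F\<close> depend on a finite set \<open>X0\<close>
        of coordinates, and the part of \<open>U\<close> over \<open>X0\<close> is finite, so one
        member \<open>h\<close> of the chain contains it. A valuation good for \<open>h\<close> may
        then be overwritten by \<open>U\<close> without affecting \<open>F\<close>.\<close>
      have "definable L S A X (\<lambda>\<sigma>. \<forall>R\<in>F. R \<sigma>)" by (rule definable_ball[OF F(1)]) (use F Rs in auto)
      then obtain X0 R0 where X0: "finite X0" "X0 \<subseteq> X"
        and R0: "\<And>\<sigma>. \<sigma> ` X \<subseteq> univ S \<Longrightarrow> R0 \<sigma> = (\<forall>R\<in>F. R \<sigma>)"
          "\<And>\<sigma> \<tau>. \<forall>i\<in>X0. \<sigma> i = \<tau> i \<Longrightarrow> R0 \<sigma> = R0 \<tau>"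
        by (rule definable_finite_support) metis
      let ?D = "{(i, a). i \<in> X0 \<and> (i, a) \<in> U}"
      have "inj_on fst ?D" by (auto simp: inj_on_def dest: sU)
      moreover have "fst ` ?D \<subseteq> X0" by auto
      ultimately have "finite ?D" using X0(1) by (meson finite_imageD finite_subset)
      moreover have "?D \<subseteq> \<Union>c" unfolding U_def by blast
      ultimately obtain h where h: "h \<in> c" "?D \<subseteq> h"
        using finite_subset_Union_chain[of ?D c "Collect P"] False c by blast
      from PD[OF cP[OF h(1)] F] obtain \<sigma> where \<sigma>: "\<sigma> ` X \<subseteq> univ S"
        "\<forall>i a. (i, a) \<in> h \<longrightarrow> \<sigma> i = a" "\<forall>R\<in>F. R \<sigma>" by (elim exE conjE)
      let ?\<tau> = "\<lambda>i. if \<exists>a. (i, a) \<in> U then THE a. (i, a) \<in> U else \<sigma> i"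
      have \<tau>: "?\<tau> i = a" if "(i, a) \<in> U" for i a
        using that sU by (auto intro!: the_equality)
      have "?\<tau> ` X \<subseteq> univ S"
      proof (rule image_subsetI)
        fix i assume "i \<in> X"
        show "?\<tau> i \<in> univ S"
        proof (cases "\<exists>a. (i, a) \<in> U")
          case True
          then obtain a where a: "(i, a) \<in> U" ..
          then have "a \<in> univ S" using UX by auto
          then show ?thesis unfolding \<tau>[OF a] .
        next
          case False
          then show ?thesis using \<sigma>(1) \<open>i \<in> X\<close> by auto
        qed
      qed
      moreover have "\<forall>i\<in>X0. ?\<tau> i = \<sigma> i"
      proof
        fix i assume "i \<in> X0"
        show "?\<tau> i = \<sigma> i"
        proof (cases "\<exists>a. (i, a) \<in> U")
          case True
          then obtain a where a: "(i, a) \<in> U" by blast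
          then have "(i, a) \<in> h" using \<open>i \<in> X0\<close> h(2) by blast
          then have "\<sigma> i = a" using \<sigma>(2) by blast
          then show ?thesis using \<tau>[OF a] by simp
        next
          case False
          then show ?thesis by (rule if_not_P)
        qed
      qed
      ultimately have "\<forall>R\<in>F. R ?\<tau>" using R0(1)[of ?\<tau>] R0(1)[of \<sigma>] R0(2)[of ?\<tau> \<sigma>] \<sigma> by simp
      then show ?thesis using \<open>?\<tau> ` X \<subseteq> univ S\<close> \<tau> by (intro exI[of _ ?\<tau>] conjI) simp_all
    qed
    then have "P U" using UX by (simp add: P_def)
    then show ?thesis unfolding U_def by blast
  qed
  then have "\<exists>g\<in>Collect P. \<forall>h\<in>Collect P. g \<subseteq> h \<longrightarrow> h = g"
    by (intro subset_Zorn) blast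
  then obtain g where "P g" and "\<forall>h\<in>Collect P. g \<subseteq> h \<longrightarrow> h = g" by (elim bexE CollectE)
  then have g: "P g" "\<And>h. P h \<Longrightarrow> g \<subseteq> h \<Longrightarrow> h = g" by simp_all
  have gX: "g \<subseteq> X \<times> univ S" using g(1) by (auto simp: P_def)
  have dom: "v \<in> fst ` g" if v: "v \<in> X" for v
  proof (rule ccontr)
    assume nv: "v \<notin> fst ` g"
    let ?A = "A \<union> snd ` g"
    have "inj_on fst g" using single[OF g(1)] by (auto simp: inj_on_def)
    then have "|g| \<le>o |X|" using gX card_of_ordLeq[of g X] by fastforce
    then have "|?A| <o \<kappa>" using A(2) X small_image[of g snd] ordLeq_ordLess_trans by blast
    \<comment> \<open>\<open>T F c\<close> says that \<open>c\<close> is a possible value at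
      \<open>v\<close> for some valuation that extends \<open>g\<close> and satisfies
      \<open>F\<close>.\<close>
    define T where "T F c \<longleftrightarrow> (\<exists>\<sigma>. \<sigma> ` X \<subseteq> univ S \<and> \<sigma> v = c \<and> (\<forall>i a. (i, a) \<in> g \<longrightarrow> \<sigma> i = a) \<and> (\<forall>R\<in>F. R \<sigma>))" for F c
    have T: "\<exists>\<psi>\<in>forms L ?A {0 :: nat}. \<forall>c\<in>univ S. sat S (\<lambda>_. c) \<psi> \<longleftrightarrow> T F c"
      if F: "finite F" "F \<subseteq> Rs" for F
    proof -
      have 1: "definable L S A X (\<lambda>\<sigma>. \<forall>R\<in>F. R \<sigma>)" by (rule definable_ball[OF F(1)]) (use F Rs in auto)
      let ?G = "\<lambda>i. if i \<in> fst ` g then Inl (THE a. (i, a) \<in> g) else Inr i"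
      have G: "?G i = Inl a" if "(i, a) \<in> g" for i a
        using that single[OF g(1)] by (auto intro!: the_equality image_eqI[where x = "(i, a)"])
      have G': "?G i = Inr i" if "i \<notin> fst ` g" for i using that by simp
      have 2: "definable L S (A \<union> snd ` g) (X - fst ` g) (\<lambda>\<sigma>. \<forall>R\<in>F. R (inst \<sigma> ?G))"
      proof (rule definable_reindex[OF 1])
        fix i assume "i \<in> X"
        show "?G i \<in> Inl ` (snd ` g \<inter> univ S) \<union> Inr ` (X - fst ` g)"
        proof (cases "i \<in> fst ` g")
          case True
          then obtain a where a: "(i, a) \<in> g" by auto
          then have "a \<in> snd ` g \<inter> univ S" using gX by force
          then show ?thesis unfolding G[OF a] by blast
        next
          case False
          then show ?thesis using \<open>i \<in> X\<close> by auto
        qed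
      qed
      note 3 = definable_ex[OF 2 nonempty, where Y = "{v}"]
      note 4 = definable_reindex[OF 3, where g = "\<lambda>i. Inr (0 :: nat)" and A' = "{}" and X' = "{0}", simplified]
      obtain \<psi> where \<psi>: "\<psi> \<in> forms L ?A {0 :: nat}"
        "\<And>\<sigma>. \<sigma> ` {0} \<subseteq> univ S \<Longrightarrow> (\<exists>\<tau>. \<tau> ` (X - fst ` g) \<subseteq> univ S \<and>
          (\<forall>i\<in>(X - fst ` g) \<inter> {v}. \<tau> i = \<sigma> 0) \<and> (\<forall>R\<in>F. R (inst \<tau> ?G))) = sat S \<sigma> \<psi>"
        by (rule definable_formE[OF 4 infinite_UNIV_nat]) (simp add: inst_def)
      have "sat S (\<lambda>_. c) \<psi> \<longleftrightarrow> T F c" if c: "c \<in> univ S" for c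
      proof -
        have "sat S (\<lambda>_. c) \<psi> \<longleftrightarrow> (\<exists>\<tau>. \<tau> ` (X - fst ` g) \<subseteq> univ S \<and> \<tau> v = c \<and> (\<forall>R\<in>F. R (inst \<tau> ?G)))"
          using \<psi>(2)[of "\<lambda>_. c"] c v nv by auto
        also have "\<dots> \<longleftrightarrow> T F c"
        proof
          assume "\<exists>\<tau>. \<tau> ` (X - fst ` g) \<subseteq> univ S \<and> \<tau> v = c \<and> (\<forall>R\<in>F. R (inst \<tau> ?G))"
          then obtain \<tau> where \<tau>: "\<tau> ` (X - fst ` g) \<subseteq> univ S" "\<tau> v = c" "\<forall>R\<in>F. R (inst \<tau> ?G)" by blast
          let ?\<sigma> = "inst \<tau> ?G"
          have s1: "?\<sigma> i = a" if "(i, a) \<in> g" for i a unfolding inst_def G[OF that] by simp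
          have s2: "?\<sigma> i = \<tau> i" if "i \<notin> fst ` g" for i unfolding inst_def G'[OF that] by simp
          have "?\<sigma> ` X \<subseteq> univ S"
          proof (rule image_subsetI)
            fix i assume "i \<in> X"
            show "?\<sigma> i \<in> univ S"
            proof (cases "i \<in> fst ` g")
              case True
              then obtain a where a: "(i, a) \<in> g" by auto
              show ?thesis unfolding s1[OF a] using a gX by blast
            next
              case False
              show ?thesis unfolding s2[OF False] using False \<tau>(1) \<open>i \<in> X\<close> by auto
            qed
          qed
          moreover have "\<forall>i a. (i, a) \<in> g \<longrightarrow> ?\<sigma> i = a" using s1 by blast
          ultimately show "T F c" unfolding T_def using \<tau>(2,3) s2[OF nv] by blast
        next
          assume "T F c"
          then obtain \<sigma> where \<sigma>: "\<sigma> ` X \<subseteq> univ S" "\<sigma> v = c" "\<forall>i a. (i, a) \<in> g \<longrightarrow> \<sigma> i = a" "\<forall>R\<in>F. R \<sigma>"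
            unfolding T_def by blast
          have "inst \<sigma> ?G = \<sigma>"
          proof
            fix i
            show "(inst \<sigma> ?G) i = \<sigma> i"
            proof (cases "i \<in> fst ` g")
              case True
              then obtain a where a: "(i, a) \<in> g" by auto
              show ?thesis unfolding inst_def G[OF a] using a \<sigma>(3) by auto
            next
              case False
              show ?thesis unfolding inst_def G'[OF False] by simp
            qed
          qed
          then show "\<exists>\<tau>. \<tau> ` (X - fst ` g) \<subseteq> univ S \<and> \<tau> v = c \<and> (\<forall>R\<in>F. R (inst \<tau> ?G))"
            using \<sigma> by (intro exI[of _ \<sigma>]) auto
        qed
        finally show ?thesis .
      qed
      then show ?thesis using \<psi>(1) by blast
    qed
    \<comment> \<open>All formulas equivalent to some \<open>T F\<close> are collected, so no
      defining formula has to be chosen. Finitely many of them are satisfied together because their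
      sets \<open>F\<close> have a finite union.\<close>
    define p where "p = {\<psi>\<in>forms L ?A {0 :: nat}. \<exists>F. finite F \<and> F \<subseteq> Rs \<and> (\<forall>c\<in>univ S. sat S (\<lambda>_. c) \<psi> \<longleftrightarrow> T F c)}"
    have "finitely_sat S p"
      unfolding finitely_sat_def
    proof (intro allI impI)
      fix H assume H: "H \<subseteq> p" "finite H"
      then have "\<forall>\<psi>\<in>H. \<exists>F. finite F \<and> F \<subseteq> Rs \<and> (\<forall>c\<in>univ S. sat S (\<lambda>_. c) \<psi> \<longleftrightarrow> T F c)"
        unfolding p_def by blast
      then obtain F where F: "\<And>\<psi>. \<psi> \<in> H \<Longrightarrow> finite (F \<psi>) \<and> F \<psi> \<subseteq> Rs \<and> (\<forall>c\<in>univ S. sat S (\<lambda>_. c) \<psi> \<longleftrightarrow> T (F \<psi>) c)"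
        by metis
      have "finite (\<Union>\<psi>\<in>H. F \<psi>)" "(\<Union>\<psi>\<in>H. F \<psi>) \<subseteq> Rs" using F H(2) by blast+
      from PD[OF g(1) this] obtain \<sigma> where \<sigma>: "\<sigma> ` X \<subseteq> univ S"
        "\<forall>i a. (i, a) \<in> g \<longrightarrow> \<sigma> i = a" "\<forall>R\<in>(\<Union>\<psi>\<in>H. F \<psi>). R \<sigma>" by (elim exE conjE)
      have "\<sigma> v \<in> univ S" using \<sigma>(1) v by blast
      moreover have "T (F \<psi>) (\<sigma> v)" if "\<psi> \<in> H" for \<psi> unfolding T_def using \<sigma> that by blast
      ultimately show "\<exists>\<tau>. range \<tau> \<subseteq> univ S \<and> (\<forall>\<psi>\<in>H. sat S \<tau> \<psi>)"
        using F by (intro exI[of _ "\<lambda>_. \<sigma> v"]) auto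
    qed
    moreover have "?A \<subseteq> univ S" using A(1) gX by auto
    moreover have "p \<subseteq> forms L ?A {0}" by (auto simp: p_def)
    ultimately obtain b where b: "realizes S {0 :: nat} b p"
      using satur \<open>|?A| <o \<kappa>\<close> unfolding saturated_def by blast
    have b0: "b 0 \<in> univ S" using b by (auto simp: realizes_def)
    have "T F (b 0)" if F: "finite F" "F \<subseteq> Rs" for F
    proof -
      obtain \<psi> where \<psi>: "\<psi>\<in>forms L ?A {0 :: nat}" "\<forall>c\<in>univ S. sat S (\<lambda>_. c) \<psi> \<longleftrightarrow> T F c"
        using T[OF F] by blast
      then have "\<psi> \<in> p" using F by (auto simp: p_def)
      then have "sat S b \<psi>" using b by (auto simp: realizes_def)
      moreover have "sat S b \<psi> = sat S (\<lambda>_. b 0) \<psi>" by (rule sat_cong) (use \<psi>(1) in \<open>auto simp: forms_def\<close>)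
      ultimately show ?thesis using \<psi>(2) b0 by blast
    qed
    note Tb = this
    have "\<exists>\<sigma>. \<sigma> ` X \<subseteq> univ S \<and> (\<forall>i a. (i, a) \<in> insert (v, b 0) g \<longrightarrow> \<sigma> i = a) \<and> (\<forall>R\<in>F. R \<sigma>)"
      if F: "finite F" "F \<subseteq> Rs" for F
    proof -
      from Tb[OF F, unfolded T_def] obtain \<sigma> where "\<sigma> ` X \<subseteq> univ S" "\<sigma> v = b 0"
        "\<forall>i a. (i, a) \<in> g \<longrightarrow> \<sigma> i = a" "\<forall>R\<in>F. R \<sigma>" by (elim exE conjE)
      then show ?thesis by (intro exI[of _ \<sigma>]) simp
    qed
    then have "P (insert (v, b 0) g)"
      using gX v b0 by (simp add: P_def)
    then have "(v, b 0) \<in> g" using g(2) by blast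
    then show False using nv by force
  qed
  have "\<exists>\<sigma>. \<sigma> ` X \<subseteq> univ S \<and> (\<forall>i a. (i, a) \<in> g \<longrightarrow> \<sigma> i = a)"
    using PD[OF g(1), of "{}"] by simp
  then obtain \<sigma> where \<sigma>: "\<sigma> ` X \<subseteq> univ S" "\<forall>i a. (i, a) \<in> g \<longrightarrow> \<sigma> i = a" by blast
  have "R \<sigma>" if R: "R \<in> Rs" for R
  proof -
    obtain X0 R0 where R0: "X0 \<subseteq> X" "\<And>\<sigma>. \<sigma> ` X \<subseteq> univ S \<Longrightarrow> R0 \<sigma> = R \<sigma>"
          "\<And>\<sigma> \<tau>. \<forall>i\<in>X0. \<sigma> i = \<tau> i \<Longrightarrow> R0 \<sigma> = R0 \<tau>"
      using definable_finite_support[OF Rs[OF R]] by metis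
    from PD[OF g(1), of "{R}"] R obtain \<tau> where \<tau>: "\<tau> ` X \<subseteq> univ S" "\<forall>i a. (i, a) \<in> g \<longrightarrow> \<tau> i = a" "R \<tau>"
      by auto
    have "\<forall>i\<in>X0. \<tau> i = \<sigma> i" 
    proof
      fix i assume "i \<in> X0"
      then have "i \<in> fst ` g" using dom R0(1) by blast
      then obtain a where "(i, a) \<in> g" by auto
      then show "\<tau> i = \<sigma> i" using \<sigma>(2) \<tau>(2) by simp
    qed
    then show ?thesis using R0(3)[of \<tau> \<sigma>] R0(2)[OF \<sigma>(1)] R0(2)[OF \<tau>(1)] \<tau>(3) by simp
  qed
  with \<sigma>(1) show ?thesis by blast
qed

end

lemma definable_agree:
  assumes "definable L S A X R" "\<sigma> ` X \<subseteq> univ S" "\<And>i. i \<in> X \<Longrightarrow> \<sigma> i = \<tau> i"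
  shows "R \<sigma> = R \<tau>"
proof -
  obtain X0 R0 where R0: "X0 \<subseteq> X" "\<And>\<sigma>. \<sigma> ` X \<subseteq> univ S \<Longrightarrow> R0 \<sigma> = R \<sigma>"
    "\<And>\<sigma> \<tau>. \<forall>i\<in>X0. \<sigma> i = \<tau> i \<Longrightarrow> R0 \<sigma> = R0 \<tau>"
    using definable_finite_support[OF assms(1)] by metis
  have "\<tau> ` X \<subseteq> univ S" using assms(2,3) by auto
  moreover have "\<forall>i\<in>X0. \<sigma> i = \<tau> i" using R0(1) assms(3) by auto
  ultimately show ?thesis using R0(2)[of \<sigma>] R0(2)[of \<tau>] R0(3)[of \<sigma> \<tau>] assms(2) by simp
qed

lemma definable_reindex_var:
  assumes "definable L S A X R" "\<And>i. i \<in> X \<Longrightarrow> g i \<in> X'"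
  shows "definable L S A X' (\<lambda>\<sigma>. R (\<lambda>i. \<sigma> (g i)))"
proof -
  have "definable L S (A \<union> {}) X' (\<lambda>\<sigma>. R (inst \<sigma> (\<lambda>i. Inr (g i))))"
    by (rule definable_reindex[OF assms(1)]) (use assms(2) in auto)
  then show ?thesis by (simp add: inst_def[abs_def])
qed

lemma definable_form:
  fixes X :: "'v set"
  assumes "definable L S A X R" "infinite (UNIV :: 'v set)"
  shows "\<exists>\<phi>\<in>forms L A X. \<forall>\<sigma>. \<sigma> ` X \<subseteq> univ S \<longrightarrow> R \<sigma> = sat S \<sigma> \<phi>"
  by (rule definable_formE[OF assms]) blast

text \<open>Elementary maps, dividing and forking are phrased with variables in \<open>nat\<close>;
  the coding \<open>c\<close> of the coordinates brings a relation into that form.\<close>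

lemma definable_to_nat:
  assumes "definable L S A X R" "inj_on c X"
  obtains \<psi> where "\<psi> \<in> forms L A (c ` X :: nat set)"
    "\<And>\<sigma>. \<sigma> ` c ` X \<subseteq> univ S \<Longrightarrow> sat S \<sigma> \<psi> = R (\<lambda>i. \<sigma> (c i))"
proof -
  have "definable L S A (c ` X) (\<lambda>\<sigma>. R (\<lambda>i. \<sigma> (c i)))" by (rule definable_reindex_var[OF assms(1)]) auto
  then show thesis
  proof (rule definable_formE)
    fix \<phi> assume "\<phi> \<in> forms L A (c ` X)" "\<And>\<sigma>. \<sigma> ` c ` X \<subseteq> univ S \<Longrightarrow> R (\<lambda>i. \<sigma> (c i)) = sat S \<sigma> \<phi>"
    then show thesis by (intro that) auto
  qed simp
qed

section \<open>Elementary maps between small sets\<close>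

context saturated_structure
begin

text \<open>In the applications the index type is a sum whose summands are the different kinds of
  conditions, decoded by \<open>case_sum\<close>.\<close>

lemma compactness_family:
  fixes X :: "'i set" and P :: "'j \<Rightarrow> ('i \<Rightarrow> 'a) \<Rightarrow> bool"
  assumes "A \<subseteq> univ S" "|A| <o \<kappa>" "|X| <o \<kappa>"
    and definable: "\<And>j. j \<in> J \<Longrightarrow> definable L S A X (P j)"
    and fin: "\<And>F. finite F \<Longrightarrow> F \<subseteq> J \<Longrightarrow> \<exists>\<sigma>. \<sigma> ` X \<subseteq> univ S \<and> (\<forall>j\<in>F. P j \<sigma>)"
  shows "\<exists>\<sigma>. \<sigma> ` X \<subseteq> univ S \<and> (\<forall>j\<in>J. P j \<sigma>)"
proof -
  have "\<exists>\<sigma>. \<sigma> ` X \<subseteq> univ S \<and> (\<forall>R\<in>P ` J. R \<sigma>)"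
  proof (rule compactness[OF assms(1-3)])
    fix R assume "R \<in> P ` J"
    then show "definable L S A X R" using definable by auto
  next
    fix F assume "finite F" "F \<subseteq> P ` J"
    then obtain F' where F': "F' \<subseteq> J" "finite F'" "F = P ` F'" using finite_subset_image by metis
    from fin[OF F'(2,1)] obtain \<sigma> where "\<sigma> ` X \<subseteq> univ S" "\<forall>j\<in>F'. P j \<sigma>" by (elim exE conjE)
    then show "\<exists>\<sigma>. \<sigma> ` X \<subseteq> univ S \<and> (\<forall>R\<in>F. R \<sigma>)" using F'(3) by (intro exI[of _ \<sigma>]) simp
  qed
  then show ?thesis by simp
qed

text \<open>Partial elementary maps play the part of automorphisms. Only the values on
  \<open>Z\<close> matter, so an extension is a new function agreeing with the old one on
  \<open>Z\<close>.\<close>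

definition elem_map :: "'a set \<Rightarrow> ('a \<Rightarrow> 'a) \<Rightarrow> bool" where
  "elem_map Z f \<longleftrightarrow> Z \<subseteq> univ S \<and> f ` Z \<subseteq> univ S \<and>
     (\<forall>\<phi>\<in>forms L {} (UNIV :: nat set). \<forall>\<tau>. \<tau> ` fv \<phi> \<subseteq> Z \<longrightarrow> sat S \<tau> \<phi> = sat S (\<lambda>v. f (\<tau> v)) \<phi>)"

lemma elem_map_sat: "elem_map Z f \<Longrightarrow> \<phi> \<in> forms L {} (UNIV :: nat set) \<Longrightarrow> \<tau> ` fv \<phi> \<subseteq> Z \<Longrightarrow>
    sat S \<tau> \<phi> = sat S (\<lambda>v. f (\<tau> v)) \<phi>"
  unfolding elem_map_def by blast

text \<open>The index type is arbitrary while elementarity is tested on formulas with variables in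
  \<open>nat\<close>; by finite support the relevant coordinates can be coded by numbers.\<close>

lemma elem_map_definable0:
  fixes X :: "'i set"
  assumes elem_map: "elem_map Z f" and R: "definable L S {} X R" and \<sigma>: "\<sigma> ` X \<subseteq> Z"
  shows "R \<sigma> = R (\<lambda>i. f (\<sigma> i))"
proof -
  obtain X0 R0 where R0: "finite X0" "X0 \<subseteq> X" "definable L S {} X0 R0" "\<And>\<sigma>. \<sigma> ` X \<subseteq> univ S \<Longrightarrow> R0 \<sigma> = R \<sigma>"
    using definable_finite_support[OF R] by (metis subset_empty)
  obtain c :: "'i \<Rightarrow> nat" where c: "inj_on c X0" using finite_imp_inj_to_nat_seg[OF R0(1)] by blast
  obtain \<psi> where \<psi>: "\<psi> \<in> forms L {} (c ` X0)"
    "\<And>\<sigma>. \<sigma> ` c ` X0 \<subseteq> univ S \<Longrightarrow> sat S \<sigma> \<psi> = R0 (\<lambda>i. \<sigma> (c i))"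
    using definable_to_nat[OF R0(3) c] by blast
  let ?d = "inv_into X0 c"
  have cd: "?d (c i) = i" if "i \<in> X0" for i using c that by simp
  have u: "Z \<subseteq> univ S" "f ` Z \<subseteq> univ S" using elem_map by (auto simp: elem_map_def)
  let ?\<tau> = "\<lambda>n. \<sigma> (?d n)"
  have \<sigma>Z: "\<sigma> i \<in> Z" if "i \<in> X0" for i using that R0(2) \<sigma> by blast
  have \<tau>: "?\<tau> ` c ` X0 \<subseteq> Z" using cd \<sigma>Z by auto
  have "R0 \<sigma> = R0 (\<lambda>i. ?\<tau> (c i))" by (rule definable_agree[OF R0(3)]) (use \<sigma>Z u cd in auto)
  also have "\<dots> = sat S ?\<tau> \<psi>" using \<psi>(2)[of ?\<tau>] \<tau> u by auto
  also have "\<dots> = sat S (\<lambda>n. f (?\<tau> n)) \<psi>"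
    by (rule elem_map_sat[OF elem_map]) (use \<psi>(1) order_trans[OF image_mono \<tau>] in \<open>auto simp: forms_def\<close>)
  also have "\<dots> = R0 (\<lambda>i. f (?\<tau> (c i)))" using \<psi>(2)[of "\<lambda>n. f (?\<tau> n)"] \<tau> u by auto
  also have "\<dots> = R0 (\<lambda>i. f (\<sigma> i))"
    by (rule definable_agree[OF R0(3)]) (use \<sigma>Z u cd in auto)
  finally show ?thesis using R0(4)[of \<sigma>] R0(4)[of "\<lambda>i. f (\<sigma> i)"] \<sigma> u by auto
qed

lemma elem_map_definable:
  assumes elem_map: "elem_map Z f" and R: "definable L S A X R" and A: "A \<subseteq> Z" "\<And>a. a \<in> A \<Longrightarrow> f a = a"
    and \<sigma>: "\<sigma> ` X \<subseteq> Z"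
  shows "R \<sigma> = R (\<lambda>i. f (\<sigma> i))"
proof -
  have u: "Z \<subseteq> univ S" "f ` Z \<subseteq> univ S" using elem_map by (auto simp: elem_map_def)
  obtain R' where R': "definable L S {} (Inl ` A \<union> Inr ` X) R'" 
    "\<And>\<sigma>. \<sigma> ` X \<subseteq> univ S \<Longrightarrow> R' (case_sum id \<sigma>) = R \<sigma>"
    using definable_unpar[OF R order_trans[OF A(1) u(1)]] by metis
  have fz: "f z \<in> univ S" "z \<in> univ S" if "z \<in> Z" for z using that u by auto
  have sz: "\<sigma> i \<in> Z" if "i \<in> X" for i using that \<sigma> by auto
  have "R \<sigma> = R' (case_sum id \<sigma>)" using R'(2)[of \<sigma>] \<sigma> u by auto
  also have "\<dots> = R' (\<lambda>i. f (case_sum id \<sigma> i))"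
    by (rule elem_map_definable0[OF elem_map R'(1)]) (use A \<sigma> in auto)
  also have "\<dots> = R' (case_sum id (\<lambda>i. f (\<sigma> i)))"
    by (rule definable_agree[OF R'(1)]) (use A fz sz in auto)
  also have "\<dots> = R (\<lambda>i. f (\<sigma> i))" using R'(2)[of "\<lambda>i. f (\<sigma> i)"] fz sz by auto
  finally show ?thesis .
qed

lemma elem_map_mono: "elem_map Z f \<Longrightarrow> Z' \<subseteq> Z \<Longrightarrow> elem_map Z' f"
  unfolding elem_map_def by (meson image_mono order_trans)

lemma elem_map_univ: "elem_map Z f \<Longrightarrow> Z \<subseteq> univ S" "elem_map Z f \<Longrightarrow> f ` Z \<subseteq> univ S"
  by (auto simp: elem_map_def)

lemma elem_map_id: "Z \<subseteq> univ S \<Longrightarrow> elem_map Z (\<lambda>z. z)"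
  by (auto simp: elem_map_def)

lemma elem_map_comp:
  assumes f: "elem_map Z f" and g: "elem_map (f ` Z) g"
  shows "elem_map Z (\<lambda>z. g (f z))"
  unfolding elem_map_def
proof (intro conjI ballI allI impI)
  show "Z \<subseteq> univ S" "(\<lambda>z. g (f z)) ` Z \<subseteq> univ S" using elem_map_univ[OF f] elem_map_univ[OF g] by auto
  fix \<phi> :: "('f, 'r, 'a, nat) fm" and \<tau>
  assume *: "\<phi> \<in> forms L {} UNIV" "\<tau> ` fv \<phi> \<subseteq> Z"
  have "sat S \<tau> \<phi> = sat S (\<lambda>v. f (\<tau> v)) \<phi>" by (rule elem_map_sat[OF f *])
  also have "\<dots> = sat S (\<lambda>v. g (f (\<tau> v))) \<phi>" by (rule elem_map_sat[OF g *(1)]) (use *(2) in auto)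
  finally show "sat S \<tau> \<phi> = sat S (\<lambda>v. g (f (\<tau> v))) \<phi>" .
qed

lemma elem_map_inj:
  assumes "elem_map Z f"
  shows "inj_on f Z"
proof (rule inj_onI)
  fix y z assume yz: "y \<in> Z" "z \<in> Z" "f y = f z"
  let ?\<tau> = "\<lambda>n :: nat. if n = 0 then y else z"
  have "sat S ?\<tau> (Eq (Var 0) (Var 1)) = sat S (\<lambda>v. f (?\<tau> v)) (Eq (Var 0) (Var 1))"
    by (rule elem_map_sat[OF assms]) (use yz in \<open>auto simp: forms_def\<close>)
  then show "y = z" using yz by simp
qed

lemma elem_map_inv:
  assumes "elem_map Z f"
  shows "elem_map (f ` Z) (inv_into Z f)"
  unfolding elem_map_def
proof (intro conjI ballI allI impI)
  note inj = elem_map_inj[OF assms]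
  show "f ` Z \<subseteq> univ S" "inv_into Z f ` f ` Z \<subseteq> univ S" using elem_map_univ[OF assms] inj by auto
  fix \<phi> :: "('f, 'r, 'a, nat) fm" and \<tau>
  assume *: "\<phi> \<in> forms L {} UNIV" "\<tau> ` fv \<phi> \<subseteq> f ` Z"
  have "sat S (\<lambda>v. inv_into Z f (\<tau> v)) \<phi> = sat S (\<lambda>v. f (inv_into Z f (\<tau> v))) \<phi>"
    by (rule elem_map_sat[OF assms *(1)]) (use *(2) inv_into_into[of _ f Z] in auto)
  also have "\<dots> = sat S \<tau> \<phi>" by (rule sat_cong) (use *(2) f_inv_into_f[of _ f Z] in blast)
  finally show "sat S \<tau> \<phi> = sat S (\<lambda>v. inv_into Z f (\<tau> v)) \<phi>" by simp
qed

text \<open>The values of \<open>g\<close> form a tuple indexed by \<open>Z \<union> Z'\<close>,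
  required to extend \<open>f\<close> and to satisfy every parameter-free relation that holds of the
  identity enumeration. Compactness finds it.\<close>

lemma elem_map_extend:
  assumes elem_map: "elem_map Z f" and small: "|Z| <o \<kappa>" "|Z'| <o \<kappa>" and Z': "Z' \<subseteq> univ S"
  obtains g where "elem_map (Z \<union> Z') g" "\<And>z. z \<in> Z \<Longrightarrow> g z = f z"
proof -
  let ?U = "Z \<union> Z'"
  note u = elem_map_univ[OF elem_map]
  define P :: "(('a \<Rightarrow> 'a) \<Rightarrow> bool) + 'a \<Rightarrow> ('a \<Rightarrow> 'a) \<Rightarrow> bool" where
    "P = case_sum (\<lambda>R. R) (\<lambda>z \<sigma>. \<sigma> z = f z)"
  define J where "J = Inl ` {R. definable L S {} ?U R \<and> R id} \<union> Inr ` Z"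
  have "\<exists>\<sigma>. \<sigma> ` ?U \<subseteq> univ S \<and> (\<forall>j\<in>J. P j \<sigma>)"
  proof (rule compactness_family[of "f ` Z" ?U J P])
    show "f ` Z \<subseteq> univ S" "|f ` Z| <o \<kappa>" "|?U| <o \<kappa>" using u small by auto
    fix j assume "j \<in> J"
    then consider R where "j = Inl R" "definable L S {} ?U R" | z where "j = Inr z" "z \<in> Z"
      unfolding J_def by blast
    then show "definable L S (f ` Z) ?U (P j)"
    proof cases
      case 1
      then show ?thesis using definable_mono[OF 1(2)] by (simp add: P_def)
    next
      case 2
      have "definable L S (f ` Z) ?U (\<lambda>\<sigma>. sat S \<sigma> (Eq (Var z) (Par (f z))))"
        by (rule definable_sat) (use 2 in \<open>auto simp: forms_def\<close>)
      then show ?thesis using 2 by (simp add: P_def)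
    qed
  next
    fix F assume F: "finite F" "F \<subseteq> J"
    let ?F = "{R. Inl R \<in> F}"
    have fin: "finite ?F" using finite_vimageI[OF F(1), of Inl] by (simp add: vimage_def)
    have FR: "definable L S {} ?U R \<and> R id" if "R \<in> ?F" for R
      using that F(2) by (auto simp: J_def)
    have 1: "definable L S {} ?U (\<lambda>\<sigma>. \<forall>R\<in>?F. R \<sigma>)" by (rule definable_ball[OF fin]) (use FR in blast)
    \<comment> \<open>The projection to \<open>Z\<close> of finitely many relations is definable and
      true of the identity, hence true of \<open>f\<close>. A witness of this projection realizes
      the finite set of conditions.\<close>
    let ?R = "\<lambda>\<sigma>. \<exists>\<tau>. \<tau> ` ?U \<subseteq> univ S \<and> (\<forall>i\<in>?U \<inter> Z. \<tau> i = \<sigma> i) \<and> (\<forall>R\<in>?F. R \<tau>)"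
    have 2: "definable L S {} Z ?R" by (rule definable_ex[OF 1 nonempty])
    have "?R id" by (rule exI[of _ id]) (use FR u Z' in auto)
    then have "?R (\<lambda>z. f (id z))" using elem_map_definable0[OF elem_map 2, of id] by simp
    then obtain \<tau> where \<tau>: "\<tau> ` ?U \<subseteq> univ S" "\<forall>i\<in>?U \<inter> Z. \<tau> i = f (id i)" "\<forall>R\<in>?F. R \<tau>"
      by (elim exE conjE)
    have "P j \<tau>" if "j \<in> F" for j
    proof (cases j)
      case (Inl R)
      then show ?thesis using bspec[OF \<tau>(3), of R] that by (simp add: P_def)
    next
      case (Inr z)
      then have "z \<in> Z" using F(2) that by (auto simp: J_def)
      then show ?thesis using \<tau>(2) Inr by (simp add: P_def)
    qed
    with \<tau>(1) show "\<exists>\<sigma>. \<sigma> ` ?U \<subseteq> univ S \<and> (\<forall>j\<in>F. P j \<sigma>)" by (intro exI[of _ \<tau>]) simp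
  qed
  then obtain g where g1: "g ` ?U \<subseteq> univ S" and "\<forall>j\<in>J. P j g" by (elim exE conjE)
  then have g: "g ` ?U \<subseteq> univ S" "\<And>j. j \<in> J \<Longrightarrow> P j g" by simp_all
  have R: "R g" if "definable L S {} ?U R" "R id" for R
    using g(2)[of "Inl R"] that by (simp add: J_def P_def)
  have "elem_map ?U g"
    unfolding elem_map_def
  proof (intro conjI ballI allI impI)
    show "?U \<subseteq> univ S" "g ` ?U \<subseteq> univ S" using u Z' g(1) by auto
    fix \<phi> :: "('f, 'r, 'a, nat) fm" and \<tau>
    assume *: "\<phi> \<in> forms L {} UNIV" "\<tau> ` fv \<phi> \<subseteq> ?U"
    have "definable L S {} (fv \<phi>) (\<lambda>\<sigma>. sat S \<sigma> \<phi>)" by (rule definable_sat) (use *(1) in \<open>auto simp: forms_def\<close>)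
    then have 1: "definable L S {} ?U (\<lambda>\<sigma>. sat S (\<lambda>v. \<sigma> (\<tau> v)) \<phi>)"
      by (rule definable_reindex_var) (use *(2) in auto)
    show "sat S \<tau> \<phi> = sat S (\<lambda>v. g (\<tau> v)) \<phi>"
      using R[OF 1] R[OF definable_not[OF 1]] by auto
  qed
  moreover have "g z = f z" if "z \<in> Z" for z
    using g(2)[of "Inr z"] that by (simp add: J_def P_def)
  ultimately show thesis by (rule that)
qed

text \<open>The assignment of \<open>b i\<close> to \<open>a i\<close> is well defined and
  compatible with the identity on \<open>C\<close> because equalities between coordinates, and
  between coordinates and elements of \<open>C\<close>, belong to the type. The index
  \<open>s z\<close> is an arbitrary choice among those with value \<open>z\<close>.\<close>

lemma tp_elem_map:
  fixes X :: "'v set"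
  assumes inf: "infinite (UNIV :: 'v set)" and C: "C \<subseteq> univ S" and a: "a ` X \<subseteq> univ S" and b: "b ` X \<subseteq> univ S"
    and tp: "tp L S C X a = tp L S C X b"
  obtains f where "elem_map (C \<union> a ` X) f" "\<And>c. c \<in> C \<Longrightarrow> f c = c" "\<And>i. i \<in> X \<Longrightarrow> f (a i) = b i"
proof -
  have tp': "sat S a \<phi> = sat S b \<phi>" if "\<phi> \<in> forms L C X" for \<phi>
    using tp that unfolding tp_def by blast
  have bc: "b i = c" if "i \<in> X" "c \<in> C" "a i = c" for i c
    using tp'[of "Eq (Var i) (Par c)"] that by (auto simp: forms_def)
  have bb: "b i = b j" if "i \<in> X" "j \<in> X" "a i = a j" for i j
    using tp'[of "Eq (Var i) (Var j)"] that by (auto simp: forms_def)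
  define s where "s z = (SOME i. i \<in> X \<and> a i = z)" for z
  have s: "s z \<in> X" "a (s z) = z" if "z \<in> a ` X" for z
    using that someI_ex[of "\<lambda>i. i \<in> X \<and> a i = z"] unfolding s_def by auto
  define f where "f z = (if z \<in> C then z else b (s z))" for z
  have fa: "f (a i) = b i" if "i \<in> X" for i
  proof (cases "a i \<in> C")
    case True
    then show ?thesis using bc[OF that True] by (simp add: f_def)
  next
    case False
    then show ?thesis using bb[OF s(1) that] s(2) that by (simp add: f_def)
  qed
  have fc: "f c = c" if "c \<in> C" for c using that by (simp add: f_def)
  have "elem_map (C \<union> a ` X) f"
    unfolding elem_map_def
  proof (intro conjI ballI allI impI)
    show "C \<union> a ` X \<subseteq> univ S" "f ` (C \<union> a ` X) \<subseteq> univ S" using C a b fc fa by auto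
    fix \<phi> :: "('f, 'r, 'a, nat) fm" and \<tau>
    assume *: "\<phi> \<in> forms L {} UNIV" "\<tau> ` fv \<phi> \<subseteq> C \<union> a ` X"
    let ?g = "\<lambda>n. if \<tau> n \<in> C then Inl (\<tau> n) else Inr (s (\<tau> n))"
    have 1: "definable L S {} (fv \<phi>) (\<lambda>\<sigma>. sat S \<sigma> \<phi>)" by (rule definable_sat) (use *(1) in \<open>auto simp: forms_def\<close>)
    have "definable L S ({} \<union> C) X (\<lambda>\<sigma>. sat S (inst \<sigma> ?g) \<phi>)"
      by (rule definable_reindex[OF 1]) (use *(2) s C in auto)
    then have "definable L S C X (\<lambda>\<sigma>. sat S (inst \<sigma> ?g) \<phi>)" by simp
    from definable_form[OF this inf] obtain \<psi> where \<psi>: "\<psi> \<in> forms L C X"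
      "\<forall>\<sigma>. \<sigma> ` X \<subseteq> univ S \<longrightarrow> sat S (inst \<sigma> ?g) \<phi> = sat S \<sigma> \<psi>" by (rule bexE)
    have "sat S \<tau> \<phi> = sat S (inst a ?g) \<phi>"
      by (rule sat_cong) (use *(2) s(2) in \<open>auto simp: inst_def\<close>)
    also have "\<dots> = sat S (inst b ?g) \<phi>" using \<psi>(2) a b tp'[OF \<psi>(1)] by simp
    also have "\<dots> = sat S (\<lambda>v. f (\<tau> v)) \<phi>"
      by (rule sat_cong) (auto simp: inst_def f_def)
    finally show "sat S \<tau> \<phi> = sat S (\<lambda>v. f (\<tau> v)) \<phi>" .
  qed
  then show thesis using fc fa by (rule that)
qed

lemma elem_map_tp:
  assumes "elem_map Z f" "C \<union> a ` X \<subseteq> Z" "\<And>c. c \<in> C \<Longrightarrow> f c = c" "\<And>i. i \<in> X \<Longrightarrow> f (a i) = b i"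
  shows "tp L S C X a = tp L S C X b"
proof -
  have "sat S a \<phi> = sat S b \<phi>" if \<phi>: "\<phi> \<in> forms L C X" for \<phi>
  proof -
    have "sat S a \<phi> = sat S (\<lambda>i. f (a i)) \<phi>"
      using elem_map_definable[OF assms(1) definable_sat[OF \<phi>, of S], of a] assms by auto
    also have "\<dots> = sat S b \<phi>" by (rule sat_cong) (use \<phi> assms(4) in \<open>auto simp: forms_def\<close>)
    finally show ?thesis .
  qed
  then show ?thesis unfolding tp_def by blast
qed

section \<open>Algebraic closure and orbits under elementary maps\<close>

definition elem_map_over :: "'a set \<Rightarrow> 'a set \<Rightarrow> ('a \<Rightarrow> 'a) \<Rightarrow> bool" where
  "elem_map_over C D f \<longleftrightarrow> elem_map (C \<union> D) f \<and> (\<forall>c\<in>C. f c = c)"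

lemma acl_univ: "acl L S A \<subseteq> univ S"
  by (auto simp: acl_def)

lemma acl_mono: "A \<subseteq> B \<Longrightarrow> acl L S A \<subseteq> acl L S B"
  unfolding acl_def using forms_mono[of A B "{0}" "{0}" L] by blast

lemma acl_incl: "C \<subseteq> univ S \<Longrightarrow> C \<subseteq> acl L S C"
proof
  fix c assume "C \<subseteq> univ S" "c \<in> C"
  then show "c \<in> acl L S C" unfolding acl_def
    by (intro CollectI conjI bexI[of _ "Eq (Var 0) (Par c)"]) (auto simp: forms_def)
qed

lemma acl_finite_support:
  assumes "e \<in> acl L S C"
  obtains C0 where "finite C0" "C0 \<subseteq> C" "e \<in> acl L S C0"
proof -
  obtain \<phi> where \<phi>: "e \<in> univ S" "\<phi> \<in> forms L C {0 :: nat}" "sat S (\<lambda>_. e) \<phi>" "finite {c\<in>univ S. sat S (\<lambda>_. c) \<phi>}"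
    using assms unfolding acl_def by blast
  have "e \<in> acl L S (pars \<phi>)" unfolding acl_def
    by (intro CollectI conjI bexI[of _ \<phi>] \<phi>) (use \<phi>(2) in \<open>auto simp: forms_def\<close>)
  then show thesis using \<phi>(2) by (intro that[of "pars \<phi>"]) (auto simp: forms_def)
qed

text \<open>Every conjugate solves the algebraic formula of \<open>e\<close>. Together with
  \<open>infinite_orbit\<close> this describes algebraicity by the size of orbits, which suits
  composition and extension of maps better than formulas.\<close>

lemma finite_orbit:
  assumes "e \<in> acl L S C" "C \<subseteq> univ S"
  shows "finite {f e |f. elem_map_over C {e} f}"
proof -
  obtain \<phi> where \<phi>: "e \<in> univ S" "\<phi> \<in> forms L C {0 :: nat}" "sat S (\<lambda>_. e) \<phi>" "finite {c\<in>univ S. sat S (\<lambda>_. c) \<phi>}"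
    using assms unfolding acl_def by blast
  have "f e \<in> {c\<in>univ S. sat S (\<lambda>_. c) \<phi>}" if f: "elem_map_over C {e} f" for f
  proof -
    have elem_map: "elem_map (C \<union> {e}) f" using f by (simp add: elem_map_over_def)
    have "sat S (\<lambda>_. e) \<phi> = sat S (\<lambda>_. f e) \<phi>"
      using elem_map_definable[OF elem_map definable_sat[OF \<phi>(2), of S], of "\<lambda>_. e"] f by (auto simp: elem_map_over_def)
    then show ?thesis using \<phi>(3) elem_map_univ[OF elem_map] by auto
  qed
  then have "{f e |f. elem_map_over C {e} f} \<subseteq> {c\<in>univ S. sat S (\<lambda>_. c) \<phi>}" by blast
  then show ?thesis using \<phi>(4) finite_subset by blast
qed

text \<open>By compactness there is a sequence of pairwise distinct realizations of the type of
  \<open>e\<close> over \<open>C\<close>; equality of types then turns each of them into the image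
  of \<open>e\<close> under an elementary map over \<open>C\<close>.\<close>

lemma infinite_orbit:
  assumes C: "C \<subseteq> univ S" "|C| <o \<kappa>" and e: "e \<in> univ S" "e \<notin> acl L S C"
  obtains g :: "nat \<Rightarrow> 'a \<Rightarrow> 'a" where "\<And>i. elem_map_over C {e} (g i)" "inj (\<lambda>i. g i e)"
proof -
  define P :: "('f, 'r, 'a, nat) fm \<times> nat + nat \<times> nat \<Rightarrow> (nat \<Rightarrow> 'a) \<Rightarrow> bool" where
    "P = case_sum (\<lambda>(\<phi>, i) \<sigma>. sat S (\<lambda>_. \<sigma> i) \<phi>) (\<lambda>(i, j) \<sigma>. \<sigma> i \<noteq> \<sigma> j)"
  define J where "J = Inl ` ({\<phi>\<in>forms L C {0 :: nat}. sat S (\<lambda>_. e) \<phi>} \<times> (UNIV :: nat set)) \<union> Inr ` {(i :: nat, j). i \<noteq> j}"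
  have "\<exists>s. range s \<subseteq> univ S \<and> (\<forall>j\<in>J. P j s)"
  proof (rule compactness_family[of C "UNIV :: nat set" J P])
    show "C \<subseteq> univ S" "|C| <o \<kappa>" "|UNIV :: nat set| <o \<kappa>" using C small_nat_type by auto
    fix j assume "j \<in> J"
    then consider \<phi> i where "j = Inl (\<phi>, i)" "\<phi> \<in> forms L C {0 :: nat}" | k l where "j = Inr (k, l)"
      unfolding J_def by blast
    then show "definable L S C UNIV (P j)"
    proof cases
      case 1
      show ?thesis using definable_reindex_var[OF definable_sat[OF 1(2), of S], of "\<lambda>_. i" UNIV] 1 by (simp add: P_def)
    next
      case 2
      have "definable L S C UNIV (\<lambda>\<sigma>. sat S \<sigma> (Neg (Eq (Var k) (Var l))))"
        by (rule definable_sat) (auto simp: forms_def Neg_def)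
      then show ?thesis using 2 by (simp add: P_def)
    qed
  next
    fix F assume F: "finite F" "F \<subseteq> J"
    let ?F = "{\<phi>. \<exists>i. Inl (\<phi>, i) \<in> F}"
    have "?F \<subseteq> fst ` projl ` F" by force
    then have fin: "finite ?F" using F(1) finite_subset by blast
    have FR: "\<phi> \<in> forms L C {0}" "sat S (\<lambda>_. e) \<phi>" if "\<phi> \<in> ?F" for \<phi>
      using that F(2) by (auto simp: J_def)
    have "definable L S C {0} (\<lambda>\<sigma>. \<forall>\<phi>\<in>?F. sat S \<sigma> \<phi>)"
      by (rule definable_ball[OF fin]) (use FR definable_sat in blast)
    from definable_form[OF this infinite_UNIV_nat] obtain \<psi> where \<psi>1: "\<psi> \<in> forms L C {0}"
      and "\<forall>\<sigma>. \<sigma> ` {0} \<subseteq> univ S \<longrightarrow> (\<forall>\<phi>\<in>?F. sat S \<sigma> \<phi>) = sat S \<sigma> \<psi>" by (rule bexE)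
    then have \<psi>: "\<psi> \<in> forms L C {0}" "\<And>\<sigma>. \<sigma> ` {0} \<subseteq> univ S \<Longrightarrow> (\<forall>\<phi>\<in>?F. sat S \<sigma> \<phi>) = sat S \<sigma> \<psi>"
      by simp_all
    have "sat S (\<lambda>_. e) \<psi>" using \<psi>(2)[of "\<lambda>_. e"] FR e by auto
    \<comment> \<open>The conjunction \<open>\<psi>\<close> of the finitely many formulas is not
      algebraic, so an injective sequence of its solutions meets all the conditions in
      \<open>F\<close> at once.\<close>
    then have "infinite {c\<in>univ S. sat S (\<lambda>_. c) \<psi>}" using e \<psi>(1) by (auto simp: acl_def)
    then obtain s :: "nat \<Rightarrow> 'a" where s: "inj s" "range s \<subseteq> {c\<in>univ S. sat S (\<lambda>_. c) \<psi>}"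
      using infinite_countable_subset by blast
    have "P j s" if "j \<in> F" for j
    proof (cases j)
      case (Inl p)
      then obtain \<phi> i where j: "j = Inl (\<phi>, i)" by (cases p) auto
      have "s i \<in> univ S" "sat S (\<lambda>_. s i) \<psi>" using s(2) by auto
      then have "sat S (\<lambda>_. s i) \<phi>" using \<psi>(2)[of "\<lambda>_. s i"] that j by auto
      then show ?thesis using j by (simp add: P_def)
    next
      case (Inr p)
      then have "Inr p \<in> J" using that F(2) by blast
      then obtain k l where "j = Inr (k, l)" "k \<noteq> l" using Inr by (auto simp: J_def)
      then show ?thesis using s(1) by (auto simp: P_def inj_eq)
    qed
    with s(2) show "\<exists>\<sigma>. range \<sigma> \<subseteq> univ S \<and> (\<forall>j\<in>F. P j \<sigma>)" by (intro exI[of _ s]) auto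
  qed
  then obtain s where s1: "range s \<subseteq> univ S" and "\<forall>j\<in>J. P j s" by (elim exE conjE)
  then have s: "range s \<subseteq> univ S" "\<And>j. j \<in> J \<Longrightarrow> P j s" by simp_all
  have inj: "inj s" using s(2)[of "Inr (_, _)"] by (auto simp: inj_def J_def P_def)
  have sf: "sat S (\<lambda>_. s i) \<phi>" if "\<phi> \<in> forms L C {0 :: nat}" "sat S (\<lambda>_. e) \<phi>" for i \<phi>
    using s(2)[of "Inl (\<phi>, i)"] that by (auto simp: J_def P_def)
  have "\<exists>f. elem_map_over C {e} f \<and> f e = s i" for i
  proof -
    have "sat S (\<lambda>_. s i) \<phi> = sat S (\<lambda>_. e) \<phi>" if "\<phi> \<in> forms L C {0 :: nat}" for \<phi>
      using sf[OF that] sf[of "Neg \<phi>"] that by auto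
    then have "tp L S C {0 :: nat} (\<lambda>_. e) = tp L S C {0} (\<lambda>_. s i)" unfolding tp_def by blast
    moreover have "s i \<in> univ S" using s(1) by auto
    ultimately obtain f where "elem_map (C \<union> (\<lambda>_. e) ` {0 :: nat}) f" "\<And>c. c \<in> C \<Longrightarrow> f c = c" "\<And>i'. i' \<in> {0 :: nat} \<Longrightarrow> f e = s i"
      using tp_elem_map[of C "\<lambda>_. e" "{0 :: nat}" "\<lambda>_. s i"] C(1) e(1) by auto
    then show ?thesis by (intro exI[of _ f]) (auto simp: elem_map_over_def)
  qed
  then obtain g where g: "\<And>i. elem_map_over C {e} (g i)" "\<And>i. g i e = s i" by metis
  show thesis by (rule that[of g]) (use g inj in auto)
qed

text \<open>A finite tuple from the algebraic closure has finitely many conjugates, so infinitely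
  many maps of any sequence agree on it. This is the mechanism behind transitivity of
  \<open>acl\<close> and all its interactions with dividing.\<close>

lemma orbit_pigeonhole:
  fixes g :: "nat \<Rightarrow> 'a \<Rightarrow> 'a"
  assumes D: "finite D" "D \<subseteq> acl L S C" and C: "C \<subseteq> univ S" and g: "\<And>i. elem_map_over C D (g i)"
  obtains I where "infinite I" "\<And>i j d. i \<in> I \<Longrightarrow> j \<in> I \<Longrightarrow> d \<in> D \<Longrightarrow> g i d = g j d"
proof -
  let ?r = "\<lambda>i. restrict (g i) D"
  have "range ?r \<subseteq> PiE D (\<lambda>d. {f d |f. elem_map_over C {d} f})"
  proof (intro image_subsetI PiE_I)
    fix i d assume "d \<in> D"
    then have "elem_map_over C {d} (g i)" using g[of i] elem_map_mono[of "C \<union> D" "g i" "C \<union> {d}"] by (auto simp: elem_map_over_def)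
    then show "?r i d \<in> {f d |f. elem_map_over C {d} f}" using \<open>d \<in> D\<close> by auto
  qed auto
  moreover have "finite (PiE D (\<lambda>d. {f d |f. elem_map_over C {d} f}))"
    using D C finite_orbit by (intro finite_PiE) auto
  ultimately have "finite (range ?r)" using finite_subset by blast
  then obtain i0 where i0: "infinite {i\<in>UNIV. ?r i = ?r i0}"
    using pigeonhole_infinite[of "UNIV :: nat set" ?r] by auto
  show thesis
  proof (rule that[OF i0])
    fix i j d assume *: "i \<in> {i\<in>UNIV. ?r i = ?r i0}" "j \<in> {i\<in>UNIV. ?r i = ?r i0}" and d: "d \<in> D"
    then have "?r i d = ?r j d" by simp
    then show "g i d = g j d" using d by simp
  qed
qed

lemma elem_map_overD:
  assumes "elem_map_over C D f"
  shows "elem_map (C \<union> D) f" "\<And>c. c \<in> C \<Longrightarrow> f c = c"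
  using assms by (auto simp: elem_map_over_def)

lemma elem_map_acl:
  assumes elem_map: "elem_map Z f" and A: "A \<subseteq> Z" "|A| <o \<kappa>" and e: "e \<in> Z" "e \<in> acl L S A"
  shows "f e \<in> acl L S (f ` A)"
proof (rule ccontr)
  assume n: "f e \<notin> acl L S (f ` A)"
  let ?B = "insert e A"
  have em0: "elem_map ?B f" using elem_map_mono[OF elem_map] A e by simp
  note u = elem_map_univ[OF em0]
  obtain g :: "nat \<Rightarrow> 'a \<Rightarrow> 'a" where g: "\<And>i. elem_map_over (f ` A) {f e} (g i)" "inj (\<lambda>i. g i (f e))"
    using infinite_orbit[of "f ` A" "f e"] u A(2) n by auto
  let ?s = "\<lambda>i. g i (f e)"
  have su: "range ?s \<subseteq> univ S" using elem_map_univ(2)[OF elem_map_overD(1)[OF g(1)]] by auto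
  have "|?B| <o \<kappa>" using A(2) small_Un[of "{e}" A] by auto
  then obtain k where k: "elem_map (f ` ?B \<union> range ?s) k" "\<And>z. z \<in> f ` ?B \<Longrightarrow> k z = inv_into ?B f z"
    using elem_map_extend[OF elem_map_inv[OF em0], of "range ?s"] su small_image[OF small_nat_type] by blast
  let ?h = "\<lambda>i z. k (g i (f z))"
  have h: "elem_map_over A {e} (?h i)" for i
    unfolding elem_map_over_def
  proof
    have 1: "elem_map (f ` ?B) (g i)" using elem_map_overD(1)[OF g(1)] by simp
    have "g i ` f ` ?B \<subseteq> f ` ?B \<union> range ?s" using elem_map_overD(2)[OF g(1)] by auto
    then have "elem_map (g i ` f ` ?B) k" using elem_map_mono[OF k(1)] by blast
    then have "elem_map (f ` ?B) (\<lambda>z. k (g i z))" using elem_map_comp[OF 1] by blast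
    then have "elem_map ?B (?h i)" using elem_map_comp[OF em0] by blast
    then show "elem_map (A \<union> {e}) (?h i)" by simp
    show "\<forall>c\<in>A. ?h i c = c"
      using elem_map_overD(2)[OF g(1)] k(2) inv_into_f_f[OF elem_map_inj[OF em0]] by auto
  qed
  have "inj (\<lambda>i. ?h i e)"
  proof (rule injI)
    fix i j assume "?h i e = ?h j e"
    then have "?s i = ?s j" using elem_map_inj[OF k(1)] by (auto dest: inj_onD)
    then show "i = j" using g(2) by (auto dest: injD)
  qed
  then have "infinite (range (\<lambda>i. ?h i e))" using finite_imageD infinite_UNIV_nat by blast
  moreover have "range (\<lambda>i. ?h i e) \<subseteq> {f e |f. elem_map_over A {e} f}"
  proof
    fix z assume "z \<in> range (\<lambda>i. ?h i e)"
    then obtain i where "z = ?h i e" by blast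
    then show "z \<in> {f e |f. elem_map_over A {e} f}" using h[of i] by (intro CollectI exI[of _ "?h i"]) simp
  qed
  ultimately show False using finite_orbit[OF e(2)] u(1) finite_subset by blast
qed

text \<open>Take infinitely many conjugates of \<open>e\<close> over \<open>C\<close> and extend the
  maps to a finite \<open>E\<close> in the closure of \<open>C\<close> over which \<open>e\<close>
  is algebraic. Infinitely many of the maps agree on \<open>E\<close>, so some conjugate of
  \<open>e\<close> has an infinite orbit over the common image of \<open>E\<close>, although it is
  algebraic over it.\<close>

lemma acl_trans:
  assumes C: "C \<subseteq> univ S" "|C| <o \<kappa>" and D: "D \<subseteq> acl L S C"
  shows "acl L S D \<subseteq> acl L S C"
proof (rule subsetI, rule ccontr)
  fix e assume e: "e \<in> acl L S D" "e \<notin> acl L S C"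
  obtain E where E: "finite E" "E \<subseteq> D" "e \<in> acl L S E" using acl_finite_support[OF e(1)] .
  have eu: "e \<in> univ S" using e(1) acl_univ by auto
  have Eu: "E \<subseteq> acl L S C" "E \<subseteq> univ S" using E(2) D acl_univ by auto
  obtain g :: "nat \<Rightarrow> 'a \<Rightarrow> 'a" where g: "\<And>i. elem_map_over C {e} (g i)" "inj (\<lambda>i. g i e)"
    using infinite_orbit[OF C eu e(2)] by metis
  have "\<exists>h. elem_map (C \<union> {e} \<union> E) h \<and> (\<forall>z\<in>C \<union> {e}. h z = g i z)" for i
    using elem_map_extend[OF elem_map_overD(1)[OF g(1)[of i]], of E] C(2) E(1) Eu(2) small_Un small_finite
    by (metis finite.emptyI finite.insertI)
  then obtain h where h: "\<And>i. elem_map (C \<union> {e} \<union> E) (h i)" "\<And>i z. z \<in> C \<union> {e} \<Longrightarrow> h i z = g i z" by metis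
  have hC: "h i c = c" if "c \<in> C" for i c using h(2) elem_map_overD(2)[OF g(1)] that by simp
  have "elem_map_over C E (h i)" for i
    using elem_map_mono[OF h(1)[of i], of "C \<union> E"] hC by (auto simp: elem_map_over_def)
  then obtain I where I: "infinite I" "\<And>i j d. i \<in> I \<Longrightarrow> j \<in> I \<Longrightarrow> d \<in> E \<Longrightarrow> h i d = h j d"
    using orbit_pigeonhole[OF E(1) Eu(1) C(1), of h] by metis
  then have "I \<noteq> {}" by auto
  then obtain i0 where i0: "i0 \<in> I" by blast
  let ?B = "insert e E"
  have emB: "elem_map ?B (h i)" for i using elem_map_mono[OF h(1)[of i], of ?B] by auto
  let ?e = "h i0 e" and ?E = "h i0 ` E"
  have acl: "?e \<in> acl L S ?E"
    using elem_map_acl[OF emB, of E e i0] E small_finite by auto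
  have *: "h i e \<in> {f ?e |f. elem_map_over ?E {?e} f}" if "i \<in> I" for i
  proof -
    let ?k = "\<lambda>z. h i (inv_into ?B (h i0) z)"
    have inv: "inv_into ?B (h i0) (h i0 z) = z" if "z \<in> ?B" for z
      using inv_into_f_f[OF elem_map_inj[OF emB]] that by blast
    have 1: "elem_map (h i0 ` ?B) (inv_into ?B (h i0))" by (rule elem_map_inv[OF emB])
    have "inv_into ?B (h i0) ` h i0 ` ?B \<subseteq> ?B" using inv by auto
    then have "elem_map (h i0 ` ?B) ?k" using elem_map_comp[OF 1] elem_map_mono[OF emB[of i]] by blast
    then have "elem_map (?E \<union> {?e}) ?k" by simp
    moreover have "?k (h i0 d) = h i0 d" if "d \<in> E" for d using inv that I(2)[OF \<open>i \<in> I\<close> i0] by simp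
    ultimately have "elem_map_over ?E {?e} ?k" by (auto simp: elem_map_over_def)
    moreover have "?k ?e = h i e" using inv by simp
    ultimately show ?thesis by (metis (mono_tags, lifting) mem_Collect_eq)
  qed
  have "inj_on (\<lambda>i. h i e) I" using g(2) h(2) by (auto simp: inj_on_def inj_def)
  then have "infinite ((\<lambda>i. h i e) ` I)" using I(1) finite_imageD by blast
  moreover have "(\<lambda>i. h i e) ` I \<subseteq> {f ?e |f. elem_map_over ?E {?e} f}" using * by blast
  moreover have "finite {f ?e |f. elem_map_over ?E {?e} f}"
    by (rule finite_orbit[OF acl]) (use elem_map_univ(2)[OF emB] in auto)
  ultimately show False using finite_subset by blast
qed

lemma acl_idem: "C \<subseteq> univ S \<Longrightarrow> |C| <o \<kappa> \<Longrightarrow> acl L S (acl L S C) = acl L S C"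
  using acl_trans[of C "acl L S C"] acl_incl[OF acl_univ, of C] by auto

text \<open>Both images of \<open>e\<close> solve the formula defining \<open>e\<close> with its
  parameters replaced by their common images. Having a single solution is a property of the
  parameters and is preserved.\<close>

lemma elem_map_dcl_unique:
  assumes f: "elem_map Z f" and g: "elem_map Z g" and A: "A \<subseteq> Z" "\<And>a. a \<in> A \<Longrightarrow> f a = g a"
    and e: "e \<in> Z" "e \<in> dcl L S A"
  shows "f e = g e"
proof (rule ccontr)
  assume ne: "f e \<noteq> g e"
  obtain \<phi> where \<phi>: "\<phi> \<in> forms L A {0 :: nat}" "{c\<in>univ S. sat S (\<lambda>_. c) \<phi>} = {e}"
    using e(2) unfolding dcl_def by blast
  have zu: "z \<in> univ S" "f z \<in> univ S" "g z \<in> univ S" if "z \<in> Z" for z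
    using that elem_map_univ[OF f] elem_map_univ[OF g] by auto
  have Az: "a \<in> Z" if "a \<in> A" for a using that A by auto
  have Au: "A \<subseteq> univ S" using Az zu by auto
  obtain R where R: "definable L S {} (Inl ` A \<union> Inr ` {0 :: nat}) R"
    "\<And>\<sigma>. \<sigma> ` {0} \<subseteq> univ S \<Longrightarrow> R (case_sum id \<sigma>) = sat S \<sigma> \<phi>"
    using definable_unpar[OF definable_sat[OF \<phi>(1)] Au] by metis
  let ?X = "Inl ` A \<union> Inr ` {0 :: nat, 1}"
  let ?s = "case_sum Inl (\<lambda>_. Inr 1) :: 'a + nat \<Rightarrow> 'a + nat"
  have 1: "definable L S {} ?X R" by (rule definable_mono[OF R(1)]) auto
  have 2: "definable L S {} ?X (\<lambda>\<rho>. R (\<lambda>i. \<rho> (?s i)))" by (rule definable_reindex_var[OF R(1)]) auto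
  have "definable L S {} ?X (\<lambda>\<rho>. sat S \<rho> (Neg (Eq (Var (Inr 0)) (Var (Inr 1)))))"
    by (rule definable_sat) (auto simp: forms_def Neg_def)
  then have 3: "definable L S {} ?X (\<lambda>\<rho>. \<rho> (Inr 0) \<noteq> \<rho> (Inr 1))" by simp
  \<comment> \<open>For given values of the parameters, \<open>?U\<close> asserts two distinct
    solutions; \<open>?s\<close> redirects the solution variable to the second one. It fails at
    \<open>A\<close> and hence at the image of \<open>A\<close>.\<close>
  let ?U = "\<lambda>\<rho>. \<exists>\<tau>. \<tau> ` ?X \<subseteq> univ S \<and> (\<forall>i\<in>?X \<inter> Inl ` A. \<tau> i = \<rho> i) \<and>
    R \<tau> \<and> R (\<lambda>i. \<tau> (?s i)) \<and> \<tau> (Inr 0) \<noteq> \<tau> (Inr 1)"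
  have U: "definable L S {} (Inl ` A) ?U"
    by (rule definable_ex[OF definable_conj[OF 1 definable_conj[OF 2 3]] nonempty])
  let ?i = "case_sum id (\<lambda>_. e) :: 'a + nat \<Rightarrow> 'a"
  have Re: "R ?i" using R(2)[of "\<lambda>_. e"] \<phi>(2) by auto
  have ai: "?i ` (Inl ` A \<union> Inr ` {0 :: nat}) \<subseteq> Z" using A e by auto
  have "\<not> ?U ?i"
  proof
    assume "?U ?i"
    then obtain \<tau> where \<tau>: "\<tau> ` ?X \<subseteq> univ S" "\<forall>i\<in>?X \<inter> Inl ` A. \<tau> i = ?i i" "R \<tau>" "R (\<lambda>i. \<tau> (?s i))"
      "\<tau> (Inr 0) \<noteq> \<tau> (Inr 1)" by (elim exE conjE)
    have t: "\<tau> (Inr 0) \<in> univ S" "\<tau> (Inr 1) \<in> univ S" using \<tau>(1) by auto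
    have ta: "\<tau> (Inl a) = a" if "a \<in> A" for a using \<tau>(2) that by auto
    have "R \<tau> = R (case_sum id (\<lambda>_. \<tau> (Inr 0)))"
      by (rule definable_agree[OF R(1)]) (use t ta Au in auto)
    then have "\<tau> (Inr 0) = e" using R(2)[of "\<lambda>_. \<tau> (Inr 0)"] \<tau>(3) t \<phi>(2) by auto
    moreover have "R (\<lambda>i. \<tau> (?s i)) = R (case_sum id (\<lambda>_. \<tau> (Inr 1)))"
      by (rule definable_agree[OF R(1)]) (use t ta Au in auto)
    then have "\<tau> (Inr 1) = e" using R(2)[of "\<lambda>_. \<tau> (Inr 1)"] \<tau>(4) t \<phi>(2) by auto
    ultimately show False using \<tau>(5) by simp
  qed
  moreover have "?i ` Inl ` A \<subseteq> Z" using A by auto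
  ultimately have nU: "\<not> ?U (\<lambda>s. f (?i s))" by (rule contrapos_nn[OF _ iffD2[OF elem_map_definable0[OF f U]]])
  let ?\<tau> = "case_sum f (\<lambda>n. if n = 0 then f e else g e) :: 'a + nat \<Rightarrow> 'a"
  have "R (\<lambda>s. f (?i s))" using elem_map_definable0[OF f R(1) ai] Re by simp
  moreover have "R (\<lambda>s. f (?i s)) = R ?\<tau>"
    by (rule definable_agree[OF R(1)]) (use zu Az e in auto)
  moreover have "R (\<lambda>s. g (?i s))" using elem_map_definable0[OF g R(1) ai] Re by simp
  moreover have "R (\<lambda>s. g (?i s)) = R (\<lambda>i. ?\<tau> (?s i))"
    by (rule definable_agree[OF R(1)]) (use zu Az e A in auto)
  ultimately have "?U (\<lambda>s. f (?i s))"
    using ne zu Az e by (intro exI[of _ ?\<tau>] conjI) auto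
  with nU show False by (rule notE)
qed

subsection \<open>Dividing\<close>

lemma k_inconsistent_cong:
  assumes "\<And>i y. y \<in> Y \<Longrightarrow> b i y = b' i y"
  shows "k_inconsistent S k \<phi> Y b = k_inconsistent S k \<phi> Y b'"
proof -
  have "override_on \<sigma> (b i) Y = override_on \<sigma> (b' i) Y" for \<sigma> i
    using assms by (auto simp: override_on_def)
  then show ?thesis unfolding k_inconsistent_def by simp
qed

text \<open>The conjugate tuples are presented as images of \<open>b\<close> under elementary maps
  over \<open>C\<close>, so that they can be extended to further elements and composed with other
  maps.\<close>

lemma dividesE:
  assumes "divides L S C \<phi> Y b" "C \<subseteq> univ S" "b ` Y \<subseteq> univ S"
  obtains k and g :: "nat \<Rightarrow> 'a \<Rightarrow> 'a" where "\<And>i. elem_map_over C (b ` Y) (g i)"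
    "k_inconsistent S k \<phi> Y (\<lambda>i v. g i (b v))"
proof -
  obtain k b' where b': "\<forall>i. b' i ` Y \<subseteq> univ S \<and> tp L S C Y (b' i) = tp L S C Y b" "k_inconsistent S k \<phi> Y b'"
    using assms(1) unfolding divides_def by (elim exE conjE)
  have "\<exists>f. elem_map_over C (b ` Y) f \<and> (\<forall>y\<in>Y. f (b y) = b' i y)" for i
    using tp_elem_map[OF infinite_UNIV_nat assms(2,3), of "b' i"] b'(1) unfolding elem_map_over_def by metis
  then obtain g where g: "\<And>i. elem_map_over C (b ` Y) (g i)" "\<And>i y. y \<in> Y \<Longrightarrow> g i (b y) = b' i y" by metis
  show thesis
  proof (rule that[OF g(1)])
    show "k_inconsistent S k \<phi> Y (\<lambda>i v. g i (b v))"
      using b'(2) k_inconsistent_cong[of Y "\<lambda>i v. g i (b v)" b' k \<phi>] g(2) by simp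
  qed
qed

lemma dividesI:
  assumes "\<And>i. elem_map_over C (b ` Y) (g i)" "k_inconsistent S k \<phi> Y (\<lambda>i v. g i (b v))"
  shows "divides L S C \<phi> Y b"
  unfolding divides_def
proof (intro exI conjI allI)
  show "k_inconsistent S k \<phi> Y (\<lambda>i v. g i (b v))" by fact
  fix i
  note g = elem_map_overD[OF assms(1)[of i]]
  show "(\<lambda>v. g i (b v)) ` Y \<subseteq> univ S" using elem_map_univ(2)[OF g(1)] by auto
  show "tp L S C Y (\<lambda>v. g i (b v)) = tp L S C Y b"
    by (rule elem_map_tp[OF g(1), symmetric]) (use g(2) in auto)
qed

text \<open>The parameters of all instances are packed into one tuple indexed by pairs. Joint
  consistency of finitely many instances thus becomes a definable relation of that tuple, which
  elementary maps preserve.\<close>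

definition consis :: "('f, 'r, 'a, nat) fm \<Rightarrow> nat set \<Rightarrow> nat set \<Rightarrow> (nat \<times> nat \<Rightarrow> 'a) \<Rightarrow> bool" where
  "consis \<phi> Y I \<beta> \<longleftrightarrow> (\<exists>\<sigma>. range \<sigma> \<subseteq> univ S \<and> (\<forall>i\<in>I. sat S (override_on \<sigma> (\<lambda>y. \<beta> (i, y)) Y) \<phi>))"

lemma k_inconsistent_iff:
  "k_inconsistent S k \<phi> Y b \<longleftrightarrow> (\<forall>I. finite I \<and> card I = k \<longrightarrow> \<not> consis \<phi> Y I (\<lambda>(i, y). b i y))"
  by (simp add: k_inconsistent_def consis_def)

lemma consis_definable:
  assumes "\<phi> \<in> forms L {} UNIV" "finite I"
  shows "definable L S {} (I \<times> Y) (consis \<phi> Y I)"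
proof -
  let ?g = "\<lambda>i v. if v \<in> Y then Inl (i, v) else Inr v"
  let ?X = "Inl ` (I \<times> Y) \<union> range Inr :: (nat \<times> nat + nat) set"
  have "definable L S {} ?X (\<lambda>\<rho>. sat S (\<lambda>v. \<rho> (?g i v)) \<phi>)" if "i \<in> I" for i
    by (rule definable_reindex_var[OF definable_sat[OF assms(1)]]) (use that in auto)
  then have 1: "definable L S {} ?X (\<lambda>\<rho>. \<forall>i\<in>I. sat S (\<lambda>v. \<rho> (?g i v)) \<phi>)"
    by (intro definable_ball assms(2))
  let ?R = "\<lambda>\<rho>. \<exists>\<tau>. \<tau> ` ?X \<subseteq> univ S \<and> (\<forall>s\<in>?X \<inter> Inl ` (I \<times> Y). \<tau> s = \<rho> s) \<and> (\<forall>i\<in>I. sat S (\<lambda>v. \<tau> (?g i v)) \<phi>)"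
  have 2: "definable L S {} (Inl ` (I \<times> Y)) ?R"
    by (rule definable_ex[OF 1 nonempty])
  have 3: "definable L S {} (I \<times> Y) (\<lambda>\<beta>. ?R (\<lambda>s. \<beta> (case_sum id undefined s)))"
    by (rule definable_reindex_var[OF 2]) auto
  show ?thesis
  proof (rule definable_cong[OF 3])
    fix \<beta> assume \<beta>: "\<beta> ` (I \<times> Y) \<subseteq> univ S"
    show "?R (\<lambda>s. \<beta> (case_sum id undefined s)) = consis \<phi> Y I \<beta>"
    proof
      assume "?R (\<lambda>s. \<beta> (case_sum id undefined s))"
      then obtain \<tau> where \<tau>: "\<tau> ` ?X \<subseteq> univ S" "\<forall>s\<in>?X \<inter> Inl ` (I \<times> Y). \<tau> s = \<beta> (case_sum id undefined s)"
        "\<forall>i\<in>I. sat S (\<lambda>v. \<tau> (?g i v)) \<phi>" by (elim exE conjE)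
      have "(\<lambda>v. \<tau> (?g i v)) = override_on (\<lambda>v. \<tau> (Inr v)) (\<lambda>y. \<beta> (i, y)) Y" if "i \<in> I" for i
        using \<tau>(2) that by (auto simp: fun_eq_iff override_on_def)
      moreover have "range (\<lambda>v. \<tau> (Inr v)) \<subseteq> univ S" using \<tau>(1) by auto
      ultimately show "consis \<phi> Y I \<beta>" using \<tau>(3) unfolding consis_def
        by (intro exI[of _ "\<lambda>v. \<tau> (Inr v)"]) simp
    next
      assume "consis \<phi> Y I \<beta>"
      then obtain \<sigma> where \<sigma>: "range \<sigma> \<subseteq> univ S" "\<forall>i\<in>I. sat S (override_on \<sigma> (\<lambda>y. \<beta> (i, y)) Y) \<phi>"
        unfolding consis_def by (elim exE conjE)
      have "(\<lambda>v. case_sum \<beta> \<sigma> (?g i v)) = override_on \<sigma> (\<lambda>y. \<beta> (i, y)) Y" for i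
        by (auto simp: fun_eq_iff override_on_def)
      then have "\<forall>i\<in>I. sat S (\<lambda>v. case_sum \<beta> \<sigma> (?g i v)) \<phi>" using \<sigma>(2) by simp
      moreover have "case_sum \<beta> \<sigma> ` ?X \<subseteq> univ S" using \<sigma>(1) \<beta> by auto
      ultimately show "?R (\<lambda>s. \<beta> (case_sum id undefined s))"
        by (intro exI[of _ "case_sum \<beta> \<sigma>"] conjI) auto
    qed
  qed
qed

lemma consis_elem_map:
  assumes "elem_map Z f" "\<phi> \<in> forms L {} UNIV" "finite I" "\<beta> ` (I \<times> Y) \<subseteq> Z"
  shows "consis \<phi> Y I (\<lambda>p. f (\<beta> p)) = consis \<phi> Y I \<beta>"
  using elem_map_definable0[OF assms(1) consis_definable[OF assms(2,3)] assms(4)] by simp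

lemma elem_map_k_inconsistent:
  assumes "elem_map Z f" "\<phi> \<in> forms L {} UNIV" "\<And>i. b i ` Y \<subseteq> Z" "k_inconsistent S k \<phi> Y b"
  shows "k_inconsistent S k \<phi> Y (\<lambda>i v. f (b i v))"
  unfolding k_inconsistent_iff
proof (intro allI impI)
  fix I :: "nat set" assume I: "finite I \<and> card I = k"
  have "(\<lambda>(i, y). b i y) ` (I \<times> Y) \<subseteq> Z" using assms(3) by auto
  from consis_elem_map[OF assms(1,2) _ this] I
  have "consis \<phi> Y I (\<lambda>p. f (case p of (i, y) \<Rightarrow> b i y)) = consis \<phi> Y I (\<lambda>(i, y). b i y)" by simp
  moreover have "(\<lambda>p. f (case p of (i, y) \<Rightarrow> b i y)) = (\<lambda>(i, y). f (b i y))" by auto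
  ultimately show "\<not> consis \<phi> Y I (\<lambda>(i, y). f (b i y))"
    using assms(4) I unfolding k_inconsistent_iff by simp
qed

text \<open>Variables may be identified as long as parameter variables stay apart from solution
  variables and identified parameters have equal values: a common solution after renaming yields one
  before.\<close>

lemma divides_reindex:
  assumes \<phi>: "\<phi> \<in> forms L {} UNIV" and C: "C \<subseteq> univ S" and b: "b ` Y \<subseteq> univ S" and div: "divides L S C \<phi> Y b"
    and sat': "\<And>\<sigma>. sat S \<sigma> \<phi>' = sat S (\<lambda>v. \<sigma> (g v)) \<phi>"
    and b': "\<And>v. v \<in> Y \<Longrightarrow> b' (g v) = b v" and g: "\<And>v. v \<in> fv \<phi> \<Longrightarrow> v \<notin> Y \<Longrightarrow> g v \<notin> g ` Y"
  shows "divides L S C \<phi>' (g ` Y) b'"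
proof -
  obtain k h where h: "\<And>i. elem_map_over C (b ` Y) (h i)" "k_inconsistent S k \<phi> Y (\<lambda>i v. h i (b v))"
    using dividesE[OF div C b] by metis
  have eq: "b' ` g ` Y = b ` Y" using b' by force
  show ?thesis
  proof (rule dividesI)
    show "elem_map_over C (b' ` g ` Y) (h i)" for i using h(1) eq by simp
    show "k_inconsistent S k \<phi>' (g ` Y) (\<lambda>i v. h i (b' v))"
      unfolding k_inconsistent_def
    proof (intro allI impI notI)
      fix I :: "nat set" assume I: "finite I \<and> card I = k"
        and "\<exists>\<sigma>. range \<sigma> \<subseteq> univ S \<and> (\<forall>i\<in>I. sat S (override_on \<sigma> (\<lambda>v. h i (b' v)) (g ` Y)) \<phi>')"
      then obtain \<sigma> where \<sigma>: "range \<sigma> \<subseteq> univ S" "\<forall>i\<in>I. sat S (override_on \<sigma> (\<lambda>v. h i (b' v)) (g ` Y)) \<phi>'"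
        by (elim exE conjE)
      have "sat S (override_on (\<lambda>v. \<sigma> (g v)) (\<lambda>v. h i (b v)) Y) \<phi>" if "i \<in> I" for i
      proof -
        have "sat S (\<lambda>v. override_on \<sigma> (\<lambda>v. h i (b' v)) (g ` Y) (g v)) \<phi>" using \<sigma>(2) that sat' by simp
        moreover have "sat S (\<lambda>v. override_on \<sigma> (\<lambda>v. h i (b' v)) (g ` Y) (g v)) \<phi>
          = sat S (override_on (\<lambda>v. \<sigma> (g v)) (\<lambda>v. h i (b v)) Y) \<phi>"
          by (rule sat_cong) (use b' g in \<open>auto simp: override_on_def\<close>)
        ultimately show ?thesis by simp
      qed
      moreover have "range (\<lambda>v. \<sigma> (g v)) \<subseteq> univ S" using \<sigma>(1) by auto
      ultimately show False using h(2) I unfolding k_inconsistent_def by blast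
    qed
  qed
qed

text \<open>The map \<open>g\<close> is extended to \<open>k'\<close> on the whole dividing
  sequence; conjugating the witnessing maps by it, as \<open>k'\<close> after \<open>h i\<close>
  after the inverse of \<open>g\<close>, gives witnesses over the image of \<open>C\<close>.\<close>

lemma elem_map_divides:
  assumes elem_map: "elem_map Z g" and Z: "C \<union> b ` Y \<subseteq> Z" and C: "|C| <o \<kappa>" and Y: "finite Y"
    and \<phi>: "\<phi> \<in> forms L {} UNIV" and div: "divides L S C \<phi> Y b"
  shows "divides L S (g ` C) \<phi> Y (\<lambda>v. g (b v))"
proof -
  let ?B = "C \<union> b ` Y"
  have em0: "elem_map ?B g" using elem_map_mono[OF elem_map Z] .
  note u = elem_map_univ[OF em0]
  obtain k h where h: "\<And>i. elem_map_over C (b ` Y) (h i)" "k_inconsistent S k \<phi> Y (\<lambda>i v. h i (b v))"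
    using dividesE[OF div] u(1) by (metis le_sup_iff)
  let ?H = "\<Union>i. h i ` b ` Y"
  have "?H = (\<lambda>(i, y). h i (b y)) ` (UNIV \<times> Y)" by force
  moreover have "|(UNIV :: nat set) \<times> Y| <o \<kappa>"
  proof -
    have "|(UNIV :: nat set) \<times> Y| \<le>o |(UNIV :: nat set) \<times> (UNIV :: nat set)|" by (rule card_of_mono1) auto
    moreover have "|(UNIV :: nat set) \<times> (UNIV :: nat set)| \<le>o |UNIV :: nat set|"
      using card_of_Times_same_infinite[OF infinite_UNIV_nat] ordIso_imp_ordLeq by blast
    ultimately show ?thesis using small_nat_type ordLeq_transitive ordLeq_ordLess_trans by blast
  qed
  ultimately have smallH: "|?H| <o \<kappa>" using small_image by metis
  have Hu: "?H \<subseteq> univ S" using elem_map_univ(2)[OF elem_map_overD(1)[OF h(1)]] by auto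
  have "|?B| <o \<kappa>" using C Y by auto
  then obtain k' where k': "elem_map (?B \<union> ?H) k'" "\<And>z. z \<in> ?B \<Longrightarrow> k' z = g z"
    using elem_map_extend[OF em0 _ smallH Hu] by blast
  let ?g' = "inv_into ?B g"
  have inv: "?g' (g z) = z" if "z \<in> ?B" for z using inv_into_f_f[OF elem_map_inj[OF em0]] that by blast
  have gB: "g ` ?B = g ` C \<union> (\<lambda>v. g (b v)) ` Y" by auto
  show ?thesis
  proof (rule dividesI)
    fix i
    have 1: "elem_map (g ` ?B) ?g'" by (rule elem_map_inv[OF em0])
    have i1: "?g' ` g ` ?B = ?B" using inv by force
    have 2: "elem_map (?g' ` g ` ?B) (h i)" unfolding i1 by (rule elem_map_overD(1)[OF h(1)])
    have "h i ` C \<subseteq> ?B" using elem_map_overD(2)[OF h(1)] by auto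
    then have "h i ` ?B \<subseteq> ?B \<union> ?H" by blast
    then have 3: "elem_map (h i ` ?B) k'" using elem_map_mono[OF k'(1)] by blast
    have 4: "elem_map ?B (\<lambda>z. k' (h i z))" by (rule elem_map_comp[OF elem_map_overD(1)[OF h(1)] 3])
    have "elem_map (g ` ?B) (\<lambda>z. k' (h i (?g' z)))" by (rule elem_map_comp[OF 1]) (use 4 i1 in simp)
    moreover have "k' (h i (?g' z)) = z" if z: "z \<in> g ` C" for z
    proof -
      obtain c where c: "c \<in> C" "z = g c" using z by blast
      then show ?thesis using inv[of c] elem_map_overD(2)[OF h(1)] k'(2)[of c] by simp
    qed
    ultimately show "elem_map_over (g ` C) ((\<lambda>v. g (b v)) ` Y) (\<lambda>z. k' (h i (?g' z)))"
      unfolding elem_map_over_def gB by blast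
  next
    have "k_inconsistent S k \<phi> Y (\<lambda>i v. k' (h i (b v)))"
      by (rule elem_map_k_inconsistent[OF k'(1) \<phi> _ h(2)]) auto
    then show "k_inconsistent S k \<phi> Y (\<lambda>i v. k' (h i (?g' (g (b v)))))"
      using k_inconsistent_cong[of Y "\<lambda>i v. k' (h i (?g' (g (b v))))" "\<lambda>i v. k' (h i (b v))" k \<phi>] inv by simp
  qed
qed

text \<open>In the usual terms, the type of \<open>A\<close> over \<open>E \<union> C\<close> does
  not divide over \<open>C\<close>. Disjunctions, which distinguish forking from dividing, do not
  occur here; they are absorbed by letting the test set \<open>E\<close> vary in the two directions
  of the characterization of \<open>indep\<close>.\<close>

definition nondividing :: "'a set \<Rightarrow> 'a set \<Rightarrow> 'a set \<Rightarrow> bool" where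
  "nondividing A C E \<longleftrightarrow> (\<forall>\<phi>\<in>forms L {} (UNIV :: nat set). \<forall>Y b a. finite Y \<longrightarrow> b ` Y \<subseteq> E \<union> C \<longrightarrow>
     a ` (fv \<phi> - Y) \<subseteq> A \<longrightarrow> divides L S C \<phi> Y b \<longrightarrow> \<not> sat S (override_on a b Y) \<phi>)"

lemma nondividingD:
  "nondividing A C E \<Longrightarrow> \<phi> \<in> forms L {} (UNIV :: nat set) \<Longrightarrow> finite Y \<Longrightarrow> b ` Y \<subseteq> E \<union> C \<Longrightarrow>
     a ` (fv \<phi> - Y) \<subseteq> A \<Longrightarrow> divides L S C \<phi> Y b \<Longrightarrow> \<not> sat S (override_on a b Y) \<phi>"
  unfolding nondividing_def by blast

lemma elem_map_nondividing:
  assumes elem_map: "elem_map Z g" and Z: "A \<union> C \<union> E \<subseteq> Z" and C: "|C| <o \<kappa>" and n: "nondividing A C E"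
  shows "nondividing (g ` A) (g ` C) (g ` E)"
  unfolding nondividing_def
proof (intro ballI allI impI notI)
  let ?B = "A \<union> C \<union> E"
  have em0: "elem_map ?B g" using elem_map_mono[OF elem_map Z] .
  let ?k = "inv_into ?B g"
  have inv: "?k (g z) = z" if "z \<in> ?B" for z using inv_into_f_f[OF elem_map_inj[OF em0]] that by blast
  have emk: "elem_map (g ` ?B) ?k" by (rule elem_map_inv[OF em0])
  fix \<phi> :: "('f, 'r, 'a, nat) fm" and Y b a
  assume \<phi>: "\<phi> \<in> forms L {} UNIV" and Y: "finite Y" and b: "b ` Y \<subseteq> g ` E \<union> g ` C" and a: "a ` (fv \<phi> - Y) \<subseteq> g ` A"
    and div: "divides L S (g ` C) \<phi> Y b" and sat: "sat S (override_on a b Y) \<phi>"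
  have ia: "?k ` g ` A = A" "?k ` g ` C = C" "?k ` g ` E = E" using inv by force+
  have "divides L S (?k ` g ` C) \<phi> Y (\<lambda>v. ?k (b v))"
    by (rule elem_map_divides[OF emk _ _ Y \<phi> div]) (use b C in auto)
  then have div': "divides L S C \<phi> Y (\<lambda>v. ?k (b v))" unfolding ia .
  have b': "(\<lambda>v. ?k (b v)) ` Y \<subseteq> E \<union> C" using image_mono[OF b, of ?k] ia by (auto simp: image_Un image_image)
  have a': "(\<lambda>v. ?k (a v)) ` (fv \<phi> - Y) \<subseteq> A" using image_mono[OF a, of ?k] ia by (auto simp: image_image)
  have "sat S (override_on a b Y) \<phi> = sat S (\<lambda>v. ?k (override_on a b Y v)) \<phi>"
    by (rule elem_map_sat[OF emk \<phi>]) (use a b in \<open>auto simp: override_on_def image_subset_iff\<close>)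
  moreover have "(\<lambda>v. ?k (override_on a b Y v)) = override_on (\<lambda>v. ?k (a v)) (\<lambda>v. ?k (b v)) Y"
    by (auto simp: override_on_def)
  ultimately show False using nondividingD[OF n \<phi> Y b' a' div'] sat by simp
qed

subsection \<open>Forking\<close>

text \<open>This is the finite form of the characterization. If it failed, the condition
  \<open>R\<close> over \<open>B \<union> C\<close>, projected to the finitely many elements of
  \<open>A\<close> occurring in \<open>D\<close>, would imply the disjunction of the dividing
  formulas in \<open>D\<close>, and a formula in the type of these elements would fork.\<close>

lemma indep_avoids_dividing:
  assumes A: "A \<subseteq> univ S" and B: "B \<subseteq> univ S" and C: "C \<subseteq> univ S" and ind: "indep L S A C B"
    and R: "definable L S {} (A \<union> B \<union> C) R" "R id"
    and D: "finite D" "\<And>\<phi> Y b a. (\<phi>, Y, b, a) \<in> D \<Longrightarrow> \<phi> \<in> forms L {} (UNIV :: nat set) \<and> finite Y \<and>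
      b ` Y \<subseteq> univ S \<and> a ` (fv \<phi> - Y) \<subseteq> A \<and> divides L S C \<phi> Y b"
  shows "\<exists>f. f ` (A \<union> B \<union> C) \<subseteq> univ S \<and> (\<forall>z\<in>B \<union> C. f z = z) \<and> R f \<and>
    (\<forall>(\<phi>, Y, b, a)\<in>D. \<not> sat S (override_on (\<lambda>v. f (a v)) b Y) \<phi>)"
proof (rule ccontr)
  assume neg: "\<not> ?thesis"
  let ?U = "A \<union> B \<union> C"
  define V where "V = (\<Union>(\<phi>, Y, b, a)\<in>D. a ` (fv \<phi> - Y))"
  have "finite V" using D(1) by (auto simp: V_def)
  moreover have "V \<subseteq> A"
  proof
    fix z assume "z \<in> V"
    then obtain \<phi> Y b a where "(\<phi>, Y, b, a) \<in> D" "z \<in> a ` (fv \<phi> - Y)" by (auto simp: V_def)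
    with D(2) show "z \<in> A" by blast
  qed
  ultimately have V: "finite V" "V \<subseteq> A" .
  obtain n :: "'a \<Rightarrow> nat" and m where n: "inj_on n V" "n ` V = {..<m}"
    using finite_imp_inj_to_nat_seg[OF V(1)] by (auto simp: lessThan_def)
  let ?e = "inv_into V n"
  have en: "?e (n z) = z" if "z \<in> V" for z using n(1) that by simp
  let ?g = "\<lambda>z. if z \<in> B \<union> C then Inl z else Inr z"
  have 1: "definable L S ({} \<union> (B \<union> C)) ?U (\<lambda>\<tau>. R (inst \<tau> ?g))"
    by (rule definable_reindex[OF R(1)]) (use B C in auto)
  have "definable L S (B \<union> C) ?U (\<lambda>\<tau>. sat S \<tau> (Eq (Var z) (Par z)))" if "z \<in> V \<inter> (B \<union> C)" for z
    by (rule definable_sat) (use that V in \<open>auto simp: forms_def\<close>)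
  then have "definable L S (B \<union> C) ?U (\<lambda>\<tau>. \<tau> z = z)" if "z \<in> V \<inter> (B \<union> C)" for z using that by simp
  then have 2: "definable L S (B \<union> C) ?U (\<lambda>\<tau>. \<forall>z\<in>V \<inter> (B \<union> C). \<tau> z = z)"
    using V(1) by (intro definable_ball) auto
  \<comment> \<open>The projection of the requirements to the elements of \<open>V\<close>, which
    will be the formula \<open>\<theta>0\<close> once \<open>V\<close> is numbered by
    \<open>n\<close>. Elements of \<open>V\<close> that lie in \<open>B \<union> C\<close> are
    pinned down by equations.\<close>
  let ?R5 = "\<lambda>\<sigma>. \<exists>\<tau>. \<tau> ` ?U \<subseteq> univ S \<and> (\<forall>z\<in>?U \<inter> V. \<tau> z = \<sigma> z) \<and> R (inst \<tau> ?g) \<and> (\<forall>z\<in>V \<inter> (B \<union> C). \<tau> z = z)"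
  have 5: "definable L S (B \<union> C) V ?R5"
    by (rule definable_ex[OF definable_conj[OF _ 2] nonempty]) (use 1 in simp)
  have 6: "definable L S (B \<union> C) {..<m} (\<lambda>\<sigma>. ?R5 (\<lambda>z. \<sigma> (n z)))"
    by (rule definable_reindex_var[OF 5]) (use n in auto)
  obtain \<theta>0 where \<theta>0: "\<theta>0 \<in> forms L (B \<union> C) {..<m}"
    "\<forall>\<sigma>. \<sigma> ` {..<m} \<subseteq> univ S \<longrightarrow> ?R5 (\<lambda>z. \<sigma> (n z)) = sat S \<sigma> \<theta>0"
    using definable_form[OF 6 infinite_UNIV_nat] by (rule bexE)
  \<comment> \<open>The trivial equations make every variable below \<open>m\<close> occur in
    \<open>\<theta>\<close>, since \<open>forks\<close> admits only dividing formulas whose solution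
    variables are free in it.\<close>
  define \<theta> where "\<theta> = foldr (\<lambda>i. Con (Eq (Var i) (Var i))) [0..<m] \<theta>0"
  have sat\<theta>: "sat S \<sigma> \<theta> = sat S \<sigma> \<theta>0" for \<sigma>
  proof -
    have "sat S \<sigma> (foldr (\<lambda>i. Con (Eq (Var i) (Var i))) ks \<theta>0) = sat S \<sigma> \<theta>0" for ks
      by (induction ks) auto
    then show ?thesis by (simp add: \<theta>_def)
  qed
  have fv\<theta>: "fv \<theta> = {..<m}"
  proof -
    have "fv (foldr (\<lambda>i. Con (Eq (Var i) (Var i))) ks \<theta>0) = set ks \<union> fv \<theta>0" for ks
      by (induction ks) (auto simp: Con_def Neg_def)
    then show ?thesis using \<theta>0(1) by (auto simp: \<theta>_def forms_def)
  qed
  have \<theta>: "\<theta> \<in> forms L (B \<union> C) {..<m}"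
  proof -
    have "foldr (\<lambda>i. Con (Eq (Var i) (Var i))) ks \<theta>0 \<in> forms L (B \<union> C) {..<m}" if "set ks \<subseteq> {..<m}" for ks
      using that \<theta>0(1) by (induction ks) (auto simp: forms_def Con_def Neg_def)
    then show ?thesis by (simp add: \<theta>_def lessThan_atLeast0)
  qed
  have eu: "?e ` {..<m} = V" using n en by (metis (no_types, lifting) image_inv_into_cancel inv_into_image_cancel n(2) order_refl)
  have "?R5 id"
  proof (intro exI[of _ id] conjI)
    have "inst id ?g = id" by (auto simp: inst_def fun_eq_iff)
    then show "R (inst id ?g)" using R(2) by simp
  qed (use A B C in auto)
  moreover have "?R5 id = ?R5 (\<lambda>z. ?e (n z))"
    by (rule definable_agree[OF 5]) (use V A en in auto)
  ultimately have "?R5 (\<lambda>z. ?e (n z))" by (rule iffD1[rotated])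
  moreover have "?e ` {..<m} \<subseteq> univ S" using eu V A by auto
  ultimately have "sat S ?e \<theta>" using spec[OF \<theta>0(2), of ?e] sat\<theta> by (metis (no_types, lifting))
  then have tp: "\<theta> \<in> tp L S (B \<union> C) {..<m} ?e" using \<theta> by (simp add: tp_def)
  \<comment> \<open>Solution variables are sent to the numbers of their values, below
    \<open>m\<close>, and parameter variables are shifted by \<open>m\<close>, so that the two kinds
    cannot collide.\<close>
  define h where "h Y a v = (if v \<in> Y then m + v else n (a v))" for Y :: "nat set" and a :: "nat \<Rightarrow> 'a" and v
  have "\<exists>\<phi>'. \<phi>' \<in> forms L {} (h Y a ` fv \<phi>) \<and> (\<forall>\<sigma>. sat S \<sigma> \<phi>' = sat S (\<lambda>v. \<sigma> (h Y a v)) \<phi>)"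
    if \<phi>: "\<phi> \<in> forms L {} (UNIV :: nat set)" for \<phi> Y a
  proof (rule reindex_formE[OF \<phi> infinite_UNIV_nat, where g = "\<lambda>v. Inr (h Y a v)"])
    fix \<phi>' assume \<phi>': "wf_fm L \<phi>'" "pars \<phi>' \<subseteq> pars \<phi> \<union> {aa. Inl aa \<in> (\<lambda>v. Inr (h Y a v)) ` fv \<phi>}"
      "fv \<phi>' \<subseteq> {w. Inr w \<in> (\<lambda>v. (Inr (h Y a v) :: 'a + nat)) ` fv \<phi>}" "\<And>S \<sigma>. sat S \<sigma> \<phi>' = sat S (inst \<sigma> (\<lambda>v. Inr (h Y a v))) \<phi>"
    then show ?thesis using \<phi>
      by (intro exI[of _ \<phi>']) (auto simp: forms_def inst_def[abs_def] image_iff)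
  qed
  then obtain T where T: "\<And>\<phi> Y a. \<phi> \<in> forms L {} (UNIV :: nat set) \<Longrightarrow> T \<phi> Y a \<in> forms L {} (h Y a ` fv \<phi>)"
    "\<And>\<phi> Y a \<sigma>. \<phi> \<in> forms L {} (UNIV :: nat set) \<Longrightarrow> sat S \<sigma> (T \<phi> Y a) = sat S (\<lambda>v. \<sigma> (h Y a v)) \<phi>"
    by metis
  define tr where "tr = (\<lambda>(\<phi>, Y, b, a). (T \<phi> Y a, (\<lambda>v. m + v) ` Y, \<lambda>u :: nat. b (u - m) :: 'a))"
  have "forks L S C \<theta>"
    unfolding forks_def
  proof (intro exI[of _ "tr ` D"] conjI)
    show "finite (tr ` D)" using D(1) by simp
    show "\<forall>(\<phi>, Y, b)\<in>tr ` D. \<phi> \<in> forms L {} (fv \<theta> \<union> Y) \<and> finite Y \<and> b ` Y \<subseteq> univ S \<and> divides L S C \<phi> Y b"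
    proof
      fix x assume "x \<in> tr ` D"
      then obtain \<phi> Y b a where d: "(\<phi>, Y, b, a) \<in> D" and x: "x = tr (\<phi>, Y, b, a)" by auto
      note dd = D(2)[OF d]
      have \<phi>: "\<phi> \<in> forms L {} UNIV" using dd by blast
      have na: "n (a v) < m" if "v \<in> fv \<phi> - Y" for v
      proof -
        have "a v \<in> V" using d that unfolding V_def by force
        then show ?thesis using n(2) by blast
      qed
      have "h Y a ` fv \<phi> \<subseteq> fv \<theta> \<union> (\<lambda>v. m + v) ` Y" using na fv\<theta> by (auto simp: h_def)
      from subsetD[OF forms_mono[OF order_refl this] T(1)[OF \<phi>]]
      have "T \<phi> Y a \<in> forms L {} (fv \<theta> \<union> (\<lambda>v. m + v) ` Y)" .
      moreover have "(\<lambda>u. b (u - m)) ` (\<lambda>v. m + v) ` Y = b ` Y" by force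
      moreover have "h Y a ` Y = (\<lambda>v. m + v) ` Y" by (auto simp: h_def)
      moreover have "divides L S C (T \<phi> Y a) (h Y a ` Y) (\<lambda>u. b (u - m))"
      proof (rule divides_reindex[OF \<phi> C, of b Y])
        fix v assume "v \<in> fv \<phi>" "v \<notin> Y"
        then show "h Y a v \<notin> h Y a ` Y" using na[of v] by (auto simp: h_def)
      qed (use dd T(2)[OF \<phi>] in \<open>auto simp: h_def\<close>)
      ultimately show "case x of (\<phi>, Y, b) \<Rightarrow> \<phi> \<in> forms L {} (fv \<theta> \<union> Y) \<and> finite Y \<and> b ` Y \<subseteq> univ S \<and> divides L S C \<phi> Y b"
        using dd by (simp add: x tr_def)
    qed
    show "\<forall>\<sigma>. range \<sigma> \<subseteq> univ S \<and> sat S \<sigma> \<theta> \<longrightarrow> (\<exists>(\<phi>, Y, b)\<in>tr ` D. sat S (override_on \<sigma> b Y) \<phi>)"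
    proof (intro allI impI)
      fix \<sigma> assume \<sigma>: "range \<sigma> \<subseteq> univ S \<and> sat S \<sigma> \<theta>"
      have "\<sigma> ` {..<m} \<subseteq> univ S" using \<sigma> by auto
      then have "?R5 (\<lambda>z. \<sigma> (n z))" using spec[OF \<theta>0(2), of \<sigma>] \<sigma> sat\<theta> by (metis (no_types, lifting))
      then obtain \<tau> where \<tau>: "\<tau> ` ?U \<subseteq> univ S" "\<forall>z\<in>?U \<inter> V. \<tau> z = \<sigma> (n z)" "R (inst \<tau> ?g)" "\<forall>z\<in>V \<inter> (B \<union> C). \<tau> z = z"
        by (elim exE conjE)
      let ?f = "inst \<tau> ?g"
      have f1: "?f z = z" if "z \<in> B \<union> C" for z using that by (simp add: inst_def)
      have f2: "?f z = \<tau> z" if "z \<notin> B \<union> C" for z using that by (simp add: inst_def)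
      have fV: "?f z = \<sigma> (n z)" if "z \<in> V" for z
      proof -
        have "\<tau> z = \<sigma> (n z)" using \<tau>(2) that V(2) by blast
        moreover have "?f z = \<tau> z" 
        proof (cases "z \<in> B \<union> C")
          case True
          then show ?thesis using f1[OF True] \<tau>(4) that by simp
        qed (rule f2)
        ultimately show ?thesis by simp
      qed
      have "?f z \<in> univ S" if "z \<in> ?U" for z
      proof (cases "z \<in> B \<union> C")
        case True
        then show ?thesis unfolding f1[OF True] using B C by blast
      next
        case False
        then show ?thesis unfolding f2[OF False] using \<tau>(1) that by blast
      qed
      then have fU: "?f ` ?U \<subseteq> univ S" by blast
      have "\<not> (\<forall>(\<phi>, Y, b, a)\<in>D. \<not> sat S (override_on (\<lambda>v. ?f (a v)) b Y) \<phi>)"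
      proof
        assume H: "\<forall>(\<phi>, Y, b, a)\<in>D. \<not> sat S (override_on (\<lambda>v. ?f (a v)) b Y) \<phi>"
        have "\<forall>z\<in>B \<union> C. ?f z = z" using f1 by (rule ballI)
        with fU \<tau>(3) H have "\<exists>f. f ` ?U \<subseteq> univ S \<and> (\<forall>z\<in>B \<union> C. f z = z) \<and> R f \<and>
          (\<forall>(\<phi>, Y, b, a)\<in>D. \<not> sat S (override_on (\<lambda>v. f (a v)) b Y) \<phi>)" by (intro exI[of _ ?f] conjI)
        with neg show False by (rule notE)
      qed
      then obtain \<phi> Y b a where d: "(\<phi>, Y, b, a) \<in> D" "sat S (override_on (\<lambda>v. ?f (a v)) b Y) \<phi>" by auto
      have \<phi>: "\<phi> \<in> forms L {} UNIV" using D(2)[OF d(1)] by blast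
      have "sat S (override_on (\<lambda>v. ?f (a v)) b Y) \<phi>
        = sat S (\<lambda>v. override_on \<sigma> (\<lambda>u. b (u - m)) ((\<lambda>v. m + v) ` Y) (h Y a v)) \<phi>"
      proof (rule sat_cong)
        fix v assume v: "v \<in> fv \<phi>"
        show "override_on (\<lambda>v. ?f (a v)) b Y v = override_on \<sigma> (\<lambda>u. b (u - m)) ((\<lambda>v. m + v) ` Y) (h Y a v)"
        proof (cases "v \<in> Y")
          case True
          then show ?thesis by (simp add: override_on_def h_def)
        next
          case False
          then have "a v \<in> V" using d(1) v unfolding V_def by force
          then have "n (a v) < m" "?f (a v) = \<sigma> (n (a v))" using n(2) fV by blast+
          then show ?thesis using False by (auto simp: override_on_def h_def)
        qed
      qed
      then have "sat S (override_on \<sigma> (\<lambda>u. b (u - m)) ((\<lambda>v. m + v) ` Y)) (T \<phi> Y a)"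
        using d(2) T(2)[OF \<phi>] by simp
      then show "\<exists>(\<phi>, Y, b)\<in>tr ` D. sat S (override_on \<sigma> b Y) \<phi>"
        using imageI[OF d(1), of tr] by (intro bexI[of _ "tr (\<phi>, Y, b, a)"]) (simp_all add: tr_def)
    qed
  qed
  moreover have "?e ` {..<m} \<subseteq> A" using eu V by auto
  ultimately show False using ind tp unfolding indep_def by blast
qed

text \<open>Compactness applied to three kinds of conditions on \<open>f\<close>: elementarity, the
  identity on \<open>B \<union> C\<close>, and avoidance of each single dividing instance with
  parameters in \<open>E \<union> C\<close>. Finite sets of them are met by
  \<open>indep_avoids_dividing\<close>.\<close>

lemma indep_nondividing:
  assumes A: "A \<subseteq> univ S" "|A| <o \<kappa>" and B: "B \<subseteq> univ S" "|B| <o \<kappa>" and C: "C \<subseteq> univ S" "|C| <o \<kappa>"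
    and E: "E \<subseteq> univ S" "|E| <o \<kappa>" and ind: "indep L S A C B"
  obtains f where "elem_map (A \<union> B \<union> C) f" "\<And>z. z \<in> B \<union> C \<Longrightarrow> f z = z" "nondividing (f ` A) C E"
proof -
  let ?U = "A \<union> B \<union> C"
  define DD where "DD = {(\<phi>, Y, b, a). \<phi> \<in> forms L {} (UNIV :: nat set) \<and> finite Y \<and> b ` Y \<subseteq> E \<union> C \<and>
    a ` (fv \<phi> - Y) \<subseteq> A \<and> divides L S C \<phi> Y b}"
  define P :: "(('a \<Rightarrow> 'a) \<Rightarrow> bool) + ('a + ('f, 'r, 'a, nat) fm \<times> nat set \<times> (nat \<Rightarrow> 'a) \<times> (nat \<Rightarrow> 'a)) \<Rightarrow> ('a \<Rightarrow> 'a) \<Rightarrow> bool"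
    where "P = case_sum (\<lambda>R. R) (case_sum (\<lambda>z \<sigma>. \<sigma> z = z)
      (\<lambda>(\<phi>, Y, b, a) \<sigma>. \<not> sat S (override_on (\<lambda>v. \<sigma> (a v)) b Y) \<phi>))"
  define J where "J = Inl ` {R. definable L S {} ?U R \<and> R id} \<union> Inr ` (Inl ` (B \<union> C) \<union> Inr ` DD)"
  have "\<exists>\<sigma>. \<sigma> ` ?U \<subseteq> univ S \<and> (\<forall>j\<in>J. P j \<sigma>)"
  proof (rule compactness_family[of "B \<union> C \<union> E"])
    show "B \<union> C \<union> E \<subseteq> univ S" "|B \<union> C \<union> E| <o \<kappa>" "|?U| <o \<kappa>" using assms by auto
    fix j assume "j \<in> J"
    then consider R where "j = Inl R" "definable L S {} ?U R" | z where "j = Inr (Inl z)" "z \<in> B \<union> C"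
      | \<phi> Y b a where "j = Inr (Inr (\<phi>, Y, b, a))" "(\<phi>, Y, b, a) \<in> DD"
      unfolding J_def by (elim UnE imageE; simp; metis prod_cases4)
    then show "definable L S (B \<union> C \<union> E) ?U (P j)"
    proof cases
      case 1
      then show ?thesis using definable_mono[OF 1(2), of "B \<union> C \<union> E" ?U] by (simp add: P_def)
    next
      case 2
      have "definable L S (B \<union> C \<union> E) ?U (\<lambda>\<sigma>. sat S \<sigma> (Eq (Var z) (Par z)))"
        by (rule definable_sat) (use 2 in \<open>auto simp: forms_def\<close>)
      then show ?thesis using 2 by (simp add: P_def)
    next
      case 3
      then have \<phi>: "\<phi> \<in> forms L {} (fv \<phi>)" and b: "b ` Y \<subseteq> E \<union> C" and a: "a ` (fv \<phi> - Y) \<subseteq> A"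
        by (auto simp: DD_def forms_def)
      let ?g = "\<lambda>v. if v \<in> Y then Inl (b v) else Inr (a v)"
      have bu: "b v \<in> E \<union> C" "b v \<in> univ S" if "v \<in> Y" for v using b E(1) C(1) that by auto
      have "definable L S ({} \<union> (E \<union> C)) ?U (\<lambda>\<sigma>. sat S (inst \<sigma> ?g) \<phi>)"
        by (rule definable_reindex[OF definable_sat[OF \<phi>]]) (use bu a in auto)
      then have "definable L S (B \<union> C \<union> E) ?U (\<lambda>\<sigma>. sat S (inst \<sigma> ?g) \<phi>)" by (rule definable_mono) auto
      moreover have "inst \<sigma> ?g = override_on (\<lambda>v. \<sigma> (a v)) b Y" for \<sigma>
        by (auto simp: inst_def fun_eq_iff override_on_def)
      ultimately have "definable L S (B \<union> C \<union> E) ?U (\<lambda>\<sigma>. sat S (override_on (\<lambda>v. \<sigma> (a v)) b Y) \<phi>)" by simp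
      then show ?thesis using 3 definable_not by (simp add: P_def)
    qed
  next
    fix F assume F: "finite F" "F \<subseteq> J"
    let ?F = "{R. Inl R \<in> F}" and ?D = "{d. Inr (Inr d) \<in> F}"
    have fin: "finite ?F" using finite_vimageI[OF F(1), of Inl] by (simp add: vimage_def)
    have finD: "finite ?D" using finite_vimageI[OF F(1), of "\<lambda>d. Inr (Inr d)"] by (simp add: vimage_def inj_def)
    have FR: "definable L S {} ?U R \<and> R id" if "R \<in> ?F" for R using that F(2) by (auto simp: J_def)
    have DR: "d \<in> DD" if "d \<in> ?D" for d using that F(2) by (auto simp: J_def)
    have "\<exists>f. f ` ?U \<subseteq> univ S \<and> (\<forall>z\<in>B \<union> C. f z = z) \<and> (\<forall>R\<in>?F. R f) \<and>
      (\<forall>(\<phi>, Y, b, a)\<in>?D. \<not> sat S (override_on (\<lambda>v. f (a v)) b Y) \<phi>)"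
    proof (rule indep_avoids_dividing[OF A(1) B(1) C(1) ind _ _ finD])
      show "definable L S {} ?U (\<lambda>\<sigma>. \<forall>R\<in>?F. R \<sigma>)" by (rule definable_ball[OF fin]) (use FR in blast)
      show "\<forall>R\<in>?F. R id" using FR by blast
      fix \<phi> Y b a assume "(\<phi>, Y, b, a) \<in> ?D"
      from DR[OF this] show "\<phi> \<in> forms L {} (UNIV :: nat set) \<and> finite Y \<and>
        b ` Y \<subseteq> univ S \<and> a ` (fv \<phi> - Y) \<subseteq> A \<and> divides L S C \<phi> Y b"
        using E(1) C(1) unfolding DD_def by auto
    qed
    then obtain f where f: "f ` ?U \<subseteq> univ S" "\<forall>z\<in>B \<union> C. f z = z" "\<forall>R\<in>?F. R f"
      "\<forall>(\<phi>, Y, b, a)\<in>?D. \<not> sat S (override_on (\<lambda>v. f (a v)) b Y) \<phi>" by (elim exE conjE)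
    have "P j f" if j: "j \<in> F" for j
    proof -
      from j F(2) have "j \<in> J" by blast
      then consider R where "j = Inl R" | z where "j = Inr (Inl z)" "z \<in> B \<union> C" | d where "j = Inr (Inr d)"
        unfolding J_def by blast
      then show ?thesis
      proof cases
        case 1
        then show ?thesis using bspec[OF f(3), of R] j by (simp add: P_def)
      next
        case 2
        then show ?thesis using f(2) by (simp add: P_def)
      next
        case 3
        then show ?thesis using bspec[OF f(4), of d] j by (simp add: P_def split: prod.splits)
      qed
    qed
    with f(1) show "\<exists>\<sigma>. \<sigma> ` ?U \<subseteq> univ S \<and> (\<forall>j\<in>F. P j \<sigma>)" by (intro exI[of _ f]) simp
  qed
  then obtain f where fu: "f ` ?U \<subseteq> univ S" and "\<forall>j\<in>J. P j f" by (elim exE conjE)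
  then have f: "\<And>j. j \<in> J \<Longrightarrow> P j f" by simp
  have R: "R f" if "definable L S {} ?U R" "R id" for R
    using f[of "Inl R"] that by (simp add: J_def P_def)
  have "elem_map ?U f"
    unfolding elem_map_def
  proof (intro conjI ballI allI impI)
    show "?U \<subseteq> univ S" "f ` ?U \<subseteq> univ S" using A B C fu by auto
    fix \<phi> :: "('f, 'r, 'a, nat) fm" and \<tau>
    assume *: "\<phi> \<in> forms L {} UNIV" "\<tau> ` fv \<phi> \<subseteq> ?U"
    have "definable L S {} (fv \<phi>) (\<lambda>\<sigma>. sat S \<sigma> \<phi>)" by (rule definable_sat) (use *(1) in \<open>auto simp: forms_def\<close>)
    then have 1: "definable L S {} ?U (\<lambda>\<sigma>. sat S (\<lambda>v. \<sigma> (\<tau> v)) \<phi>)"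
      by (rule definable_reindex_var) (use *(2) in auto)
    show "sat S \<tau> \<phi> = sat S (\<lambda>v. f (\<tau> v)) \<phi>"
      using R[OF 1] R[OF definable_not[OF 1]] by auto
  qed
  moreover have "f z = z" if "z \<in> B \<union> C" for z
    using f[of "Inr (Inl z)"] that by (simp add: J_def P_def)
  moreover have "nondividing (f ` A) C E"
    unfolding nondividing_def
  proof (intro ballI allI impI)
    fix \<phi> :: "('f, 'r, 'a, nat) fm" and Y b a
    assume \<phi>: "\<phi> \<in> forms L {} UNIV" and Y: "finite Y" and b: "b ` Y \<subseteq> E \<union> C" and a: "a ` (fv \<phi> - Y) \<subseteq> f ` A"
      and div: "divides L S C \<phi> Y b"
    let ?a = "\<lambda>v. inv_into A f (a v)"
    have a': "?a v \<in> A" "f (?a v) = a v" if "v \<in> fv \<phi> - Y" for v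
      using that a inv_into_into[of "a v" f A] f_inv_into_f[of "a v" f A] by blast+
    have "(\<phi>, Y, b, ?a) \<in> DD" using \<phi> Y b a' div by (auto simp: DD_def)
    then have "\<not> sat S (override_on (\<lambda>v. f (?a v)) b Y) \<phi>"
      using f[of "Inr (Inr (\<phi>, Y, b, ?a))"] by (simp add: J_def P_def)
    moreover have "sat S (override_on (\<lambda>v. f (?a v)) b Y) \<phi> = sat S (override_on a b Y) \<phi>"
      by (rule sat_cong) (use a' in \<open>auto simp: override_on_def\<close>)
    ultimately show "\<not> sat S (override_on a b Y) \<phi>" by simp
  qed
  ultimately show thesis by (rule that)
qed

text \<open>The parameters of a forking disjunction form a finite test set \<open>E\<close>. The
  conjugate of \<open>A\<close> over \<open>B \<union> C\<close> still satisfies the forking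
  formula, hence one of its dividing disjuncts, which is excluded for \<open>E\<close>. So finite
  test sets suffice in this direction.\<close>

lemma nondividing_indep:
  assumes BC: "B \<subseteq> univ S" "C \<subseteq> univ S"
    and ex: "\<And>E. E \<subseteq> univ S \<Longrightarrow> finite E \<Longrightarrow>
      \<exists>f. elem_map (A \<union> B \<union> C) f \<and> (\<forall>z\<in>B \<union> C. f z = z) \<and> nondividing (f ` A) C E"
  shows "indep L S A C B"
  unfolding indep_def
proof (intro allI impI ballI notI)
  fix X :: "nat set" and a \<theta>
  assume X: "finite X \<and> a ` X \<subseteq> A" and \<theta>: "\<theta> \<in> tp L S (B \<union> C) X a" and fk: "forks L S C \<theta>"
  obtain D where D: "finite D"
    "\<forall>(\<phi>, Y, b)\<in>D. \<phi> \<in> forms L {} (fv \<theta> \<union> Y) \<and> finite Y \<and> b ` Y \<subseteq> univ S \<and> divides L S C \<phi> Y b"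
    "\<forall>\<sigma>. range \<sigma> \<subseteq> univ S \<and> sat S \<sigma> \<theta> \<longrightarrow> (\<exists>(\<phi>, Y, b)\<in>D. sat S (override_on \<sigma> b Y) \<phi>)"
    using fk unfolding forks_def by (elim exE conjE)
  let ?E = "\<Union>(\<phi>, Y, b)\<in>D. b ` Y"
  have "?E \<subseteq> univ S"
  proof
    fix z assume "z \<in> ?E"
    then obtain \<phi> Y b where "(\<phi>, Y, b) \<in> D" "z \<in> b ` Y" by auto
    then show "z \<in> univ S" using bspec[OF D(2), of "(\<phi>, Y, b)"] by auto
  qed
  moreover have "finite ?E"
  proof (rule finite_UN_I[OF D(1)])
    fix x assume "x \<in> D"
    then show "finite (case x of (\<phi>, Y, b) \<Rightarrow> b ` Y)" using bspec[OF D(2), of x] by auto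
  qed
  ultimately have "?E \<subseteq> univ S" "finite ?E" .
  from ex[OF this] obtain f where f: "elem_map (A \<union> B \<union> C) f" "\<forall>z\<in>B \<union> C. f z = z" "nondividing (f ` A) C ?E"
    by (elim exE conjE)
  have \<theta>f: "\<theta> \<in> forms L (B \<union> C) X" "sat S a \<theta>" using \<theta> by (auto simp: tp_def)
  have s1: "sat S (\<lambda>v. f (a v)) \<theta>"
    using elem_map_definable[OF f(1) definable_sat[OF \<theta>f(1)], of a] f(2) X \<theta>f(2) by auto
  obtain d where d: "d \<in> univ S" using nonempty by blast
  let ?\<sigma> = "\<lambda>v. if v \<in> X then f (a v) else d"
  have "sat S ?\<sigma> \<theta> = sat S (\<lambda>v. f (a v)) \<theta>" by (rule sat_cong) (use \<theta>f(1) in \<open>auto simp: forms_def\<close>)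
  moreover have "range ?\<sigma> \<subseteq> univ S" using d X elem_map_univ(2)[OF f(1)] by auto
  ultimately have "\<exists>(\<phi>, Y, b)\<in>D. sat S (override_on ?\<sigma> b Y) \<phi>" using spec[OF D(3), of ?\<sigma>] s1 by simp
  then obtain \<phi> Y b where d: "(\<phi>, Y, b) \<in> D" "sat S (override_on ?\<sigma> b Y) \<phi>" by auto
  have dd: "\<phi> \<in> forms L {} (fv \<theta> \<union> Y)" "finite Y" "divides L S C \<phi> Y b" using D(2) d(1) by auto
  have "?\<sigma> ` (fv \<phi> - Y) \<subseteq> f ` A" using dd(1) \<theta>f(1) X by (auto simp: forms_def)
  moreover have "b ` Y \<subseteq> ?E \<union> C" using d(1) by force
  moreover have "\<phi> \<in> forms L {} UNIV" using dd(1) by (auto simp: forms_def)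
  ultimately show False using nondividingD[OF f(3) _ dd(2) _ _ dd(3), of ?\<sigma>] d(2) by blast
qed

text \<open>A test set \<open>E\<close> on the image side is pulled back by an extension
  \<open>k\<close> of the inverse of \<open>g\<close>, a conjugate of \<open>A\<close> avoiding the
  pulled-back set is found there, and an extension \<open>m\<close> of the inverse of
  \<open>k\<close> pushes it forward.\<close>

lemma elem_map_indep:
  assumes elem_map: "elem_map Z g" and Z: "A \<union> B \<union> C \<subseteq> Z" and small: "|A| <o \<kappa>" "|B| <o \<kappa>" "|C| <o \<kappa>"
    and ind: "indep L S A C B"
  shows "indep L S (g ` A) (g ` C) (g ` B)"
proof -
  let ?U = "A \<union> B \<union> C"
  have em0: "elem_map ?U g" using elem_map_mono[OF elem_map Z] .
  note u = elem_map_univ[OF em0]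
  have inv: "inv_into ?U g (g z) = z" if "z \<in> ?U" for z using inv_into_f_f[OF elem_map_inj[OF em0]] that by blast
  have sU: "|?U| <o \<kappa>" using small by auto
  have Au: "A \<subseteq> univ S" and Bu: "B \<subseteq> univ S" and Cu: "C \<subseteq> univ S" using u(1) by auto
  show ?thesis
  proof (rule nondividing_indep)
    show "g ` B \<subseteq> univ S" "g ` C \<subseteq> univ S" using u by auto
    fix E assume E: "E \<subseteq> univ S" "finite E"
    have sE: "|E| <o \<kappa>" using E(2) by auto
    obtain k where k: "elem_map (g ` ?U \<union> E) k" "\<And>z. z \<in> g ` ?U \<Longrightarrow> k z = inv_into ?U g z"
      using elem_map_extend[OF elem_map_inv[OF em0] small_image[OF sU] sE E(1)] by metis
    have kg: "k (g z) = z" if "z \<in> ?U" for z using k(2)[OF imageI[OF that]] inv[OF that] by simp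
    have kgU: "k ` g ` ?U = ?U" using kg by force
    have kEu: "k ` E \<subseteq> univ S" using elem_map_univ(2)[OF k(1)] by auto
    obtain f where f: "elem_map ?U f" "\<And>z. z \<in> B \<union> C \<Longrightarrow> f z = z" "nondividing (f ` A) C (k ` E)"
      using indep_nondividing[OF Au small(1) Bu small(2) Cu small(3) kEu small_image[OF sE] ind] by metis
    let ?K = "g ` ?U \<union> E"
    let ?l = "inv_into ?K k"
    have lk: "?l (k z) = z" if "z \<in> ?K" for z using inv_into_f_f[OF elem_map_inj[OF k(1)]] that by blast
    have eml: "elem_map (k ` ?K) ?l" by (rule elem_map_inv[OF k(1)])
    have sK: "|k ` ?K| <o \<kappa>" using sU sE by auto
    have fAu: "f ` A \<subseteq> univ S" using elem_map_univ(2)[OF f(1)] by auto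
    obtain m where m: "elem_map (k ` ?K \<union> f ` A) m" "\<And>z. z \<in> k ` ?K \<Longrightarrow> m z = ?l z"
      using elem_map_extend[OF eml sK small_image[OF small(1)] fAu] by metis
    have mk: "m (k z) = z" if "z \<in> ?K" for z using m(2)[OF imageI[OF that]] lk[OF that] by simp
    have mz: "m z = g z" if "z \<in> ?U" for z using mk[of "g z"] kg[OF that] that by simp
    have mE: "m ` k ` E = E" using mk by force
    have mC: "m ` C = g ` C" using mz by force
    have UK: "?U \<subseteq> k ` ?K" using kgU by blast
    have "f ` A \<union> C \<union> k ` E \<subseteq> k ` ?K \<union> f ` A" using UK by blast
    from elem_map_nondividing[OF m(1) this small(3) f(3)] have nd: "nondividing (m ` f ` A) (g ` C) E" unfolding mE mC .
    let ?h = "\<lambda>z. m (f (k z))"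
    have fU: "f ` ?U \<subseteq> k ` ?K \<union> f ` A" using UK f(2) by auto
    have emf: "elem_map ?U (\<lambda>z. m (f z))" by (rule elem_map_comp[OF f(1) elem_map_mono[OF m(1) fU]])
    have "elem_map (g ` ?U) ?h"
      by (rule elem_map_comp[OF elem_map_mono[OF k(1)]]) (use emf kgU in auto)
    moreover have "?h z = z" if z: "z \<in> g ` B \<union> g ` C" for z
    proof -
      obtain y where y: "y \<in> B \<union> C" "z = g y" using z by blast
      then show ?thesis using kg[of y] f(2)[of y] mz[of y] by simp
    qed
    moreover have "?h ` g ` A = m ` f ` A" using kg by force
    ultimately show "\<exists>f. elem_map (g ` A \<union> g ` B \<union> g ` C) f \<and> (\<forall>z\<in>g ` B \<union> g ` C. f z = z) \<and> nondividing (f ` g ` A) (g ` C) E"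
      using nd by (intro exI[of _ ?h]) (simp add: image_Un)
  qed
qed

text \<open>The core of left transitivity: a sequence witnessing dividing of \<open>\<phi>\<close>
  over \<open>C\<close> is replaced, up to length \<open>m\<close>, by one whose members satisfy a
  given property of \<open>b\<close> over \<open>C \<union> A1\<close>. Otherwise the failure would
  be expressible by a formula true of \<open>A1\<close>; that formula cannot divide over
  \<open>C\<close>, and a common solution of its conjugates along the original sequence produces
  what was said to fail.\<close>

lemma nondividing_trans_finite:
  assumes C: "C \<subseteq> univ S" and A1: "A1 \<subseteq> univ S" "nondividing A1 C E" and E: "E \<subseteq> univ S"
    and \<phi>: "\<phi> \<in> forms L {} UNIV" and Y: "finite Y" and b: "b ` Y \<subseteq> E \<union> C"
    and g: "\<And>i. elem_map_over C (b ` Y) (g i)" and inc: "k_inconsistent S k \<phi> Y (\<lambda>i v. g i (b v))"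
    and R: "definable L S (C \<union> A1) Y R" "R b"
  shows "\<exists>\<beta>. \<beta> ` ({..<m} \<times> Y) \<subseteq> univ S \<and> (\<forall>i<m. R (\<lambda>y. \<beta> (i, y))) \<and>
    (\<forall>I\<subseteq>{..<m}. card I = k \<longrightarrow> \<not> consis \<phi> Y I \<beta>)"
proof (cases "m = 0")
  case True
  \<comment> \<open>Even for \<open>m = 0\<close> the empty index set has to be inconsistent if
    \<open>k = 0\<close>; this is inherited from \<open>inc\<close>.\<close>
  have "\<not> consis \<phi> Y {} \<beta>" if "k = 0" for \<beta>
    using inc that unfolding k_inconsistent_iff by (auto simp: consis_def)
  then show ?thesis using True by (intro exI[of _ undefined]) auto
next
  case False
  have bu: "b ` Y \<subseteq> univ S" using b E C by auto
  obtain A0 Y0 R0 where A0: "finite A0" "A0 \<subseteq> C \<union> A1" "Y0 \<subseteq> Y" "definable L S A0 Y0 R0"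
    "\<And>\<sigma>. \<sigma> ` Y \<subseteq> univ S \<Longrightarrow> R0 \<sigma> = R \<sigma>"
    using definable_finite_support[OF R(1)] by metis
  have A0u: "A0 \<subseteq> univ S" using A0(2) C A1(1) by auto
  obtain R' where R': "definable L S {} (Inl ` A0 \<union> Inr ` Y) R'" "\<And>\<sigma>. \<sigma> ` Y \<subseteq> univ S \<Longrightarrow> R' (case_sum id \<sigma>) = R0 \<sigma>"
    using definable_unpar[OF definable_mono[OF A0(4) order_refl A0(3)] A0u] by metis
  let ?Z = "Inl ` A0 \<union> Inr ` ({..<m} \<times> Y) :: ('a + nat \<times> nat) set"
  let ?r = "\<lambda>i. map_sum id (\<lambda>y. (i, y)) :: 'a + nat \<Rightarrow> 'a + nat \<times> nat"
  have 1: "definable L S {} ?Z (\<lambda>\<rho>. R' (\<lambda>s. \<rho> (?r i s)))" if "i < m" for i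
    by (rule definable_reindex_var[OF R'(1)]) (use that in auto)
  have "definable L S {} ?Z (\<lambda>\<rho>. \<forall>i\<in>{..<m}. R' (\<lambda>s. \<rho> (?r i s)))"
    by (rule definable_ball) (use 1 in auto)
  moreover have "definable L S {} ?Z (\<lambda>\<rho>. \<not> consis \<phi> Y I (\<lambda>p. \<rho> (Inr p)))" if "I \<subseteq> {..<m}" for I
    by (rule definable_not, rule definable_reindex_var[OF consis_definable[OF \<phi>]]) (use that finite_subset in auto)
  then have "definable L S {} ?Z (\<lambda>\<rho>. \<forall>I\<in>{I. I \<subseteq> {..<m} \<and> card I = k}. \<not> consis \<phi> Y I (\<lambda>p. \<rho> (Inr p)))"
    by (intro definable_ball) auto
  ultimately have 2: "definable L S {} ?Z (\<lambda>\<rho>. (\<forall>i\<in>{..<m}. R' (\<lambda>s. \<rho> (?r i s))) \<and>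
      (\<forall>I\<in>{I. I \<subseteq> {..<m} \<and> card I = k}. \<not> consis \<phi> Y I (\<lambda>p. \<rho> (Inr p))))"
    by (rule definable_conj)
  \<comment> \<open>\<open>U\<close> says of a copy of the parameters \<open>A0\<close> that there
    are \<open>m\<close> tuples with the property \<open>R\<close> for these parameters, each
    \<open>k\<close> of which give inconsistent instances of \<open>\<phi>\<close>.\<close>
  define U where "U = (\<lambda>\<rho>. \<exists>\<tau>. \<tau> ` ?Z \<subseteq> univ S \<and> (\<forall>s\<in>?Z \<inter> Inl ` A0. \<tau> s = \<rho> s) \<and>
    (\<forall>i\<in>{..<m}. R' (\<lambda>s. \<tau> (?r i s))) \<and>
      (\<forall>I\<in>{I. I \<subseteq> {..<m} \<and> card I = k}. \<not> consis \<phi> Y I (\<lambda>p. \<tau> (Inr p))))"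
  have 3: "definable L S {} (Inl ` A0) U" unfolding U_def by (rule definable_ex[OF 2 nonempty])
  let ?s = "case_sum Inl undefined :: 'a + nat \<Rightarrow> 'a + nat \<times> nat"
  have 4: "definable L S {} (Inl ` A0 \<union> Inr ` Y) (\<lambda>\<rho>. U (\<lambda>s. \<rho> (case_sum Inl undefined s)))"
    by (rule definable_reindex_var[OF 3]) auto
  have U_ex: ?thesis if u: "U \<rho>" and \<rho>: "\<And>a. a \<in> A0 \<Longrightarrow> \<rho> (Inl a) = a" for \<rho>
  proof -
    obtain \<tau> where \<tau>: "\<tau> ` ?Z \<subseteq> univ S" "\<forall>s\<in>?Z \<inter> Inl ` A0. \<tau> s = \<rho> s"
      "\<forall>i\<in>{..<m}. R' (\<lambda>s. \<tau> (?r i s))"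
      "\<forall>I\<in>{I. I \<subseteq> {..<m} \<and> card I = k}. \<not> consis \<phi> Y I (\<lambda>p. \<tau> (Inr p))"
      using u unfolding U_def by (elim exE conjE)
    have \<tau>a: "\<tau> (Inl a) = a" if "a \<in> A0" for a using \<tau>(2) that \<rho>[OF that] by simp
    have \<tau>u: "\<tau> (Inr (i, y)) \<in> univ S" if "i < m" "y \<in> Y" for i y using \<tau>(1) that by auto
    have "R (\<lambda>y. \<tau> (Inr (i, y)))" if i: "i < m" for i
    proof -
      have "R' (\<lambda>s. \<tau> (?r i s)) = R' (case_sum id (\<lambda>y. \<tau> (Inr (i, y))))"
        by (rule definable_agree[OF R'(1)]) (use \<tau>a \<tau>u[OF i] A0u in auto)
      then show ?thesis using \<tau>(3) i R'(2)[of "\<lambda>y. \<tau> (Inr (i, y))"] A0(5)[of "\<lambda>y. \<tau> (Inr (i, y))"] \<tau>u[OF i]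
        by auto
    qed
    then show ?thesis using \<tau>(4) \<tau>u by (intro exI[of _ "\<lambda>p. \<tau> (Inr p)"]) auto
  qed
  show ?thesis
  proof (rule ccontr)
    assume neg: "\<not> ?thesis"
    let ?X = "Inl ` A0 \<union> Inr ` Y"
    \<comment> \<open>The formula that must not exist: \<open>b\<close> has the property, but no
      sequence of length \<open>m\<close> has it. The elements of \<open>A0\<close> in
      \<open>C\<close> and the tuple \<open>b\<close> are its parameters, the rest of
      \<open>A0\<close> is its solution.\<close>
    let ?\<Psi> = "\<lambda>\<rho>. R' \<rho> \<and> \<not> U (\<lambda>s. \<rho> (case_sum Inl undefined s))"
    have \<Psi>: "definable L S {} ?X ?\<Psi>" by (rule definable_conj[OF R'(1) definable_not[OF 4]])
    have finX: "finite ?X" using A0(1) Y by simp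
    obtain c :: "'a + nat \<Rightarrow> nat" where c: "inj_on c ?X" using finite_imp_inj_to_nat_seg[OF finX] by blast
    obtain \<psi> where \<psi>: "\<psi> \<in> forms L {} (c ` ?X)" "\<And>\<sigma>. \<sigma> ` c ` ?X \<subseteq> univ S \<Longrightarrow> sat S \<sigma> \<psi> = ?\<Psi> (\<lambda>i. \<sigma> (c i))"
      using definable_to_nat[OF \<Psi> c] by metis
    let ?d = "inv_into ?X c"
    have dc: "?d (c s) = s" if "s \<in> ?X" for s using c that by simp
    let ?Y = "c ` (Inl ` (A0 \<inter> C) \<union> Inr ` Y)"
    let ?b = "\<lambda>n. case_sum id b (?d n)"
    have bc: "?b (c s) = case_sum id b s" if "s \<in> ?X" for s using dc[OF that] by simp
    have bY: "?b ` ?Y = (A0 \<inter> C) \<union> b ` Y"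
    proof -
      have "?b ` ?Y = case_sum id b ` (Inl ` (A0 \<inter> C) \<union> Inr ` Y)"
        unfolding image_image by (rule image_cong[OF refl]) (use bc in auto)
      then show ?thesis by (simp add: image_Un image_image)
    qed
    have "\<not> divides L S C \<psi> ?Y ?b"
    proof
      assume div: "divides L S C \<psi> ?Y ?b"
      have "\<not> sat S (override_on ?b ?b ?Y) \<psi>"
      proof (rule nondividingD[OF A1(2) _ _ _ _ div])
        show "\<psi> \<in> forms L {} UNIV" using \<psi>(1) by (auto simp: forms_def)
        show "finite ?Y" using A0(1) Y by simp
        show "?b ` ?Y \<subseteq> E \<union> C" unfolding bY using b by auto
        have "fv \<psi> \<subseteq> c ` ?X" using \<psi>(1) by (auto simp: forms_def)
        then have "fv \<psi> - ?Y \<subseteq> c ` ?X - ?Y" by (rule Diff_mono[OF _ order_refl])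
        also have "\<dots> \<subseteq> c ` (?X - (Inl ` (A0 \<inter> C) \<union> Inr ` Y))" by (rule image_diff_subset)
        also have "\<dots> \<subseteq> c ` Inl ` (A0 - C)" by (rule image_mono) auto
        finally have "fv \<psi> - ?Y \<subseteq> c ` Inl ` (A0 - C)" .
        then have "?b ` (fv \<psi> - ?Y) \<subseteq> ?b ` c ` Inl ` (A0 - C)" by (rule image_mono)
        also have "\<dots> \<subseteq> A1" using bc A0(2) by (auto simp: image_image)
        finally show "?b ` (fv \<psi> - ?Y) \<subseteq> A1" .
      qed
      moreover have "override_on ?b ?b ?Y = ?b" by (auto simp: override_on_def)
      moreover have "sat S ?b \<psi>"
      proof -
        have "?b ` c ` ?X \<subseteq> univ S" using bc bu A0u by (auto simp: image_image)
        then have "sat S ?b \<psi> = ?\<Psi> (\<lambda>i. ?b (c i))" by (rule \<psi>(2))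
        also have "?\<Psi> (\<lambda>i. ?b (c i)) = ?\<Psi> (case_sum id b)"
          by (rule definable_agree[OF \<Psi>]) (use bc bu A0u in auto)
        finally have "sat S ?b \<psi> = ?\<Psi> (case_sum id b)" .
        moreover have "R' (case_sum id b)" using R'(2)[OF bu] A0(5)[OF bu] R(2) by simp
        moreover have "\<not> U (\<lambda>s. case_sum id b (case_sum Inl undefined s))"
        proof
          assume u: "U (\<lambda>s. case_sum id b (case_sum Inl undefined s))"
          show False by (rule notE[OF neg U_ex[OF u]]) simp
        qed
        ultimately show ?thesis by simp
      qed
      ultimately show False by simp
    qed
    then have "\<not> k_inconsistent S m \<psi> ?Y (\<lambda>i v. g i (?b v))"
    proof (rule contrapos_nn)
      assume *: "k_inconsistent S m \<psi> ?Y (\<lambda>i v. g i (?b v))"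
      show "divides L S C \<psi> ?Y ?b"
      proof (rule dividesI[OF _ *])
        fix i
        have "C \<union> ?b ` ?Y = C \<union> b ` Y" unfolding bY by auto
        then show "elem_map_over C (?b ` ?Y) (g i)" using g[of i] by (simp add: elem_map_over_def)
      qed
    qed
    \<comment> \<open>Some \<open>m\<close> conjugates of the formula under the maps
      \<open>g i\<close> have a common solution: the values outside \<open>C\<close> are shared,
      while \<open>b\<close> runs through the original dividing sequence.\<close>
    then obtain I \<sigma> where I: "finite I" "card I = m" and \<sigma>: "range \<sigma> \<subseteq> univ S"
      "\<forall>i\<in>I. sat S (override_on \<sigma> (\<lambda>v. g i (?b v)) ?Y) \<psi>"
      unfolding k_inconsistent_def by auto
    define \<rho> where "\<rho> i s = override_on \<sigma> (\<lambda>v. g i (?b v)) ?Y (c s)" for i s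
    have gu: "g i (b y) \<in> univ S" if "y \<in> Y" for i y using elem_map_univ(2)[OF elem_map_overD(1)[OF g[of i]]] that by auto
    have gC: "g i z = z" if "z \<in> C" for i z using elem_map_overD(2)[OF g[of i]] that by blast
    have \<rho>Y: "\<rho> i (Inr y) = g i (b y)" if "y \<in> Y" for i y
      using that bc[of "Inr y"] by (auto simp: \<rho>_def override_on_def)
    have \<rho>C: "\<rho> i (Inl z) = z" if "z \<in> A0" "z \<in> C" for i z
      using that bc[of "Inl z"] gC by (auto simp: \<rho>_def override_on_def)
    have \<rho>A: "\<rho> i (Inl z) = \<sigma> (c (Inl z))" if "z \<in> A0" "z \<notin> C" for i z
    proof -
      have "c (Inl z) \<notin> ?Y"
      proof
        assume "c (Inl z) \<in> ?Y"
        then obtain s where s: "c (Inl z) = c s" "s \<in> Inl ` (A0 \<inter> C) \<union> Inr ` Y" by blast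
        then have "Inl z = s" using inj_onD[OF c, of "Inl z" s] that by auto
        then show False using s that by auto
      qed
      then show ?thesis by (simp add: \<rho>_def override_on_def)
    qed
    have \<rho>u: "\<rho> i s \<in> univ S" if "s \<in> ?X" for i s
      using that \<rho>Y \<rho>C \<rho>A gu A0u \<sigma>(1) by (cases s) (auto, metis rangeI subsetD)
    have \<rho>\<Psi>: "?\<Psi> (\<rho> i)" if "i \<in> I" for i
    proof -
      have "override_on \<sigma> (\<lambda>v. g i (?b v)) ?Y ` c ` ?X \<subseteq> univ S"
        using \<rho>u[of _ i] unfolding \<rho>_def by blast
      from \<psi>(2)[OF this] \<sigma>(2) that show ?thesis unfolding \<rho>_def by blast
    qed
    obtain e :: "nat \<Rightarrow> nat" where e: "bij_betw e {..<m} I"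
      using ex_bij_betw_nat_finite[OF I(1)] I(2) by (auto simp: lessThan_atLeast0)
    have eI: "e i \<in> I" if "i < m" for i using e that by (auto simp: bij_betw_def)
    \<comment> \<open>Any member of \<open>I\<close> can be used to read off the common values of
      the parameters; that one exists is the reason for treating \<open>m = 0\<close> apart.\<close>
    have e0: "e 0 \<in> I" using eI False by simp
    let ?\<tau> = "case_sum (\<lambda>a. \<rho> (e 0) (Inl a)) (\<lambda>(i, y). g (e i) (b y))"
    have "U (\<lambda>s. \<rho> (e 0) (case_sum Inl undefined s))"
      unfolding U_def
    proof (intro exI[of _ ?\<tau>] conjI ballI)
      show "?\<tau> ` ?Z \<subseteq> univ S" using \<rho>u gu by auto
      show "?\<tau> s = \<rho> (e 0) (case_sum Inl undefined s)" if "s \<in> ?Z \<inter> Inl ` A0" for s using that by auto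
      show "R' (\<lambda>s. ?\<tau> (?r i s))" if "i \<in> {..<m}" for i
      proof -
        have "\<rho> (e 0) (Inl z) = \<rho> (e i) (Inl z)" if "z \<in> A0" for z using \<rho>C[OF that] \<rho>A[OF that] by (cases "z \<in> C") auto
        then have "R' (\<rho> (e i)) = R' (\<lambda>s. ?\<tau> (?r i s))"
          by (intro definable_agree[OF R'(1)]) (use \<rho>u \<rho>Y gu in auto)
        then show ?thesis using \<rho>\<Psi>[OF eI] that by blast
      qed
      fix J assume J: "J \<in> {I. I \<subseteq> {..<m} \<and> card I = k}"
      have inj: "inj_on e J" using e J by (auto simp: bij_betw_def intro: inj_on_subset)
      have "finite J" using J finite_subset by auto
      then have "\<not> consis \<phi> Y (e ` J) (\<lambda>(i, y). g i (b y))"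
        using inc card_image[OF inj] J unfolding k_inconsistent_iff by simp
      then show "\<not> consis \<phi> Y J (\<lambda>p. ?\<tau> (Inr p))" by (simp add: consis_def)
    qed
    then show False using \<rho>\<Psi>[OF e0] by blast
  qed
qed

text \<open>By compactness the finite sequences give an infinite one in the type of \<open>b\<close>
  over \<open>C \<union> A1\<close> that is still \<open>k\<close>-inconsistent for
  \<open>\<phi>\<close>. With the coordinates in \<open>A1\<close> moved to the parameter side,
  \<open>\<phi>\<close> divides over \<open>C \<union> A1\<close>, against the assumption on
  \<open>A2\<close>.\<close>

lemma nondividing_trans:
  assumes C: "C \<subseteq> univ S" "|C| <o \<kappa>" and A1: "A1 \<subseteq> univ S" "|A1| <o \<kappa>" and E: "E \<subseteq> univ S"
    and n1: "nondividing A1 C E" and n2: "nondividing A2 (C \<union> A1) E"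
  shows "nondividing (A1 \<union> A2) C E"
  unfolding nondividing_def
proof (intro ballI allI impI notI)
  fix \<phi> :: "('f, 'r, 'a, nat) fm" and Y b a
  assume \<phi>: "\<phi> \<in> forms L {} UNIV" and Y: "finite Y" and b: "b ` Y \<subseteq> E \<union> C" and a: "a ` (fv \<phi> - Y) \<subseteq> A1 \<union> A2"
    and div: "divides L S C \<phi> Y b" and sat: "sat S (override_on a b Y) \<phi>"
  have bu: "b ` Y \<subseteq> univ S" using b E C by auto
  obtain k g where g: "\<And>i. elem_map_over C (b ` Y) (g i)" "k_inconsistent S k \<phi> Y (\<lambda>i v. g i (b v))"
    using dividesE[OF div C(1) bu] by metis
  define P :: "(((nat \<Rightarrow> 'a) \<Rightarrow> bool) \<times> nat) + nat set \<Rightarrow> (nat \<times> nat \<Rightarrow> 'a) \<Rightarrow> bool" where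
    "P = case_sum (\<lambda>(R, i) \<beta>. R (\<lambda>y. \<beta> (i, y))) (\<lambda>I \<beta>. \<not> consis \<phi> Y I \<beta>)"
  define J where "J = Inl ` ({R. definable L S (C \<union> A1) Y R \<and> R b} \<times> (UNIV :: nat set)) \<union> Inr ` {I :: nat set. finite I \<and> card I = k}"
  let ?X = "UNIV \<times> Y :: (nat \<times> nat) set"
  have "\<exists>\<beta>. \<beta> ` ?X \<subseteq> univ S \<and> (\<forall>j\<in>J. P j \<beta>)"
  proof (rule compactness_family)
    show "C \<union> A1 \<subseteq> univ S" "|C \<union> A1| <o \<kappa>" using C A1 by auto
    have "|?X| \<le>o |(UNIV :: nat set) \<times> (UNIV :: nat set)|" by (rule card_of_mono1) auto
    moreover have "|(UNIV :: nat set) \<times> (UNIV :: nat set)| \<le>o |UNIV :: nat set|"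
      using card_of_Times_same_infinite[OF infinite_UNIV_nat] ordIso_imp_ordLeq by blast
    ultimately show "|?X| <o \<kappa>" using small_nat_type ordLeq_transitive ordLeq_ordLess_trans by blast
    fix j assume "j \<in> J"
    then consider R i where "j = Inl (R, i)" "definable L S (C \<union> A1) Y R" | I where "j = Inr I" "finite I"
      unfolding J_def by blast
    then show "definable L S (C \<union> A1) ?X (P j)"
    proof cases
      case 1
      have "definable L S (C \<union> A1) ?X (\<lambda>\<beta>. R (\<lambda>y. \<beta> (i, y)))" by (rule definable_reindex_var[OF 1(2)]) auto
      then show ?thesis using 1 by (simp add: P_def)
    next
      case 2
      have "definable L S (C \<union> A1) ?X (consis \<phi> Y I)" by (rule definable_mono[OF consis_definable[OF \<phi> 2(2)]]) auto
      then show ?thesis using 2 definable_not by (simp add: P_def)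
    qed
  next
    fix F assume F: "finite F" "F \<subseteq> J"
    let ?F = "{R. \<exists>i. Inl (R, i) \<in> F}"
    have "?F \<subseteq> fst ` projl ` F" by force
    then have fin: "finite ?F" using F(1) finite_subset by blast
    have FR: "definable L S (C \<union> A1) Y R \<and> R b" if "R \<in> ?F" for R using that F(2) by (auto simp: J_def)
    have R: "definable L S (C \<union> A1) Y (\<lambda>\<sigma>. \<forall>R\<in>?F. R \<sigma>)" by (rule definable_ball[OF fin]) (use FR in blast)
    have Rb: "\<forall>R\<in>?F. R b" using FR by blast
    have "\<exists>m. (\<forall>R i. Inl (R, i) \<in> F \<longrightarrow> i < m) \<and> (\<forall>I. Inr I \<in> F \<longrightarrow> I \<subseteq> {..<m})"
    proof -
      let ?N = "(\<Union>x\<in>F. case_sum (\<lambda>(R, i). {i}) (\<lambda>I. I) x)"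
      have "finite (case_sum (\<lambda>(R, i). {i}) (\<lambda>I. I) x)" if x: "x \<in> F" for x
      proof (cases x)
        case (Inl p)
        then show ?thesis by (cases p) auto
      next
        case (Inr I)
        then show ?thesis using F(2) x by (auto simp: J_def)
      qed
      then have "finite ?N" using F(1) by blast
      then obtain m where "\<forall>n\<in>?N. n < m" using finite_nat_set_iff_bounded by blast
      then have m: "?N \<subseteq> {..<m}" by blast
      have "i < m" if "Inl (R, i) \<in> F" for R i using m that by fastforce
      moreover have "I \<subseteq> {..<m}" if "Inr I \<in> F" for I using m that by fastforce
      ultimately show ?thesis by blast
    qed
    then obtain m where m: "\<And>R i. Inl (R, i) \<in> F \<Longrightarrow> i < m" "\<And>I. Inr I \<in> F \<Longrightarrow> I \<subseteq> {..<m}" by blast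
    from nondividing_trans_finite[OF C(1) A1(1) n1 E \<phi> Y b g R Rb, of m]
    obtain \<beta> where \<beta>: "\<beta> ` ({..<m} \<times> Y) \<subseteq> univ S" "\<forall>i<m. \<forall>R\<in>?F. R (\<lambda>y. \<beta> (i, y))"
      "\<forall>I\<subseteq>{..<m}. card I = k \<longrightarrow> \<not> consis \<phi> Y I \<beta>" by (elim exE conjE)
    obtain d where d: "d \<in> univ S" using nonempty by blast
    let ?\<beta> = "\<lambda>p. if fst p < m then \<beta> p else d"
    have "P j ?\<beta>" if j: "j \<in> F" for j
    proof (cases j)
      case (Inl p)
      then obtain R i where ji: "j = Inl (R, i)" by (cases p) auto
      have "i < m" using m(1) j ji by blast
      then have "(\<lambda>y. ?\<beta> (i, y)) = (\<lambda>y. \<beta> (i, y))" by simp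
      moreover have "R \<in> ?F" using j ji by blast
      then have "R (\<lambda>y. \<beta> (i, y))" using \<beta>(2) \<open>i < m\<close> by blast
      ultimately show ?thesis using ji by (simp add: P_def)
    next
      case (Inr I)
      then have I: "I \<subseteq> {..<m}" "card I = k" using m(2) j F(2) by (auto simp: J_def)
      have "consis \<phi> Y I ?\<beta> = consis \<phi> Y I \<beta>"
        unfolding consis_def using I(1) by (auto simp: subset_iff)
      then show ?thesis using \<beta>(3) I Inr by (simp add: P_def)
    qed
    moreover have "?\<beta> ` ?X \<subseteq> univ S" using \<beta>(1) d by auto
    ultimately show "\<exists>\<sigma>. \<sigma> ` ?X \<subseteq> univ S \<and> (\<forall>j\<in>F. P j \<sigma>)" by (intro exI[of _ ?\<beta>] conjI ballI)
  qed
  then obtain \<beta> where \<beta>u: "\<beta> ` ?X \<subseteq> univ S" and "\<forall>j\<in>J. P j \<beta>" by (elim exE conjE)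
  then have \<beta>: "\<And>j. j \<in> J \<Longrightarrow> P j \<beta>" by simp
  have \<beta>R: "R (\<lambda>y. \<beta> (i, y))" if "definable L S (C \<union> A1) Y R" "R b" for R i
    using \<beta>[of "Inl (R, i)"] that by (simp add: J_def P_def)
  have \<beta>I: "\<not> consis \<phi> Y I \<beta>" if "finite I" "card I = k" for I
    using \<beta>[of "Inr I"] that by (simp add: J_def P_def)
  let ?D = "C \<union> A1"
  have Du: "?D \<subseteq> univ S" using C A1 by auto
  have "\<exists>f. elem_map_over ?D (b ` Y) f \<and> (\<forall>y\<in>Y. f (b y) = \<beta> (i, y))" for i
  proof -
    have "sat S b \<psi> = sat S (\<lambda>y. \<beta> (i, y)) \<psi>" if \<psi>: "\<psi> \<in> forms L ?D Y" for \<psi>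
      using \<beta>R[OF definable_sat[OF \<psi>]] \<beta>R[OF definable_not[OF definable_sat[OF \<psi>]]] by blast
    then have "tp L S ?D Y b = tp L S ?D Y (\<lambda>y. \<beta> (i, y))" unfolding tp_def by blast
    moreover have "(\<lambda>y. \<beta> (i, y)) ` Y \<subseteq> univ S" using \<beta>u by auto
    ultimately show ?thesis using tp_elem_map[OF infinite_UNIV_nat Du bu] unfolding elem_map_over_def by metis
  qed
  then obtain f where f: "\<And>i. elem_map_over ?D (b ` Y) (f i)" "\<And>i y. y \<in> Y \<Longrightarrow> f i (b y) = \<beta> (i, y)" by metis
  \<comment> \<open>The solution variables with value in \<open>A1\<close> become parameter
    variables. The maps \<open>f i\<close> fix \<open>A1\<close>, so along the new sequence these
    parameters stay constant.\<close>
  define X1 where "X1 = {v\<in>fv \<phi> - Y. a v \<in> A1}"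
  have X1: "X1 \<inter> Y = {}" "finite X1" "a ` X1 \<subseteq> A1" by (auto simp: X1_def)
  let ?b = "override_on b a X1" and ?Y = "Y \<union> X1"
  have bY: "?b ` ?Y = b ` Y \<union> a ` X1" using X1(1) by (force simp: override_on_def)
  have d1: "divides L S ?D \<phi> ?Y ?b"
  proof (rule dividesI)
    show "elem_map_over ?D (?b ` ?Y) (f i)" for i
    proof -
      have "?D \<union> ?b ` ?Y = ?D \<union> b ` Y" unfolding bY using X1(3) by auto
      then show ?thesis using f(1)[of i] by (simp add: elem_map_over_def)
    qed
    show "k_inconsistent S k \<phi> ?Y (\<lambda>i v. f i (?b v))"
      unfolding k_inconsistent_def
    proof (intro allI impI notI)
      fix I :: "nat set" assume I: "finite I \<and> card I = k"
        and "\<exists>\<sigma>. range \<sigma> \<subseteq> univ S \<and> (\<forall>i\<in>I. sat S (override_on \<sigma> (\<lambda>v. f i (?b v)) ?Y) \<phi>)"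
      then obtain \<sigma> where \<sigma>: "range \<sigma> \<subseteq> univ S" "\<forall>i\<in>I. sat S (override_on \<sigma> (\<lambda>v. f i (?b v)) ?Y) \<phi>"
        by (elim exE conjE)
      have fa: "f i (a v) = a v" if "v \<in> X1" for i v using elem_map_overD(2)[OF f(1)[of i]] X1(3) that by auto
      have "override_on \<sigma> (\<lambda>v. f i (?b v)) ?Y = override_on (override_on \<sigma> a X1) (\<lambda>y. \<beta> (i, y)) Y" for i
        using X1(1) f(2) fa by (fastforce simp: override_on_def fun_eq_iff)
      moreover have "range (override_on \<sigma> a X1) \<subseteq> univ S" using \<sigma>(1) X1(3) A1(1) by (auto simp: override_on_def)
      ultimately have "consis \<phi> Y I \<beta>" unfolding consis_def using \<sigma>(2)
        by (intro exI[of _ "override_on \<sigma> a X1"]) simp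
      then show False using \<beta>I I by blast
    qed
  qed
  have d2: "?b ` ?Y \<subseteq> E \<union> ?D" unfolding bY using b X1(3) by auto
  have d3: "a ` (fv \<phi> - ?Y) \<subseteq> A2" using a by (auto simp: X1_def)
  have "finite ?Y" using Y X1(2) by simp
  from nondividingD[OF n2 \<phi> this d2 d3 d1] have "\<not> sat S (override_on a ?b ?Y) \<phi>" .
  moreover have "override_on a ?b ?Y = override_on a b Y" using X1(1) by (auto simp: override_on_def fun_eq_iff)
  ultimately show False using sat by simp
qed

section \<open>The calculus of nonforking independence\<close>

lemma indep_mono:
  assumes "indep L S A C B" "A' \<subseteq> A" "B' \<subseteq> B"
  shows "indep L S A' C B'"
  unfolding indep_def
proof (intro allI impI ballI)
  fix X :: "nat set" and a \<theta>
  assume "finite X \<and> a ` X \<subseteq> A'" and "\<theta> \<in> tp L S (B' \<union> C) X a"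
  then have "finite X \<and> a ` X \<subseteq> A" "\<theta> \<in> tp L S (B \<union> C) X a"
    using assms(2,3) by (auto simp: tp_def forms_def)
  then show "\<not> forks L S C \<theta>" using assms(1) unfolding indep_def by blast
qed

text \<open>The base enters forking through dividing only, so a comparison of bases can be made for
  single dividing formulas.\<close>

lemma forks_base:
  assumes "forks L S D \<theta>"
    and "\<And>\<phi> Y b. \<phi> \<in> forms L {} UNIV \<Longrightarrow> finite Y \<Longrightarrow> b ` Y \<subseteq> univ S \<Longrightarrow> divides L S D \<phi> Y b \<Longrightarrow>
      divides L S C \<phi> Y b"
  shows "forks L S C \<theta>"
proof -
  obtain D' where D': "finite D'"
    "\<forall>(\<phi>, Y, b)\<in>D'. \<phi> \<in> forms L {} (fv \<theta> \<union> Y) \<and> finite Y \<and> b ` Y \<subseteq> univ S \<and> divides L S D \<phi> Y b"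
    "\<forall>\<sigma>. range \<sigma> \<subseteq> univ S \<and> sat S \<sigma> \<theta> \<longrightarrow> (\<exists>(\<phi>, Y, b)\<in>D'. sat S (override_on \<sigma> b Y) \<phi>)"
    using assms(1) unfolding forks_def by (elim exE conjE)
  show ?thesis
    unfolding forks_def
  proof (intro exI[of _ D'] conjI D'(1,3) ballI)
    fix x assume x: "x \<in> D'"
    obtain \<phi> Y b where xx: "x = (\<phi>, Y, b)" by (cases x) auto
    have d: "\<phi> \<in> forms L {} (fv \<theta> \<union> Y)" "finite Y" "b ` Y \<subseteq> univ S" "divides L S D \<phi> Y b"
      using bspec[OF D'(2) x] xx by auto
    have "\<phi> \<in> forms L {} UNIV" using d(1) by (auto simp: forms_def)
    from assms(2)[OF this d(2-4)] show "case x of (\<phi>, Y, b) \<Rightarrow> \<phi> \<in> forms L {} (fv \<theta> \<union> Y) \<and> finite Y \<and>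
      b ` Y \<subseteq> univ S \<and> divides L S C \<phi> Y b" using d xx by simp
  qed
qed

text \<open>Tuples with the same type over \<open>D\<close> have the same type over
  \<open>C\<close>, so dividing over \<open>D\<close> implies dividing over \<open>C\<close>; and
  \<open>B \<union> D\<close> is \<open>B \<union> C\<close>, so the formulas tested are the
  same.\<close>

lemma indep_base_mono:
  assumes ind: "indep L S A C B" and D: "C \<subseteq> D" "D \<subseteq> B \<union> C"
  shows "indep L S A D B"
  unfolding indep_def
proof (intro allI impI ballI notI)
  fix X :: "nat set" and a \<theta>
  assume X: "finite X \<and> a ` X \<subseteq> A" and \<theta>: "\<theta> \<in> tp L S (B \<union> D) X a" and fk: "forks L S D \<theta>"
  have "B \<union> D = B \<union> C" using D by auto
  then have \<theta>': "\<theta> \<in> tp L S (B \<union> C) X a" using \<theta> by simp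
  have tp: "tp L S C Y b = tp L S C Y b'" if "tp L S D Y b = tp L S D Y b'" for Y :: "nat set" and b b'
  proof -
    have "tp L S C Y c = tp L S D Y c \<inter> forms L C Y" for c
      using forms_mono[OF D(1) order_refl, of L Y] by (auto simp: tp_def)
    then show ?thesis using that by simp
  qed
  have "divides L S C \<phi> Y b" if div: "divides L S D \<phi> Y b" for \<phi> Y b
  proof -
    obtain k b' where b': "\<forall>i. b' i ` Y \<subseteq> univ S \<and> tp L S D Y (b' i) = tp L S D Y b" "k_inconsistent S k \<phi> Y b'"
      using div unfolding divides_def by (elim exE conjE)
    have "b' i ` Y \<subseteq> univ S \<and> tp L S C Y (b' i) = tp L S C Y b" for i
      using spec[OF b'(1), of i] tp[of Y "b' i" b] by blast
    with b'(2) show ?thesis unfolding divides_def by blast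
  qed
  then have "forks L S C \<theta>" by (rule forks_base[OF fk])
  then show False using ind X \<theta>' unfolding indep_def by blast
qed

text \<open>First \<open>A\<close> is moved by \<open>f\<close> to avoid the test set, then
  \<open>f\<close> is extended to \<open>A'\<close> and the second independence is carried along,
  and finally the image of \<open>A'\<close> is moved over the image of \<open>A\<close>.
  \<open>nondividing_trans\<close> joins the two steps.\<close>

lemma indep_left_trans:
  assumes A: "A \<subseteq> univ S" "|A| <o \<kappa>" and A': "A' \<subseteq> univ S" "|A'| <o \<kappa>"
    and B: "B \<subseteq> univ S" "|B| <o \<kappa>" and C: "C \<subseteq> univ S" "|C| <o \<kappa>"
    and i1: "indep L S A C B" and i2: "indep L S A' (C \<union> A) B"
  shows "indep L S (A \<union> A') C B"
proof (rule nondividing_indep[OF B(1) C(1)])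
  fix E assume E: "E \<subseteq> univ S" "finite E"
  have sE: "|E| <o \<kappa>" using E(2) by auto
  obtain f where f: "elem_map (A \<union> B \<union> C) f" "\<And>z. z \<in> B \<union> C \<Longrightarrow> f z = z" "nondividing (f ` A) C E"
    using indep_nondividing[OF A B C E(1) sE i1] by metis
  have "|A \<union> B \<union> C| <o \<kappa>" using A B C by auto
  then obtain g where g: "elem_map (A \<union> B \<union> C \<union> A') g" "\<And>z. z \<in> A \<union> B \<union> C \<Longrightarrow> g z = f z"
    using elem_map_extend[OF f(1) _ A'(2,1)] by metis
  have gz: "g z = z" if "z \<in> B \<union> C" for z using g(2)[of z] f(2)[OF that] that by auto
  have gA: "g ` A = f ` A" using g(2) by auto
  have gC: "g ` (C \<union> A) = C \<union> g ` A" "g ` B = B" using gz by (force simp: image_Un)+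
  have gu: "g ` A \<subseteq> univ S" "g ` A' \<subseteq> univ S" using elem_map_univ(2)[OF g(1)] by auto
  have "indep L S (g ` A') (g ` (C \<union> A)) (g ` B)"
    by (rule elem_map_indep[OF g(1) _ A'(2) B(2) _ i2]) (use A C in auto)
  then have i3: "indep L S (g ` A') (C \<union> g ` A) B" unfolding gC .
  have CA: "C \<union> g ` A \<subseteq> univ S" "|C \<union> g ` A| <o \<kappa>" using C gu A by auto
  obtain h where h: "elem_map (g ` A' \<union> B \<union> (C \<union> g ` A)) h" "\<And>z. z \<in> B \<union> (C \<union> g ` A) \<Longrightarrow> h z = z"
    "nondividing (h ` g ` A') (C \<union> g ` A) E"
    using indep_nondividing[OF gu(2) small_image[OF A'(2)] B CA E(1) sE i3] by metis
  have nd: "nondividing (g ` A \<union> h ` g ` A') C E"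
    using nondividing_trans[OF C gu(1) small_image[OF A(2)] E(1) _ h(3)] f(3) gA by simp
  have hA: "h ` g ` A = g ` A" using h(2) by force
  have U: "A \<union> A' \<union> B \<union> C = A \<union> B \<union> C \<union> A'" by auto
  have "g ` (A \<union> B \<union> C \<union> A') \<subseteq> g ` A' \<union> B \<union> (C \<union> g ` A)" using gz by auto
  then have "elem_map (A \<union> A' \<union> B \<union> C) (\<lambda>z. h (g z))"
    unfolding U using elem_map_comp[OF g(1) elem_map_mono[OF h(1)]] by blast
  moreover have "h (g z) = z" if "z \<in> B \<union> C" for z using gz[OF that] h(2)[of z] that by auto
  moreover have "(\<lambda>z. h (g z)) ` (A \<union> A') = g ` A \<union> h ` g ` A'"
    using hA by (auto simp: image_Un image_image)
  ultimately show "\<exists>f. elem_map (A \<union> A' \<union> B \<union> C) f \<and> (\<forall>z\<in>B \<union> C. f z = z) \<and> nondividing (f ` (A \<union> A')) C E"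
    using nd by (intro exI[of _ "\<lambda>z. h (g z)"]) simp
qed

lemma nondividing_mono:
  assumes "nondividing A C E" "E' \<subseteq> E"
  shows "nondividing A C E'"
  unfolding nondividing_def
proof (intro ballI allI impI)
  fix \<phi> :: "('f, 'r, 'a, nat) fm" and Y b a
  assume *: "\<phi> \<in> forms L {} UNIV" "finite Y" and b: "b ` Y \<subseteq> E' \<union> C" and **: "a ` (fv \<phi> - Y) \<subseteq> A" "divides L S C \<phi> Y b"
  have "b ` Y \<subseteq> E \<union> C" using b assms(2) by auto
  from nondividingD[OF assms(1) * this **] show "\<not> sat S (override_on a b Y) \<phi>" .
qed

text \<open>A conjugation over \<open>B \<union> C\<close> may move \<open>D\<close>, but only in
  finitely many ways. The test set is enlarged in advance so as to be ready for each of them, and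
  afterwards the motion that really occurred is undone.\<close>

lemma indep_right_finite:
  assumes A: "A \<subseteq> univ S" "|A| <o \<kappa>" and B: "B \<subseteq> univ S" "|B| <o \<kappa>" and C: "C \<subseteq> univ S" "|C| <o \<kappa>"
    and ind: "indep L S A C B" and D: "finite D" "D \<subseteq> acl L S (B \<union> C)"
  shows "indep L S A C (B \<union> D)"
proof (rule nondividing_indep)
  have Du: "D \<subseteq> univ S" using D(2) acl_univ by auto
  show "B \<union> D \<subseteq> univ S" "C \<subseteq> univ S" using B C Du by auto
  fix E assume E: "E \<subseteq> univ S" "finite E"
  have sE: "|E| <o \<kappa>" using E(2) by auto
  define H where "H = {restrict f D |f. elem_map_over (B \<union> C) D f}"
  let ?PE = "PiE D (\<lambda>d. {f d |f. elem_map_over (B \<union> C) {d} f})"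
  have "H \<subseteq> ?PE"
  proof
    fix h assume "h \<in> H"
    then obtain f where f: "elem_map_over (B \<union> C) D f" "h = restrict f D" unfolding H_def by blast
    have "elem_map_over (B \<union> C) {d} f" if "d \<in> D" for d
      using f(1) elem_map_mono[of "B \<union> C \<union> D" f "B \<union> C \<union> {d}"] that by (auto simp: elem_map_over_def)
    then show "h \<in> ?PE" using f(2) by (auto simp: PiE_def)
  qed
  moreover have "finite ?PE" using D B C finite_orbit[of _ "B \<union> C"] by (intro finite_PiE) auto
  ultimately have finH: "finite H" using finite_subset by blast
  have sBC: "|B \<union> C \<union> D| <o \<kappa>" using B C D by auto
  have "\<exists>u. elem_map (B \<union> C \<union> D \<union> E) u \<and> (\<forall>z\<in>B \<union> C. u z = z) \<and> (\<forall>d\<in>D. u d = h d)" if hH: "h \<in> H" for h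
  proof -
    obtain f where f: "elem_map_over (B \<union> C) D f" "h = restrict f D" using hH unfolding H_def by blast
    obtain u where "elem_map (B \<union> C \<union> D \<union> E) u" "\<And>z. z \<in> B \<union> C \<union> D \<Longrightarrow> u z = f z"
      using elem_map_extend[OF elem_map_overD(1)[OF f(1)] sBC sE E(1)] by metis
    then show ?thesis using elem_map_overD(2)[OF f(1)] f(2) by (intro exI[of _ u]) auto
  qed
  then have "\<forall>h\<in>H. \<exists>u. elem_map (B \<union> C \<union> D \<union> E) u \<and> (\<forall>z\<in>B \<union> C. u z = z) \<and> (\<forall>d\<in>D. u d = h d)"
    by (rule ballI)
  from bchoice[OF this] obtain u where
    "\<forall>h\<in>H. elem_map (B \<union> C \<union> D \<union> E) (u h) \<and> (\<forall>z\<in>B \<union> C. u h z = z) \<and> (\<forall>d\<in>D. u h d = h d)" by (rule exE)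
  then have u: "\<And>h. h \<in> H \<Longrightarrow> elem_map (B \<union> C \<union> D \<union> E) (u h)"
    "\<And>h z. h \<in> H \<Longrightarrow> z \<in> B \<union> C \<Longrightarrow> u h z = z" "\<And>h d. h \<in> H \<Longrightarrow> d \<in> D \<Longrightarrow> u h d = h d" by blast+
  let ?E = "\<Union>h\<in>H. u h ` E"
  have E': "finite ?E" "?E \<subseteq> univ S" using finH E elem_map_univ(2)[OF u(1)] by auto
  obtain f where f: "elem_map (A \<union> B \<union> C) f" "\<And>z. z \<in> B \<union> C \<Longrightarrow> f z = z" "nondividing (f ` A) C ?E"
    using indep_nondividing[OF A B C E'(2) small_finite[OF E'(1)] ind] by metis
  have "|A \<union> B \<union> C| <o \<kappa>" using A B C by auto
  then obtain g where g: "elem_map (A \<union> B \<union> C \<union> D) g" "\<And>z. z \<in> A \<union> B \<union> C \<Longrightarrow> g z = f z"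
    using elem_map_extend[OF f(1) _ small_finite[OF D(1)] Du] by metis
  have gz: "g z = z" if "z \<in> B \<union> C" for z using g(2)[of z] f(2)[OF that] that by auto
  have gA: "g ` A = f ` A" using g(2) by auto
  have "elem_map (B \<union> C \<union> D) g" by (rule elem_map_mono[OF g(1)]) auto
  then have "elem_map_over (B \<union> C) D g" using gz by (simp add: elem_map_over_def)
  \<comment> \<open>The actual motion of \<open>D\<close> is one of the prepared ones. The inverse
    of its extension brings \<open>D\<close> back to its place and the avoided copy back to
    \<open>E\<close>.\<close>
  then have h: "restrict g D \<in> H" (is "?h \<in> _") unfolding H_def by blast
  let ?K = "B \<union> C \<union> D \<union> E"
  let ?v = "inv_into ?K (u ?h)"
  have vu: "?v (u ?h z) = z" if "z \<in> ?K" for z using inv_into_f_f[OF elem_map_inj[OF u(1)[OF h]]] that by blast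
  have emv: "elem_map (u ?h ` ?K) ?v" by (rule elem_map_inv[OF u(1)[OF h]])
  have sK: "|u ?h ` ?K| <o \<kappa>" using sBC sE by (intro small_image) auto
  have gAu: "g ` A \<subseteq> univ S" using elem_map_univ(2)[OF g(1)] by auto
  obtain k where k: "elem_map (u ?h ` ?K \<union> g ` A) k" "\<And>z. z \<in> u ?h ` ?K \<Longrightarrow> k z = ?v z"
    using elem_map_extend[OF emv sK small_image[OF A(2)] gAu] by metis
  have ku: "k (u ?h z) = z" if "z \<in> ?K" for z using k(2)[OF imageI[OF that]] vu[OF that] by simp
  have kz: "k z = z" if "z \<in> B \<union> C" for z using ku[of z] u(2)[OF h that] that by auto
  have kg: "k (g d) = d" if "d \<in> D" for d using ku[of d] u(3)[OF h that] that by auto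
  have ndf: "nondividing (g ` A) C (u ?h ` E)"
    unfolding gA
  proof (rule nondividing_mono[OF f(3)])
    show "u ?h ` E \<subseteq> ?E" using h by blast
  qed
  have CK: "C \<subseteq> u ?h ` ?K" using u(2)[OF h] by force
  have "g ` A \<union> C \<union> u ?h ` E \<subseteq> u ?h ` ?K \<union> g ` A" using CK by blast
  from elem_map_nondividing[OF k(1) this C(2) ndf] have "nondividing (k ` g ` A) (k ` C) (k ` u ?h ` E)" .
  moreover have "k ` C = C" "k ` u ?h ` E = E" using kz ku by force+
  ultimately have nd: "nondividing (k ` g ` A) C E" by simp
  have U: "A \<union> (B \<union> D) \<union> C = A \<union> B \<union> C \<union> D" by auto
  have BK: "B \<subseteq> u ?h ` ?K" using u(2)[OF h] by force
  have DK: "g ` D \<subseteq> u ?h ` ?K" using u(3)[OF h] by force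
  have "g ` (A \<union> B \<union> C \<union> D) \<subseteq> u ?h ` ?K \<union> g ` A" using BK CK DK gz by (auto simp: image_Un)
  then have "elem_map (A \<union> (B \<union> D) \<union> C) (\<lambda>z. k (g z))"
    unfolding U using elem_map_comp[OF g(1) elem_map_mono[OF k(1)]] by blast
  moreover have "\<forall>z\<in>B \<union> D \<union> C. k (g z) = z" using gz kz kg by auto
  moreover have "(\<lambda>z. k (g z)) ` A = k ` g ` A" by auto
  ultimately show "\<exists>f. elem_map (A \<union> (B \<union> D) \<union> C) f \<and> (\<forall>z\<in>B \<union> D \<union> C. f z = z) \<and> nondividing (f ` A) C E"
    using nd by (intro exI[of _ "\<lambda>z. k (g z)"]) simp
qed

text \<open>A formula has finitely many parameters in the closure, so the finite case
  suffices.\<close>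

lemma indep_right_acl:
  assumes A: "A \<subseteq> univ S" "|A| <o \<kappa>" and B: "B \<subseteq> univ S" "|B| <o \<kappa>" and C: "C \<subseteq> univ S" "|C| <o \<kappa>"
    and ind: "indep L S A C B"
  shows "indep L S A C (acl L S (B \<union> C))"
  unfolding indep_def
proof (intro allI impI ballI notI)
  fix X :: "nat set" and a \<theta>
  assume X: "finite X \<and> a ` X \<subseteq> A" and \<theta>: "\<theta> \<in> tp L S (acl L S (B \<union> C) \<union> C) X a" and fk: "forks L S C \<theta>"
  let ?D = "pars \<theta>"
  have "C \<subseteq> acl L S (B \<union> C)" using acl_incl[of "B \<union> C"] B C by auto
  then have D: "?D \<subseteq> acl L S (B \<union> C)" using \<theta> by (auto simp: tp_def forms_def)
  have "indep L S A C (B \<union> ?D)" by (rule indep_right_finite[OF A B C ind _ D]) simp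
  moreover have "\<theta> \<in> tp L S (B \<union> ?D \<union> C) X a" using \<theta> by (auto simp: tp_def forms_def)
  ultimately show False using X fk unfolding indep_def by blast
qed

text \<open>Along a dividing sequence the solution tuple in the closure of \<open>C\<close> has
  finitely many conjugates. Infinitely many instances then share one solution, contradicting
  \<open>k\<close>-inconsistency; hence the identity already avoids every test set.\<close>

lemma indep_acl_self:
  assumes C: "C \<subseteq> univ S" "|C| <o \<kappa>" and B: "B \<subseteq> univ S" and A: "A \<subseteq> acl L S C"
  shows "indep L S A C B"
proof (rule nondividing_indep[OF B C(1)])
  fix E assume E: "E \<subseteq> univ S" "finite E"
  have Au: "A \<subseteq> univ S" using A acl_univ by auto
  have "nondividing A C E"
    unfolding nondividing_def
  proof (intro ballI allI impI notI)
    fix \<phi> :: "('f, 'r, 'a, nat) fm" and Y b a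
    assume \<phi>: "\<phi> \<in> forms L {} UNIV" and Y: "finite Y" and b: "b ` Y \<subseteq> E \<union> C" and a: "a ` (fv \<phi> - Y) \<subseteq> A"
      and div: "divides L S C \<phi> Y b" and sat: "sat S (override_on a b Y) \<phi>"
    have bu: "b ` Y \<subseteq> univ S" using b E C by auto
    obtain k g where g: "\<And>i. elem_map_over C (b ` Y) (g i)" "k_inconsistent S k \<phi> Y (\<lambda>i v. g i (b v))"
      using dividesE[OF div C(1) bu] by metis
    let ?D = "a ` (fv \<phi> - Y)"
    have D: "finite ?D" "?D \<subseteq> acl L S C" "?D \<subseteq> univ S" using a A Au by auto
    have sb: "|C \<union> b ` Y| <o \<kappa>" using C Y by auto
    have "\<exists>h. elem_map (C \<union> b ` Y \<union> ?D) h \<and> (\<forall>z\<in>C \<union> b ` Y. h z = g i z)" for i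
      using elem_map_extend[OF elem_map_overD(1)[OF g(1)[of i]] sb small_finite[OF D(1)] D(3)] by metis
    then obtain h where h: "\<And>i. elem_map (C \<union> b ` Y \<union> ?D) (h i)" "\<And>i z. z \<in> C \<union> b ` Y \<Longrightarrow> h i z = g i z" by metis
    have hC: "h i z = z" if "z \<in> C" for i z using h(2)[of z i] elem_map_overD(2)[OF g(1)[of i]] that by simp
    have "elem_map_over C ?D (h i)" for i
      using elem_map_mono[OF h(1)[of i], of "C \<union> ?D"] hC by (auto simp: elem_map_over_def)
    then obtain I where I: "infinite I" "\<And>i j d. i \<in> I \<Longrightarrow> j \<in> I \<Longrightarrow> d \<in> ?D \<Longrightarrow> h i d = h j d"
      using orbit_pigeonhole[OF D(1,2) C(1), of h] by metis
    then have "I \<noteq> {}" by auto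
    then obtain i0 where i0: "i0 \<in> I" by blast
    obtain F where F: "F \<subseteq> I" "finite F" "card F = k" using infinite_arbitrarily_large[OF I(1)] by metis
    obtain d where d: "d \<in> univ S" using nonempty by blast
    \<comment> \<open>The image of the solution under \<open>h i0\<close>, which all maps with index
      in \<open>I\<close> have in common, solves all the instances in \<open>F\<close>.\<close>
    let ?\<sigma> = "\<lambda>v. if v \<in> fv \<phi> - Y then h i0 (a v) else d"
    have "range ?\<sigma> \<subseteq> univ S" using d elem_map_univ(2)[OF h(1)[of i0]] by auto
    moreover have "sat S (override_on ?\<sigma> (\<lambda>v. g i (b v)) Y) \<phi>" if "i \<in> F" for i
    proof -
      have "sat S (override_on a b Y) \<phi> = sat S (\<lambda>v. h i (override_on a b Y v)) \<phi>"
        by (rule elem_map_sat[OF h(1)[of i] \<phi>]) (auto simp: override_on_def)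
      moreover have "\<dots> = sat S (override_on ?\<sigma> (\<lambda>v. g i (b v)) Y) \<phi>"
      proof (rule sat_cong)
        fix v assume "v \<in> fv \<phi>"
        moreover have "i \<in> I" using that F(1) by blast
        ultimately show "h i (override_on a b Y v) = override_on ?\<sigma> (\<lambda>v. g i (b v)) Y v"
          using h(2)[of "b v" i] I(2)[OF _ i0, of i "a v"] by (auto simp: override_on_def)
      qed
      ultimately show ?thesis using sat by simp
    qed
    ultimately show False using g(2) F(2,3) unfolding k_inconsistent_def by blast
  qed
  moreover have "elem_map (A \<union> B \<union> C) (\<lambda>z. z)" using elem_map_id[of "A \<union> B \<union> C"] Au B C by auto
  ultimately show "\<exists>f. elem_map (A \<union> B \<union> C) f \<and> (\<forall>z\<in>B \<union> C. f z = z) \<and> nondividing (f ` A) C E"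
    by (intro exI[of _ "\<lambda>z. z"]) simp
qed

text \<open>Elements algebraic over \<open>C \<union> A\<close> are independent from anything over
  that base, and left transitivity combines this with the independence of \<open>A\<close>.\<close>

lemma indep_left_acl:
  assumes A: "A \<subseteq> univ S" "|A| <o \<kappa>" and B: "B \<subseteq> univ S" "|B| <o \<kappa>" and C: "C \<subseteq> univ S" "|C| <o \<kappa>"
    and A': "A' \<subseteq> acl L S (C \<union> A)" "|A'| <o \<kappa>" and ind: "indep L S A C B"
  shows "indep L S A' C B"
proof -
  have "indep L S A' (C \<union> A) B" by (rule indep_acl_self[OF _ _ B(1) A'(1)]) (use A C in auto)
  moreover have "A' \<subseteq> univ S" using A'(1) acl_univ by auto
  ultimately have "indep L S (A \<union> A') C B" using indep_left_trans[OF A _ A'(2) B C ind] by blast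
  then show ?thesis by (rule indep_mono) auto
qed

text \<open>The type of \<open>b\<close> over the closure must be kept along the sequence. For
  finitely many conditions only finitely many algebraic parameters \<open>A0\<close> matter;
  infinitely many of the maps agree on them, and correcting by one of these maps makes the
  parameters fixed.\<close>

lemma divides_acl:
  assumes C: "C \<subseteq> univ S" "|C| <o \<kappa>" and aclC: "|acl L S C| <o \<kappa>" and b: "b ` Y \<subseteq> univ S" and Y: "finite Y"
    and \<phi>: "\<phi> \<in> forms L {} UNIV" and div: "divides L S C \<phi> Y b"
  shows "divides L S (acl L S C) \<phi> Y b"
proof -
  let ?D = "acl L S C"
  have Du: "?D \<subseteq> univ S" by (rule acl_univ)
  obtain k g where g: "\<And>i. elem_map_over C (b ` Y) (g i)" "k_inconsistent S k \<phi> Y (\<lambda>i v. g i (b v))"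
    using dividesE[OF div C(1) b] by metis
  define P :: "(((nat \<Rightarrow> 'a) \<Rightarrow> bool) \<times> nat) + nat set \<Rightarrow> (nat \<times> nat \<Rightarrow> 'a) \<Rightarrow> bool" where
    "P = case_sum (\<lambda>(R, i) \<beta>. R (\<lambda>y. \<beta> (i, y))) (\<lambda>I \<beta>. \<not> consis \<phi> Y I \<beta>)"
  define J where "J = Inl ` ({R. definable L S ?D Y R \<and> R b} \<times> (UNIV :: nat set)) \<union> Inr ` {I :: nat set. finite I \<and> card I = k}"
  let ?X = "UNIV \<times> Y :: (nat \<times> nat) set"
  have "\<exists>\<beta>. \<beta> ` ?X \<subseteq> univ S \<and> (\<forall>j\<in>J. P j \<beta>)"
  proof (rule compactness_family[OF Du aclC])
    have "|?X| \<le>o |(UNIV :: nat set) \<times> (UNIV :: nat set)|" by (rule card_of_mono1) auto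
    moreover have "|(UNIV :: nat set) \<times> (UNIV :: nat set)| \<le>o |UNIV :: nat set|"
      using card_of_Times_same_infinite[OF infinite_UNIV_nat] ordIso_imp_ordLeq by blast
    ultimately show "|?X| <o \<kappa>" using small_nat_type ordLeq_transitive ordLeq_ordLess_trans by blast
    fix j assume "j \<in> J"
    then consider R i where "j = Inl (R, i)" "definable L S ?D Y R" | I where "j = Inr I" "finite I"
      unfolding J_def by blast
    then show "definable L S ?D ?X (P j)"
    proof cases
      case 1
      have "definable L S ?D ?X (\<lambda>\<beta>. R (\<lambda>y. \<beta> (i, y)))" by (rule definable_reindex_var[OF 1(2)]) auto
      then show ?thesis using 1 by (simp add: P_def)
    next
      case 2
      have "definable L S ?D ?X (consis \<phi> Y I)" by (rule definable_mono[OF consis_definable[OF \<phi> 2(2)]]) auto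
      then show ?thesis using 2 definable_not by (simp add: P_def)
    qed
  next
    fix F assume F: "finite F" "F \<subseteq> J"
    let ?F = "{R. \<exists>i. Inl (R, i) \<in> F}"
    have "?F \<subseteq> fst ` projl ` F" by force
    then have fin: "finite ?F" using F(1) finite_subset by blast
    have FR: "definable L S ?D Y R \<and> R b" if "R \<in> ?F" for R using that F(2) by (auto simp: J_def)
    define RR where "RR = (\<lambda>\<sigma>. \<forall>R\<in>?F. R \<sigma>)"
    have R: "definable L S ?D Y RR" unfolding RR_def by (rule definable_ball[OF fin]) (use FR in blast)
    have Rb: "RR b" unfolding RR_def using FR by blast
    obtain A0 Y0 R0 where A0: "finite A0" "A0 \<subseteq> ?D" "Y0 \<subseteq> Y" "definable L S A0 Y0 R0"
      "\<And>\<sigma>. \<sigma> ` Y \<subseteq> univ S \<Longrightarrow> R0 \<sigma> = RR \<sigma>"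
      using definable_finite_support[OF R] by metis
    have A0u: "A0 \<subseteq> univ S" using A0(2) Du by auto
    have sb: "|C \<union> b ` Y| <o \<kappa>" using C Y by auto
    have "\<exists>h. elem_map (C \<union> b ` Y \<union> A0) h \<and> (\<forall>z\<in>C \<union> b ` Y. h z = g i z)" for i
      using elem_map_extend[OF elem_map_overD(1)[OF g(1)[of i]] sb small_finite[OF A0(1)] A0u] by metis
    then obtain h where h: "\<And>i. elem_map (C \<union> b ` Y \<union> A0) (h i)" "\<And>i z. z \<in> C \<union> b ` Y \<Longrightarrow> h i z = g i z" by metis
    have hC: "h i z = z" if "z \<in> C" for i z using h(2)[of z i] elem_map_overD(2)[OF g(1)[of i]] that by simp
    have "elem_map_over C A0 (h i)" for i
      using elem_map_mono[OF h(1)[of i], of "C \<union> A0"] hC by (auto simp: elem_map_over_def)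
    then obtain I where I: "infinite I" "\<And>i j d. i \<in> I \<Longrightarrow> j \<in> I \<Longrightarrow> d \<in> A0 \<Longrightarrow> h i d = h j d"
      using orbit_pigeonhole[OF A0(1,2) C(1), of h] by metis
    then have "I \<noteq> {}" by auto
    then obtain i0 where i0: "i0 \<in> I" by blast
    obtain e :: "nat \<Rightarrow> nat" where e: "inj e" "range e \<subseteq> I" using infinite_countable_subset[OF I(1)] by blast
    let ?B = "C \<union> b ` Y \<union> A0"
    let ?v = "inv_into A0 (h i0)"
    have em0: "elem_map A0 (h i0)" by (rule elem_map_mono[OF h(1)]) auto
    have vh: "?v (h i0 z) = z" if "z \<in> A0" for z using inv_into_f_f[OF elem_map_inj[OF em0]] that by blast
    let ?H = "(\<lambda>(i, y). h (e i) (b y)) ` (UNIV \<times> Y)"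
    have sH: "|?H| <o \<kappa>"
    proof -
      have "|?X| \<le>o |(UNIV :: nat set) \<times> (UNIV :: nat set)|" by (rule card_of_mono1) auto
      moreover have "|(UNIV :: nat set) \<times> (UNIV :: nat set)| \<le>o |UNIV :: nat set|"
        using card_of_Times_same_infinite[OF infinite_UNIV_nat] ordIso_imp_ordLeq by blast
      ultimately have "|?X| <o \<kappa>" using small_nat_type ordLeq_transitive ordLeq_ordLess_trans by blast
      then show ?thesis by (rule small_image)
    qed
    have Hu: "?H \<subseteq> univ S" using elem_map_univ(2)[OF h(1)] by auto
    \<comment> \<open>The map \<open>l\<close> undoes the common action of the selected maps on
      \<open>A0\<close>. Composed with them it fixes \<open>A0\<close>, so the corrected sequence
      satisfies the conditions over \<open>A0\<close>, and it keeps its inconsistency because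
      \<open>l\<close> is elementary on all of it.\<close>
    obtain l where l: "elem_map (h i0 ` A0 \<union> ?H) l" "\<And>z. z \<in> h i0 ` A0 \<Longrightarrow> l z = ?v z"
      using elem_map_extend[OF elem_map_inv[OF em0] small_image[OF small_finite[OF A0(1)]] sH Hu] by metis
    have lh: "l (h i0 z) = z" if "z \<in> A0" for z using l(2)[OF imageI[OF that]] vh[OF that] by simp
    let ?\<beta> = "\<lambda>(i, y). l (h (e i) (b y))"
    have HI: "h (e i) (b y) \<in> ?H" if "y \<in> Y" for i y by (rule image_eqI[of _ _ "(i, y)"]) (use that in auto)
    have "l z \<in> univ S" if "z \<in> ?H" for z using elem_map_univ(2)[OF l(1)] that by blast
    from this[OF HI] have \<beta>u: "?\<beta> ` ?X \<subseteq> univ S" by auto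
    have R\<beta>: "RR (\<lambda>y. l (h (e i) (b y)))" for i
    proof -
      have eI: "e i \<in> I" using e(2) by auto
      let ?m = "\<lambda>z. l (h (e i) z)"
      have 1: "elem_map (b ` Y \<union> A0) (h (e i))" by (rule elem_map_mono[OF h(1)]) auto
      have "h (e i) ` A0 \<subseteq> h i0 ` A0" using I(2)[OF eI i0] by auto
      moreover have "h (e i) ` b ` Y \<subseteq> ?H" using HI by blast
      ultimately have "h (e i) ` (b ` Y \<union> A0) \<subseteq> h i0 ` A0 \<union> ?H" by blast
      then have 2: "elem_map (b ` Y \<union> A0) ?m" using elem_map_comp[OF 1 elem_map_mono[OF l(1)]] by blast
      have "R0 b = R0 (\<lambda>y. ?m (b y))"
        by (rule elem_map_definable[OF 2 definable_mono[OF A0(4) order_refl A0(3)]]) (use I(2)[OF eI i0] lh in auto)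
      moreover have "R0 b" using A0(5)[OF b] Rb by simp
      moreover have "(\<lambda>y. ?m (b y)) ` Y \<subseteq> univ S" using \<beta>u by auto
      ultimately show ?thesis using A0(5)[of "\<lambda>y. ?m (b y)"] by simp
    qed
    have ninc: "\<not> consis \<phi> Y I' ?\<beta>" if I': "finite I'" "card I' = k" for I'
    proof -
      have "consis \<phi> Y I' (\<lambda>p. l ((\<lambda>(i, y). h (e i) (b y)) p)) = consis \<phi> Y I' (\<lambda>(i, y). h (e i) (b y))"
        by (rule consis_elem_map[OF l(1) \<phi> I'(1)]) (intro le_supI2 image_mono, auto)
      moreover have "(\<lambda>p. l ((\<lambda>(i, y). h (e i) (b y)) p)) = ?\<beta>" by auto
      moreover have "\<not> consis \<phi> Y (e ` I') (\<lambda>(i, y). g i (b y))"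
        using g(2) card_image[OF inj_on_subset[OF e(1)], of I'] I' unfolding k_inconsistent_iff by simp
      moreover have "override_on \<sigma> (\<lambda>y. h (e i) (b y)) Y = override_on \<sigma> (\<lambda>y. g (e i) (b y)) Y" for i \<sigma>
        using h(2) by (auto simp: override_on_def fun_eq_iff)
      then have "consis \<phi> Y I' (\<lambda>(i, y). h (e i) (b y)) = consis \<phi> Y (e ` I') (\<lambda>(i, y). g i (b y))"
        by (simp add: consis_def)
      ultimately show ?thesis by simp
    qed
    have "P j ?\<beta>" if j: "j \<in> F" for j
    proof (cases j)
      case (Inl p)
      then obtain R i where ji: "j = Inl (R, i)" by (cases p) auto
      have "R \<in> ?F" using j ji by blast
      then have "R (\<lambda>y. l (h (e i) (b y)))" using R\<beta>[of i] unfolding RR_def by (rule bspec[rotated])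
      then show ?thesis using ji by (simp add: P_def)
    next
      case (Inr I)
      then have I: "finite I" "card I = k" using j F(2) by (auto simp: J_def)
      from ninc[OF this] show ?thesis using Inr by (simp add: P_def)
    qed
    with \<beta>u show "\<exists>\<sigma>. \<sigma> ` ?X \<subseteq> univ S \<and> (\<forall>j\<in>F. P j \<sigma>)" by (intro exI[of _ ?\<beta>] conjI ballI)
  qed
  then obtain \<beta> where \<beta>u: "\<beta> ` ?X \<subseteq> univ S" and "\<forall>j\<in>J. P j \<beta>" by (elim exE conjE)
  then have \<beta>: "\<And>j. j \<in> J \<Longrightarrow> P j \<beta>" by simp
  have \<beta>R: "R (\<lambda>y. \<beta> (i, y))" if "definable L S ?D Y R" "R b" for R i
    using \<beta>[of "Inl (R, i)"] that by (simp add: J_def P_def)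
  have \<beta>I: "\<not> consis \<phi> Y I \<beta>" if "finite I" "card I = k" for I
    using \<beta>[of "Inr I"] that by (simp add: J_def P_def)
  show ?thesis
    unfolding divides_def
  proof (intro exI conjI allI)
    fix i
    show "(\<lambda>y. \<beta> (i, y)) ` Y \<subseteq> univ S" using \<beta>u by auto
    have "sat S b \<psi> = sat S (\<lambda>y. \<beta> (i, y)) \<psi>" if \<psi>: "\<psi> \<in> forms L ?D Y" for \<psi>
      using \<beta>R[OF definable_sat[OF \<psi>]] \<beta>R[OF definable_not[OF definable_sat[OF \<psi>]]] by blast
    then show "tp L S ?D Y (\<lambda>y. \<beta> (i, y)) = tp L S ?D Y b" unfolding tp_def by blast
  next
    show "k_inconsistent S k \<phi> Y (\<lambda>i y. \<beta> (i, y))" unfolding k_inconsistent_iff using \<beta>I by simp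
  qed
qed

text \<open>Dividing over \<open>C\<close> passes to its closure, so forking over \<open>C\<close>
  does too. It serves to replace a closed base by a generating set.\<close>

lemma indep_acl_base:
  assumes C: "C \<subseteq> univ S" "|C| <o \<kappa>" and aclC: "|acl L S C| <o \<kappa>" and ind: "indep L S A (acl L S C) B"
  shows "indep L S A C B"
  unfolding indep_def
proof (intro allI impI ballI notI)
  fix X :: "nat set" and a \<theta>
  assume X: "finite X \<and> a ` X \<subseteq> A" and \<theta>: "\<theta> \<in> tp L S (B \<union> C) X a" and fk: "forks L S C \<theta>"
  have "forks L S (acl L S C) \<theta>"
    by (rule forks_base[OF fk]) (rule divides_acl[OF C aclC])
  moreover have "\<theta> \<in> tp L S (B \<union> acl L S C) X a"
    using \<theta> acl_incl[OF C(1)] by (auto simp: tp_def forms_def)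
  ultimately show False using ind X unfolding indep_def by blast
qed

text \<open>A common element \<open>e\<close> would be independent from itself over
  \<open>C\<close>. If it had infinitely many conjugates over \<open>C\<close>, the formula stating
  equality with \<open>e\<close> would divide, being 2-inconsistent along them, although
  \<open>e\<close> satisfies it.\<close>

lemma indep_acl_inter:
  assumes A: "A \<subseteq> univ S" "|A| <o \<kappa>" and B: "B \<subseteq> univ S" "|B| <o \<kappa>" and C: "C \<subseteq> univ S" "|C| <o \<kappa>"
    and ind: "indep L S A C B"
  shows "acl L S (A \<union> C) \<inter> acl L S (B \<union> C) \<subseteq> acl L S C"
proof (rule subsetI, rule ccontr)
  fix e assume e: "e \<in> acl L S (A \<union> C) \<inter> acl L S (B \<union> C)" and ne: "e \<notin> acl L S C"
  have eu: "e \<in> univ S" using e acl_univ by blast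
  have e1: "{e} \<subseteq> univ S" "|{e}| <o \<kappa>" using eu by auto
  have e2: "{e} \<subseteq> acl L S (C \<union> A)" using e by (simp add: Un_commute)
  have "indep L S A C {e}"
    by (rule indep_mono[OF indep_right_acl[OF A B C ind] order_refl]) (use e in simp)
  from indep_left_acl[OF A e1 C e2 e1(2) this] have i: "indep L S {e} C {e}" .
  obtain f where f: "elem_map ({e} \<union> {e} \<union> C) f" "\<And>z. z \<in> {e} \<union> C \<Longrightarrow> f z = z" "nondividing (f ` {e}) C {e}"
    using indep_nondividing[OF e1 e1 C e1 i] by metis
  have nd: "nondividing {e} C {e}" using f(2,3) by simp
  obtain g :: "nat \<Rightarrow> 'a \<Rightarrow> 'a" where g: "\<And>i. elem_map_over C {e} (g i)" "inj (\<lambda>i. g i e)"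
    using infinite_orbit[OF C eu ne] by metis
  let ?\<phi> = "Eq (Var 0) (Var 1) :: ('f, 'r, 'a, nat) fm"
  have "divides L S C ?\<phi> {1} (\<lambda>_. e)"
  proof (rule dividesI)
    show "elem_map_over C ((\<lambda>_. e) ` {1 :: nat}) (g i)" for i using g(1) by simp
    show "k_inconsistent S 2 ?\<phi> {1} (\<lambda>i v. g i e)"
      unfolding k_inconsistent_def
    proof (intro allI impI notI)
      fix I :: "nat set" assume I: "finite I \<and> card I = 2"
        and "\<exists>\<sigma>. range \<sigma> \<subseteq> univ S \<and> (\<forall>i\<in>I. sat S (override_on \<sigma> (\<lambda>v. g i e) {1}) ?\<phi>)"
      then obtain \<sigma> where \<sigma>: "\<forall>i\<in>I. \<sigma> 0 = g i e" by (auto simp: override_on_def)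
      obtain i j where "i \<in> I" "j \<in> I" "i \<noteq> j" using I by (metis card_2_iff')
      moreover from this have "g i e = g j e" using \<sigma> by metis
      ultimately show False using injD[OF g(2), of i j] by simp
    qed
  qed
  moreover have "?\<phi> \<in> forms L {} UNIV" by (auto simp: forms_def)
  ultimately have "\<not> sat S (override_on (\<lambda>_. e) (\<lambda>_. e) {1}) ?\<phi>"
    using nondividingD[OF nd, of ?\<phi> "{1}" "\<lambda>_. e" "\<lambda>_. e"] by auto
  then show False by (simp add: override_on_def)
qed

end

subsection \<open>Cardinality of the algebraic closure\<close>

lemma finite_ordLeq_infinite:
  assumes "finite A" "infinite B"
  shows "|A| \<le>o |B|"
proof -
  obtain f :: "'a \<Rightarrow> nat" where "inj_on f A" using finite_imp_inj_to_nat_seg[OF assms(1)] by blast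
  then have "|A| \<le>o |UNIV :: nat set|" by (metis card_of_ordLeq top_greatest)
  then show ?thesis using assms(2) infinite_iff_card_of_nat ordLeq_transitive by blast
qed

lemma lists_ordLeq:
  assumes "infinite B"
  shows "|lists B| \<le>o |B|"
proof -
  have 1: "|{xs\<in>lists B. length xs = n}| \<le>o |B|" for n
  proof (induction n)
    case 0
    have "{xs\<in>lists B. length xs = 0} = {[]}" by auto
    moreover have "|{[]}| \<le>o |B|" by (rule finite_ordLeq_infinite[OF _ assms]) simp
    ultimately show ?case by simp
  next
    case (Suc n)
    have eq: "{xs\<in>lists B. length xs = Suc n} = (\<lambda>(x, xs). x # xs) ` (B \<times> {xs\<in>lists B. length xs = n})"
      by (force simp: length_Suc_conv image_iff)
    have "|B \<times> {xs\<in>lists B. length xs = n}| \<le>o |B|"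
      by (rule card_of_Sigma_ordLeq_infinite[OF assms]) (use Suc in \<open>auto simp: card_of_mono1\<close>)
    then show ?case unfolding eq by (rule ordLeq_transitive[OF card_of_image])
  qed
  have "lists B = (\<Union>n. {xs\<in>lists B. length xs = n})" by auto
  moreover have "|\<Union>n\<in>UNIV. {xs\<in>lists B. length xs = n}| \<le>o |B|"
    by (rule card_of_UNION_ordLeq_infinite[OF assms]) (use 1 infinite_iff_card_of_nat assms in auto)
  ultimately show ?thesis by simp
qed

context saturated_structure
begin

text \<open>An algebraic element is coded by a parameter-free formula and a list of parameters:
  variable 0 stands for the element, variable \<open>n\<close> for list entry \<open>n - 1\<close>.
  This is what can be counted.\<close>

lemma acl_nat_form:
  assumes A: "A \<subseteq> univ S" and e: "e \<in> acl L S A"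
  obtains \<psi> as where "\<psi> \<in> forms L {} (UNIV :: nat set)" "as \<in> lists A"
    "finite {c\<in>univ S. sat S (\<lambda>n. if n = 0 then c else as ! (n - 1)) \<psi>}"
    "e \<in> {c\<in>univ S. sat S (\<lambda>n. if n = 0 then c else as ! (n - 1)) \<psi>}"
proof -
  obtain \<phi> where \<phi>: "e \<in> univ S" "\<phi> \<in> forms L A {0 :: nat}" "sat S (\<lambda>_. e) \<phi>" "finite {c\<in>univ S. sat S (\<lambda>_. c) \<phi>}"
    using e unfolding acl_def by blast
  let ?A = "pars \<phi>"
  have A0: "finite ?A" "?A \<subseteq> A" using \<phi>(2) by (auto simp: forms_def)
  obtain as where as: "set as = ?A" using finite_list[OF A0(1)] by blast
  have "\<phi> \<in> forms L ?A {0}" using \<phi>(2) by (auto simp: forms_def)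
  moreover have Au: "?A \<subseteq> univ S" using A A0 by auto
  ultimately obtain R where R: "definable L S {} (Inl ` ?A \<union> Inr ` {0 :: nat}) R"
    "\<And>\<sigma>. \<sigma> ` {0} \<subseteq> univ S \<Longrightarrow> R (case_sum id \<sigma>) = sat S \<sigma> \<phi>"
    using definable_unpar[OF definable_sat] by metis
  define k where "k a = (SOME k. k < length as \<and> as ! k = a)" for a
  have k: "k a < length as \<and> as ! (k a) = a" if "a \<in> ?A" for a
    unfolding k_def by (rule someI_ex) (use that as in \<open>auto simp: in_set_conv_nth\<close>)
  define c where "c = (case_sum (\<lambda>a. Suc (k a)) (\<lambda>_. 0) :: 'a + nat \<Rightarrow> nat)"
  have inj: "inj_on c (Inl ` ?A \<union> Inr ` {0})"
  proof (rule inj_onI)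
    fix s t assume "s \<in> Inl ` ?A \<union> Inr ` {0}" "t \<in> Inl ` ?A \<union> Inr ` {0}" "c s = c t"
    then show "s = t" using k by (auto simp: c_def) metis
  qed
  obtain \<psi> where \<psi>: "\<psi> \<in> forms L {} (c ` (Inl ` ?A \<union> Inr ` {0}))"
    "\<And>\<sigma>. \<sigma> ` c ` (Inl ` ?A \<union> Inr ` {0}) \<subseteq> univ S \<Longrightarrow> sat S \<sigma> \<psi> = R (\<lambda>i. \<sigma> (c i))"
    using definable_to_nat[OF R(1) inj] by metis
  let ?\<sigma> = "\<lambda>d n. if n = 0 then d else as ! (n - 1)"
  have eq: "sat S (?\<sigma> d) \<psi> = sat S (\<lambda>_. d) \<phi>" if d: "d \<in> univ S" for d
  proof -
    have "?\<sigma> d ` c ` (Inl ` ?A \<union> Inr ` {0}) \<subseteq> univ S" using k Au d by (auto simp: c_def)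
    then have "sat S (?\<sigma> d) \<psi> = R (\<lambda>i. ?\<sigma> d (c i))" by (rule \<psi>(2))
    also have "\<dots> = R (case_sum id (\<lambda>_. d))"
      by (rule definable_agree[OF R(1)]) (use k Au d in \<open>auto simp: c_def\<close>)
    also have "\<dots> = sat S (\<lambda>_. d) \<phi>" by (rule R(2)) (use d in auto)
    finally show ?thesis .
  qed
  have set_eq: "{d\<in>univ S. sat S (?\<sigma> d) \<psi>} = {d\<in>univ S. sat S (\<lambda>_. d) \<phi>}" using eq by blast
  show thesis
  proof (rule that[of \<psi> as])
    show "\<psi> \<in> forms L {} UNIV" using \<psi>(1) by (auto simp: forms_def)
    show "as \<in> lists A" using as A0(2) by auto
    show "finite {d\<in>univ S. sat S (?\<sigma> d) \<psi>}" unfolding set_eq by (rule \<phi>(4))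
    show "e \<in> {d\<in>univ S. sat S (?\<sigma> d) \<psi>}" unfolding set_eq using \<phi> by blast
  qed
qed

text \<open>The closure is covered by finite solution sets indexed by pairs of a formula and a list
  of parameters.\<close>

lemma small_acl:
  assumes fc: "|forms L {} (UNIV :: nat set) :: ('f, 'r, 'a, nat) fm set| <o \<kappa>" and A: "A \<subseteq> univ S" "|A| <o \<kappa>"
  shows "|acl L S A| <o \<kappa>"
proof -
  let ?F = "forms L {} (UNIV :: nat set) :: ('f, 'r, 'a, nat) fm set"
  \<comment> \<open>One small infinite set that bounds the formulas, the lists and each finite
    solution set. A single bound below \<open>\<kappa>\<close> also works when
    \<open>\<kappa>\<close> is singular.\<close>
  let ?B = "?F <+> (A <+> (UNIV :: nat set))"
  have infAN: "infinite (A <+> (UNIV :: nat set))" by auto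
  have inf: "infinite ?B" by auto
  note sAN = card_of_Plus_ordLess_infinite_Field[OF infinite_Field Card A(2) small_nat_type[of UNIV]]
  have sB: "|?B| <o \<kappa>" by (rule card_of_Plus_ordLess_infinite_Field[OF infinite_Field Card fc sAN])
  have F: "|?F| \<le>o |?B|" by (rule card_of_Plus1)
  have AN: "|A <+> (UNIV :: nat set)| \<le>o |?B|" by (rule card_of_Plus2)
  have "|lists A| \<le>o |lists (A <+> (UNIV :: nat set))|"
  proof -
    have "map Inl ` lists A \<subseteq> lists (A <+> (UNIV :: nat set))" by auto
    moreover have "inj_on (map (Inl :: 'a \<Rightarrow> 'a + nat)) (lists A)" by (auto simp: inj_on_def)
    ultimately show ?thesis by (intro card_of_ordLeq[THEN iffD1] exI conjI)
  qed
  also have "|lists (A <+> (UNIV :: nat set))| \<le>o |A <+> (UNIV :: nat set)|" by (rule lists_ordLeq[OF infAN])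
  also note AN
  finally have lA: "|lists A| \<le>o |?B|" .
  let ?I = "?F \<times> lists A"
  have I: "|?I| \<le>o |?B|" by (rule card_of_Sigma_ordLeq_infinite[OF inf F]) (use lA in auto)
  define Fi where "Fi = (\<lambda>(\<psi>, as). let X = {c\<in>univ S. sat S (\<lambda>n. if n = 0 then c else as ! (n - 1)) \<psi>} in if finite X then X else {})"
  have "finite (Fi i)" for i by (cases i) (simp add: Fi_def Let_def)
  then have "|Fi i| \<le>o |?B|" for i
    using finite_ordLeq_infinite[OF _ inf] by blast
  then have U: "|\<Union>i\<in>?I. Fi i| \<le>o |?B|" by (intro card_of_UNION_ordLeq_infinite[OF inf I]) auto
  have "acl L S A \<subseteq> (\<Union>i\<in>?I. Fi i)"
  proof
    fix e assume "e \<in> acl L S A"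
    then obtain \<psi> as where p: "\<psi> \<in> ?F" "as \<in> lists A"
      "finite {c\<in>univ S. sat S (\<lambda>n. if n = 0 then c else as ! (n - 1)) \<psi>}"
      "e \<in> {c\<in>univ S. sat S (\<lambda>n. if n = 0 then c else as ! (n - 1)) \<psi>}"
      by (rule acl_nat_form[OF A(1)]) blast
    have "e \<in> Fi (\<psi>, as)" using p(3,4) by (simp add: Fi_def)
    moreover have "(\<psi>, as) \<in> ?I" using p(1,2) by blast
    ultimately show "e \<in> (\<Union>i\<in>?I. Fi i)" by blast
  qed
  then have "|acl L S A| \<le>o |\<Union>i\<in>?I. Fi i|" by (rule card_of_mono1)
  from ordLeq_ordLess_trans[OF ordLeq_transitive[OF this U] sB] show ?thesis .
qed

end

fun strip_closure :: "('f, 'r, 'a, 'v) fm \<Rightarrow> ('f, 'r, 'a, 'v) fm" where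
  "strip_closure (All v \<phi>) = strip_closure \<phi>"
| "strip_closure (Imp \<phi> \<psi>) = \<psi>"
| "strip_closure \<phi> = \<phi>"

lemma sat_foldr_All:
  "(\<And>\<tau>. \<tau> ` set vs \<subseteq> univ S \<Longrightarrow> (\<And>v. v \<notin> set vs \<Longrightarrow> \<tau> v = \<sigma> v) \<Longrightarrow> sat S \<tau> \<phi>) \<Longrightarrow> sat S \<sigma> (foldr All vs \<phi>)"
proof (induction vs arbitrary: \<sigma>)
  case (Cons v vs)
  have "sat S (\<sigma>(v := a)) (foldr All vs \<phi>)" if a: "a \<in> univ S" for a
  proof (rule Cons.IH)
    fix \<tau> assume \<tau>: "\<tau> ` set vs \<subseteq> univ S" "\<And>u. u \<notin> set vs \<Longrightarrow> \<tau> u = (\<sigma>(v := a)) u"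
    have "\<tau> v \<in> univ S" using \<tau>(1) \<tau>(2)[of v] a by (cases "v \<in> set vs") auto
    then show "sat S \<tau> \<phi>" using \<tau> by (intro Cons.prems) auto
  qed
  then show ?case by simp
qed auto

lemma sat_foldr_AllD: "sat S \<sigma> (foldr All vs \<phi>) \<Longrightarrow> \<sigma> ` set vs \<subseteq> univ S \<Longrightarrow> sat S \<sigma> \<phi>"
proof (induction vs arbitrary: \<sigma>)
  case (Cons v vs)
  have "\<sigma> v \<in> univ S" using Cons.prems by auto
  then have "sat S (\<sigma>(v := \<sigma> v)) (foldr All vs \<phi>)" using Cons.prems(1) by (simp del: fun_upd_triv)
  then show ?case using Cons.IH[of \<sigma>] Cons.prems(2) by auto
qed simp

lemma foldr_All_props:
  "fv (foldr All vs \<phi>) = fv \<phi> - set vs" "pars (foldr All vs \<phi>) = pars \<phi>" "wf_fm L (foldr All vs \<phi>) = wf_fm L \<phi>"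
  "strip_closure (foldr All vs \<phi>) = strip_closure \<phi>"
  by (induction vs) auto

text \<open>A formula is recovered from the universal closure of \<open>Bot \<longrightarrow> \<phi>\<close>, which belongs to \<open>T\<close>.\<close>

lemma card_forms_le_theory:
  assumes T: "complete_theory L T" and S: "model L T S"
  shows "|forms L {} (UNIV :: nat set) :: ('f, 'r, 'a, nat) fm set| \<le>o |T :: ('f, 'r, 'a, nat) fm set|"
proof -
  let ?F = "forms L {} (UNIV :: nat set) :: ('f, 'r, 'a, nat) fm set"
  define u where "u \<phi> = foldr All (sorted_list_of_set (fv \<phi>)) (Imp Bot \<phi>)" for \<phi> :: "('f, 'r, 'a, nat) fm"
  have "strip_closure (u \<phi>) = \<phi>" for \<phi> by (simp add: u_def foldr_All_props)
  then have "inj_on u ?F" by (metis inj_onI)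
  moreover have "u \<phi> \<in> T" if \<phi>: "\<phi> \<in> ?F" for \<phi>
  proof -
    have "u \<phi> \<in> forms L {} {}" using \<phi> by (auto simp: u_def forms_def foldr_All_props)
    moreover have "sat S \<sigma> (u \<phi>)" for \<sigma> unfolding u_def by (rule sat_foldr_All) simp
    then have "Neg (u \<phi>) \<notin> T" using S by (auto simp: model_def)
    ultimately show ?thesis using T by (auto simp: complete_theory_def)
  qed
  then have "u ` ?F \<subseteq> T" by blast
  ultimately show ?thesis by (intro card_of_ordLeq[THEN iffD1] exI conjI)
qed

lemma infinite_forms: "infinite (forms L {} (UNIV :: nat set) :: ('f, 'r, 'a, nat) fm set)"
proof -
  have "inj (\<lambda>n. Eq (Var n) (Var n) :: ('f, 'r, 'a, nat) fm)" by (auto simp: inj_def)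
  then have "infinite (range (\<lambda>n. Eq (Var n) (Var n) :: ('f, 'r, 'a, nat) fm))" using finite_imageD infinite_UNIV_nat by blast
  moreover have "range (\<lambda>n. Eq (Var n) (Var n)) \<subseteq> (forms L {} (UNIV :: nat set) :: ('f, 'r, 'a, nat) fm set)"
    by (auto simp: forms_def)
  ultimately show ?thesis using finite_subset by blast
qed

subsection \<open>Quantifier elimination and substructures\<close>

lemma quantifier_elim_sat:
  assumes T: "complete_theory L T" and qe: "quantifier_elim L T" and S: "model L T S"
    and \<phi>: "\<phi> \<in> forms L {} (UNIV :: nat set)"
  shows "\<exists>\<psi>\<in>forms L {} (fv \<phi>). qfree \<psi> \<and> (\<forall>\<tau>. \<tau> ` fv \<phi> \<subseteq> univ S \<longrightarrow> sat S \<tau> \<phi> = sat S \<tau> \<psi>)"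
proof -
  obtain \<psi> vs where \<psi>: "\<psi> \<in> forms L {} (fv \<phi>)" "qfree \<psi>" "foldr All vs (Iff \<phi> \<psi>) \<in> T"
    using qe \<phi> unfolding quantifier_elim_def by blast
  obtain d where d: "d \<in> univ S" using S by (auto simp: model_def)
  have fv: "fv \<psi> \<subseteq> fv \<phi>" using \<psi>(1) by (auto simp: forms_def)
  have "sat S \<tau> \<phi> = sat S \<tau> \<psi>" if \<tau>: "\<tau> ` fv \<phi> \<subseteq> univ S" for \<tau>
  proof -
    \<comment> \<open>Variables outside \<open>fv \<phi>\<close> get a value in the universe, since
      the quantifiers of the closure range over the universe only.\<close>
    let ?\<tau> = "\<lambda>v. if v \<in> fv \<phi> then \<tau> v else d"
    have "sat S ?\<tau> (foldr All vs (Iff \<phi> \<psi>))" using S \<psi>(3) by (auto simp: model_def)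
    then have "sat S ?\<tau> (Iff \<phi> \<psi>)" by (rule sat_foldr_AllD) (use \<tau> d in auto)
    moreover have "sat S ?\<tau> \<phi> = sat S \<tau> \<phi>" "sat S ?\<tau> \<psi> = sat S \<tau> \<psi>"
      by (rule sat_cong; use fv in auto)+
    ultimately show ?thesis by simp
  qed
  with \<psi> show ?thesis by blast
qed

lemma substructure_eval:
  assumes sub: "substructure L N M"
  shows "wf_tm L t \<Longrightarrow> pars_tm t \<subseteq> univ N \<Longrightarrow> \<tau> ` fv_tm t \<subseteq> univ N \<Longrightarrow>
    eval N \<tau> t \<in> univ N \<and> eval N \<tau> t = eval M \<tau> t"
proof (induction t)
  case (Fn f ts)
  have IH: "eval N \<tau> t \<in> univ N \<and> eval N \<tau> t = eval M \<tau> t" if "t \<in> set ts" for t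
    by (rule Fn.IH[OF that]) (use Fn.prems that in \<open>auto simp: image_subset_iff\<close>)
  have m: "map (eval N \<tau>) ts = map (eval M \<tau>) ts" using IH by simp
  have s: "set (map (eval N \<tau>) ts) \<subseteq> univ N" unfolding set_map using IH by blast
  have f: "(f, length ts) \<in> Fsym L" using Fn.prems by simp
  have 1: "fint N f (map (eval N \<tau>) ts) = fint M f (map (eval N \<tau>) ts)"
    using sub f s unfolding substructure_def by fastforce
  have 2: "fint M f (map (eval N \<tau>) ts) \<in> univ N"
    using sub f s unfolding substructure_def substr_set_def by fastforce
  show ?case using 1 2 unfolding eval.simps m by simp
qed auto

lemma substructure_sat:
  assumes sub: "substructure L N M"
  shows "qfree \<phi> \<Longrightarrow> wf_fm L \<phi> \<Longrightarrow> pars \<phi> \<subseteq> univ N \<Longrightarrow> \<tau> ` fv \<phi> \<subseteq> univ N \<Longrightarrow> sat N \<tau> \<phi> = sat M \<tau> \<phi>"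
proof (induction \<phi>)
  case (Eq s t)
  have "eval N \<tau> s = eval M \<tau> s" "eval N \<tau> t = eval M \<tau> t"
    using substructure_eval[OF sub, of s \<tau>] substructure_eval[OF sub, of t \<tau>] Eq.prems by (auto simp: image_Un)
  then show ?case by simp
next
  case (Rel r ts)
  have IH: "eval N \<tau> t \<in> univ N \<and> eval N \<tau> t = eval M \<tau> t" if "t \<in> set ts" for t
    by (rule substructure_eval[OF sub]) (use Rel.prems that in \<open>auto simp: image_subset_iff\<close>)
  have m: "map (eval N \<tau>) ts = map (eval M \<tau>) ts" using IH by simp
  have s: "set (map (eval N \<tau>) ts) \<subseteq> univ N" unfolding set_map using IH by blast
  have "(r, length ts) \<in> Rsym L" using Rel.prems by simp
  then have "rint N r (map (eval N \<tau>) ts) = rint M r (map (eval N \<tau>) ts)"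
    using sub s unfolding substructure_def by fastforce
  then show ?case unfolding sat.simps m .
qed (auto simp: image_Un)

text \<open>Quantifier elimination is available for parameter-free formulas with variables in
  \<open>nat\<close>; the decoding \<open>e\<close> remembers which number stands for which
  parameter or variable.\<close>

lemma form_to_nat:
  fixes \<phi> :: "('f, 'r, 'a, 'v) fm"
  assumes "\<phi> \<in> forms L C X"
  obtains \<phi>' and e :: "nat \<Rightarrow> 'a + 'v" where "\<phi>' \<in> forms L {} (UNIV :: nat set)"
    "\<And>n. n \<in> fv \<phi>' \<Longrightarrow> e n \<in> Inl ` C \<union> Inr ` X" "\<And>S \<sigma>. sat S \<sigma> \<phi> = sat S (inst \<sigma> e) \<phi>'"
proof -
  let ?V = "fv (unpar \<phi>)"
  obtain c :: "'a + 'v \<Rightarrow> nat" where c: "inj_on c ?V" using finite_imp_inj_to_nat_seg[OF finite_fv[of "unpar \<phi>"]] by blast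
  have u: "unpar \<phi> \<in> forms L {} UNIV" using assms by (auto simp: forms_def unpar_props)
  let ?g = "\<lambda>v. Inr (c v) :: 'a + nat"
  obtain \<phi>' :: "('f, 'r, 'a, nat) fm" where \<phi>': "wf_fm L \<phi>'"
    "pars \<phi>' \<subseteq> pars (unpar \<phi>) \<union> {a. Inl a \<in> ?g ` ?V}" "fv \<phi>' \<subseteq> {w. Inr w \<in> ?g ` ?V}"
    "\<And>S \<sigma>. sat S \<sigma> \<phi>' = sat S (inst \<sigma> ?g) (unpar \<phi>)" "qfree (unpar \<phi>) \<Longrightarrow> qfree \<phi>'"
    by (rule reindex_formE[OF u infinite_UNIV_nat, where g = ?g]) blast
  let ?e = "inv_into ?V c"
  have V: "?V \<subseteq> Inl ` C \<union> Inr ` X" using assms by (auto simp: forms_def unpar_props)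
  show thesis
  proof (rule that[of \<phi>' ?e])
    show "\<phi>' \<in> forms L {} UNIV" using \<phi>'(1,2) by (auto simp: forms_def unpar_props)
    show "?e n \<in> Inl ` C \<union> Inr ` X" if "n \<in> fv \<phi>'" for n
    proof -
      have "n \<in> c ` ?V" using \<phi>'(3) that by auto
      then have "?e n \<in> ?V" by (rule inv_into_into)
      then show ?thesis using V by blast
    qed
    fix S :: "('f, 'r, 'a) struc" and \<sigma>
    have "sat S (inst \<sigma> ?e) \<phi>' = sat S (inst (inst \<sigma> ?e) ?g) (unpar \<phi>)" by (rule \<phi>'(4))
    also have "\<dots> = sat S (case_sum id \<sigma>) (unpar \<phi>)"
    proof (rule sat_cong)
      fix v assume "v \<in> ?V"
      then have "?e (c v) = v" using c by simp
      then show "inst (inst \<sigma> ?e) ?g v = case_sum id \<sigma> v" by (cases v) (simp_all add: inst_def)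
    qed
    finally show "sat S \<sigma> \<phi> = sat S (inst \<sigma> ?e) \<phi>'" by (simp add: sat_unpar)
  qed
qed

text \<open>Quantifier elimination reduces a type in \<open>M\<close> to quantifier-free formulas,
  and for tuples and parameters from \<open>N\<close> these may be evaluated in the substructure
  \<open>N\<close>.\<close>

lemma tp_eq_of_qf_eq:
  fixes M N :: "('f, 'r, 'a) struc" and X :: "'v set"
  assumes inf: "infinite (UNIV :: 'v set)" and sub: "substructure L N M"
    and qe: "\<And>\<phi>. \<phi> \<in> forms L {} (UNIV :: nat set) \<Longrightarrow>
      \<exists>\<psi>\<in>forms L {} (fv \<phi>). qfree \<psi> \<and> (\<forall>\<tau>. \<tau> ` fv \<phi> \<subseteq> univ M \<longrightarrow> sat M \<tau> \<phi> = sat M \<tau> \<psi>)"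
    and C: "C \<subseteq> univ N" and a: "a ` X \<subseteq> univ N" and b: "b ` X \<subseteq> univ N"
    and eq: "\<And>\<psi>. \<psi> \<in> forms L C X \<Longrightarrow> qfree \<psi> \<Longrightarrow> sat N a \<psi> = sat N b \<psi>"
  shows "tp L M C X a = tp L M C X b"
proof -
  have NM: "univ N \<subseteq> univ M" using sub by (auto simp: substructure_def substr_set_def)
  have "sat M a \<phi> = sat M b \<phi>" if \<phi>: "\<phi> \<in> forms L C X" for \<phi>
  proof -
    obtain \<phi>' and e :: "nat \<Rightarrow> 'a + 'v" where \<phi>': "\<phi>' \<in> forms L {} (UNIV :: nat set)"
      "\<And>n. n \<in> fv \<phi>' \<Longrightarrow> e n \<in> Inl ` C \<union> Inr ` X" "\<And>S \<sigma>. sat S \<sigma> \<phi> = sat S (inst \<sigma> e) \<phi>'"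
      by (rule form_to_nat[OF \<phi>]) blast
    obtain \<psi> where \<psi>: "\<psi> \<in> forms L {} (fv \<phi>')" "qfree \<psi>"
      "\<forall>\<tau>. \<tau> ` fv \<phi>' \<subseteq> univ M \<longrightarrow> sat M \<tau> \<phi>' = sat M \<tau> \<psi>" using qe[OF \<phi>'(1)] by blast
    have fv: "fv \<psi> \<subseteq> fv \<phi>'" using \<psi>(1) by (auto simp: forms_def)
    obtain \<chi> :: "('f, 'r, 'a, 'v) fm" where \<chi>: "wf_fm L \<chi>"
      "pars \<chi> \<subseteq> pars \<psi> \<union> {a. Inl a \<in> e ` fv \<psi>}" "fv \<chi> \<subseteq> {w. Inr w \<in> e ` fv \<psi>}"
      "\<And>S \<sigma>. sat S \<sigma> \<chi> = sat S (inst \<sigma> e) \<psi>" "qfree \<psi> \<Longrightarrow> qfree \<chi>"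
      by (rule reindex_formE[OF \<psi>(1) inf, where g = e]) blast
    have "pars \<chi> \<subseteq> C"
    proof
      fix z assume "z \<in> pars \<chi>"
      then have "Inl z \<in> e ` fv \<psi>" using \<chi>(2) \<psi>(1) by (auto simp: forms_def)
      then obtain n where n: "n \<in> fv \<psi>" "Inl z = e n" by blast
      then have "e n \<in> Inl ` C \<union> Inr ` X" using \<phi>'(2) fv by blast
      then show "z \<in> C" unfolding n(2)[symmetric] by auto
    qed
    moreover have "fv \<chi> \<subseteq> X"
    proof
      fix v assume "v \<in> fv \<chi>"
      then have "Inr v \<in> e ` fv \<psi>" using \<chi>(3) by auto
      then obtain n where n: "n \<in> fv \<psi>" "Inr v = e n" by blast
      then have "e n \<in> Inl ` C \<union> Inr ` X" using \<phi>'(2) fv by blast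
      then show "v \<in> X" unfolding n(2)[symmetric] by auto
    qed
    ultimately have \<chi>f: "\<chi> \<in> forms L C X" using \<chi>(1) by (auto simp: forms_def)
    have key: "sat M c \<phi> = sat N c \<chi>" if c: "c ` X \<subseteq> univ N" for c
    proof -
      have iN: "inst c e n \<in> univ N" if "n \<in> fv \<phi>'" for n using \<phi>'(2)[OF that] c C by (auto simp: inst_def)
      then have "inst c e ` fv \<phi>' \<subseteq> univ M" using NM by blast
      then have "sat M c \<phi> = sat M (inst c e) \<psi>" using \<phi>'(3)[of M c] \<psi>(3) by simp
      also have "\<dots> = sat N (inst c e) \<psi>"
        by (rule substructure_sat[OF sub \<psi>(2), symmetric]) (use \<psi>(1) iN fv in \<open>auto simp: forms_def\<close>)
      finally show ?thesis using \<chi>(4)[of N c] by simp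
    qed
    show ?thesis using key[OF a] key[OF b] eq[OF \<chi>f \<chi>(5)[OF \<psi>(2)]] by simp
  qed
  then show ?thesis unfolding tp_def by blast
qed

subsection \<open>Amalgamation systems given by realizations\<close>

lemma complete_type_eq_tp:
  assumes "complete_type L S C X p" "realizes S X b p"
  shows "p = tp L S C X b"
proof
  show "p \<subseteq> tp L S C X b" using assms by (auto simp: complete_type_def realizes_def tp_def)
  show "tp L S C X b \<subseteq> p"
  proof
    fix \<phi> assume \<phi>: "\<phi> \<in> tp L S C X b"
    show "\<phi> \<in> p"
    proof (rule ccontr)
      assume "\<phi> \<notin> p"
      then have "Neg \<phi> \<in> p" using assms(1) \<phi> by (auto simp: complete_type_def tp_def)
      then have "sat S b (Neg \<phi>)" using assms(2) by (auto simp: realizes_def)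
      then show False using \<phi> by (auto simp: tp_def)
    qed
  qed
qed

lemma amalg_systemD:
  assumes "amalg_system L S \<kappa> C J x p"
  shows "\<forall>w\<in>J. \<forall>i\<in>w. {i} \<in> J"
    "\<forall>w\<in>J. |x w| <o \<kappa> \<and> complete_type L S C (x w) (p w)"
    "\<forall>w\<in>J. \<forall>y\<in>x w. \<forall>z\<in>x w. y \<noteq> z \<longrightarrow> Neg (Eq (Var y) (Var z)) \<in> p w"
    "\<forall>v\<in>J. \<forall>w\<in>J. x v \<inter> x w = x (v \<inter> w)"
    "\<forall>v\<in>J. \<forall>w\<in>J. v \<subseteq> w \<longrightarrow> {\<phi>\<in>p w. fv \<phi> \<subseteq> x v} = p v"
    "\<forall>w\<in>J. \<forall>c. realizes S (x w) c (p w) \<longrightarrow>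
       (\<forall>i\<in>w. indep L S (c ` x {i}) C (\<Union>j\<in>w - {i}. c ` x {j})) \<and>
       c ` x w \<subseteq> acl L S (C \<union> (\<Union>i\<in>w. c ` x {i}))"
  using assms unfolding amalg_system_def by - (elim conjE, assumption)+

lemma tp_restrict:
  assumes "X \<subseteq> Y"
  shows "{\<phi>\<in>tp L S C Y a. fv \<phi> \<subseteq> X} = tp L S C X a"
  using assms by (auto simp: tp_def forms_def)

lemma tp_param_mono:
  assumes "tp L S C X a = tp L S C X b" "C' \<subseteq> C" "X' \<subseteq> X"
  shows "tp L S C' X' a = tp L S C' X' b"
proof -
  have "tp L S C' X' c = tp L S C X c \<inter> forms L C' X'" for c
    using forms_mono[OF assms(2,3), of L] by (auto simp: tp_def)
  then show ?thesis using assms(1) by simp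
qed

context saturated_structure
begin

lemma complete_type_realized:
  fixes X :: "'v set"
  assumes "complete_type L S C X p" "C \<subseteq> univ S" "|C| <o \<kappa>" "|X| <o \<kappa>"
  obtains b where "realizes S X b p"
proof -
  have p: "p \<subseteq> forms L C X" "finitely_sat S p" using assms(1) by (auto simp: complete_type_def)
  have "\<exists>\<sigma>. \<sigma> ` X \<subseteq> univ S \<and> (\<forall>\<phi>\<in>p. sat S \<sigma> \<phi>)"
  proof (rule compactness_family[OF assms(2-4)])
    fix \<phi> assume "\<phi> \<in> p"
    then show "definable L S C X (\<lambda>\<sigma>. sat S \<sigma> \<phi>)" using p(1) definable_sat by blast
  next
    fix F assume "finite F" "F \<subseteq> p"
    then obtain \<sigma> where "range \<sigma> \<subseteq> univ S" "\<forall>\<phi>\<in>F. sat S \<sigma> \<phi>" using p(2) unfolding finitely_sat_def by blast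
    then show "\<exists>\<sigma>. \<sigma> ` X \<subseteq> univ S \<and> (\<forall>\<phi>\<in>F. sat S \<sigma> \<phi>)" by blast
  qed
  then show thesis using that unfolding realizes_def by blast
qed

lemma complete_type_tp:
  assumes "a ` X \<subseteq> univ S"
  shows "complete_type L S C X (tp L S C X a)"
proof -
  obtain d where d: "d \<in> univ S" using nonempty by blast
  let ?a = "\<lambda>v. if v \<in> X then a v else d"
  have eq: "sat S ?a \<phi> = sat S a \<phi>" if "\<phi> \<in> forms L C X" for \<phi>
    by (rule sat_cong) (use that in \<open>auto simp: forms_def\<close>)
  have "finitely_sat S (tp L S C X a)"
    unfolding finitely_sat_def
  proof (intro allI impI)
    fix F assume "F \<subseteq> tp L S C X a" "finite F"
    then have "\<forall>\<phi>\<in>F. sat S ?a \<phi>" using eq by (auto simp: tp_def)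
    moreover have "range ?a \<subseteq> univ S" using assms d by auto
    ultimately show "\<exists>\<sigma>. range \<sigma> \<subseteq> univ S \<and> (\<forall>\<phi>\<in>F. sat S \<sigma> \<phi>)" by blast
  qed
  then show ?thesis by (auto simp: complete_type_def tp_def)
qed

text \<open>One tuple \<open>a w\<close> per index determines the system. The clauses about all
  realizations need checking only for \<open>a w\<close>, since any other realization is its image
  under an elementary map over \<open>C\<close>, which preserves independence and
  algebraicity.\<close>

lemma amalg_systemI:
  fixes x :: "nat set \<Rightarrow> 'v set"
  assumes inf: "infinite (UNIV :: 'v set)" and C: "C \<subseteq> univ S" "|C| <o \<kappa>" and J: "finite J" "\<And>w i. w \<in> J \<Longrightarrow> i \<in> w \<Longrightarrow> {i} \<in> J"
    and x: "\<And>w. w \<in> J \<Longrightarrow> |x w| <o \<kappa>" "\<And>v w. v \<in> J \<Longrightarrow> w \<in> J \<Longrightarrow> x v \<inter> x w = x (v \<inter> w)"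
    and a: "\<And>w. w \<in> J \<Longrightarrow> a w ` x w \<subseteq> univ S" "\<And>w. w \<in> J \<Longrightarrow> inj_on (a w) (x w)"
    and coh: "\<And>v w. v \<in> J \<Longrightarrow> w \<in> J \<Longrightarrow> v \<subseteq> w \<Longrightarrow> tp L S C (x v) (a w) = tp L S C (x v) (a v)"
    and ind: "\<And>w i. w \<in> J \<Longrightarrow> i \<in> w \<Longrightarrow> indep L S (a w ` x {i}) C (\<Union>j\<in>w - {i}. a w ` x {j})"
    and alg: "\<And>w. w \<in> J \<Longrightarrow> a w ` x w \<subseteq> acl L S (C \<union> (\<Union>i\<in>w. a w ` x {i}))"
    and finw: "\<And>w. w \<in> J \<Longrightarrow> finite w"
  shows "amalg_system L S \<kappa> C J x (\<lambda>w. tp L S C (x w) (a w))"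
  unfolding amalg_system_def
proof (intro conjI ballI allI impI)
  have sub: "x v \<subseteq> x w" if "v \<in> J" "w \<in> J" "v \<subseteq> w" for v w
    using x(2)[OF that(1,2)] that(3) by (simp add: inf_absorb1 le_iff_inf)
  fix w assume w: "w \<in> J"
  show "complete_type L S C (x w) (tp L S C (x w) (a w))" by (rule complete_type_tp[OF a(1)[OF w]])
  show "Neg (Eq (Var y) (Var z)) \<in> tp L S C (x w) (a w)" if "y \<in> x w" "z \<in> x w" "y \<noteq> z" for y z
    using inj_onD[OF a(2)[OF w], of y z] that by (auto simp: tp_def forms_def Neg_def)
  show "{\<phi>\<in>tp L S C (x v) (a v). fv \<phi> \<subseteq> x w} = tp L S C (x w) (a w)" if "v \<in> J" "w \<subseteq> v" for v
    using tp_restrict[OF sub[OF w that], of L S C "a v"] coh[OF w that] by simp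
  fix b assume b: "realizes S (x w) b (tp L S C (x w) (a w))"
  have "tp L S C (x w) (a w) = tp L S C (x w) b"
    by (rule complete_type_eq_tp[OF complete_type_tp[OF a(1)[OF w]] b])
  moreover have "b ` x w \<subseteq> univ S" using b by (simp add: realizes_def)
  ultimately obtain f where f: "elem_map (C \<union> a w ` x w) f" "\<And>c. c \<in> C \<Longrightarrow> f c = c" "\<And>y. y \<in> x w \<Longrightarrow> f (a w y) = b y"
    using tp_elem_map[OF inf C(1) a(1)[OF w]] by metis
  have xi: "x {i} \<subseteq> x w" "{i} \<in> J" if "i \<in> w" for i using sub[of "{i}" w] J(2)[OF w that] w that by auto
  have fx: "f ` a w ` x {i} = b ` x {i}" if "i \<in> w" for i
    using f(3) xi(1)[OF that] unfolding image_image by (intro image_cong) auto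
  have fC: "f ` C = C" using f(2) by force
  have fU: "f ` (\<Union>j\<in>I. a w ` x {j}) = (\<Union>j\<in>I. b ` x {j})" if "I \<subseteq> w" for I
    unfolding image_UN
  proof (rule SUP_cong[OF refl])
    fix j assume "j \<in> I"
    then show "f ` a w ` x {j} = b ` x {j}" using fx that by blast
  qed
  have sm: "|a w ` x {i}| <o \<kappa>" if "i \<in> w" for i by (rule small_image[OF x(1)[OF xi(2)[OF that]]])
  have smU: "|\<Union>j\<in>I. a w ` x {j}| <o \<kappa>" if "I \<subseteq> w" for I
    by (rule small_UN_finite) (use finw[OF w] that sm finite_subset in auto)
  have aU: "(\<Union>j\<in>I. a w ` x {j}) \<subseteq> a w ` x w" if "I \<subseteq> w" for I using xi(1) that by blast
  show "indep L S (b ` x {i}) C (\<Union>j\<in>w - {i}. b ` x {j})" if i: "i \<in> w" for i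
  proof -
    have "indep L S (f ` a w ` x {i}) (f ` C) (f ` (\<Union>j\<in>w - {i}. a w ` x {j}))"
      by (rule elem_map_indep[OF f(1) _ sm[OF i] smU C(2) ind[OF w i]]) (use aU[of "w - {i}"] xi(1)[OF i] in auto)
    then show ?thesis unfolding fx[OF i] fC fU[OF Diff_subset] .
  qed
  show "b ` x w \<subseteq> acl L S (C \<union> (\<Union>i\<in>w. b ` x {i}))"
  proof (rule image_subsetI)
    fix y assume y: "y \<in> x w"
    let ?A = "C \<union> (\<Union>i\<in>w. a w ` x {i})"
    have "f (a w y) \<in> acl L S (f ` ?A)"
    proof (rule elem_map_acl[OF f(1)])
      show "?A \<subseteq> C \<union> a w ` x w" using aU[of w] by auto
      show "|?A| <o \<kappa>" using C(2) smU[of w] by auto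
      show "a w y \<in> C \<union> a w ` x w" using y by auto
      show "a w y \<in> acl L S ?A" using alg[OF w] y by auto
    qed
    moreover have "f ` ?A = C \<union> (\<Union>i\<in>w. b ` x {i})" unfolding image_Un fC fU[OF order_refl] ..
    ultimately show "b y \<in> acl L S (C \<union> (\<Union>i\<in>w. b ` x {i}))" using f(3)[OF y] by simp
  qed
qed (use C J x in auto)

text \<open>For surjectivity, the inverse map is extended to a given algebraic element, whose image
  is algebraic over \<open>A\<close> and therefore already in the domain of
  \<open>f\<close>.\<close>

lemma elem_map_acl_image:
  assumes elem_map: "elem_map (acl L S A) f" and A: "A \<subseteq> univ S" "|A| <o \<kappa>" "|acl L S A| <o \<kappa>"
  shows "f ` acl L S A = acl L S (f ` A)"
proof
  have Aa: "A \<subseteq> acl L S A" by (rule acl_incl[OF A(1)])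
  show "f ` acl L S A \<subseteq> acl L S (f ` A)" using elem_map_acl[OF elem_map Aa A(2)] by blast
  show "acl L S (f ` A) \<subseteq> f ` acl L S A"
  proof
    fix e assume e: "e \<in> acl L S (f ` A)"
    let ?B = "f ` acl L S A" and ?g = "inv_into (acl L S A) f"
    have inv: "?g (f z) = z" if "z \<in> acl L S A" for z using inv_into_f_f[OF elem_map_inj[OF elem_map]] that by blast
    have eu: "{e} \<subseteq> univ S" using e acl_univ by auto
    have e1: "|{e}| <o \<kappa>" by auto
    obtain g where g: "elem_map (?B \<union> {e}) g" "\<And>z. z \<in> ?B \<Longrightarrow> g z = ?g z"
      using elem_map_extend[OF elem_map_inv[OF elem_map] small_image[OF A(3)] e1 eu] by metis
    have gf: "g (f z) = z" if "z \<in> acl L S A" for z using g(2)[OF imageI[OF that]] inv[OF that] by simp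
    have "f ` A \<subseteq> ?B \<union> {e}" using Aa by blast
    from elem_map_acl[OF g(1) this small_image[OF A(2)] _ e] have "g e \<in> acl L S (g ` f ` A)" by simp
    moreover have "g ` f ` A = A" using gf Aa by force
    ultimately have ge: "g e \<in> acl L S A" by simp
    then have "g (f (g e)) = g e" by (rule gf)
    then have "f (g e) = e" using inj_onD[OF elem_map_inj[OF g(1)], of "f (g e)" e] ge by blast
    then show "e \<in> ?B" using ge by (metis imageI)
  qed
qed

end

lemma wf_fm_lang_union: "wf_fm L \<phi> \<Longrightarrow> wf_fm (lang_union L K) \<phi>" "wf_fm K \<phi> \<Longrightarrow> wf_fm (lang_union L K) \<phi>"
proof -
  have "wf_tm L t \<Longrightarrow> wf_tm (lang_union L K) t" "wf_tm K t \<Longrightarrow> wf_tm (lang_union L K) t" for t :: "('a, 'c, 'd) tm"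
    by (induction t) (auto simp: lang_union_def)
  then show "wf_fm L \<phi> \<Longrightarrow> wf_fm (lang_union L K) \<phi>" "wf_fm K \<phi> \<Longrightarrow> wf_fm (lang_union L K) \<phi>"
    by (induction \<phi>) (auto simp: lang_union_def)
qed

subsection \<open>The annotated system induced on the reduct\<close>

text \<open>The theories appear only through their consequences: quantifier elimination as a
  statement about \<open>M\<close>, and the bound on the cardinality as smallness of the sets of
  formulas.\<close>

locale expansion =
  fixes L\<^sub>0 L' L\<^sub>1 :: "('f, 'r) lang" and M N :: "('f, 'r, 'a) struc" and \<kappa> :: "'k rel"
    and G :: "'a set set" and Vars :: "'v itself"
  assumes sat0: "saturated_structure L\<^sub>0 M \<kappa>" and sat1: "saturated_structure L\<^sub>1 N \<kappa>"
    and L1: "L\<^sub>1 = lang_union L\<^sub>0 L'" and Nstr: "is_struc L\<^sub>1 N" and NM: "substructure L\<^sub>0 N M"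
    and qe: "\<And>\<phi> :: ('f, 'r, 'a, nat) fm. \<phi> \<in> forms L\<^sub>0 {} UNIV \<Longrightarrow>
      \<exists>\<psi>\<in>forms L\<^sub>0 {} (fv \<phi>). qfree \<psi> \<and> (\<forall>\<tau>. \<tau> ` fv \<phi> \<subseteq> univ M \<longrightarrow> sat M \<tau> \<phi> = sat M \<tau> \<psi>)"
    and c0: "|forms L\<^sub>0 {} (UNIV :: nat set) :: ('f, 'r, 'a, nat) fm set| <o \<kappa>"
    and c1: "|forms L\<^sub>1 {} (UNIV :: nat set) :: ('f, 'r, 'a, nat) fm set| <o \<kappa>"
    and vars: "\<kappa> \<le>o |UNIV :: 'v set|"
    and G: "\<And>A. A \<in> G \<Longrightarrow> substr_set L' N A \<and> |A| <o \<kappa>"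
    and H1: "\<And>A. A \<subseteq> univ N \<Longrightarrow> A = acl L\<^sub>0 M A \<inter> univ N \<Longrightarrow>
        acl L\<^sub>0 M A = dcl L\<^sub>0 M (A \<union> acl L\<^sub>0 M {})"
    and H2: "\<And>C (X :: 'v set) a. C \<subseteq> univ N \<Longrightarrow> C = acl L\<^sub>0 M C \<inter> univ N \<Longrightarrow> a ` X \<subseteq> univ N \<Longrightarrow>
        \<exists>!q. complete_type L\<^sub>0 M (acl L\<^sub>0 M C) X q \<and> tp L\<^sub>0 M C X a \<subseteq> q"
    and H3: "\<And>A. A \<subseteq> univ N \<Longrightarrow> |A| <o \<kappa> \<Longrightarrow> acl L\<^sub>1 N A = A \<Longrightarrow> A \<in> G"
      "\<And>A. A \<in> G \<Longrightarrow> acl L\<^sub>1 N A = acl L\<^sub>0 M A \<inter> univ N"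
    and H4: "\<And>A B C. A \<in> G \<Longrightarrow> B \<in> G \<Longrightarrow> C \<in> G \<Longrightarrow> C \<subseteq> A \<inter> B \<Longrightarrow>
        indep L\<^sub>1 N A C B \<longleftrightarrow> indep L\<^sub>0 M A C B \<and> A \<union> B \<in> G"
    and H5: "\<And>(X :: 'v set) a b. a ` X \<in> G \<Longrightarrow> b ` X \<subseteq> univ N \<Longrightarrow> acl L\<^sub>1 N (b ` X) = b ` X \<Longrightarrow>
        qftp L\<^sub>1 N {} X a = qftp L\<^sub>1 N {} X b \<Longrightarrow> tp L\<^sub>1 N {} X a = tp L\<^sub>1 N {} X b"
    and H6: "\<And>C W (x :: nat set \<Rightarrow> 'v set) p I t x' p'. index_family W \<Longrightarrow>
        rel_acl_fair_system L\<^sub>0 L' L\<^sub>1 M N \<kappa> G C W x p I \<Longrightarrow>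
        strongly_fair_system L\<^sub>0 L' M N \<kappa> G C W x p I \<Longrightarrow>
        minimal_completion L\<^sub>0 M \<kappa> C W x p t x' p' \<Longrightarrow>
        strongly_fair_system L\<^sub>0 L' M N \<kappa> G C (insert t W) x' p'
          (I(t := generated_annotation L' (x' t) (\<Union>w\<in>W. I w)))"
begin

sublocale M: saturated_structure L\<^sub>0 M \<kappa> by (rule sat0)
sublocale N: saturated_structure L\<^sub>1 N \<kappa> by (rule sat1)

lemma inf_vars: "infinite (UNIV :: 'v set)"
proof -
  have "natLeq \<le>o |UNIV :: 'v set|"
    by (rule ordLeq_transitive[OF ordLess_imp_ordLeq[OF M.unctbl] vars])
  then show ?thesis using infinite_iff_natLeq_ordLeq by blast
qed

lemma NM_univ: "univ N \<subseteq> univ M"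
  using NM by (auto simp: substructure_def substr_set_def)

lemma forms_L0: "forms L\<^sub>0 A X \<subseteq> forms L\<^sub>1 A X" and forms_L': "forms L' A X \<subseteq> forms L\<^sub>1 A X"
  unfolding forms_def L1 by (auto simp: wf_fm_lang_union)

end

text \<open>Each \<open>b w\<close> is a chosen realization of \<open>p w\<close>. The choices are
  not coordinated: for \<open>v \<subseteq> w\<close> the tuple \<open>b v\<close> and the subtuple
  of \<open>b w\<close> on \<open>x v\<close> have the same type but may be different.\<close>

locale t1_system = expansion L\<^sub>0 L' L\<^sub>1 M N \<kappa> G Vars
  for L\<^sub>0 L' L\<^sub>1 :: "('f, 'r) lang" and M N :: "('f, 'r, 'a) struc" and \<kappa> :: "'k rel"
    and G :: "'a set set" and Vars :: "'v itself" +
  fixes Q :: "'a set" and W :: "nat set set" and x :: "nat set \<Rightarrow> 'v set"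
    and p :: "nat set \<Rightarrow> ('f, 'r, 'a, 'v) fm set" and b :: "nat set \<Rightarrow> 'v \<Rightarrow> 'a"
  assumes Q: "Q \<subseteq> univ N" "|Q| <o \<kappa>" "acl L\<^sub>1 N Q = Q" and W: "index_family W"
    and sys: "acl_system L\<^sub>1 N \<kappa> Q W x p" and b: "\<And>w. w \<in> W \<Longrightarrow> realizes N (x w) (b w) (p w)"
begin

lemma Wsub: "w \<in> W \<Longrightarrow> v \<subseteq> w \<Longrightarrow> v \<in> W"
  using W unfolding index_family_def by blast

lemma finW: "finite W"
  using W by (simp add: index_family_def)

lemma finw:
  assumes "w \<in> W"
  shows "finite w"
proof -
  have "Pow w \<subseteq> W" using Wsub[OF assms] by blast
  then show ?thesis using finW finite_subset finite_Pow_iff by blast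
qed

lemma am: "amalg_system L\<^sub>1 N \<kappa> Q W x p"
  using sys by (simp add: acl_system_def)

lemma xsmall: "w \<in> W \<Longrightarrow> |x w| <o \<kappa>" and ptype: "w \<in> W \<Longrightarrow> complete_type L\<^sub>1 N Q (x w) (p w)"
  using amalg_systemD(2)[OF am] by auto

lemma pneq: "w \<in> W \<Longrightarrow> y \<in> x w \<Longrightarrow> z \<in> x w \<Longrightarrow> y \<noteq> z \<Longrightarrow> Neg (Eq (Var y) (Var z)) \<in> p w"
  using amalg_systemD(3)[OF am] by blast

lemma xint: "v \<in> W \<Longrightarrow> w \<in> W \<Longrightarrow> x v \<inter> x w = x (v \<inter> w)"
  using amalg_systemD(4)[OF am] by blast

lemma prest: "v \<in> W \<Longrightarrow> w \<in> W \<Longrightarrow> v \<subseteq> w \<Longrightarrow> {\<phi>\<in>p w. fv \<phi> \<subseteq> x v} = p v"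
  using amalg_systemD(5)[OF am] by blast

lemma pind: "w \<in> W \<Longrightarrow> realizes N (x w) c (p w) \<Longrightarrow> i \<in> w \<Longrightarrow>
    indep L\<^sub>1 N (c ` x {i}) Q (\<Union>j\<in>w - {i}. c ` x {j})"
  using amalg_systemD(6)[OF am] by blast

lemma pacl: "w \<in> W \<Longrightarrow> realizes N (x w) c (p w) \<Longrightarrow> c ` x w = acl L\<^sub>1 N (Q \<union> (\<Union>i\<in>w. c ` x {i}))"
  using sys unfolding acl_system_def by blast

lemma xsub:
  assumes "w \<in> W" "v \<subseteq> w"
  shows "x v \<subseteq> x w"
  using xint[OF Wsub[OF assms] assms(1)] assms(2) by (simp add: inf_absorb1 le_iff_inf)

abbreviation E :: "nat set \<Rightarrow> nat set \<Rightarrow> 'a set" where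
  "E w v \<equiv> b w ` x v"

abbreviation UE :: "nat set \<Rightarrow> nat set \<Rightarrow> 'a set" where
  "UE w v \<equiv> (\<Union>i\<in>v. b w ` x {i})"

lemma real_sub:
  assumes w: "w \<in> W" "v \<subseteq> w"
  shows "realizes N (x v) (b w) (p v)"
  unfolding realizes_def
proof
  show "b w ` x v \<subseteq> univ N" using b[OF w(1)] xsub[OF w] by (auto simp: realizes_def)
  show "\<forall>\<phi>\<in>p v. sat N (b w) \<phi>"
  proof
    fix \<phi> assume "\<phi> \<in> p v"
    then have "\<phi> \<in> p w" using prest[OF Wsub[OF w] w] by blast
    then show "sat N (b w) \<phi>" using b[OF w(1)] by (auto simp: realizes_def)
  qed
qed

lemma p_tp:
  assumes w: "w \<in> W" "v \<subseteq> w"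
  shows "p v = tp L\<^sub>1 N Q (x v) (b w)"
  by (rule complete_type_eq_tp[OF ptype[OF Wsub[OF w]] real_sub[OF w]])

lemma b_inj: "w \<in> W \<Longrightarrow> inj_on (b w) (x w)"
proof (rule inj_onI, rule ccontr)
  fix y z assume w: "w \<in> W" and yz: "y \<in> x w" "z \<in> x w" "b w y = b w z" "y \<noteq> z"
  have "sat N (b w) (Neg (Eq (Var y) (Var z)))" using pneq[OF w yz(1,2,4)] b[OF w] unfolding realizes_def by blast
  then show False using yz(3) by simp
qed

section \<open>Subtuples of one realization\<close>

context
  fixes w assumes w: "w \<in> W"
begin

lemma E_univ: "v \<subseteq> w \<Longrightarrow> E w v \<subseteq> univ N"
  using real_sub[OF w] by (simp add: realizes_def)

lemma E_small: "v \<subseteq> w \<Longrightarrow> |E w v| <o \<kappa>"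
  by (rule N.small_image[OF xsmall[OF Wsub[OF w]]])

lemma UE_univ: "v \<subseteq> w \<Longrightarrow> UE w v \<subseteq> univ N"
  using E_univ by blast

lemma UE_small: "v \<subseteq> w \<Longrightarrow> |UE w v| <o \<kappa>"
  by (rule N.small_UN_finite) (use finw[OF w] finite_subset E_small in auto)

lemma E_eq: "v \<subseteq> w \<Longrightarrow> E w v = acl L\<^sub>1 N (Q \<union> UE w v)"
  by (rule pacl[OF Wsub[OF w] real_sub[OF w]])

lemma QUE: "v \<subseteq> w \<Longrightarrow> Q \<union> UE w v \<subseteq> univ N" "v \<subseteq> w \<Longrightarrow> |Q \<union> UE w v| <o \<kappa>"
  using Q UE_univ UE_small by auto

lemma E_acl: "v \<subseteq> w \<Longrightarrow> acl L\<^sub>1 N (E w v) = E w v"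
  using E_eq N.acl_idem[OF QUE] by simp

lemma E_incl: "v \<subseteq> w \<Longrightarrow> Q \<union> UE w v \<subseteq> E w v"
  using E_eq N.acl_incl[OF QUE(1)] by simp

lemma E_mono: "v \<subseteq> v' \<Longrightarrow> v' \<subseteq> w \<Longrightarrow> E w v \<subseteq> E w v'"
  by (intro image_mono xsub Wsub[OF w])

lemma E_empty: "E w {} = Q"
  using E_eq[of "{}"] Q(3) by simp

lemma E_G: "v \<subseteq> w \<Longrightarrow> E w v \<in> G"
  by (intro H3(1) E_univ E_small E_acl)

text \<open>The vertices of \<open>u\<close> are added one at a time on the left. Each vertex is
  independent over \<open>Q\<close> from all the others, and base monotonicity raises its base to
  the vertices in \<open>r\<close> and those already treated, as left transitivity demands.\<close>

lemma indep1_sets: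
  assumes "finite u" "u \<union> s \<subseteq> w" "u \<inter> s = {}" "r \<subseteq> s"
  shows "indep L\<^sub>1 N (UE w u) (Q \<union> UE w r) (UE w s)"
  using assms
proof (induction u rule: finite_induct)
  case empty
  then show ?case by (intro N.indep_acl_self QUE UE_univ) auto
next
  case (insert i u)
  let ?C = "Q \<union> UE w r"
  have rs: "r \<subseteq> w" "s \<subseteq> w" "u \<subseteq> w" "i \<in> w" using insert.prems by auto
  have IH: "indep L\<^sub>1 N (UE w u) ?C (UE w s)" by (rule insert.IH) (use insert.prems in auto)
  let ?B = "UE w (u \<union> s)"
  have "indep L\<^sub>1 N (E w {i}) Q (UE w (w - {i}))" by (rule pind[OF w b[OF w] rs(4)])
  then have "indep L\<^sub>1 N (E w {i}) Q ?B" by (rule N.indep_mono) (use insert in auto)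
  then have "indep L\<^sub>1 N (E w {i}) (?C \<union> UE w u) ?B" by (rule N.indep_base_mono) (use insert.prems in auto)
  then have i2: "indep L\<^sub>1 N (E w {i}) (?C \<union> UE w u) (UE w s)" by (rule N.indep_mono) auto
  have "{i} \<subseteq> w" using rs by simp
  from N.indep_left_trans[OF UE_univ UE_small E_univ[OF this] E_small[OF this] UE_univ UE_small QUE IH i2]
  have "indep L\<^sub>1 N (UE w u \<union> E w {i}) ?C (UE w s)" using rs by simp
  moreover have "UE w (insert i u) = UE w u \<union> E w {i}" by auto
  ultimately show ?case by simp
qed

text \<open>Passing from vertices to closures takes three moves: close on the right, enlarge the
  base to the closed set \<open>E w (v \<inter> v')\<close>, then close on the left.\<close>

lemma indep1_E:
  assumes v: "v \<subseteq> w" "v' \<subseteq> w"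
  shows "indep L\<^sub>1 N (E w v) (E w (v \<inter> v')) (E w v')"
proof -
  let ?u = "v - v'" and ?r = "v \<inter> v'"
  let ?C = "Q \<union> UE w ?r"
  have uw: "?u \<subseteq> w" and rw: "?r \<subseteq> w" using v by auto
  note U = UE_univ[OF uw] UE_small[OF uw] and C = QUE[OF rw]
  have "indep L\<^sub>1 N (UE w ?u) ?C (UE w v')"
    by (rule indep1_sets[OF finite_subset[OF uw finw[OF w]]]) (use v in auto)
  from N.indep_right_acl[OF U UE_univ[OF v(2)] UE_small[OF v(2)] C this]
  have "indep L\<^sub>1 N (UE w ?u) ?C (acl L\<^sub>1 N (UE w v' \<union> ?C))" .
  moreover have "UE w v' \<union> ?C = Q \<union> UE w v'" by auto
  ultimately have 1: "indep L\<^sub>1 N (UE w ?u) ?C (E w v')" using E_eq[OF v(2)] by simp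
  have 2: "indep L\<^sub>1 N (UE w ?u) (E w ?r) (E w v')"
    by (rule N.indep_base_mono[OF 1 E_incl[OF rw]]) (use E_mono[of ?r v'] v in auto)
  have "Q \<union> UE w v \<subseteq> E w ?r \<union> UE w ?u" using E_incl[OF rw] by blast
  then have "E w v \<subseteq> acl L\<^sub>1 N (E w ?r \<union> UE w ?u)" unfolding E_eq[OF v(1)] by (rule N.acl_mono)
  from N.indep_left_acl[OF U E_univ[OF v(2)] E_small[OF v(2)] E_univ[OF rw] E_small[OF rw] this E_small[OF v(1)] 2]
  show ?thesis .
qed

text \<open>Induction on the length only, since the base \<open>?C\<close> of the independence used in the step is
  itself such a union, for the shorter list of the sets \<open>u \<inter> v\<close>.\<close>

lemma G_union_list:
  "vs \<noteq> [] \<Longrightarrow> (\<forall>v\<in>set vs. v \<subseteq> w) \<Longrightarrow> length vs = n \<Longrightarrow> (\<Union>v\<in>set vs. E w v) \<in> G"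
proof (induction n arbitrary: vs)
  case 0
  then show ?case by simp
next
  case (Suc n)
  then obtain v us where vs: "vs = v # us" "length us = n" by (cases vs) auto
  have v: "v \<subseteq> w" and us: "\<forall>u\<in>set us. u \<subseteq> w" using Suc.prems vs by auto
  show ?case
  proof (cases "us = []")
    case True
    then show ?thesis using vs E_G[OF v] by simp
  next
    case False
    let ?s = "\<Union>(set us)" and ?us = "map (\<lambda>u. u \<inter> v) us"
    let ?A = "\<Union>u\<in>set us. E w u" and ?C = "\<Union>u\<in>set ?us. E w u"
    have A: "?A \<in> G" by (rule Suc.IH[OF False us vs(2)])
    have C: "?C \<in> G" by (rule Suc.IH) (use False us vs(2) v in auto)
    have sw: "?s \<subseteq> w" "?s \<inter> v \<subseteq> w" using us by auto
    have i1: "indep L\<^sub>1 N (E w ?s) (E w (?s \<inter> v)) (E w v)" by (rule indep1_E[OF sw(1) v])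
    have Cu: "?C \<subseteq> E w (?s \<inter> v)"
    proof (rule UN_least)
      fix u assume "u \<in> set ?us"
      then have "u \<subseteq> ?s \<inter> v" by auto
      then show "E w u \<subseteq> E w (?s \<inter> v)" by (rule E_mono[OF _ sw(2)])
    qed
    \<comment> \<open>The union \<open>?C\<close> contains all vertices of
      \<open>?s \<inter> v\<close>, so it generates \<open>E w (?s \<inter> v)\<close>, though it
      need not be equal to it.\<close>
    have "Q \<union> UE w (?s \<inter> v) \<subseteq> ?C"
    proof -
      have uw: "u \<subseteq> w" if "u \<in> set ?us" for u using that us by auto
      obtain u0 where u0: "u0 \<in> set ?us" using False by (cases us) auto
      have "Q \<subseteq> ?C" using E_incl[OF uw[OF u0]] u0 by blast
      moreover have "E w {i} \<subseteq> ?C" if i: "i \<in> ?s \<inter> v" for i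
      proof -
        obtain u where u: "u \<in> set us" "i \<in> u \<inter> v" using i by blast
        then have u': "u \<inter> v \<in> set ?us" by auto
        have "E w {i} \<subseteq> E w (u \<inter> v)" by (rule E_mono) (use u uw[OF u'] in auto)
        then show ?thesis using u' by blast
      qed
      ultimately show ?thesis by blast
    qed
    then have "E w (?s \<inter> v) \<subseteq> acl L\<^sub>1 N ?C" unfolding E_eq[OF sw(2)] by (rule N.acl_mono)
    moreover have "acl L\<^sub>1 N ?C \<subseteq> E w (?s \<inter> v)" using N.acl_mono[OF Cu] E_acl[OF sw(2)] by simp
    ultimately have aclC: "acl L\<^sub>1 N ?C = E w (?s \<inter> v)" by blast
    have Cuniv: "?C \<subseteq> univ N" "|?C| <o \<kappa>" "|acl L\<^sub>1 N ?C| <o \<kappa>"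
      using Cu E_univ[OF sw(2)] G[OF C] E_small[OF sw(2)] aclC by auto
    \<comment> \<open>H4 needs a base inside both sides, and the closed set
      \<open>E w (?s \<inter> v)\<close> need not be contained in \<open>?A\<close>. Hence the base
      is lowered to its generating set \<open>?C\<close>, which lies in \<open>G\<close> by the
      induction hypothesis.\<close>
    have "indep L\<^sub>1 N (E w ?s) (acl L\<^sub>1 N ?C) (E w v)" using i1 aclC by simp
    then have "indep L\<^sub>1 N (E w ?s) ?C (E w v)" by (rule N.indep_acl_base[OF Cuniv])
    moreover have "?A \<subseteq> E w ?s"
    proof (rule UN_least)
      fix u assume "u \<in> set us"
      then have "u \<subseteq> ?s" by auto
      then show "E w u \<subseteq> E w ?s" by (rule E_mono[OF _ sw(1)])
    qed
    ultimately have "indep L\<^sub>1 N ?A ?C (E w v)" by (rule N.indep_mono[OF _ _ order_refl])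
    moreover have "?C \<subseteq> ?A \<inter> E w v"
    proof -
      have Euv: "E w (u \<inter> v) \<subseteq> ?A \<inter> E w v" if u: "u \<in> set us" for u
      proof -
        have "E w (u \<inter> v) \<subseteq> E w u" "E w (u \<inter> v) \<subseteq> E w v" using us v u by (auto intro!: E_mono del: image_subsetI subsetI)
        then show ?thesis using u by blast
      qed
      show ?thesis
      proof (rule UN_least)
        fix u' assume "u' \<in> set ?us"
        then have "u' \<in> (\<lambda>u. u \<inter> v) ` set us" by simp
        then obtain u where "u' = u \<inter> v" "u \<in> set us" by (rule imageE)
        then show "E w u' \<subseteq> ?A \<inter> E w v" using Euv by simp
      qed
    qed
    ultimately have "?A \<union> E w v \<in> G" using H4[OF A E_G[OF v] C] by blast
    then show ?thesis using vs by (simp add: Un_commute)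
  qed
qed

lemma G_union:
  assumes "V \<noteq> {}" "\<And>v. v \<in> V \<Longrightarrow> v \<subseteq> w"
  shows "(\<Union>v\<in>V. E w v) \<in> G"
proof -
  have "V \<subseteq> Pow w" using assms(2) by blast
  then have "finite V" using finw[OF w] finite_subset by blast
  then obtain vs where "set vs = V" using finite_list by blast
  then show ?thesis using G_union_list[of vs] assms by auto
qed

lemma indep0_E: "v \<subseteq> w \<Longrightarrow> v' \<subseteq> w \<Longrightarrow> indep L\<^sub>0 M (E w v) (E w (v \<inter> v')) (E w v')"
  using indep1_E H4[OF E_G E_G E_G, of v v' "v \<inter> v'"] E_mono[of "v \<inter> v'" v] E_mono[of "v \<inter> v'" v']
  by (metis Int_greatest inf_le1 inf_le2 order_trans)

lemma acl0_E_N: "v \<subseteq> w \<Longrightarrow> acl L\<^sub>0 M (E w v) \<inter> univ N = E w v"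
  using H3(2)[OF E_G] E_acl by simp

lemma E_univ0: "v \<subseteq> w \<Longrightarrow> E w v \<subseteq> univ M"
  using E_univ NM_univ by blast

text \<open>The subtuples are independent in \<open>M\<close> over their common part, and
  independent sets share no algebraic elements beyond the base. This keeps the new variables for
  different index sets apart in \<open>bt_inj\<close>.\<close>

lemma acl0_inter:
  assumes v: "v \<subseteq> w" "v' \<subseteq> w"
  shows "acl L\<^sub>0 M (E w v) \<inter> acl L\<^sub>0 M (E w v') \<subseteq> acl L\<^sub>0 M (E w (v \<inter> v'))"
proof -
  have r: "v \<inter> v' \<subseteq> w" using v by auto
  have "E w v \<union> E w (v \<inter> v') = E w v" "E w v' \<union> E w (v \<inter> v') = E w v'"
    using E_mono[of "v \<inter> v'" v] E_mono[of "v \<inter> v'" v'] v by auto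
  then show ?thesis
    using M.indep_acl_inter[OF E_univ0[OF v(1)] E_small[OF v(1)] E_univ0[OF v(2)] E_small[OF v(2)]
        E_univ0[OF r] E_small[OF r] indep0_E[OF v]] by simp
qed

text \<open>A priori the tuple is algebraic over its vertices only in T1. The union of
  \<open>Q\<close> and the vertices belongs to \<open>G\<close>, and for members of \<open>G\<close>
  the two closures agree inside \<open>N\<close> by H3.\<close>

lemma E_acl0:
  assumes v: "v \<subseteq> w"
  shows "E w v \<subseteq> acl L\<^sub>0 M (Q \<union> UE w v)"
proof -
  \<comment> \<open>The empty index contributes \<open>Q\<close>, because \<open>E w {}\<close>
    equals \<open>Q\<close>.\<close>
  let ?V = "insert {} ((\<lambda>i. {i}) ` v)"
  have "(\<Union>u\<in>?V. E w u) \<in> G" by (rule G_union) (use v in auto)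
  moreover have "(\<Union>u\<in>?V. E w u) = Q \<union> UE w v" using E_empty by auto
  ultimately have "Q \<union> UE w v \<in> G" by simp
  from H3(2)[OF this] show ?thesis using E_eq[OF v] by auto
qed

lemma indep0_fam:
  assumes i: "i \<in> w"
  shows "indep L\<^sub>0 M (E w {i}) Q (UE w (w - {i}))"
proof -
  have s: "{i} \<subseteq> w" "w - {i} \<subseteq> w" "{i} \<inter> (w - {i}) = {}" using i by auto
  have "indep L\<^sub>0 M (E w {i}) Q (E w (w - {i}))" using indep0_E[OF s(1,2)] unfolding s(3) E_empty .
  then show ?thesis by (rule M.indep_mono) (use E_incl[OF s(2)] in auto)
qed

lemma tp0_coh:
  assumes v: "v \<subseteq> w"
  shows "tp L\<^sub>0 M Q (x v) (b w) = tp L\<^sub>0 M Q (x v) (b v)"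
proof (rule tp_eq_of_qf_eq[OF inf_vars NM qe Q(1) E_univ[OF v]])
  show "b v ` x v \<subseteq> univ N" using b[OF Wsub[OF w v]] by (simp add: realizes_def)
  fix \<psi> assume "\<psi> \<in> forms L\<^sub>0 Q (x v)"
  then have \<psi>: "\<psi> \<in> forms L\<^sub>1 Q (x v)" using forms_L0 by blast
  have "tp L\<^sub>1 N Q (x v) (b w) = tp L\<^sub>1 N Q (x v) (b v)"
    using p_tp[OF w v] p_tp[OF Wsub[OF w v] order_refl] by simp
  then show "sat N (b w) \<psi> = sat N (b v) \<psi>" using \<psi> unfolding tp_def by blast
qed

end

definition q :: "nat set \<Rightarrow> ('f, 'r, 'a, 'v) fm set" where
  "q w = tp L\<^sub>0 M Q (x w) (b w)"

definition I :: "nat set \<Rightarrow> ('f, 'r, 'a, 'v) fm set" where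
  "I w = qftp L' N {} (x w) (b w)"

lemma Q0: "Q \<subseteq> univ M"
  using Q(1) NM_univ by blast

lemma q_system: "amalg_system L\<^sub>0 M \<kappa> Q W x q"
proof -
  have "amalg_system L\<^sub>0 M \<kappa> Q W x (\<lambda>w. tp L\<^sub>0 M Q (x w) (b w))"
  proof (rule M.amalg_systemI[OF inf_vars Q0 Q(2) finW])
    fix w assume w: "w \<in> W"
    show "|x w| <o \<kappa>" by (rule xsmall[OF w])
    show "b w ` x w \<subseteq> univ M" by (rule E_univ0[OF w order_refl])
    show "inj_on (b w) (x w)" by (rule b_inj[OF w])
    show "E w w \<subseteq> acl L\<^sub>0 M (Q \<union> UE w w)" by (rule E_acl0[OF w order_refl])
    show "finite w" by (rule finw[OF w])
    fix i assume "i \<in> w"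
    then show "{i} \<in> W" "indep L\<^sub>0 M (E w {i}) Q (UE w (w - {i}))" using Wsub[OF w] indep0_fam[OF w] by auto
  next
    fix v w assume vw: "v \<in> W" "w \<in> W"
    show "x v \<inter> x w = x (v \<inter> w)" by (rule xint[OF vw])
    show "tp L\<^sub>0 M Q (x v) (b w) = tp L\<^sub>0 M Q (x v) (b v)" if "v \<subseteq> w" by (rule tp0_coh[OF vw(2) that])
  qed
  then show ?thesis by (simp add: q_def[abs_def])
qed

lemma I_annotation:
  assumes w: "w \<in> W"
  shows "annotation L' (x w) (I w)"
  unfolding annotation_def
proof (intro exI conjI)
  \<comment> \<open>The restriction of \<open>N\<close> to the tuple is a structure because members
    of \<open>G\<close> are closed under the functions of \<open>L'\<close>.\<close>
  let ?S = "N\<lparr>univ := E w w\<rparr>"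
  have "substr_set L' N (E w w)" using G[OF E_G[OF w order_refl]] by simp
  then show "is_struc L' ?S" by (simp add: is_struc_def substr_set_def)
  show "bij_betw (b w) (x w) (univ ?S)" using b_inj[OF w] by (simp add: bij_betw_def)
  have ev: "eval ?S \<tau> t = eval N \<tau> t" for \<tau> and t :: "('f, 'a, 'v) tm"
    by (induction t) (auto cong: map_cong)
  have "sat ?S \<tau> \<phi> = sat N \<tau> \<phi>" if "qfree \<phi>" for \<tau> and \<phi> :: "('f, 'r, 'a, 'v) fm"
    using that by (induction \<phi>) (auto simp: ev cong: map_cong)
  then show "I w = qftp L' ?S {} (x w) (b w)" by (auto simp: I_def qftp_def tp_def)
qed

lemma I_coh:
  assumes w: "w \<in> W" "v \<subseteq> w"
  shows "{\<phi>\<in>I w. fv \<phi> \<subseteq> x v} = I v"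
proof -
  have "tp L\<^sub>1 N Q (x v) (b w) = tp L\<^sub>1 N Q (x v) (b v)"
    using p_tp[OF w] p_tp[OF Wsub[OF w] order_refl] by simp
  then have eq: "sat N (b w) \<phi> = sat N (b v) \<phi>" if "\<phi> \<in> forms L\<^sub>1 Q (x v)" for \<phi>
    using that unfolding tp_def by blast
  have "sat N (b w) \<phi> = sat N (b v) \<phi>" if "\<phi> \<in> forms L' {} (x v)" for \<phi>
    by (rule eq) (use that forms_L' forms_mono[of "{}" Q "x v" "x v" L\<^sub>1] in blast)
  then show ?thesis using xsub[OF w] by (auto simp: I_def qftp_def tp_def forms_def)
qed

lemma annotated: "annotated_system L\<^sub>0 L' M N \<kappa> Q W x q I"
  unfolding annotated_system_def using Q(1) q_system I_annotation I_coh by simp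

lemma realizes_qI:
  assumes w: "w \<in> W"
  shows "realizes_annotated M N (x w) (b w) (q w) (I w)"
  using E_univ[OF w order_refl] E_univ0[OF w order_refl]
  by (auto simp: realizes_annotated_def realizes_def q_def I_def qftp_def tp_def)

lemma rel_acl_fair: "rel_acl_fair_system L\<^sub>0 L' L\<^sub>1 M N \<kappa> G Q W x q I"
  unfolding rel_acl_fair_system_def
  using annotated realizes_qI E_G E_acl by (metis order_refl)

lemma strongly_fair: "strongly_fair_system L\<^sub>0 L' M N \<kappa> G Q W x q I"
  unfolding strongly_fair_system_def
proof (intro conjI ballI annotated)
  fix w assume w: "w \<in> W"
  show "\<exists>a. realizes_annotated M N (x w) a (q w) (I w) \<and>
      (\<forall>V\<subseteq>W. V \<noteq> {} \<and> (\<forall>v\<in>V. v \<subseteq> w) \<longrightarrow> (\<Union>v\<in>V. a ` x v) \<in> G)"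
    using realizes_qI[OF w] G_union[OF w] by (intro exI[of _ "b w"]) auto
qed

subsection \<open>The algebraically closed system over the algebraic closure of the base\<close>

abbreviation aQ :: "'a set" where
  "aQ \<equiv> acl L\<^sub>0 M Q"

abbreviation A0 :: "nat set \<Rightarrow> nat set \<Rightarrow> 'a set" where
  "A0 w v \<equiv> acl L\<^sub>0 M (E w v)"

lemma aQ_univ: "aQ \<subseteq> univ M" and aQ_small: "|aQ| <o \<kappa>" and Q_aQ: "Q \<subseteq> aQ"
  using M.acl_univ M.small_acl[OF c0 Q0 Q(2)] M.acl_incl[OF Q0] by auto

lemma A0_univ: "A0 w v \<subseteq> univ M"
  by (rule M.acl_univ)

lemma A0_small: "w \<in> W \<Longrightarrow> v \<subseteq> w \<Longrightarrow> |A0 w v| <o \<kappa>"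
  by (rule M.small_acl[OF c0 E_univ0 E_small])

lemma E_A0: "w \<in> W \<Longrightarrow> v \<subseteq> w \<Longrightarrow> E w v \<subseteq> A0 w v"
  by (rule M.acl_incl[OF E_univ0])

lemma aQ_A0: "w \<in> W \<Longrightarrow> v \<subseteq> w \<Longrightarrow> aQ \<subseteq> A0 w v"
  using E_incl by (intro M.acl_mono) auto

lemma A0_mono: "w \<in> W \<Longrightarrow> u \<subseteq> v \<Longrightarrow> v \<subseteq> w \<Longrightarrow> A0 w u \<subseteq> A0 w v"
  by (rule M.acl_mono[OF E_mono])

lemma aQ_N: "Q = aQ \<inter> univ N"
proof -
  obtain w where "w \<in> W" using W by (auto simp: index_family_def)
  then have "{} \<in> W" using Wsub by blast
  from acl0_E_N[OF this order_refl] show ?thesis unfolding E_empty[OF \<open>{} \<in> W\<close>] by simp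
qed

text \<open>Both types extend the common type over \<open>Q\<close>, and H2 allows only one
  extension to the closure.\<close>

lemma tp0_aQ:
  assumes w: "w \<in> W" and v: "v \<subseteq> w"
  shows "tp L\<^sub>0 M aQ (x v) (b w) = tp L\<^sub>0 M aQ (x v) (b v)"
proof -
  have vW: "v \<in> W" by (rule Wsub[OF w v])
  have sub: "tp L\<^sub>0 M Q (x v) c \<subseteq> tp L\<^sub>0 M aQ (x v) c" for c
    using forms_mono[OF Q_aQ order_refl, of L\<^sub>0 "x v"] by (auto simp: tp_def)
  have 1: "complete_type L\<^sub>0 M aQ (x v) (tp L\<^sub>0 M aQ (x v) (b w)) \<and> tp L\<^sub>0 M Q (x v) (b w) \<subseteq> tp L\<^sub>0 M aQ (x v) (b w)"
    using M.complete_type_tp[OF E_univ0[OF w v]] sub by blast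
  have 2: "complete_type L\<^sub>0 M aQ (x v) (tp L\<^sub>0 M aQ (x v) (b v)) \<and> tp L\<^sub>0 M Q (x v) (b w) \<subseteq> tp L\<^sub>0 M aQ (x v) (b v)"
    using M.complete_type_tp[OF E_univ0[OF vW order_refl]] sub[of "b v"] tp0_coh[OF w v] by simp
  from H2[OF Q(1) aQ_N E_univ[OF w v]]
  show ?thesis by (rule ex1E) (use 1 2 in metis)
qed

text \<open>\<open>F v w\<close> transports the algebraic closure of \<open>b v\<close> to that of the subtuple of \<open>b w\<close> with
  index \<open>v\<close>; existence rests on H2 and uniqueness on H1.\<close>

definition is_F :: "nat set \<Rightarrow> nat set \<Rightarrow> ('a \<Rightarrow> 'a) \<Rightarrow> bool" where
  "is_F v w f \<longleftrightarrow> M.elem_map (A0 v v) f \<and> (\<forall>z\<in>aQ. f z = z) \<and> (\<forall>y\<in>x v. f (b v y) = b w y)"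

definition F :: "nat set \<Rightarrow> nat set \<Rightarrow> 'a \<Rightarrow> 'a" where
  "F v w = (SOME f. is_F v w f)"

lemma is_F_F:
  assumes w: "w \<in> W" and v: "v \<subseteq> w"
  shows "is_F v w (F v w)"
proof -
  have vW: "v \<in> W" by (rule Wsub[OF w v])
  obtain f where f: "M.elem_map (aQ \<union> b v ` x v) f" "\<And>c. c \<in> aQ \<Longrightarrow> f c = c" "\<And>y. y \<in> x v \<Longrightarrow> f (b v y) = b w y"
    using M.tp_elem_map[OF inf_vars aQ_univ E_univ0[OF vW order_refl] E_univ0[OF w v] tp0_aQ[OF w v, symmetric]] by metis
  have "|aQ \<union> b v ` x v| <o \<kappa>" using aQ_small E_small[OF vW order_refl] by auto
  then obtain g where g: "M.elem_map (aQ \<union> b v ` x v \<union> A0 v v) g" "\<And>z. z \<in> aQ \<union> b v ` x v \<Longrightarrow> g z = f z"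
    using M.elem_map_extend[OF f(1) _ A0_small[OF vW order_refl] A0_univ] by metis
  have "M.elem_map (A0 v v) g" by (rule M.elem_map_mono[OF g(1)]) auto
  then have "is_F v w g" unfolding is_F_def using g(2) f(2,3) by auto
  then show ?thesis unfolding F_def by (rule someI[of "is_F v w"])
qed

lemma F_elem_map: "w \<in> W \<Longrightarrow> v \<subseteq> w \<Longrightarrow> M.elem_map (A0 v v) (F v w)"
  and F_aQ: "w \<in> W \<Longrightarrow> v \<subseteq> w \<Longrightarrow> z \<in> aQ \<Longrightarrow> F v w z = z"
  and F_b: "w \<in> W \<Longrightarrow> v \<subseteq> w \<Longrightarrow> y \<in> x v \<Longrightarrow> F v w (b v y) = b w y"
  using is_F_F unfolding is_F_def by blast+

text \<open>By H1 the closure of \<open>E v v\<close> is definable over \<open>E v v\<close>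
  together with the elements algebraic over the empty set. There the two maps agree, the latter
  elements being in \<open>aQ\<close>.\<close>

lemma is_F_unique:
  assumes v: "v \<in> W" and f: "is_F v w f" and g: "is_F v w g" and e: "e \<in> A0 v v"
  shows "f e = g e"
proof (rule M.elem_map_dcl_unique[of "A0 v v" f g "E v v \<union> acl L\<^sub>0 M {}"])
  have a: "acl L\<^sub>0 M {} \<subseteq> aQ" by (rule M.acl_mono) simp
  show "M.elem_map (A0 v v) f" "M.elem_map (A0 v v) g" using f g by (auto simp: is_F_def)
  show "E v v \<union> acl L\<^sub>0 M {} \<subseteq> A0 v v" using a aQ_A0[OF v order_refl] E_A0[OF v order_refl] by auto
  show "f z = g z" if "z \<in> E v v \<union> acl L\<^sub>0 M {}" for z using that a f g by (auto simp: is_F_def)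
  show "e \<in> A0 v v" by fact
  have "E v v = acl L\<^sub>0 M (E v v) \<inter> univ N" using acl0_E_N[OF v order_refl] by simp
  from H1[OF E_univ[OF v order_refl] this] show "e \<in> dcl L\<^sub>0 M (E v v \<union> acl L\<^sub>0 M {})" using e by simp
qed

lemma F_E:
  assumes "w \<in> W" "v \<subseteq> w" "u \<subseteq> v"
  shows "F v w ` E v u = E w u"
proof -
  have "x u \<subseteq> x v" by (rule xsub[OF Wsub[OF assms(1,2)] assms(3)])
  then show ?thesis unfolding image_image using F_b[OF assms(1,2)] by (intro image_cong) auto
qed

lemma F_A0:
  assumes w: "w \<in> W" and v: "v \<subseteq> w" and u: "u \<subseteq> v"
  shows "F v w ` A0 v u = A0 w u"
proof -
  have vW: "v \<in> W" by (rule Wsub[OF w v])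
  have "M.elem_map (A0 v u) (F v w)" by (rule M.elem_map_mono[OF F_elem_map[OF w v] A0_mono[OF vW u order_refl]])
  from M.elem_map_acl_image[OF this E_univ0[OF vW u] E_small[OF vW u] A0_small[OF vW u]]
  show ?thesis unfolding F_E[OF w v u] .
qed

lemma F_A0_iff:
  assumes w: "w \<in> W" and v: "v \<subseteq> w" and u: "u \<subseteq> v" and e: "e \<in> A0 v v"
  shows "F v w e \<in> A0 w u \<longleftrightarrow> e \<in> A0 v u"
proof
  assume "F v w e \<in> A0 w u"
  then obtain e' where e': "e' \<in> A0 v u" "F v w e' = F v w e" unfolding F_A0[OF w v u, symmetric] by force
  then have "e' \<in> A0 v v" using A0_mono[OF Wsub[OF w v] u order_refl] by blast
  then have "e' = e" using inj_onD[OF M.elem_map_inj[OF F_elem_map[OF w v]] e'(2)] e by blast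
  then show "e \<in> A0 v u" using e'(1) by simp
next
  assume "e \<in> A0 v u"
  then show "F v w e \<in> A0 w u" unfolding F_A0[OF w v u, symmetric] by blast
qed

lemma F_E_iff:
  assumes w: "w \<in> W" and v: "v \<subseteq> w" and e: "e \<in> A0 v v"
  shows "F v w e \<in> E w v \<longleftrightarrow> e \<in> E v v"
proof
  assume "F v w e \<in> E w v"
  then obtain e' where e': "e' \<in> E v v" "F v w e' = F v w e" unfolding F_E[OF w v order_refl, symmetric] by force
  then have "e' \<in> A0 v v" using E_A0[OF Wsub[OF w v] order_refl] by blast
  then have "e' = e" using inj_onD[OF M.elem_map_inj[OF F_elem_map[OF w v]] e'(2)] e by blast
  then show "e \<in> E v v" using e'(1) by simp
next
  assume "e \<in> E v v"
  then show "F v w e \<in> E w v" unfolding F_E[OF w v order_refl, symmetric] by blast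
qed

text \<open>The composite has the defining properties of the direct map, so uniqueness identifies
  them. Coherence of the enlarged tuples is exactly this identity at the new variables.\<close>

lemma F_cocycle:
  assumes w: "w \<in> W" and v: "v \<subseteq> w" and u: "u \<subseteq> v" and e: "e \<in> A0 u u"
  shows "F v w (F u v e) = F u w e"
proof -
  have vW: "v \<in> W" by (rule Wsub[OF w v])
  have uW: "u \<in> W" by (rule Wsub[OF vW u])
  have uw: "u \<subseteq> w" using u v by blast
  have "F u v ` A0 u u \<subseteq> A0 v v" unfolding F_A0[OF vW u order_refl] by (rule A0_mono[OF vW u order_refl])
  from M.elem_map_comp[OF F_elem_map[OF vW u] M.elem_map_mono[OF F_elem_map[OF w v] this]]
  have "M.elem_map (A0 u u) (\<lambda>z. F v w (F u v z))" .
  moreover have "F v w (F u v (b u y)) = b w y" if "y \<in> x u" for y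
    using F_b[OF vW u that] F_b[OF w v, of y] xsub[OF vW u] that by auto
  ultimately have "is_F u w (\<lambda>z. F v w (F u v z))"
    unfolding is_F_def using F_aQ[OF vW u] F_aQ[OF w v] by simp
  from is_F_unique[OF uW this is_F_F[OF w uw] e] show ?thesis .
qed

text \<open>Each element of \<open>A0 v v\<close> that comes neither from \<open>x v\<close> nor from a proper subset of \<open>v\<close>
  receives one new variable \<open>\<zeta> (v, e)\<close>.\<close>

definition Zs :: "nat set \<Rightarrow> 'a set" where
  "Zs v = A0 v v - (E v v \<union> (\<Union>u\<in>{u. u \<subset> v}. A0 v u))"

lemma small_Sigma: "|Sigma W Zs| <o \<kappa>"
proof -
  have "Sigma W Zs = (\<Union>v\<in>W. Pair v ` Zs v)" by auto
  moreover have "|\<Union>v\<in>W. Pair v ` Zs v| <o \<kappa>"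
  proof (rule M.small_UN_finite[OF finW])
    fix v assume v: "v \<in> W"
    have "|Zs v| <o \<kappa>" by (rule M.small_subset[OF A0_small[OF v order_refl]]) (auto simp: Zs_def)
    then show "|Pair v ` Zs v| <o \<kappa>" by (rule M.small_image)
  qed
  ultimately show ?thesis by simp
qed

section \<open>Variables and realizations of the enlarged system\<close>

definition fresh :: "(nat set \<times> 'a \<Rightarrow> 'v) \<Rightarrow> bool" where
  "fresh f \<longleftrightarrow> inj_on f (Sigma W Zs) \<and> f ` Sigma W Zs \<inter> (\<Union>w\<in>W. x w) = {}"

definition \<zeta> :: "nat set \<times> 'a \<Rightarrow> 'v" where
  "\<zeta> = (SOME f. fresh f)"

text \<open>Removing the small set of old variables from an infinite type of cardinality at least
  \<open>\<kappa>\<close> leaves at least \<open>\<kappa>\<close> variables, enough for the small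
  set of new elements.\<close>

lemma fresh_\<zeta>: "fresh \<zeta>"
proof -
  let ?X = "\<Union>w\<in>W. x w"
  have X: "|?X| <o \<kappa>" by (rule M.small_UN_finite[OF finW xsmall])
  have X': "|?X| <o |UNIV :: 'v set|" by (rule ordLess_ordLeq_trans[OF X vars])
  have "\<not> |UNIV - ?X| <o |UNIV :: 'v set|"
  proof
    assume "|UNIV - ?X| <o |UNIV :: 'v set|"
    from card_of_Un_ordLess_infinite[OF inf_vars X' this] have "|UNIV :: 'v set| <o |UNIV :: 'v set|" by simp
    then show False using ordLess_irreflexive by blast
  qed
  then have "|UNIV :: 'v set| \<le>o |UNIV - ?X|"
    using not_ordLess_iff_ordLeq[OF card_of_Well_order card_of_Well_order] by blast
  then have "\<kappa> \<le>o |UNIV - ?X|" by (rule ordLeq_transitive[OF vars])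
  then have "|Sigma W Zs| \<le>o |UNIV - ?X|"
    by (rule ordLess_imp_ordLeq[OF ordLess_ordLeq_trans[OF small_Sigma]])
  then obtain f where "inj_on f (Sigma W Zs) \<and> f ` Sigma W Zs \<subseteq> UNIV - ?X" using card_of_ordLeq[of "Sigma W Zs" "UNIV - ?X"] by blast
  then have "fresh f" unfolding fresh_def by blast
  then show ?thesis unfolding \<zeta>_def by (rule someI[of fresh])
qed

definition xt :: "nat set \<Rightarrow> 'v set" where
  "xt w = x w \<union> \<zeta> ` Sigma (Pow w) Zs"

text \<open>At the variable \<open>\<zeta> (v, e)\<close> every tuple with index \<open>w\<close>
  above \<open>v\<close> takes the transported copy of \<open>e\<close>. The variable does not
  depend on \<open>w\<close>, so the enlarged variable sets intersect correctly.\<close>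

definition bt :: "nat set \<Rightarrow> 'v \<Rightarrow> 'a" where
  "bt w y = (if y \<in> x w then b w y else case inv_into (Sigma W Zs) \<zeta> y of (v, e) \<Rightarrow> F v w e)"

lemma \<zeta>_inj: "v \<in> W \<Longrightarrow> e \<in> Zs v \<Longrightarrow> v' \<in> W \<Longrightarrow> e' \<in> Zs v' \<Longrightarrow> \<zeta> (v, e) = \<zeta> (v', e') \<Longrightarrow> v = v' \<and> e = e'"
proof -
  assume a: "v \<in> W" "e \<in> Zs v" "v' \<in> W" "e' \<in> Zs v'" "\<zeta> (v, e) = \<zeta> (v', e')"
  have "inj_on \<zeta> (Sigma W Zs)" using fresh_\<zeta> by (simp add: fresh_def)
  from inj_onD[OF this a(5)] a(1-4) show ?thesis by auto
qed

lemma \<zeta>_new: "v \<in> W \<Longrightarrow> e \<in> Zs v \<Longrightarrow> w \<in> W \<Longrightarrow> \<zeta> (v, e) \<notin> x w"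
  using fresh_\<zeta> unfolding fresh_def by blast

lemma bt_x: "y \<in> x w \<Longrightarrow> bt w y = b w y"
  by (simp add: bt_def)

lemma bt_\<zeta>:
  assumes "v \<in> W" "e \<in> Zs v" "w \<in> W"
  shows "bt w (\<zeta> (v, e)) = F v w e"
proof -
  have "inj_on \<zeta> (Sigma W Zs)" using fresh_\<zeta> by (simp add: fresh_def)
  then have "inv_into (Sigma W Zs) \<zeta> (\<zeta> (v, e)) = (v, e)" using assms by (intro inv_into_f_f) auto
  then show ?thesis using \<zeta>_new[OF assms] by (simp add: bt_def)
qed

lemma xt_cases:
  assumes "w \<in> W" "y \<in> xt w"
  obtains "y \<in> x w" | v e where "v \<in> W" "v \<subseteq> w" "e \<in> Zs v" "y = \<zeta> (v, e)"
  using assms Wsub unfolding xt_def by blast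

lemma xt_int:
  assumes v: "v \<in> W" and w: "w \<in> W"
  shows "xt v \<inter> xt w = xt (v \<inter> w)"
proof
  have vw: "v \<inter> w \<in> W" using Wsub[OF v] by blast
  show "xt v \<inter> xt w \<subseteq> xt (v \<inter> w)"
  proof
    fix y assume "y \<in> xt v \<inter> xt w"
    then have yv: "y \<in> xt v" and yw: "y \<in> xt w" by auto
    show "y \<in> xt (v \<inter> w)"
    proof (rule xt_cases[OF v yv])
      assume y: "y \<in> x v"
      show ?thesis
      proof (rule xt_cases[OF w yw])
        assume "y \<in> x w"
        then show ?thesis using y xint[OF v w] by (auto simp: xt_def)
      next
        fix u e assume "u \<in> W" "u \<subseteq> w" "e \<in> Zs u" "y = \<zeta> (u, e)"
        then show ?thesis using y \<zeta>_new[OF _ _ v] by blast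
      qed
    next
      fix u e assume u: "u \<in> W" "u \<subseteq> v" "e \<in> Zs u" "y = \<zeta> (u, e)"
      show ?thesis
      proof (rule xt_cases[OF w yw])
        assume "y \<in> x w"
        then show ?thesis using u \<zeta>_new[OF _ _ w] by blast
      next
        fix u' e' assume u': "u' \<in> W" "u' \<subseteq> w" "e' \<in> Zs u'" "y = \<zeta> (u', e')"
        then have "u = u'" using \<zeta>_inj[OF u(1,3) u'(1,3)] u(4) by simp
        then show ?thesis using u u'(2) by (auto simp: xt_def)
      qed
    qed
  qed
  show "xt (v \<inter> w) \<subseteq> xt v \<inter> xt w" using xsub[OF v, of "v \<inter> w"] xsub[OF w, of "v \<inter> w"] by (auto simp: xt_def)
qed

lemma Zs_A0: "e \<in> Zs v \<Longrightarrow> e \<in> A0 v v"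
  by (simp add: Zs_def)

lemma bt_coh:
  assumes w: "w \<in> W" and v: "v \<subseteq> w" and y: "y \<in> xt v"
  shows "F v w (bt v y) = bt w y"
proof (rule xt_cases[OF Wsub[OF w v] y])
  assume y: "y \<in> x v"
  then have "y \<in> x w" using xsub[OF w v] by blast
  then show ?thesis using F_b[OF w v y] bt_x[OF y] bt_x by simp
next
  fix u e assume u: "u \<in> W" "u \<subseteq> v" "e \<in> Zs u" "y = \<zeta> (u, e)"
  then show ?thesis using bt_\<zeta>[OF u(1,3)] Wsub[OF w v] w F_cocycle[OF w v u(2) Zs_A0[OF u(3)]] by simp
qed

text \<open>An element of the closure of \<open>b w\<close> is assigned to a smallest index set
  whose closure contains it. Pulled back along \<open>F\<close>, it is then either a coordinate of
  \<open>b v\<close> or one of the new elements in \<open>Zs v\<close>.\<close>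

lemma bt_img:
  assumes w: "w \<in> W"
  shows "bt w ` xt w = A0 w w"
proof
  show "bt w ` xt w \<subseteq> A0 w w"
  proof (rule image_subsetI)
    fix y assume y: "y \<in> xt w"
    show "bt w y \<in> A0 w w"
    proof (rule xt_cases[OF w y])
      assume "y \<in> x w"
      then show ?thesis using bt_x E_A0[OF w order_refl] by auto
    next
      fix u e assume u: "u \<in> W" "u \<subseteq> w" "e \<in> Zs u" "y = \<zeta> (u, e)"
      have "F u w e \<in> A0 w u" using F_A0_iff[OF w u(2) order_refl Zs_A0[OF u(3)]] Zs_A0[OF u(3)] by blast
      then show ?thesis using bt_\<zeta>[OF u(1,3) w] u(4) A0_mono[OF w u(2) order_refl] by auto
    qed
  qed
  show "A0 w w \<subseteq> bt w ` xt w"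
  proof
    fix e assume "e \<in> A0 w w"
    then have "w \<subseteq> w \<and> e \<in> A0 w w" by simp
    \<comment> \<open>Least cardinality is enough: a proper subset whose closure contained the
      element would be strictly smaller.\<close>
    from ex_has_least_nat[of "\<lambda>v. v \<subseteq> w \<and> e \<in> A0 w v", OF this, of card]
    obtain v where v: "v \<subseteq> w" "e \<in> A0 w v" and "\<forall>u. u \<subseteq> w \<and> e \<in> A0 w u \<longrightarrow> card v \<le> card u"
      by (elim exE conjE)
    then have min: "\<And>u. u \<subseteq> w \<Longrightarrow> e \<in> A0 w u \<Longrightarrow> card v \<le> card u" by blast
    have vW: "v \<in> W" by (rule Wsub[OF w v(1)])
    from v(2) have "e \<in> F v w ` A0 v v" unfolding F_A0[OF w v(1) order_refl] .
    then obtain e' where e': "e = F v w e'" "e' \<in> A0 v v" by (rule imageE)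
    show "e \<in> bt w ` xt w"
    proof (cases "e' \<in> E v v")
      case True
      then have "e \<in> E w v" using F_E_iff[OF w v(1) e'(2)] e'(1) by simp
      then obtain y where y: "y \<in> x v" "e = b w y" by blast
      then have "y \<in> x w" using xsub[OF w v(1)] by blast
      then have "e = bt w y" "y \<in> xt w" using y(2) bt_x by (auto simp: xt_def)
      then show ?thesis by blast
    next
      case False
      have "e' \<notin> A0 v u" if u: "u \<subset> v" for u
      proof
        assume "e' \<in> A0 v u"
        then have "e \<in> A0 w u" using F_A0_iff[OF w v(1) _ e'(2), of u] e'(1) u by auto
        then have "card v \<le> card u" using min[of u] u v(1) by auto
        moreover have "card u < card v" by (rule psubset_card_mono[OF finw[OF vW] u])
        ultimately show False by simp
      qed
      then have Z: "e' \<in> Zs v" using e'(2) False by (auto simp: Zs_def)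
      have "bt w (\<zeta> (v, e')) = e" using bt_\<zeta>[OF vW Z w] e'(1) by simp
      moreover have "\<zeta> (v, e') \<in> xt w" using v(1) Z by (auto simp: xt_def)
      ultimately show ?thesis by blast
    qed
  qed
qed

lemma bt_img_sub:
  assumes w: "w \<in> W" and v: "v \<subseteq> w"
  shows "bt w ` xt v = A0 w v"
proof -
  have "bt w ` xt v = F v w ` bt v ` xt v" unfolding image_image using bt_coh[OF w v] by (intro image_cong) auto
  also have "\<dots> = A0 w v" unfolding bt_img[OF Wsub[OF w v]] by (rule F_A0[OF w v order_refl])
  finally show ?thesis .
qed

text \<open>An element of \<open>N\<close> in the closure of a subtuple lies in the subtuple itself,
  by \<open>acl0_E_N\<close>. Hence a transported new element is not a coordinate of
  \<open>b w\<close> at all, not only of its part on \<open>v\<close>.\<close>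

lemma Zs_F:
  assumes w: "w \<in> W" and v: "v \<subseteq> w" and e: "e \<in> Zs v"
  shows "F v w e \<notin> E w w" "u \<subset> v \<Longrightarrow> F v w e \<notin> A0 w u"
proof -
  note eA = Zs_A0[OF e]
  have FA: "F v w e \<in> A0 w v" using F_A0_iff[OF w v order_refl eA] eA by blast
  show "F v w e \<notin> E w w"
  proof
    assume "F v w e \<in> E w w"
    then have "F v w e \<in> A0 w v \<inter> univ N" using FA E_univ[OF w order_refl] by blast
    then have "F v w e \<in> E w v" unfolding acl0_E_N[OF w v] .
    then show False using F_E_iff[OF w v eA] e by (simp add: Zs_def)
  qed
  show "F v w e \<notin> A0 w u" if u: "u \<subset> v"
    using F_A0_iff[OF w v _ eA, of u] u e by (auto simp: Zs_def)
qed

text \<open>If new variables for \<open>v\<close> and \<open>u\<close> had the same value, it would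
  lie in the closure for \<open>v \<inter> u\<close> by \<open>acl0_inter\<close>. New elements
  avoid the closures of proper subsets, so \<open>v\<close> equals \<open>u\<close>, and
  \<open>F\<close> is injective.\<close>

lemma bt_inj:
  assumes w: "w \<in> W"
  shows "inj_on (bt w) (xt w)"
proof (rule inj_onI)
  have mixed: False if y: "y \<in> x w" and u: "u \<in> W" "u \<subseteq> w" "e \<in> Zs u" and eq: "b w y = F u w e" for y u e
    using Zs_F(1)[OF w u(2,3)] y eq by (metis imageI)
  fix y z assume yz: "y \<in> xt w" "z \<in> xt w" "bt w y = bt w z"
  show "y = z"
  proof (rule xt_cases[OF w yz(1)])
    assume y: "y \<in> x w"
    show ?thesis
    proof (rule xt_cases[OF w yz(2)])
      assume "z \<in> x w"
      then show ?thesis using inj_onD[OF b_inj[OF w], of y z] y yz(3) bt_x by simp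
    next
      fix u e assume u: "u \<in> W" "u \<subseteq> w" "e \<in> Zs u" "z = \<zeta> (u, e)"
      then show ?thesis using mixed[OF y u(1-3)] yz(3) bt_x[OF y] bt_\<zeta>[OF u(1,3) w] by simp
    qed
  next
    fix v e assume v: "v \<in> W" "v \<subseteq> w" "e \<in> Zs v" "y = \<zeta> (v, e)"
    show ?thesis
    proof (rule xt_cases[OF w yz(2)])
      assume z: "z \<in> x w"
      then show ?thesis using mixed[OF z v(1-3)] yz(3) bt_x[OF z] bt_\<zeta>[OF v(1,3) w] v(4) by simp
    next
      fix u e' assume u: "u \<in> W" "u \<subseteq> w" "e' \<in> Zs u" "z = \<zeta> (u, e')"
      have eq: "F v w e = F u w e'" using yz(3) v(4) u(4) bt_\<zeta>[OF v(1,3) w] bt_\<zeta>[OF u(1,3) w] by simp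
      have "F v w e \<in> A0 w v" using F_A0_iff[OF w v(2) order_refl] Zs_A0[OF v(3)] by blast
      moreover have "F u w e' \<in> A0 w u" using F_A0_iff[OF w u(2) order_refl] Zs_A0[OF u(3)] by blast
      ultimately have "F v w e \<in> A0 w v \<inter> A0 w u" using eq by simp
      then have int: "F v w e \<in> A0 w (v \<inter> u)" using acl0_inter[OF w v(2) u(2)] by blast
      have "\<not> v \<inter> u \<subset> v" using Zs_F(2)[OF w v(2,3)] int by blast
      moreover have "\<not> v \<inter> u \<subset> u" using Zs_F(2)[OF w u(2,3)] int unfolding eq by blast
      ultimately have vu: "v = u" by blast
      then have "e = e'" using inj_onD[OF M.elem_map_inj[OF F_elem_map[OF w v(2)]], of e e'] eq Zs_A0 v(3) u(3) by simp
      then show ?thesis using vu v(4) u(4) by simp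
    qed
  qed
qed

lemma xt_small:
  assumes w: "w \<in> W"
  shows "|xt w| <o \<kappa>"
proof -
  have "\<zeta> ` Sigma (Pow w) Zs \<subseteq> \<zeta> ` Sigma W Zs" using Wsub[OF w] by (intro image_mono) auto
  then have "|\<zeta> ` Sigma (Pow w) Zs| <o \<kappa>" by (rule M.small_subset[OF M.small_image[OF small_Sigma]])
  then show ?thesis unfolding xt_def using xsmall[OF w] by auto
qed

text \<open>Starting over \<open>Q\<close>: the right side is closed, which puts \<open>aQ\<close>
  into it, so the base may be raised to \<open>aQ\<close>; then the left side is closed.\<close>

lemma indep0_aQ:
  assumes w: "w \<in> W" and i: "i \<in> w"
  shows "indep L\<^sub>0 M (A0 w {i}) aQ (\<Union>j\<in>w - {i}. A0 w {j})"
proof -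
  have iw: "{i} \<subseteq> w" and ww: "w - {i} \<subseteq> w" using i by auto
  let ?B = "acl L\<^sub>0 M (UE w (w - {i}) \<union> Q)"
  have Uu: "UE w (w - {i}) \<subseteq> univ M" using UE_univ[OF w ww] NM_univ by blast
  have UQ: "UE w (w - {i}) \<union> Q \<subseteq> univ M" "|UE w (w - {i}) \<union> Q| <o \<kappa>" using Uu Q0 UE_small[OF w ww] Q(2) by auto
  have Bs: "|?B| <o \<kappa>" by (rule M.small_acl[OF c0 UQ])
  note Ei = E_univ0[OF w iw] E_small[OF w iw]
  have "indep L\<^sub>0 M (E w {i}) Q ?B"
    by (rule M.indep_right_acl[OF Ei Uu UE_small[OF w ww] Q0 Q(2) indep0_fam[OF w i]])
  then have "indep L\<^sub>0 M (E w {i}) aQ ?B"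
    by (rule M.indep_base_mono[OF _ Q_aQ]) (use M.acl_mono[of Q "UE w (w - {i}) \<union> Q"] in auto)
  then have "indep L\<^sub>0 M (A0 w {i}) aQ ?B"
    by (intro M.indep_left_acl[OF Ei M.acl_univ Bs aQ_univ aQ_small _ A0_small[OF w iw]] M.acl_mono) auto
  then show ?thesis
  proof (rule M.indep_mono[OF _ order_refl])
    show "(\<Union>j\<in>w - {i}. A0 w {j}) \<subseteq> ?B"
    proof (rule UN_least)
      fix j assume "j \<in> w - {i}"
      then show "A0 w {j} \<subseteq> ?B" by (intro M.acl_mono) auto
    qed
  qed
qed

definition qt :: "nat set \<Rightarrow> ('f, 'r, 'a, 'v) fm set" where
  "qt w = tp L\<^sub>0 M aQ (xt w) (bt w)"

lemma qt_amalg: "amalg_system L\<^sub>0 M \<kappa> aQ W xt qt"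
proof -
  have "amalg_system L\<^sub>0 M \<kappa> aQ W xt (\<lambda>w. tp L\<^sub>0 M aQ (xt w) (bt w))"
  proof (rule M.amalg_systemI[OF inf_vars aQ_univ aQ_small finW])
    fix w assume w: "w \<in> W"
    show "|xt w| <o \<kappa>" by (rule xt_small[OF w])
    show "bt w ` xt w \<subseteq> univ M" unfolding bt_img[OF w] by (rule A0_univ)
    show "inj_on (bt w) (xt w)" by (rule bt_inj[OF w])
    show "finite w" by (rule finw[OF w])
    have bti: "bt w ` xt {j} = A0 w {j}" if "j \<in> w" for j by (rule bt_img_sub[OF w]) (use that in auto)
    show "bt w ` xt w \<subseteq> acl L\<^sub>0 M (aQ \<union> (\<Union>i\<in>w. bt w ` xt {i}))"
    proof -
      have "Q \<union> UE w w \<subseteq> aQ \<union> (\<Union>i\<in>w. bt w ` xt {i})"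
        using Q_aQ E_A0[OF w, of "{_}"] bti by fastforce
      then have 1: "acl L\<^sub>0 M (Q \<union> UE w w) \<subseteq> acl L\<^sub>0 M (aQ \<union> (\<Union>i\<in>w. bt w ` xt {i}))" by (rule M.acl_mono)
      have "Q \<union> UE w w \<subseteq> univ M" using QUE(1)[OF w order_refl] NM_univ by blast
      from M.acl_trans[OF this QUE(2)[OF w order_refl] E_acl0[OF w order_refl]] 1
      show ?thesis unfolding bt_img[OF w] by blast
    qed
    fix i assume i: "i \<in> w"
    then show "{i} \<in> W" using Wsub[OF w] by auto
    have "(\<Union>j\<in>w - {i}. bt w ` xt {j}) = (\<Union>j\<in>w - {i}. A0 w {j})" using bti by (intro SUP_cong) auto
    then show "indep L\<^sub>0 M (bt w ` xt {i}) aQ (\<Union>j\<in>w - {i}. bt w ` xt {j})" using indep0_aQ[OF w i] bti[OF i] by simp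
  next
    fix v w assume vw: "v \<in> W" "w \<in> W"
    show "xt v \<inter> xt w = xt (v \<inter> w)" by (rule xt_int[OF vw])
    assume v: "v \<subseteq> w"
    show "tp L\<^sub>0 M aQ (xt v) (bt w) = tp L\<^sub>0 M aQ (xt v) (bt v)"
    proof (rule M.elem_map_tp[OF F_elem_map[OF vw(2) v], symmetric])
      show "aQ \<union> bt v ` xt v \<subseteq> A0 v v" unfolding bt_img[OF vw(1)] using aQ_A0[OF vw(1) order_refl] by simp
    qed (use F_aQ[OF vw(2) v] bt_coh[OF vw(2) v] in auto)
  qed
  then show ?thesis by (simp add: qt_def[abs_def])
qed

text \<open>Any realization is the image of \<open>bt w\<close> under an elementary map defined on
  the whole closure of \<open>E w w\<close>. Such a map sends a closure onto a closure, and the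
  tuple stays algebraic over its vertices.\<close>

lemma qt_acl: "acl_system L\<^sub>0 M \<kappa> aQ W xt qt"
  unfolding acl_system_def
proof (intro conjI qt_amalg ballI allI impI)
  fix w c assume w: "w \<in> W" and c: "realizes M (xt w) c (qt w)"
  have bu: "bt w ` xt w \<subseteq> univ M" unfolding bt_img[OF w] by (rule A0_univ)
  have tp: "tp L\<^sub>0 M aQ (xt w) (bt w) = tp L\<^sub>0 M aQ (xt w) c"
    using complete_type_eq_tp[OF M.complete_type_tp[OF bu]] c unfolding qt_def by blast
  have cu: "c ` xt w \<subseteq> univ M" using c by (simp add: realizes_def)
  obtain g where g: "M.elem_map (aQ \<union> bt w ` xt w) g" "\<And>z. z \<in> aQ \<Longrightarrow> g z = z" "\<And>y. y \<in> xt w \<Longrightarrow> g (bt w y) = c y"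
    using M.tp_elem_map[OF inf_vars aQ_univ bu cu tp] by metis
  have elem_map: "M.elem_map (A0 w w) g" using M.elem_map_mono[OF g(1)] unfolding bt_img[OF w] by simp
  have gi: "g ` A0 w w = c ` xt w" unfolding bt_img[OF w, symmetric] image_image using g(3) by (intro image_cong) auto
  note Ew = E_univ0[OF w order_refl] E_small[OF w order_refl]
  have ga: "g ` A0 w w = acl L\<^sub>0 M (g ` E w w)" by (rule M.elem_map_acl_image[OF elem_map Ew A0_small[OF w order_refl]])
  have gE: "g ` E w w \<subseteq> univ M" "|g ` E w w| <o \<kappa>"
    using M.elem_map_univ(2)[OF elem_map] E_A0[OF w order_refl] M.small_image[OF Ew(2)] by auto
  show "c ` xt w = acl L\<^sub>0 M (aQ \<union> (\<Union>i\<in>w. c ` xt {i}))"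
  proof
    show "c ` xt w \<subseteq> acl L\<^sub>0 M (aQ \<union> (\<Union>i\<in>w. c ` xt {i}))"
      using amalg_systemD(6)[OF qt_amalg] w c by blast
    have "aQ \<subseteq> g ` A0 w w" using g(2) aQ_A0[OF w order_refl] by force
    moreover have "c ` xt {i} \<subseteq> c ` xt w" if "i \<in> w" for i
    proof -
      have "{i} \<in> W" "{i} \<inter> w = {i}" using Wsub[OF w, of "{i}"] that by auto
      then have "xt {i} \<subseteq> xt w" using xt_int[of "{i}" w] w by auto
      then show ?thesis by (rule image_mono)
    qed
    ultimately have "aQ \<union> (\<Union>i\<in>w. c ` xt {i}) \<subseteq> acl L\<^sub>0 M (g ` E w w)" unfolding ga[symmetric] gi by blast
    from M.acl_trans[OF gE this] show "acl L\<^sub>0 M (aQ \<union> (\<Union>i\<in>w. c ` xt {i})) \<subseteq> c ` xt w"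
      unfolding ga[symmetric] gi .
  qed
qed

subsection \<open>Transfer of completions\<close>

text \<open>The value is the only solution of an equation with parameters in \<open>E w w\<close>,
  and \<open>E w w\<close> is algebraically closed in T1.\<close>

lemma E_closed:
  assumes w: "w \<in> W" and f: "(f, length bs) \<in> Fsym L\<^sub>1" and bs: "set bs \<subseteq> E w w"
  shows "fint N f bs \<in> E w w"
proof -
  have bsN: "set bs \<subseteq> univ N" using bs E_univ[OF w order_refl] by blast
  have u: "fint N f bs \<in> univ N"
    using Nstr f bsN unfolding is_struc_def substr_set_def by fastforce
  let ?\<phi> = "Eq (Var 0) (Fn f (map Par bs)) :: ('f, 'r, 'a, nat) fm"
  have ev: "map (eval N \<sigma>) (map Par bs) = bs" for \<sigma> :: "nat \<Rightarrow> 'a" by (simp add: comp_def)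
  have s: "sat N (\<lambda>_. c) ?\<phi> \<longleftrightarrow> c = fint N f bs" for c unfolding sat.simps eval.simps ev ..
  have "?\<phi> \<in> forms L\<^sub>1 (E w w) {0}" using f bs by (auto simp: forms_def)
  moreover have "{c\<in>univ N. sat N (\<lambda>_. c) ?\<phi>} = {fint N f bs}" using u s by auto
  ultimately have "fint N f bs \<in> acl L\<^sub>1 N (E w w)" unfolding acl_def using u s
    by (intro CollectI conjI bexI[of _ ?\<phi>]) auto
  then show ?thesis unfolding E_acl[OF w order_refl] .
qed

text \<open>An atomic formula of the union language may mix symbols of \<open>L\<^sub>0\<close> and
  \<open>L'\<close> inside one term. As the coordinates of \<open>b w\<close> are closed under all
  functions, each subterm can be replaced by a variable, and each single replacement is a formula in
  one of the two languages.\<close>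

lemma qf_eq:
  assumes w: "w \<in> W"
    and T: "\<And>\<psi>. \<psi> \<in> forms L\<^sub>0 {} (x w) \<union> forms L' {} (x w) \<Longrightarrow> qfree \<psi> \<Longrightarrow> sat N a \<psi> = sat N (b w) \<psi>"
  shows "qfree \<phi> \<Longrightarrow> \<phi> \<in> forms L\<^sub>1 {} (x w) \<Longrightarrow> sat N a \<phi> = sat N (b w) \<phi>"
proof -
  have Lf: "(f, k) \<in> Fsym L\<^sub>1 \<Longrightarrow> (f, k) \<in> Fsym L\<^sub>0 \<or> (f, k) \<in> Fsym L'" for f k by (simp add: L1 lang_union_def)
  have Lr: "(r, k) \<in> Rsym L\<^sub>1 \<Longrightarrow> (r, k) \<in> Rsym L\<^sub>0 \<or> (r, k) \<in> Rsym L'" for r k by (simp add: L1 lang_union_def)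
  have tm: "\<exists>y\<in>x w. eval N (b w) t = b w y \<and> eval N a t = a y"
    if "wf_tm L\<^sub>1 t" "pars_tm t = {}" "fv_tm t \<subseteq> x w" for t
    using that
  proof (induction t)
    case (Fn f ts)
    have "\<forall>t\<in>set ts. \<exists>y. y \<in> x w \<and> eval N (b w) t = b w y \<and> eval N a t = a y"
    proof
      fix t assume t: "t \<in> set ts"
      have "\<exists>y\<in>x w. eval N (b w) t = b w y \<and> eval N a t = a y"
        by (rule Fn.IH[OF t]) (use Fn.prems t in auto)
      then show "\<exists>y. y \<in> x w \<and> eval N (b w) t = b w y \<and> eval N a t = a y" by blast
    qed
    from bchoice[OF this] obtain h where h: "\<forall>t\<in>set ts. h t \<in> x w \<and> eval N (b w) t = b w (h t) \<and> eval N a t = a (h t)"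
      by (rule exE)
    let ?ys = "map h ts"
    have mb: "map (eval N (b w)) ts = map (b w) ?ys" and ma: "map (eval N a) ts = map a ?ys" using h by auto
    have f: "(f, length ?ys) \<in> Fsym L\<^sub>1" using Fn.prems by simp
    have "fint N f (map (b w) ?ys) \<in> E w w" by (rule E_closed[OF w]) (use f h in auto)
    then obtain y where y: "fint N f (map (b w) ?ys) = b w y" "y \<in> x w" by (rule imageE)
    \<comment> \<open>The graph of one function symbol at variables; it belongs to a single
      language, so the assumption transfers it from \<open>b w\<close> to \<open>a\<close>.\<close>
    let ?\<psi> = "Eq (Fn f (map Var ?ys)) (Var y) :: ('f, 'r, 'a, 'v) fm"
    have ev: "map (eval N \<sigma>) (map Var ?ys) = map \<sigma> ?ys" for \<sigma> :: "'v \<Rightarrow> 'a" by simp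
    have s: "sat N \<sigma> ?\<psi> \<longleftrightarrow> fint N f (map \<sigma> ?ys) = \<sigma> y" for \<sigma> unfolding sat.simps eval.simps ev ..
    have "?\<psi> \<in> forms L\<^sub>0 {} (x w) \<union> forms L' {} (x w)"
      using Lf[OF f] y(2) h by (auto simp: forms_def)
    then have "sat N a ?\<psi> = sat N (b w) ?\<psi>" by (rule T) simp
    then have "fint N f (map a ?ys) = a y" unfolding s using y(1) by (rule iffD2)
    then show ?case using y unfolding eval.simps ma mb by blast
  qed auto
  show "sat N a \<phi> = sat N (b w) \<phi>" if "qfree \<phi>" "\<phi> \<in> forms L\<^sub>1 {} (x w)"
    using that
  proof (induction \<phi>)
    case (Eq s t)
    obtain y z where y: "y \<in> x w" "eval N (b w) s = b w y" "eval N a s = a y"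
      and z: "z \<in> x w" "eval N (b w) t = b w z" "eval N a t = a z"
      using tm[of s] tm[of t] Eq.prems by (auto simp: forms_def)
    have "sat N a (Eq (Var y) (Var z)) = sat N (b w) (Eq (Var y) (Var z))"
      by (rule T) (use y(1) z(1) in \<open>auto simp: forms_def\<close>)
    then show ?case using y z by simp
  next
    case (Rel r ts)
    have "\<forall>t\<in>set ts. \<exists>y. y \<in> x w \<and> eval N (b w) t = b w y \<and> eval N a t = a y"
    proof
      fix t assume t: "t \<in> set ts"
      have "\<exists>y\<in>x w. eval N (b w) t = b w y \<and> eval N a t = a y"
        by (rule tm) (use Rel.prems t in \<open>auto simp: forms_def\<close>)
      then show "\<exists>y. y \<in> x w \<and> eval N (b w) t = b w y \<and> eval N a t = a y" by blast
    qed
    from bchoice[OF this] obtain h where h: "\<forall>t\<in>set ts. h t \<in> x w \<and> eval N (b w) t = b w (h t) \<and> eval N a t = a (h t)"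
      by (rule exE)
    let ?ys = "map h ts"
    have mb: "map (eval N (b w)) ts = map (b w) ?ys" and ma: "map (eval N a) ts = map a ?ys" using h by auto
    let ?\<psi> = "Rel r (map Var ?ys) :: ('f, 'r, 'a, 'v) fm"
    have ev: "map (eval N \<sigma>) (map Var ?ys) = map \<sigma> ?ys" for \<sigma> :: "'v \<Rightarrow> 'a" by simp
    have r: "(r, length ts) \<in> Rsym L\<^sub>1" using Rel.prems by (simp add: forms_def)
    have "sat N a ?\<psi> = sat N (b w) ?\<psi>"
      by (rule T) (use Lr[OF r] h in \<open>auto simp: forms_def\<close>)
    then show ?case unfolding sat.simps ev ma mb .
  qed (auto simp: forms_def)
qed

text \<open>The set \<open>Q\<close> is enumerated by the coordinates in \<open>x {}\<close>, so a
  parameter in \<open>Q\<close> can be replaced by such a variable. This is what lets H5, which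
  concerns types without parameters, control types over \<open>Q\<close>.\<close>

lemma tp_over_Q:
  assumes w: "w \<in> W" and tp: "tp L\<^sub>1 N {} (x w) a = tp L\<^sub>1 N {} (x w) (b w)"
    and aQ: "\<And>y. y \<in> x {} \<Longrightarrow> a y = b w y"
  shows "tp L\<^sub>1 N Q (x w) a = tp L\<^sub>1 N Q (x w) (b w)"
proof -
  have x0: "x {} \<subseteq> x w" by (rule xsub[OF w]) simp
  define s where "s c = (SOME y. y \<in> x {} \<and> b w y = c)" for c
  have s: "s c \<in> x {} \<and> b w (s c) = c" if "c \<in> Q" for c
    unfolding s_def by (rule someI_ex) (use that E_empty[OF w] in auto)
  have "sat N a \<phi> = sat N (b w) \<phi>" if \<phi>: "\<phi> \<in> forms L\<^sub>1 Q (x w)" for \<phi>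
  proof -
    have u: "unpar \<phi> \<in> forms L\<^sub>1 {} UNIV" and V: "fv (unpar \<phi>) \<subseteq> Inl ` Q \<union> Inr ` x w"
      using \<phi> by (auto simp: forms_def unpar_props)
    let ?g = "case_sum (\<lambda>c. Inr (s c)) Inr :: 'a + 'v \<Rightarrow> 'a + 'v"
    obtain \<phi>' :: "('f, 'r, 'a, 'v) fm" where \<phi>': "wf_fm L\<^sub>1 \<phi>'"
      "pars \<phi>' \<subseteq> pars (unpar \<phi>) \<union> {a. Inl a \<in> ?g ` fv (unpar \<phi>)}" "fv \<phi>' \<subseteq> {w. Inr w \<in> ?g ` fv (unpar \<phi>)}"
      "\<And>S \<sigma>. sat S \<sigma> \<phi>' = sat S (inst \<sigma> ?g) (unpar \<phi>)" "qfree (unpar \<phi>) \<Longrightarrow> qfree \<phi>'"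
      by (rule reindex_formE[OF u inf_vars, where g = ?g]) blast
    have gI: "?g v \<in> Inr ` x w" if "v \<in> fv (unpar \<phi>)" for v
    proof -
      have "v \<in> Inl ` Q \<union> Inr ` x w" using V that by blast
      then show ?thesis
      proof
        assume "v \<in> Inl ` Q"
        then obtain c where c: "v = Inl c" "c \<in> Q" by (rule imageE)
        then have "s c \<in> x w" using s[OF c(2)] x0 by blast
        then show ?thesis using c(1) by simp
      next
        assume "v \<in> Inr ` x w"
        then show ?thesis by (rule imageE) simp
      qed
    qed
    have "pars \<phi>' = {}"
    proof (rule ccontr)
      assume "pars \<phi>' \<noteq> {}"
      then obtain z where "z \<in> pars \<phi>'" by blast
      then have "Inl z \<in> ?g ` fv (unpar \<phi>)" using \<phi>'(2) by (auto simp: unpar_props)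
      then show False using gI by (metis Inl_Inr_False imageE)
    qed
    moreover have "fv \<phi>' \<subseteq> x w"
    proof
      fix y assume "y \<in> fv \<phi>'"
      then have "Inr y \<in> ?g ` fv (unpar \<phi>)" using \<phi>'(3) by blast
      then obtain v where "Inr y = ?g v" "v \<in> fv (unpar \<phi>)" by (rule imageE)
      then have "Inr y \<in> (Inr ` x w :: ('a + 'v) set)" using gI[of v] by simp
      then show "y \<in> x w" by auto
    qed
    ultimately have \<phi>'f: "\<phi>' \<in> forms L\<^sub>1 {} (x w)" using \<phi>'(1) by (simp add: forms_def)
    have key: "sat N c \<phi> = sat N c \<phi>'" if c: "\<And>y. y \<in> x {} \<Longrightarrow> c y = b w y" for c
    proof -
      have "sat N (inst c ?g) (unpar \<phi>) = sat N (case_sum id c) (unpar \<phi>)"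
      proof (rule sat_cong)
        fix v assume "v \<in> fv (unpar \<phi>)"
        then have "v \<in> Inl ` Q \<union> Inr ` x w" using V by blast
        then show "inst c ?g v = case_sum id c v" using s c by (auto simp: inst_def)
      qed
      then show ?thesis using \<phi>'(4)[of N c] by (simp add: sat_unpar)
    qed
    have "sat N a \<phi>' = sat N (b w) \<phi>'" using tp \<phi>'f unfolding tp_def by blast
    then show ?thesis using key[OF aQ] key[of "b w"] by simp
  qed
  then show ?thesis unfolding tp_def by blast
qed

section \<open>Completion at a new top index\<close>

context
  fixes t x' p'
  assumes comp: "completion L\<^sub>0 M \<kappa> aQ W xt qt t x' p'" and tW: "t \<notin> W" and single: "\<And>i. i \<in> t \<Longrightarrow> {i} \<in> W"
begin

abbreviation X :: "'v set" where
  "X \<equiv> \<Union>w\<in>W. x w"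

abbreviation xx :: "nat set \<Rightarrow> 'v set" where
  "xx \<equiv> x(t := X)"

lemma wt: "w \<in> W \<Longrightarrow> w \<subseteq> t" and x'_W: "w \<in> W \<Longrightarrow> x' w = xt w" and p'_W: "w \<in> W \<Longrightarrow> p' w = qt w"
  and am': "amalg_system L\<^sub>0 M \<kappa> aQ (insert t W) x' p'"
  using comp unfolding completion_def by auto

lemma xx_W: "w \<in> W \<Longrightarrow> xx w = x w"
  using tW by auto

lemma fin_t: "finite t"
proof -
  have "t \<subseteq> \<Union>W" using single by blast
  then show ?thesis using finW finw finite_subset by (metis finite_Union)
qed

lemma X_small: "|X| <o \<kappa>"
  by (rule M.small_UN_finite[OF finW xsmall])

lemma not_sub:
  assumes "w \<in> W"
  shows "\<not> t \<subseteq> w"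
proof
  assume "t \<subseteq> w"
  then have "w = t" using wt[OF assms] by (rule subset_antisym[symmetric])
  then show False using tW assms by simp
qed

lemma xx_int:
  assumes "v \<in> insert t W" "w \<in> insert t W"
  shows "xx v \<inter> xx w = xx (v \<inter> w)"
proof -
  have 1: "xx t \<inter> xx w = xx (t \<inter> w)" if "w \<in> W" for w
  proof -
    have "t \<inter> w = w" using wt[OF that] by blast
    then show ?thesis using that xx_W[OF that] by auto
  qed
  have 2: "xx v \<inter> xx w = xx (v \<inter> w)" if vw: "v \<in> W" "w \<in> W" for v w
  proof -
    have "v \<inter> w \<in> W" using Wsub[OF vw(1)] by blast
    then show ?thesis using xint[OF vw] xx_W vw by simp
  qed
  consider "v = t" "w = t" | "v = t" "w \<in> W" | "v \<in> W" "w = t" | "v \<in> W" "w \<in> W" using assms by blast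
  then show ?thesis
  proof cases
    case 3
    then show ?thesis using 1[OF 3(1)] by (simp add: Int_commute)
  qed (use 1 2 in auto)
qed

lemma xx_small: "w \<in> insert t W \<Longrightarrow> |xx w| <o \<kappa>"
  using X_small xsmall by auto

lemma xx_single: "i \<in> t \<Longrightarrow> xx {i} = x {i}"
  by (rule xx_W[OF single])

text \<open>A realization \<open>c\<close> of the given top type is restricted to the old variables.
  Independence descends from \<open>aQ\<close> to \<open>Q\<close> by \<open>indep_acl_base\<close>,
  and each part of \<open>c\<close> on some \<open>x v\<close> is algebraic over its own vertices
  because it realizes \<open>q v\<close>.\<close>

lemma minimal_ex:
  obtains q' where "minimal_completion L\<^sub>0 M \<kappa> Q W x q t xx q'"
    "\<And>w. w \<in> W \<Longrightarrow> {\<phi>\<in>q' t. fv \<phi> \<subseteq> x w} = q w"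
proof -
  note D = amalg_systemD[OF am']
  have ty: "|x' t| <o \<kappa>" "complete_type L\<^sub>0 M aQ (x' t) (p' t)" using D(2) by auto
  obtain c where c: "realizes M (x' t) c (p' t)"
    using M.complete_type_realized[OF ty(2) aQ_univ aQ_small ty(1)] .
  have xtt: "xt w \<subseteq> x' t" if w: "w \<in> W" for w
  proof -
    have "x' w \<inter> x' t = x' (w \<inter> t)" using D(4) w by blast
    moreover have "w \<inter> t = w" using wt[OF w] by blast
    ultimately show ?thesis using x'_W[OF w] by auto
  qed
  have xw: "x w \<subseteq> xt w" for w by (auto simp: xt_def)
  have Xt: "X \<subseteq> x' t" using xtt xw by blast
  have cu: "c ` x' t \<subseteq> univ M" using c by (simp add: realizes_def)
  have tpw: "tp L\<^sub>0 M Q (x w) c = tp L\<^sub>0 M Q (x w) (b w)" if w: "w \<in> W" for w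
  proof -
    have pt: "p' t = tp L\<^sub>0 M aQ (x' t) c" by (rule complete_type_eq_tp[OF ty(2) c])
    have "{\<phi>\<in>p' t. fv \<phi> \<subseteq> x' w} = p' w" using D(5) w wt[OF w] by blast
    then have "tp L\<^sub>0 M aQ (xt w) c = tp L\<^sub>0 M aQ (xt w) (bt w)"
      using tp_restrict[OF xtt[OF w], of L\<^sub>0 M aQ c] p'_W[OF w] x'_W[OF w] unfolding pt qt_def by simp
    then have "tp L\<^sub>0 M Q (x w) c = tp L\<^sub>0 M Q (x w) (bt w)" by (rule tp_param_mono[OF _ Q_aQ xw])
    moreover have "sat M (bt w) \<phi> = sat M (b w) \<phi>" if "\<phi> \<in> forms L\<^sub>0 Q (x w)" for \<phi>
      by (rule sat_cong) (use that bt_x in \<open>auto simp: forms_def\<close>)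
    then have "tp L\<^sub>0 M Q (x w) (bt w) = tp L\<^sub>0 M Q (x w) (b w)" unfolding tp_def by blast
    ultimately show ?thesis by simp
  qed
  \<comment> \<open>The old indices keep their realizations in \<open>N\<close>; only the top index
    uses \<open>c\<close>, which lives in \<open>M\<close>.\<close>
  define a0 where "a0 w = (if w = t then c else b w)" for w
  have a0W: "a0 w = b w" if "w \<in> W" for w using that tW by (auto simp: a0_def)
  have a0t: "a0 t = c" by (simp add: a0_def)
  let ?q = "\<lambda>w. tp L\<^sub>0 M Q (xx w) (a0 w)"
  have cQ: "realizes M (x w) c (q w)" if w: "w \<in> W" for w
    unfolding realizes_def
  proof
    show "c ` x w \<subseteq> univ M" using cu xtt[OF w] xw by blast
    show "\<forall>\<phi>\<in>q w. sat M c \<phi>" unfolding q_def tpw[OF w, symmetric] by (auto simp: tp_def)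
  qed
  have am: "amalg_system L\<^sub>0 M \<kappa> Q (insert t W) xx ?q"
  proof (rule M.amalg_systemI[OF inf_vars Q0 Q(2)])
    show "finite (insert t W)" using finW by simp
    show "|xx w| <o \<kappa>" if "w \<in> insert t W" for w by (rule xx_small[OF that])
    show "xx v \<inter> xx w = xx (v \<inter> w)" if "v \<in> insert t W" "w \<in> insert t W" for v w by (rule xx_int[OF that])
    show "finite w" if "w \<in> insert t W" for w using that finw fin_t by auto
    show "{i} \<in> insert t W" if "w \<in> insert t W" "i \<in> w" for w i using that single Wsub[of w "{i}"] by auto
    show "a0 w ` xx w \<subseteq> univ M" if "w \<in> insert t W" for w
    proof (cases "w = t")
      case True
      then show ?thesis using cu Xt a0t by auto
    next
      case False
      then have "w \<in> W" using that by blast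
      then show ?thesis using E_univ0[OF _ order_refl] a0W xx_W by simp
    qed
    show "inj_on (a0 w) (xx w)" if "w \<in> insert t W" for w
    proof (cases "w = t")
      case True
      have "inj_on c X"
      proof (rule inj_onI, rule ccontr)
        fix y z assume yz: "y \<in> X" "z \<in> X" "c y = c z" "y \<noteq> z"
        then have "Neg (Eq (Var y) (Var z)) \<in> p' t" using D(3) Xt by blast
        then have "sat M c (Neg (Eq (Var y) (Var z)))" using c unfolding realizes_def by blast
        then show False using yz(3) by simp
      qed
      then show ?thesis using True a0t by simp
    next
      case False
      then have "w \<in> W" using that by blast
      then show ?thesis using b_inj a0W xx_W by simp
    qed
    show "tp L\<^sub>0 M Q (xx v) (a0 w) = tp L\<^sub>0 M Q (xx v) (a0 v)" if vw: "v \<in> insert t W" "w \<in> insert t W" "v \<subseteq> w" for v w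
    proof (cases "v \<in> W")
      case True
      show ?thesis
      proof (cases "w \<in> W")
        case wW: True
        then show ?thesis using tp0_coh[OF wW vw(3)] True xx_W a0W by simp
      next
        case False
        then have "w = t" using vw by blast
        then show ?thesis using tpw[OF True] True xx_W a0W a0t by simp
      qed
    next
      case False
      then have "v = t" using vw by blast
      then have "w = t" using vw not_sub by blast
      then show ?thesis using \<open>v = t\<close> by simp
    qed
    show "indep L\<^sub>0 M (a0 w ` xx {i}) Q (\<Union>j\<in>w - {i}. a0 w ` xx {j})" if w: "w \<in> insert t W" "i \<in> w" for w i
    proof (cases "w = t")
      case True
      have i: "i \<in> t" using w True by simp
      have "indep L\<^sub>0 M (c ` x' {i}) aQ (\<Union>j\<in>t - {i}. c ` x' {j})" using D(6) c i by blast
      then have ind: "indep L\<^sub>0 M (c ` x' {i}) Q (\<Union>j\<in>t - {i}. c ` x' {j})" by (rule M.indep_acl_base[OF Q0 Q(2) aQ_small])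
      have sub: "xx {j} \<subseteq> x' {j}" if "j \<in> t" for j using x'_W[OF single[OF that]] xx_single[OF that] xw by simp
      have "indep L\<^sub>0 M (c ` xx {i}) Q (\<Union>j\<in>t - {i}. c ` xx {j})"
      proof (rule M.indep_mono[OF ind])
        show "c ` xx {i} \<subseteq> c ` x' {i}" by (rule image_mono[OF sub[OF i]])
        show "(\<Union>j\<in>t - {i}. c ` xx {j}) \<subseteq> (\<Union>j\<in>t - {i}. c ` x' {j})"
          by (rule UN_mono[OF order_refl image_mono[OF sub]]) blast
      qed
      then show ?thesis using True a0t by simp
    next
      case False
      then have wW: "w \<in> W" using w by blast
      have s: "xx {j} = x {j}" if "j \<in> w" for j using wt[OF wW] that xx_single by blast
      then have "(\<Union>j\<in>w - {i}. b w ` xx {j}) = (\<Union>j\<in>w - {i}. b w ` x {j})" by (intro SUP_cong) auto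
      then show ?thesis using indep0_fam[OF wW w(2)] s[OF w(2)] a0W[OF wW] by simp
    qed
    show "a0 w ` xx w \<subseteq> acl L\<^sub>0 M (Q \<union> (\<Union>i\<in>w. a0 w ` xx {i}))" if w: "w \<in> insert t W" for w
    proof (cases "w = t")
      case True
      have "c ` X \<subseteq> acl L\<^sub>0 M (Q \<union> (\<Union>i\<in>t. c ` xx {i}))"
      proof (rule image_subsetI)
        fix y assume "y \<in> X"
        then obtain v where v: "v \<in> W" "y \<in> x v" by blast
        have "c ` x v \<subseteq> acl L\<^sub>0 M (Q \<union> (\<Union>i\<in>v. c ` x {i}))" using amalg_systemD(6)[OF q_system] v(1) cQ[OF v(1)] by blast
        moreover have "Q \<union> (\<Union>i\<in>v. c ` x {i}) \<subseteq> Q \<union> (\<Union>i\<in>t. c ` xx {i})" using wt[OF v(1)] xx_single by blast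
        then have "acl L\<^sub>0 M (Q \<union> (\<Union>i\<in>v. c ` x {i})) \<subseteq> acl L\<^sub>0 M (Q \<union> (\<Union>i\<in>t. c ` xx {i}))" by (rule M.acl_mono)
        ultimately show "c y \<in> acl L\<^sub>0 M (Q \<union> (\<Union>i\<in>t. c ` xx {i}))" using v(2) by blast
      qed
      then show ?thesis using True a0t by simp
    next
      case False
      then have wW: "w \<in> W" using w by blast
      have s: "xx {j} = x {j}" if "j \<in> w" for j using wt[OF wW] that xx_single by blast
      then have "(\<Union>j\<in>w. b w ` xx {j}) = (\<Union>j\<in>w. b w ` x {j})" by (intro SUP_cong) auto
      then show ?thesis using E_acl0[OF wW order_refl] a0W[OF wW] xx_W[OF wW] by simp
    qed
  qed
  have qW: "?q w = q w" if "w \<in> W" for w using that a0W xx_W by (simp add: q_def)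
  show thesis
  proof (rule that[of ?q])
    show "minimal_completion L\<^sub>0 M \<kappa> Q W x q t xx ?q"
      unfolding minimal_completion_def completion_def using am wt xx_W qW by simp
    fix w assume w: "w \<in> W"
    have "{\<phi>\<in>?q t. fv \<phi> \<subseteq> xx w} = ?q w" using amalg_systemD(5)[OF am] w wt[OF w] by blast
    then show "{\<phi>\<in>?q t. fv \<phi> \<subseteq> x w} = q w" using qW[OF w] xx_W[OF w] by simp
  qed
qed

text \<open>H6 provides a realization \<open>a\<close> of the minimal completion inside
  \<open>N\<close>. On each \<open>x w\<close> it has the quantifier-free type of the closed tuple
  \<open>b w\<close>, so H5 gives equality of the full types; H4, read from right to left, gives
  independence in T1.\<close>

lemma completion_t: "\<exists>p''. completion L\<^sub>1 N \<kappa> Q W x p t xx p''"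
proof -
  obtain q' where mc: "minimal_completion L\<^sub>0 M \<kappa> Q W x q t xx q'"
    and q'r: "\<And>w. w \<in> W \<Longrightarrow> {\<phi>\<in>q' t. fv \<phi> \<subseteq> x w} = q w" by (rule minimal_ex) blast
  let ?gen = "generated_annotation L' (xx t) (\<Union>w\<in>W. I w)"
  have amq: "amalg_system L\<^sub>0 M \<kappa> Q (insert t W) xx q'"
    using mc unfolding minimal_completion_def completion_def by blast
  have sf: "strongly_fair_system L\<^sub>0 L' M N \<kappa> G Q (insert t W) xx q' (I(t := ?gen))"
    by (rule H6[OF W rel_acl_fair strongly_fair mc])
  then have "\<exists>a. realizes_annotated M N (xx t) a (q' t) ((I(t := ?gen)) t) \<and>
      (\<forall>V\<subseteq>insert t W. V \<noteq> {} \<and> (\<forall>v\<in>V. v \<subseteq> t) \<longrightarrow> (\<Union>v\<in>V. a ` xx v) \<in> G)"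
    unfolding strongly_fair_system_def by blast
  then obtain a where a: "realizes_annotated M N X a (q' t) (generated_annotation L' X (\<Union>w\<in>W. I w))"
    and aG: "\<And>V. V \<subseteq> insert t W \<Longrightarrow> V \<noteq> {} \<Longrightarrow> (\<forall>v\<in>V. v \<subseteq> t) \<Longrightarrow> (\<Union>v\<in>V. a ` xx v) \<in> G"
    by auto
  have aM: "realizes M X a (q' t)" and aN: "realizes N X a (generated_annotation L' X (\<Union>w\<in>W. I w))"
    using a by (auto simp: realizes_annotated_def)
  have aX: "a ` X \<subseteq> univ N" using aN by (simp add: realizes_def)
  have axw: "a ` x w \<subseteq> univ N" if "w \<in> W" for w using aX that by blast
  have aG1: "a ` x w \<in> G" if w: "w \<in> W" for w using aG[of "{w}"] w wt[OF w] xx_W[OF w] by simp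
  have aI: "sat N a \<phi>" if "w \<in> W" "\<phi> \<in> I w" for w \<phi>
  proof -
    have "\<phi> \<in> forms L' {} X" "qfree \<phi>" using that by (auto simp: I_def qftp_def tp_def forms_def)
    then have "\<phi> \<in> generated_annotation L' X (\<Union>w\<in>W. I w)" using that unfolding generated_annotation_def by blast
    then show ?thesis using aN by (auto simp: realizes_def)
  qed
  have aq: "sat M a \<phi>" if "w \<in> W" "\<phi> \<in> q w" for w \<phi>
    using that q'r[OF that(1)] aM unfolding realizes_def by blast
  have aqw: "tp L\<^sub>0 M Q (x w) a = tp L\<^sub>0 M Q (x w) (b w)" if w: "w \<in> W" for w
  proof -
    have "realizes M (x w) a (q w)" using axw[OF w] NM_univ aq[OF w] by (auto simp: realizes_def)
    then have "q w = tp L\<^sub>0 M Q (x w) a"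
      using complete_type_eq_tp[OF M.complete_type_tp[OF E_univ0[OF w order_refl]]] unfolding q_def by blast
    then show ?thesis by (simp add: q_def)
  qed
  have tp0: "tp L\<^sub>1 N {} (x w) a = tp L\<^sub>1 N {} (x w) (b w)" if w: "w \<in> W" for w
  proof (rule H5[OF aG1[OF w] E_univ[OF w order_refl] E_acl[OF w order_refl]])
    have "sat N a \<psi> = sat N (b w) \<psi>" if \<psi>: "\<psi> \<in> forms L\<^sub>0 {} (x w) \<union> forms L' {} (x w)" "qfree \<psi>" for \<psi>
    proof -
      from \<psi>(1) consider "\<psi> \<in> forms L\<^sub>0 {} (x w)" | "\<psi> \<in> forms L' {} (x w)" by blast
      then show ?thesis
      proof cases
        case 1
        have tr: "sat N c \<psi> = sat M c \<psi>" if "c ` x w \<subseteq> univ N" for c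
          by (rule substructure_sat[OF NM \<psi>(2)]) (use 1 that in \<open>auto simp: forms_def\<close>)
        have "\<psi> \<in> forms L\<^sub>0 Q (x w)" using 1 by (auto simp: forms_def)
        then have "sat M a \<psi> = sat M (b w) \<psi>" using aqw[OF w] unfolding tp_def by blast
        then show ?thesis using tr[OF axw[OF w]] tr[OF E_univ[OF w order_refl]] by simp
      next
        case 2
        \<comment> \<open>The annotation \<open>I w\<close> contains every quantifier-free formula
          true of \<open>b w\<close>, so applying this to a formula and to its negation yields
          agreement in both directions.\<close>
        have pos: "sat N a \<chi>" if "\<chi> \<in> forms L' {} (x w)" "qfree \<chi>" "sat N (b w) \<chi>" for \<chi>
          by (rule aI[OF w]) (use that in \<open>auto simp: I_def qftp_def tp_def\<close>)
        have "Neg \<psi> \<in> forms L' {} (x w)" "qfree (Neg \<psi>)" using 2 \<psi>(2) by (auto simp: Neg_def forms_def)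
        then show ?thesis using pos[OF 2 \<psi>(2)] pos[of "Neg \<psi>"] by auto
      qed
    qed
    then have "sat N a \<phi> = sat N (b w) \<phi>" if "qfree \<phi>" "\<phi> \<in> forms L\<^sub>1 {} (x w)" for \<phi>
      by (rule qf_eq[OF w _ that])
    then show "qftp L\<^sub>1 N {} (x w) a = qftp L\<^sub>1 N {} (x w) (b w)" unfolding qftp_def tp_def by blast
  qed
  have tp1: "tp L\<^sub>1 N Q (x w) a = tp L\<^sub>1 N Q (x w) (b w)" if w: "w \<in> W" for w
  proof (rule tp_over_Q[OF w tp0[OF w]])
    fix y assume y: "y \<in> x {}"
    have yw: "y \<in> x w" using y xsub[OF w, of "{}"] by auto
    have "b w y \<in> Q" using y E_empty[OF w] by blast
    then have "Eq (Var y) (Par (b w y)) \<in> tp L\<^sub>0 M Q (x w) (b w)" using yw by (auto simp: tp_def forms_def)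
    then have "Eq (Var y) (Par (b w y)) \<in> tp L\<^sub>0 M Q (x w) a" using aqw[OF w] by simp
    then show "a y = b w y" by (simp add: tp_def)
  qed
  have pa: "realizes N (x w) a (p w)" if w: "w \<in> W" for w
    using axw[OF w] p_tp[OF w order_refl] tp1[OF w] by (auto simp: realizes_def tp_def)
  have eW: "{} \<in> W"
  proof -
    obtain w where "w \<in> W" using W by (auto simp: index_family_def)
    then show ?thesis using Wsub by blast
  qed
  have aQ0: "a ` x {} = Q" using pacl[OF eW pa[OF eW]] Q(3) by simp
  define a1 where "a1 w = (if w = t then a else b w)" for w
  have a1W: "a1 w = b w" if "w \<in> W" for w using that tW by (auto simp: a1_def)
  have a1t: "a1 t = a" by (simp add: a1_def)
  let ?p = "\<lambda>w. tp L\<^sub>1 N Q (xx w) (a1 w)"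
  have "amalg_system L\<^sub>1 N \<kappa> Q (insert t W) xx ?p"
  proof (rule N.amalg_systemI[OF inf_vars Q(1) Q(2)])
    show "finite (insert t W)" using finW by simp
    show "|xx w| <o \<kappa>" if "w \<in> insert t W" for w by (rule xx_small[OF that])
    show "xx v \<inter> xx w = xx (v \<inter> w)" if "v \<in> insert t W" "w \<in> insert t W" for v w by (rule xx_int[OF that])
    show "finite w" if "w \<in> insert t W" for w using that finw fin_t by auto
    show "{i} \<in> insert t W" if "w \<in> insert t W" "i \<in> w" for w i using that single Wsub[of w "{i}"] by auto
    show "a1 w ` xx w \<subseteq> univ N" if "w \<in> insert t W" for w
    proof (cases "w = t")
      case True
      then show ?thesis using aX a1t by auto
    next
      case False
      then have "w \<in> W" using that by blast
      then show ?thesis using E_univ[OF _ order_refl] a1W xx_W by simp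
    qed
    show "inj_on (a1 w) (xx w)" if "w \<in> insert t W" for w
    proof (cases "w = t")
      case True
      have "inj_on a X"
      proof (rule inj_onI, rule ccontr)
        fix y z assume yz: "y \<in> X" "z \<in> X" "a y = a z" "y \<noteq> z"
        have "y \<in> xx t" "z \<in> xx t" using yz by auto
        then have "Neg (Eq (Var y) (Var z)) \<in> q' t" using amalg_systemD(3)[OF amq] yz(4) by blast
        then have "sat M a (Neg (Eq (Var y) (Var z)))" using aM unfolding realizes_def by blast
        then show False using yz(3) by simp
      qed
      then show ?thesis using True a1t by simp
    next
      case False
      then have "w \<in> W" using that by blast
      then show ?thesis using b_inj a1W xx_W by simp
    qed
    show "tp L\<^sub>1 N Q (xx v) (a1 w) = tp L\<^sub>1 N Q (xx v) (a1 v)" if vw: "v \<in> insert t W" "w \<in> insert t W" "v \<subseteq> w" for v w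
    proof (cases "v \<in> W")
      case True
      show ?thesis
      proof (cases "w \<in> W")
        case wW: True
        then show ?thesis using p_tp[OF wW vw(3)] p_tp[OF True order_refl] True xx_W a1W by simp
      next
        case False
        then have "w = t" using vw by blast
        then show ?thesis using tp1[OF True] True xx_W a1W a1t by simp
      qed
    next
      case False
      then have "v = t" using vw by blast
      then have "w = t" using vw not_sub by blast
      then show ?thesis using \<open>v = t\<close> by simp
    qed
    show "indep L\<^sub>1 N (a1 w ` xx {i}) Q (\<Union>j\<in>w - {i}. a1 w ` xx {j})" if w: "w \<in> insert t W" "i \<in> w" for w i
    proof (cases "w = t")
      case True
      have i: "i \<in> t" using w True by simp
      let ?A = "a ` xx {i}" and ?B = "\<Union>j\<in>t - {i}. a ` xx {j}"
      \<comment> \<open>The empty index is included so that the union over \<open>?V\<close>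
        contains \<open>Q\<close>; H4 requires the base to be a subset of both sides.\<close>
      let ?V = "insert {} ((\<lambda>j. {j}) ` (t - {i}))"
      have V: "?V \<subseteq> insert t W" "{i} \<in> insert t W" using eW single i by auto
      have B: "(\<Union>v\<in>?V. a ` xx v) = Q \<union> ?B" using aQ0 xx_W[OF eW] by auto
      have AG: "?A \<in> G" using aG[of "{{i}}"] V i by simp
      have BG: "Q \<union> ?B \<in> G" using aG[OF V(1)] B by auto
      have "(\<Union>v\<in>insert {i} ?V. a ` xx v) \<in> G" by (rule aG) (use V i in auto)
      then have ABG: "?A \<union> (Q \<union> ?B) \<in> G" using B by simp
      have QG: "Q \<in> G" by (rule H3(1)[OF Q])
      have QA: "Q \<subseteq> ?A"
        using aQ0 xsub[OF single[OF i], of "{}"] xx_single[OF i] by auto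
      have "realizes M (xx t) a (q' t)" using aM by simp
      then have "indep L\<^sub>0 M ?A Q ?B" using amalg_systemD(6)[OF amq] i by blast
      \<comment> \<open>Adding the base to the right side changes nothing, since
        \<open>indep\<close> only sees the union of the two.\<close>
      then have "indep L\<^sub>0 M ?A Q (Q \<union> ?B)" by (simp add: indep_def Un_ac)
      then have "indep L\<^sub>1 N ?A Q (Q \<union> ?B)" using H4[OF AG BG QG] QA ABG by blast
      then have "indep L\<^sub>1 N ?A Q ?B" by (rule N.indep_mono) auto
      then show ?thesis using True a1t by simp
    next
      case False
      then have wW: "w \<in> W" using w by blast
      have s: "xx {j} = x {j}" if "j \<in> w" for j using wt[OF wW] that xx_single by blast
      then have "(\<Union>j\<in>w - {i}. b w ` xx {j}) = (\<Union>j\<in>w - {i}. b w ` x {j})" by (intro SUP_cong) auto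
      then show ?thesis using pind[OF wW b[OF wW] w(2)] s[OF w(2)] a1W[OF wW] by simp
    qed
    show "a1 w ` xx w \<subseteq> acl L\<^sub>1 N (Q \<union> (\<Union>i\<in>w. a1 w ` xx {i}))" if w: "w \<in> insert t W" for w
    proof (cases "w = t")
      case True
      have "a ` X \<subseteq> acl L\<^sub>1 N (Q \<union> (\<Union>i\<in>t. a ` xx {i}))"
      proof (rule image_subsetI)
        fix y assume "y \<in> X"
        then obtain v where v: "v \<in> W" "y \<in> x v" by blast
        have "Q \<union> (\<Union>i\<in>v. a ` x {i}) \<subseteq> Q \<union> (\<Union>i\<in>t. a ` xx {i})" using wt[OF v(1)] xx_single by blast
        then have "acl L\<^sub>1 N (Q \<union> (\<Union>i\<in>v. a ` x {i})) \<subseteq> acl L\<^sub>1 N (Q \<union> (\<Union>i\<in>t. a ` xx {i}))" by (rule N.acl_mono)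
        then show "a y \<in> acl L\<^sub>1 N (Q \<union> (\<Union>i\<in>t. a ` xx {i}))" using v(2) pacl[OF v(1) pa[OF v(1)]] by blast
      qed
      then show ?thesis using True a1t by simp
    next
      case False
      then have wW: "w \<in> W" using w by blast
      have s: "xx {j} = x {j}" if "j \<in> w" for j using wt[OF wW] that xx_single by blast
      then have "(\<Union>j\<in>w. b w ` xx {j}) = (\<Union>j\<in>w. b w ` x {j})" by (intro SUP_cong) auto
      then show ?thesis using pacl[OF wW b[OF wW]] a1W[OF wW] xx_W[OF wW] by simp
    qed
  qed
  moreover have "?p w = p w" if "w \<in> W" for w using that a1W xx_W p_tp[OF that order_refl] by simp
  ultimately have "completion L\<^sub>1 N \<kappa> Q W x p t xx ?p" unfolding completion_def using wt xx_W by simp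
  then show ?thesis by blast
qed

end

section \<open>Degenerate top indices and the conclusion\<close>

lemma completion_self: "t \<in> W \<Longrightarrow> (\<And>w. w \<in> W \<Longrightarrow> w \<subseteq> t) \<Longrightarrow> completion L\<^sub>1 N \<kappa> Q W x p t x p"
  using am by (simp add: completion_def insert_absorb)

text \<open>If \<open>t\<close> already belongs to \<open>W\<close>, it is the maximum and the
  system completes itself. Otherwise the main case applies as soon as all vertices of
  \<open>t\<close> occur in \<open>W\<close>.\<close>

lemma completion_exists:
  assumes comp: "completion L\<^sub>0 M \<kappa> aQ W xt qt t x' p'"
  shows "\<exists>t x' p'. completion L\<^sub>1 N \<kappa> Q W x p t x' p'"
proof -
  have wt: "w \<subseteq> t" if "w \<in> W" for w using comp that by (simp add: completion_def)
  have am': "amalg_system L\<^sub>0 M \<kappa> aQ (insert t W) x' p'" using comp by (simp add: completion_def)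
  have sing: "{i} \<in> insert t W" if "i \<in> t" for i using amalg_systemD(1)[OF am'] that by blast
  show ?thesis
  proof (cases "t \<in> W")
    case True
    then show ?thesis using completion_self wt by blast
  next
    case tW: False
    show ?thesis
    proof (cases "\<forall>i\<in>t. {i} \<in> W")
      case True
      then show ?thesis using completion_t[OF comp tW] by blast
    next
      case False
      \<comment> \<open>A missing singleton can only be \<open>t\<close> itself. Then every member
        of \<open>W\<close> is a subset of \<open>{i}\<close> different from it, hence empty, and
        the empty set serves as the top index.\<close>
      then obtain i where "t = {i}" using sing by blast
      then have sub: "w \<subseteq> {}" if "w \<in> W" for w using wt[OF that] that tW by (metis subset_singletonD order_refl)
      obtain w where "w \<in> W" using W by (auto simp: index_family_def)
      then have "{} \<in> W" using sub[of w] by simp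
      then show ?thesis using completion_self sub by blast
    qed
  qed
qed

end

theorem theorem3p4:
  fixes L\<^sub>0 L' L\<^sub>1 :: "('f, 'r) lang"
    and T\<^sub>0 T\<^sub>1 :: "('f, 'r, 'a, nat) fm set"
    and M N :: "('f, 'r, 'a) struc"
    and \<kappa> :: "'k rel"
    and G :: "'a set set"
    and Q :: "'a set"
    and n :: nat
  assumes T0: "complete_theory L\<^sub>0 T\<^sub>0" "simple_theory L\<^sub>0 T\<^sub>0" "quantifier_elim L\<^sub>0 T\<^sub>0"
    and L1: "L\<^sub>1 = lang_union L\<^sub>0 L'"
    and L'_fun: "\<And>f k. (f, k) \<in> Fsym L' \<Longrightarrow> k = 0 \<or> k = 1"
    and L'_rel: "\<And>r k. (r, k) \<in> Rsym L' \<Longrightarrow> k = 1"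
    and T1: "complete_theory L\<^sub>1 T\<^sub>1" "simple_theory L\<^sub>1 T\<^sub>1" "universal_part T\<^sub>0 \<subseteq> T\<^sub>1"
    and kappa: "Card_order \<kappa>" "|T\<^sub>1| <o \<kappa>"
    and vars: "\<kappa> \<le>o |UNIV :: 'v set|"
    and N: "model L\<^sub>1 T\<^sub>1 N" "saturated L\<^sub>1 N \<kappa>"
    and M: "model L\<^sub>0 T\<^sub>0 M" "saturated L\<^sub>0 M \<kappa>"
    and NM: "substructure L\<^sub>0 N M"
    and G: "\<And>A. A \<in> G \<Longrightarrow> substr_set L' N A \<and> |A| <o \<kappa>"
    and G_aut: "\<And>h A. automorphism L\<^sub>1 N h \<Longrightarrow> A \<in> G \<Longrightarrow> h ` A \<in> G"
    and H1: "\<And>A. A \<subseteq> univ N \<Longrightarrow> A = acl L\<^sub>0 M A \<inter> univ N \<Longrightarrow>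
        acl L\<^sub>0 M A = dcl L\<^sub>0 M (A \<union> acl L\<^sub>0 M {})"
    and H2: "\<And>C (X :: 'v set) a. C \<subseteq> univ N \<Longrightarrow> C = acl L\<^sub>0 M C \<inter> univ N \<Longrightarrow> a ` X \<subseteq> univ N \<Longrightarrow>
        \<exists>!q. complete_type L\<^sub>0 M (acl L\<^sub>0 M C) X q \<and> tp L\<^sub>0 M C X a \<subseteq> q"
    and H3: "\<And>A. A \<subseteq> univ N \<Longrightarrow> |A| <o \<kappa> \<Longrightarrow> acl L\<^sub>1 N A = A \<Longrightarrow> A \<in> G"
      "\<And>A. A \<in> G \<Longrightarrow> acl L\<^sub>1 N A = acl L\<^sub>0 M A \<inter> univ N"
    and H4: "\<And>A B C. A \<in> G \<Longrightarrow> B \<in> G \<Longrightarrow> C \<in> G \<Longrightarrow> C \<subseteq> A \<inter> B \<Longrightarrow>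
        indep L\<^sub>1 N A C B \<longleftrightarrow> indep L\<^sub>0 M A C B \<and> A \<union> B \<in> G"
    and H5: "\<And>(X :: 'v set) a b. a ` X \<in> G \<Longrightarrow> b ` X \<subseteq> univ N \<Longrightarrow> acl L\<^sub>1 N (b ` X) = b ` X \<Longrightarrow>
        qftp L\<^sub>1 N {} X a = qftp L\<^sub>1 N {} X b \<Longrightarrow> tp L\<^sub>1 N {} X a = tp L\<^sub>1 N {} X b"
    and H6: "\<And>C W (x :: nat set \<Rightarrow> 'v set) p I t x' p'. index_family W \<Longrightarrow>
        rel_acl_fair_system L\<^sub>0 L' L\<^sub>1 M N \<kappa> G C W x p I \<Longrightarrow>
        strongly_fair_system L\<^sub>0 L' M N \<kappa> G C W x p I \<Longrightarrow>
        minimal_completion L\<^sub>0 M \<kappa> C W x p t x' p' \<Longrightarrow>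
        strongly_fair_system L\<^sub>0 L' M N \<kappa> G C (insert t W) x' p'
          (I(t := generated_annotation L' (x' t) (\<Union>w\<in>W. I w)))"
    and Q: "Q \<subseteq> univ N" "|Q| <o \<kappa>" "acl L\<^sub>1 N Q = Q"
    and n: "n \<ge> 1"
    and ex0: "n_existence TYPE('v) L\<^sub>0 M \<kappa> n (acl L\<^sub>0 M Q)"
  shows "n_existence TYPE('v) L\<^sub>1 N \<kappa> n Q"
proof -
  let ?F0 = "forms L\<^sub>0 {} (UNIV :: nat set) :: ('f, 'r, 'a, nat) fm set"
  let ?F1 = "forms L\<^sub>1 {} (UNIV :: nat set) :: ('f, 'r, 'a, nat) fm set"
  have c1: "|?F1| <o \<kappa>" by (rule ordLeq_ordLess_trans[OF card_forms_le_theory[OF T1(1) N(1)] kappa(2)])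
  have "?F0 \<subseteq> ?F1" unfolding L1 by (auto simp: forms_def wf_fm_lang_union)
  then have c0: "|?F0| <o \<kappa>" by (rule ordLeq_ordLess_trans[OF card_of_mono1 c1])
  \<comment> \<open>Uncountability of \<open>\<kappa>\<close> is derived: it exceeds the cardinality
    of \<open>T\<^sub>1\<close>, which is at least that of the infinite set of formulas.\<close>
  have "natLeq \<le>o |?F1|" using infinite_forms infinite_iff_natLeq_ordLeq by blast
  then have unctbl: "natLeq <o \<kappa>" by (rule ordLeq_ordLess_trans[OF _ c1])
  have s0: "saturated_structure L\<^sub>0 M \<kappa>"
    by unfold_locales (use M kappa(1) unctbl in \<open>auto simp: model_def\<close>)
  have s1: "saturated_structure L\<^sub>1 N \<kappa>"
    by unfold_locales (use N kappa(1) unctbl in \<open>auto simp: model_def\<close>)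
  have Nstr: "is_struc L\<^sub>1 N" using N(1) by (simp add: model_def)
  have qe: "\<exists>\<psi>\<in>forms L\<^sub>0 {} (fv \<phi>). qfree \<psi> \<and> (\<forall>\<tau>. \<tau> ` fv \<phi> \<subseteq> univ M \<longrightarrow> sat M \<tau> \<phi> = sat M \<tau> \<psi>)"
    if "\<phi> \<in> forms L\<^sub>0 {} UNIV" for \<phi> :: "('f, 'r, 'a, nat) fm"
    by (rule quantifier_elim_sat[OF T0(1,3) M(1) that])
  have e: "expansion TYPE('v) L\<^sub>0 L' L\<^sub>1 M N \<kappa> G"
    by (rule expansion.intro[OF s0 s1 L1 Nstr NM qe c0 c1 vars G H1 H2 H3 H4 H5 H6])
  interpret N: saturated_structure L\<^sub>1 N \<kappa> by (rule s1)
  show ?thesis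
    unfolding n_existence_def
  proof (intro allI impI)
    fix W :: "nat set set" and x :: "nat set \<Rightarrow> 'v set" and p
    assume *: "index_family W \<and> W \<subseteq> Pow {1..n} \<and> acl_system L\<^sub>1 N \<kappa> Q W x p"
    then have ifW: "index_family W" and Wn: "W \<subseteq> Pow {1..n}" and sys: "acl_system L\<^sub>1 N \<kappa> Q W x p" by auto
    have am: "amalg_system L\<^sub>1 N \<kappa> Q W x p" using sys by (simp add: acl_system_def)
    have "\<exists>b. realizes N (x w) b (p w)" if w: "w \<in> W" for w
    proof -
      have "|x w| <o \<kappa>" "complete_type L\<^sub>1 N Q (x w) (p w)" using amalg_systemD(2)[OF am] w by auto
      then show ?thesis using N.complete_type_realized[OF _ Q(1,2)] by metis
    qed
    then obtain b where b: "\<And>w. w \<in> W \<Longrightarrow> realizes N (x w) (b w) (p w)" by metis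
    interpret t1_system L\<^sub>0 L' L\<^sub>1 M N \<kappa> G "TYPE('v)" Q W x p b
      by (rule t1_system.intro[OF e]) (unfold_locales, use Q ifW sys b in auto)
    obtain t x' p' where "completion L\<^sub>0 M \<kappa> (acl L\<^sub>0 M Q) W xt qt t x' p'"
      using ex0 ifW Wn qt_acl unfolding n_existence_def by blast
    then show "\<exists>t x' p'. completion L\<^sub>1 N \<kappa> Q W x p t x' p'" by (rule completion_exists)
  qed
qed

end
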